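(* For every integer $n \ge 13$, there exists a finite simple graph $T_n$ on exactly $n$ vertices that is linklessly embeddable and Tutte-4-connected.
   Context: All graphs are finite and simple. A graph is intrinsically linked if every embedding of it in $\mathbb{R}^3$ contains a nontrivial link (a pair of disjoint cycles that are nontrivially linked); a graph is linklessly embeddable if it is not intrinsically linked, i.e. it admits an embedding in $\mathbb{R}^3$ in which no two disjoint cycles form a nontrivial link. A graph is called Tutte-4-connected if it is 4-connected and triangle-free (contains no cycle of length 3). *)

theory Defs
  imports "HOL-Analysis.Analysis"
begin

definition simple_graph :: "'a set \<Rightarrow> ('a \<Rightarrow> 'a \<Rightarrow> bool) \<Rightarrow> bool" where
  "simple_graph V E \<longleftrightarrow> finite V \<and> (\<forall>u v. E u v \<longrightarrow> u \<in> V \<and> v \<in> V)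
     \<and> (\<forall>u v. E u v \<longrightarrow> E v u) \<and> (\<forall>u. \<not> E u u)"

text \<open>The subgraph induced on S is connected (the empty graph counts as connected;
this is irrelevant below since k-connectivity requires more than k vertices).\<close>

definition graph_connected :: "'a set \<Rightarrow> ('a \<Rightarrow> 'a \<Rightarrow> bool) \<Rightarrow> bool" where
  "graph_connected S E \<longleftrightarrow>
     (\<forall>u\<in>S. \<forall>v\<in>S. (\<lambda>x y. E x y \<and> x \<in> S \<and> y \<in> S)\<^sup>*\<^sup>* u v)"

definition k_connected :: "'a set \<Rightarrow> ('a \<Rightarrow> 'a \<Rightarrow> bool) \<Rightarrow> nat \<Rightarrow> bool" where
  "k_connected V E k \<longleftrightarrow> card V > k \<and>
     (\<forall>X. X \<subseteq> V \<and> card X < k \<longrightarrow> graph_connected (V - X) E)"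

definition triangle_free :: "('a \<Rightarrow> 'a \<Rightarrow> bool) \<Rightarrow> bool" where
  "triangle_free E \<longleftrightarrow> \<not> (\<exists>a b c. E a b \<and> E b c \<and> E c a)"

definition tutte_4_connected :: "'a set \<Rightarrow> ('a \<Rightarrow> 'a \<Rightarrow> bool) \<Rightarrow> bool" where
  "tutte_4_connected V E \<longleftrightarrow> k_connected V E 4 \<and> triangle_free E"

definition graph_cycle :: "'a set \<Rightarrow> ('a \<Rightarrow> 'a \<Rightarrow> bool) \<Rightarrow> 'a list \<Rightarrow> bool" where
  "graph_cycle V E cs \<longleftrightarrow> length cs \<ge> 3 \<and> distinct cs \<and> set cs \<subseteq> V \<and>
     (\<forall>i<length cs. E (cs ! i) (cs ! ((i + 1) mod length cs)))"

definition graph_embedding ::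
  "'a set \<Rightarrow> ('a \<Rightarrow> 'a \<Rightarrow> bool) \<Rightarrow> ('a \<Rightarrow> real^3) \<Rightarrow> ('a \<Rightarrow> 'a \<Rightarrow> real \<Rightarrow> real^3) \<Rightarrow> bool" where
  "graph_embedding V E p g \<longleftrightarrow>
     inj_on p V \<and>
     (\<forall>u v. E u v \<longrightarrow> arc (g u v) \<and> pathstart (g u v) = p u \<and> pathfinish (g u v) = p v
        \<and> path_image (g v u) = path_image (g u v)
        \<and> (\<forall>t\<in>{0<..<1}. g u v t \<notin> p ` V)) \<and>
     (\<forall>u v x y. E u v \<and> E x y \<and> {u, v} \<noteq> {x, y} \<longrightarrow>
        path_image (g u v) \<inter> path_image (g x y) \<subseteq> p ` ({u, v} \<inter> {x, y}))"

definition cycle_image ::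
  "('a \<Rightarrow> 'a \<Rightarrow> real \<Rightarrow> real^3) \<Rightarrow> 'a list \<Rightarrow> (real^3) set" where
  "cycle_image g cs = (\<Union>i<length cs. path_image (g (cs ! i) (cs ! ((i + 1) mod length cs))))"

definition unlink_circle1 :: "(real^3) set" where
  "unlink_circle1 = {x. x $ 3 = 0 \<and> (x $ 1)\<^sup>2 + (x $ 2)\<^sup>2 = 1}"

definition unlink_circle2 :: "(real^3) set" where
  "unlink_circle2 = {x. x $ 3 = 0 \<and> (x $ 1 - 3)\<^sup>2 + (x $ 2)\<^sup>2 = 1}"

text \<open>Two disjoint closed curves A, B form a trivial link iff some homeomorphism of R^3
carries them onto the standard unlink (the unlink is amphichiral, so
orientation does not matter).\<close>

definition trivial_link :: "(real^3) set \<Rightarrow> (real^3) set \<Rightarrow> bool" where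
  "trivial_link A B \<longleftrightarrow> (\<exists>h k. homeomorphism UNIV UNIV h k \<and>
       h ` A = unlink_circle1 \<and> h ` B = unlink_circle2)"

definition linkless_embedding ::
  "'a set \<Rightarrow> ('a \<Rightarrow> 'a \<Rightarrow> bool) \<Rightarrow> ('a \<Rightarrow> real^3) \<Rightarrow> ('a \<Rightarrow> 'a \<Rightarrow> real \<Rightarrow> real^3) \<Rightarrow> bool" where
  "linkless_embedding V E p g \<longleftrightarrow> graph_embedding V E p g \<and>
     (\<forall>c1 c2. graph_cycle V E c1 \<and> graph_cycle V E c2 \<and> set c1 \<inter> set c2 = {} \<longrightarrow>
        trivial_link (cycle_image g c1) (cycle_image g c2))"

definition linklessly_embeddable :: "'a set \<Rightarrow> ('a \<Rightarrow> 'a \<Rightarrow> bool) \<Rightarrow> bool" where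
  "linklessly_embeddable V E \<longleftrightarrow> (\<exists>p g. linkless_embedding V E p g)"

end

theory Submission
  imports Defs
begin

text \<open>
  The graphs are drawn with straight edges in \<open>complex \<times> real\<close>. If, at every crossing of the projections, one closed polygon
  passes over another, and both polygons can be traversed downwards (at a self-crossing the earlier edge is on top), then a
  homeomorphism that preserves the projection makes the heights monotone along each polygon and puts the two polygons on different
  sides of a plane; turning the horizontal planes then carries them to two round circles. So a drawing is linkless as soon as all pairs of disjoint
  cycles have this property.

  An apex placed above a plane drawing always has it. Taking for the plane part the vertex-face graph of a plane map
  and joining the apex to all faces gives triangle-free graphs; subdividing an edge of the map between two triangles
  and joining the new vertex to their tips preserves 4-connectivity and adds three vertices. Starting from the octahedron, the square antiprism
  and the square antiprism with one diagonal this covers 15, 18 and all \<open>n \<ge> 19\<close>. For 13, 14, 16, 17 explicit non-planar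
  drawings with few crossings are checked by a search over the cycles that meet three crossings.
\<close>

section \<open>Isotopies of the unlink\<close>

text \<open>\<open>trivial_link\<close> asks for a homeomorphism of the whole space onto two fixed
  round circles, so vanishing linking numbers would not be enough: every disjoint pair of cycles has
  to be untied. Maps that preserve the projection can do this because new heights are constrained
  only by the order of the old ones over a common projected point, and that order can be checked
  edge by edge. A cycle with at most two self-crossings can always be traversed downwards, hence the
  search over triples of crossings.

  By Euler's formula a plane map with e edges has e + 2 vertices and faces together, so with the
  apex n = e + 3: octahedron 12 + 3, square antiprism 16 + 3, with a diagonal 17 + 3, and each
  inserted vertex adds three edges. Map vertices are not joined to the apex and need degree at least
  4. For simple maps with v vertices, 2v \<le> e \<le> 3v - 6 forces e \<ge> 12 and excludes e = 13,
  while e = 14 would need a 4-regular plane graph on 7 vertices, which does not exist. So 13, 14, 16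
  and 17 are out of reach of this construction and need drawings with crossings.\<close>

definition fiber_gauge :: "real \<Rightarrow> real \<Rightarrow> real \<Rightarrow> complex \<times> real \<Rightarrow> real" where
  "fiber_gauge L M \<epsilon> p = L * norm (fst p) + max (M * snd p) (\<epsilon> * snd p)"

text \<open>Both summands are convex and positively homogeneous. Subadditivity is the only property
  of a norm that survives: for positive slopes the gauge is negative straight downwards.\<close>

lemma fiber_gauge_add:
  assumes "0 \<le> L"
  shows "fiber_gauge L M \<epsilon> (p + q) \<le> fiber_gauge L M \<epsilon> p + fiber_gauge L M \<epsilon> q"
proof -
  have "L * norm (fst p + fst q) \<le> L * norm (fst p) + L * norm (fst q)"
    by (metis assms distrib_left mult_left_mono norm_triangle_ineq)
  then show ?thesis
    by (auto simp: fiber_gauge_def max_def algebra_simps)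
qed

text \<open>Constants found for different pieces of a curve can be merged, because raising the
  Lipschitz constant and the upper slope and lowering the lower slope only weakens the
  bound.\<close>

lemma fiber_gauge_mono:
  assumes "L \<le> L'" "M \<le> M'" "\<epsilon>' \<le> \<epsilon>" "\<epsilon> \<le> M" "0 < \<epsilon>'"
  shows "fiber_gauge L M \<epsilon> p \<le> fiber_gauge L' M' \<epsilon>' p"
proof -
  have "L * norm (fst p) \<le> L' * norm (fst p)"
    using assms by (simp add: mult_right_mono)
  moreover have "max (M * snd p) (\<epsilon> * snd p) \<le> max (M' * snd p) (\<epsilon>' * snd p)"
  proof (cases "snd p \<ge> 0")
    case True
    then have "M * snd p \<le> M' * snd p" "\<epsilon> * snd p \<le> M * snd p"
      using assms by (auto intro: mult_right_mono)
    then show ?thesis by auto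
  next
    case False
    then have "\<epsilon> * snd p \<le> \<epsilon>' * snd p" "M * snd p \<le> \<epsilon> * snd p"
      using assms by (auto intro: mult_right_mono_neg)
    then show ?thesis by auto
  qed
  ultimately show ?thesis unfolding fiber_gauge_def by linarith
qed

lemma bijective_imp_homeomorphism:
  fixes f :: "'a::euclidean_space \<Rightarrow> 'a"
  assumes "continuous_on UNIV f" "inj f" "surj f"
  obtains g where "homeomorphism UNIV UNIV f g"
  using invariance_of_domain_homeomorphism[of UNIV f] assms by auto

text \<open>The heights are extended by an infimal convolution with an asymmetric norm (McShane's
  extension); the slope of the gauge between \<open>\<epsilon>\<close> and \<open>M\<close> in the fibre direction makes
  the extension strictly increasing along fibres.\<close>

lemma fiberwise_homeomorphism:
  fixes \<gamma> :: "'i \<Rightarrow> complex \<times> real" and \<tau> :: "'i \<Rightarrow> real"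
  assumes "I \<noteq> {}" and L: "0 \<le> L" and \<epsilon>: "0 < \<epsilon>" "\<epsilon> \<le> M"
    and bt: "\<And>u. u \<in> I \<Longrightarrow> \<bar>\<tau> u\<bar> \<le> B" and bg: "\<And>u. u \<in> I \<Longrightarrow> \<bar>snd (\<gamma> u)\<bar> \<le> B"
    and cond: "\<And>u v. u \<in> I \<Longrightarrow> v \<in> I \<Longrightarrow> \<tau> u - \<tau> v \<le> fiber_gauge L M \<epsilon> (\<gamma> u - \<gamma> v)"
  obtains F G where "homeomorphism UNIV UNIV F G"
    "\<And>u. u \<in> I \<Longrightarrow> F (\<gamma> u) = (fst (\<gamma> u), \<tau> u)"
proof -
  let ?\<rho> = "fiber_gauge L M \<epsilon>"
  define f where "f p = (INF u\<in>I. \<tau> u + ?\<rho> (p - \<gamma> u))" for p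
  \<comment> \<open>The gauge is negative below the sample points, so the infimum is finite only
    because the sample points have bounded heights.\<close>
  have lower: "- B - \<epsilon> * (\<bar>snd p\<bar> + B) \<le> \<tau> u + ?\<rho> (p - \<gamma> u)" if "u \<in> I" for u p
  proof -
    have "- (\<bar>snd p\<bar> + B) \<le> snd p - snd (\<gamma> u)"
      using bg[OF that] by linarith
    then have "\<epsilon> * - (\<bar>snd p\<bar> + B) \<le> \<epsilon> * (snd p - snd (\<gamma> u))"
      using \<epsilon> by (intro mult_left_mono) auto
    moreover have "0 \<le> L * norm (fst p - fst (\<gamma> u))" using L by simp
    moreover have "- B \<le> \<tau> u" using bt[OF that] by linarith
    moreover have "\<epsilon> * (snd p - snd (\<gamma> u)) \<le> max (M * (snd p - snd (\<gamma> u))) (\<epsilon> * (snd p - snd (\<gamma> u)))"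
      by simp
    ultimately have "- B - \<epsilon> * (\<bar>snd p\<bar> + B) \<le> \<tau> u + (L * norm (fst p - fst (\<gamma> u)) +
        max (M * (snd p - snd (\<gamma> u))) (\<epsilon> * (snd p - snd (\<gamma> u))))"
      unfolding mult_minus_right by linarith
    then show ?thesis
      unfolding fiber_gauge_def by simp
  qed
  have bdd: "bdd_below ((\<lambda>u. \<tau> u + ?\<rho> (p - \<gamma> u)) ` I)" for p
    using lower[of _ p] by (intro bdd_belowI2) blast
  have f_le: "f p \<le> \<tau> u + ?\<rho> (p - \<gamma> u)" if "u \<in> I" for p u
    unfolding f_def by (rule cINF_lower[OF bdd that])
  \<comment> \<open>Everything follows from this inequality: for arbitrary points it gives a
    Lipschitz bound, for two points of one fibre it gives growth at rate at least
    \<open>\<epsilon>\<close>.\<close>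
  have f_diff: "f p \<le> f q + ?\<rho> (p - q)" for p q
  proof -
    have "f p - ?\<rho> (p - q) \<le> \<tau> u + ?\<rho> (q - \<gamma> u)" if "u \<in> I" for u
      using f_le[OF that, of p] fiber_gauge_add[OF L, of M \<epsilon> "p - q" "q - \<gamma> u"]
      by simp
    then have "f p - ?\<rho> (p - q) \<le> f q"
      unfolding f_def[of q] using \<open>I \<noteq> {}\<close> by (intro cINF_greatest) auto
    then show ?thesis by simp
  qed
  have f_eq: "f (\<gamma> u) = \<tau> u" if "u \<in> I" for u
  proof (rule antisym)
    show "f (\<gamma> u) \<le> \<tau> u"
      using f_le[OF that, of "\<gamma> u"] by (simp add: fiber_gauge_def)
    show "\<tau> u \<le> f (\<gamma> u)"
      unfolding f_def using \<open>I \<noteq> {}\<close> cond[OF that] by (intro cINF_greatest) (auto simp: algebra_simps)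
  qed
  have rho_bound: "?\<rho> p \<le> (L + M) * norm p" for p
  proof -
    have "L * norm (fst p) \<le> L * norm p"
      using L by (metis mult_left_mono norm_fst_le prod.collapse)
    moreover have "M * snd p \<le> M * norm p" "\<epsilon> * snd p \<le> M * norm p"
    proof -
      have *: "\<bar>snd p\<bar> \<le> norm p" by (metis norm_snd_le prod.collapse real_norm_def)
      show "M * snd p \<le> M * norm p" using * \<epsilon> by (intro mult_left_mono) auto
      have "\<epsilon> * snd p \<le> \<epsilon> * norm p" using * \<epsilon> by (intro mult_left_mono) auto
      also have "\<dots> \<le> M * norm p" using \<epsilon> by (intro mult_right_mono) auto
      finally show "\<epsilon> * snd p \<le> M * norm p" .
    qed
    ultimately show ?thesis unfolding fiber_gauge_def by (simp add: algebra_simps)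
  qed
  have lip: "\<bar>f p - f q\<bar> \<le> (L + M) * dist p q" for p q
    using f_diff[of p q] f_diff[of q p] rho_bound[of "p - q"] rho_bound[of "q - p"]
    by (simp add: dist_norm norm_minus_commute)
  have contf: "continuous_on UNIV f"
  proof (rule continuous_on_iff[THEN iffD2], intro ballI allI impI)
    fix p and e :: real assume "0 < e"
    have pos: "0 < L + M + 1" using L \<epsilon> by simp
    show "\<exists>d>0. \<forall>q\<in>UNIV. dist q p < d \<longrightarrow> dist (f q) (f p) < e"
    proof (intro exI conjI ballI impI)
      show "0 < e / (L + M + 1)" using \<open>0 < e\<close> pos by simp
      fix q assume "dist q p < e / (L + M + 1)"
      then have "(L + M + 1) * dist q p < e"
        using pos by (simp add: pos_less_divide_eq mult.commute)
      moreover have "(L + M) * dist q p \<le> (L + M + 1) * dist q p"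
        by (simp add: mult_right_mono)
      ultimately show "dist (f q) (f p) < e"
        using lip[of q p] by (simp add: dist_real_def)
    qed
  qed
  have incr: "f (w, z) + \<epsilon> * (z' - z) \<le> f (w, z')" if "z \<le> z'" for w z z'
  proof -
    have "M * (z - z') \<le> \<epsilon> * (z - z')" using that \<epsilon> by (intro mult_right_mono_neg) auto
    then have "?\<rho> ((w, z) - (w, z')) = \<epsilon> * (z - z')"
      by (simp add: fiber_gauge_def)
    then show ?thesis using f_diff[of "(w, z)" "(w, z')"] by (simp add: algebra_simps)
  qed
  define F where "F p = (fst p, f p)" for p :: "complex \<times> real"
  have "continuous_on UNIV F"
    unfolding F_def by (intro continuous_intros contf)
  moreover have "inj F"
  proof (rule injI)
    fix p q assume eq: "F p = F q"
    obtain w z w' z' where pq: "p = (w, z)" "q = (w', z')" by (metis prod.collapse)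
    with eq have w: "w' = w" "f (w, z) = f (w, z')" by (auto simp: F_def)
    have "\<not> z < z'" "\<not> z' < z"
      using incr[of z z' w] incr[of z' z w] w(2) mult_pos_pos[OF \<epsilon>(1), of "z' - z"]
        mult_pos_pos[OF \<epsilon>(1), of "z - z'"]
      by linarith+
    then have "z = z'" by simp
    then show "p = q" using pq w by simp
  qed
  moreover have "surj F"
  unfolding surj_def
  proof
    fix q :: "complex \<times> real"
    obtain w y where q: "q = (w, y)" by (metis prod.collapse)
    \<comment> \<open>Growth at rate \<open>\<epsilon>\<close> from height 0 reaches the value
      \<open>y\<close> within distance \<open>R\<close>.\<close>
    define R where "R = (\<bar>y\<bar> + \<bar>f (w, 0)\<bar>) / \<epsilon>"
    have R: "0 \<le> R" "\<epsilon> * R = \<bar>y\<bar> + \<bar>f (w, 0)\<bar>" using \<epsilon> by (auto simp: R_def)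
    have "f (w, -R) \<le> y" "y \<le> f (w, R)"
      using incr[of "-R" 0 w] incr[of 0 R w] R by auto
    moreover have "continuous_on {-R..R} (\<lambda>z. f (w, z))"
      by (rule continuous_on_compose2[OF contf]) (auto intro!: continuous_intros)
    ultimately obtain z where "f (w, z) = y"
      using IVT'[of "\<lambda>z. f (w, z)" "-R" y R] R by auto
    then have "q = F (w, z)" using q by (auto simp: F_def)
    then show "\<exists>p. q = F p" ..
  qed
  ultimately obtain G where "homeomorphism UNIV UNIV F G"
    by (rule bijective_imp_homeomorphism)
  then show thesis using that f_eq by (auto simp: F_def)
qed

text \<open>One constant serves as Lipschitz bound, as upper slope and, inverted, as lower slope.
  Since larger constants give weaker bounds, each pair of pieces may be treated separately with a
  constant of its own.\<close>

definition gauge_bounded ::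
  "('i \<Rightarrow> complex \<times> real) \<Rightarrow> ('i \<Rightarrow> real) \<Rightarrow> 'i set \<Rightarrow>
   ('j \<Rightarrow> complex \<times> real) \<Rightarrow> ('j \<Rightarrow> real) \<Rightarrow> 'j set \<Rightarrow> bool" where
  "gauge_bounded \<gamma> \<tau> I \<gamma>' \<tau>' J \<longleftrightarrow>
    (\<exists>K\<ge>1. \<forall>u\<in>I. \<forall>v\<in>J. \<tau> u - \<tau>' v \<le> fiber_gauge K K (1/K) (\<gamma> u - \<gamma>' v))"

text \<open>Meant for a single edge and for two edges at a common vertex, where the distance of the
  projections controls all heights. Of the constant \<open>2 * L + 1\<close>, one \<open>L\<close>
  pays for the new heights and one for a negative contribution of the old heights.\<close>

lemma gauge_bounded_lipschitz:
  assumes "0 \<le> L"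
    and "\<And>u v. u \<in> I \<Longrightarrow> v \<in> J \<Longrightarrow> \<bar>\<tau> u - \<tau>' v\<bar> \<le> L * norm (fst (\<gamma> u) - fst (\<gamma>' v))"
    and "\<And>u v. u \<in> I \<Longrightarrow> v \<in> J \<Longrightarrow> \<bar>snd (\<gamma> u) - snd (\<gamma>' v)\<bar> \<le> L * norm (fst (\<gamma> u) - fst (\<gamma>' v))"
  shows "gauge_bounded \<gamma> \<tau> I \<gamma>' \<tau>' J"
unfolding gauge_bounded_def
proof (intro exI conjI ballI)
  let ?K = "2 * L + 1"
  show "1 \<le> ?K" using assms(1) by simp
  fix u v assume uv: "u \<in> I" "v \<in> J"
  let ?w = "norm (fst (\<gamma> u) - fst (\<gamma>' v))" and ?z = "snd (\<gamma> u) - snd (\<gamma>' v)"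
  define y where "y = (1/?K) * ?z"
  have "\<bar>y\<bar> \<le> 1 * \<bar>?z\<bar>"
    unfolding abs_mult y_def using assms(1) by (intro mult_right_mono) auto
  then have "\<bar>y\<bar> \<le> L * ?w"
    using assms(3)[OF uv] by simp
  then have "- (L * ?w) \<le> y"
    by (simp add: abs_le_iff)
  moreover have "\<tau> u - \<tau>' v \<le> L * ?w" using assms(2)[OF uv] by (simp add: abs_le_iff)
  moreover have "L * ?w + L * ?w \<le> ?K * ?w" by (simp add: algebra_simps)
  ultimately have "\<tau> u - \<tau>' v \<le> ?K * ?w + max (?K * ?z) y" by linarith
  then show "\<tau> u - \<tau>' v \<le> fiber_gauge ?K ?K (1/?K) (\<gamma> u - \<gamma>' v)"
    unfolding fiber_gauge_def y_def by simp
qed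

text \<open>Meant for pieces without a common vertex. By compactness there is a gap
  \<open>\<eta>\<close>: for every pair of parameters either the projections are at least
  \<open>\<eta>\<close> apart, or the old and the new height differences have the same sign and size
  at least \<open>\<eta>\<close>. A constant that is large against \<open>1 / \<eta>\<close> works
  in both situations.\<close>

lemma gauge_bounded_separated:
  fixes \<gamma> \<gamma>' :: "real \<Rightarrow> complex \<times> real"
  assumes comp: "compact I" "compact J"
    and cont: "continuous_on I \<gamma>" "continuous_on J \<gamma>'" "continuous_on I \<tau>" "continuous_on J \<tau>'"
    and ord: "\<And>u v. u \<in> I \<Longrightarrow> v \<in> J \<Longrightarrow> fst (\<gamma> u) = fst (\<gamma>' v) \<Longrightarrow>
      0 < (snd (\<gamma> u) - snd (\<gamma>' v)) * (\<tau> u - \<tau>' v)"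
  shows "gauge_bounded \<gamma> \<tau> I \<gamma>' \<tau>' J"
proof -
  let ?P = "I \<times> J"
  define dw where "dw p = norm (fst (\<gamma> (fst p)) - fst (\<gamma>' (snd p)))" for p
  define dz where "dz p = snd (\<gamma> (fst p)) - snd (\<gamma>' (snd p))" for p
  define dt where "dt p = \<tau> (fst p) - \<tau>' (snd p)" for p
  have c1: "continuous_on ?P (\<lambda>p. \<gamma> (fst p))" "continuous_on ?P (\<lambda>p. \<gamma>' (snd p))"
    "continuous_on ?P (\<lambda>p. \<tau> (fst p))" "continuous_on ?P (\<lambda>p. \<tau>' (snd p))"
    by (rule continuous_on_compose2[OF cont(1)] continuous_on_compose2[OF cont(2)]
        continuous_on_compose2[OF cont(3)] continuous_on_compose2[OF cont(4)];
        auto intro!: continuous_intros)+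
  have cdw: "continuous_on ?P dw" and cdz: "continuous_on ?P dz" and cdt: "continuous_on ?P dt"
    unfolding dw_def dz_def dt_def by (intro continuous_intros c1)+
  have cP: "compact ?P" using comp by (rule compact_Times)
  obtain R where R: "R \<ge> 1" "\<And>p. p \<in> ?P \<Longrightarrow> \<bar>dz p\<bar> \<le> R" "\<And>p. p \<in> ?P \<Longrightarrow> \<bar>dt p\<bar> \<le> R"
  proof -
    have "bounded (dz ` ?P)" "bounded (dt ` ?P)"
      using compact_continuous_image[OF cdz cP] compact_continuous_image[OF cdt cP]
      by (auto intro: compact_imp_bounded)
    then obtain a b where a: "\<forall>x\<in>dz ` ?P. norm x \<le> a" and b: "\<forall>x\<in>dt ` ?P. norm x \<le> b"
      unfolding bounded_iff by blast
    have "\<bar>dz p\<bar> \<le> max 1 (max a b)" "\<bar>dt p\<bar> \<le> max 1 (max a b)" if "p \<in> ?P" for p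
      using bspec[OF a imageI[OF that]] bspec[OF b imageI[OF that]] by simp_all
    then show thesis by (intro that[of "max 1 (max a b)"]) auto
  qed
  \<comment> \<open>Positive exactly where the two differences are both positive or both
    negative.\<close>
  define h where "h p = max (min (dz p) (dt p)) (min (- dz p) (- dt p))" for p
  have ch: "continuous_on ?P h"
    unfolding h_def
    by (rule continuous_on_max continuous_on_min continuous_on_minus cdz cdt)+
  have hpos: "0 < h p" if "p \<in> ?P" "dw p = 0" for p
  proof -
    have "0 < dz p * dt p"
      using ord[of "fst p" "snd p"] that by (auto simp: dw_def dz_def dt_def)
    then have "0 < dz p \<and> 0 < dt p \<or> dz p < 0 \<and> dt p < 0" by (simp add: zero_less_mult_iff)
    then show ?thesis by (auto simp: h_def)
  qed
  obtain \<eta> where \<eta>: "0 < \<eta>" "\<And>p. p \<in> ?P \<Longrightarrow> \<eta> \<le> max (dw p) (h p)"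
  proof (cases "?P = {}")
    case True
    then show thesis by (intro that[of 1]) auto
  next
    case False
    have "continuous_on ?P (\<lambda>p. max (dw p) (h p))" by (rule continuous_on_max[OF cdw ch])
    from continuous_attains_inf[OF cP False this]
    obtain q where q: "q \<in> ?P" "\<And>p. p \<in> ?P \<Longrightarrow> max (dw q) (h q) \<le> max (dw p) (h p)"
      by auto
    have "0 \<le> dw q" by (simp add: dw_def)
    then have "0 < max (dw q) (h q)"
      using hpos[OF q(1)] by (cases "dw q = 0") (simp_all add: less_max_iff_disj)
    then show thesis using q(2) that by blast
  qed
  \<comment> \<open>The factor 2 leaves room for two terms of size \<open>R\<close>: the difference
    of the new heights and the lower slope times the difference of the old ones.\<close>
  define K where "K = max 1 (2 * R / \<eta>)"
  have K: "1 \<le> K" "2 * R \<le> K * \<eta>" "1/K \<le> 1" "0 < 1/K"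
  proof -
    show "1 \<le> K" by (simp add: K_def)
    have "2 * R = (2 * R / \<eta>) * \<eta>" using \<eta> by simp
    also have "\<dots> \<le> K * \<eta>" unfolding K_def using \<eta> by (intro mult_right_mono) auto
    finally show "2 * R \<le> K * \<eta>" .
    show "1/K \<le> 1" "0 < 1/K" using \<open>1 \<le> K\<close> by auto
  qed
  have "\<tau> u - \<tau>' v \<le> fiber_gauge K K (1/K) (\<gamma> u - \<gamma>' v)" if uv: "u \<in> I" "v \<in> J" for u v
  proof -
    let ?p = "(u, v)"
    have p: "?p \<in> ?P" using uv by simp
    have goal: "dt ?p \<le> K * dw ?p + max (K * dz ?p) ((1/K) * dz ?p)"
    proof (cases "\<eta> \<le> dw ?p")
      case True
      have "K * \<eta> \<le> K * dw ?p" using True K by (intro mult_left_mono) auto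
      moreover have "- R \<le> (1/K) * dz ?p"
      proof -
        have "\<bar>(1/K) * dz ?p\<bar> \<le> 1 * R"
          unfolding abs_mult using R(2)[OF p] K by (intro mult_mono) auto
        then show ?thesis by linarith
      qed
      ultimately show ?thesis using K(2) R(3)[OF p] by linarith
    next
      case False
      then have "\<eta> \<le> h ?p" using \<eta>(2)[OF p] by auto
      then consider "\<eta> \<le> dz ?p" | "dt ?p \<le> - \<eta>"
        unfolding h_def by linarith
      then have "dt ?p \<le> max (K * dz ?p) ((1/K) * dz ?p)"
      proof cases
        case 1
        have "K * \<eta> \<le> K * dz ?p" using 1 K by (intro mult_left_mono) auto
        then have "dt ?p \<le> K * dz ?p" using K(2) R(1) R(3)[OF p] by linarith
        then show ?thesis by simp
      next
        case 2
        have "(1/K) * R \<le> \<eta> / 2"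
          using K \<eta> by (simp add: field_simps)
        moreover have "\<bar>(1/K) * dz ?p\<bar> \<le> (1/K) * R"
          unfolding abs_mult using R(2)[OF p] K by (intro mult_mono) auto
        ultimately have "dt ?p \<le> (1/K) * dz ?p" using 2 \<eta>(1) by linarith
        then show ?thesis by simp
      qed
      moreover have "0 \<le> K * dw ?p" using K by (simp add: dw_def)
      ultimately show ?thesis by linarith
    qed
    then show ?thesis by (simp add: fiber_gauge_def dw_def dz_def dt_def)
  qed
  then show ?thesis using K(1) unfolding gauge_bounded_def by blast
qed

lemma fiber_gauge_le:
  assumes "1 \<le> K" "K \<le> K'"
  shows "fiber_gauge K K (1/K) p \<le> fiber_gauge K' K' (1/K') p"
proof (rule fiber_gauge_mono)
  have "1 / K \<le> 1" using assms by simp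
  then show "1 / K \<le> K" using assms by linarith
qed (use assms in \<open>auto simp: frac_le\<close>)

lemma gauge_bounded_UN:
  assumes "finite S" "finite T"
    and "\<And>i j. i \<in> S \<Longrightarrow> j \<in> T \<Longrightarrow> gauge_bounded \<gamma> \<tau> (I i) \<gamma>' \<tau>' (J j)"
  shows "gauge_bounded \<gamma> \<tau> (\<Union>i\<in>S. I i) \<gamma>' \<tau>' (\<Union>j\<in>T. J j)"
proof -
  obtain k where k: "\<And>i j. i \<in> S \<Longrightarrow> j \<in> T \<Longrightarrow> 1 \<le> k i j \<and>
      (\<forall>u\<in>I i. \<forall>v\<in>J j. \<tau> u - \<tau>' v \<le> fiber_gauge (k i j) (k i j) (1/k i j) (\<gamma> u - \<gamma>' v))"
    using assms(3) unfolding gauge_bounded_def by metis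
  define K where "K = Max (insert 1 ((\<lambda>(i, j). k i j) ` (S \<times> T)))"
  have fin: "finite (insert 1 ((\<lambda>(i, j). k i j) ` (S \<times> T)))" using assms(1,2) by simp
  have "1 \<le> K" unfolding K_def using fin by (intro Max_ge) auto
  moreover have "\<tau> u - \<tau>' v \<le> fiber_gauge K K (1/K) (\<gamma> u - \<gamma>' v)"
    if u: "u \<in> (\<Union>i\<in>S. I i)" and v: "v \<in> (\<Union>j\<in>T. J j)" for u v
  proof -
    obtain i j where ij: "i \<in> S" "j \<in> T" "u \<in> I i" "v \<in> J j" using u v by blast
    have "k i j \<le> K" unfolding K_def using fin ij by (intro Max_ge) auto
    then have "fiber_gauge (k i j) (k i j) (1/k i j) (\<gamma> u - \<gamma>' v) \<le> fiber_gauge K K (1/K) (\<gamma> u - \<gamma>' v)"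
      using k[OF ij(1,2)] by (intro fiber_gauge_le) auto
    moreover have "\<tau> u - \<tau>' v \<le> fiber_gauge (k i j) (k i j) (1/k i j) (\<gamma> u - \<gamma>' v)"
      using k[OF ij(1,2)] ij(3,4) by blast
    ultimately show ?thesis by linarith
  qed
  ultimately show ?thesis unfolding gauge_bounded_def by blast
qed

text \<open>Both curves are indexed by the disjoint sum of their parameter sets, so that a single
  homeomorphism prescribes the heights of both.\<close>

lemma gauge_bounded_homeomorphism:
  fixes \<gamma> :: "'i \<Rightarrow> complex \<times> real" and \<gamma>' :: "'j \<Rightarrow> complex \<times> real"
  assumes "gauge_bounded \<gamma> \<tau> I \<gamma> \<tau> I" "gauge_bounded \<gamma> \<tau> I \<gamma>' \<tau>' J"
    "gauge_bounded \<gamma>' \<tau>' J \<gamma> \<tau> I" "gauge_bounded \<gamma>' \<tau>' J \<gamma>' \<tau>' J"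
    and "I \<noteq> {}"
    and bnd: "\<And>u. u \<in> I \<Longrightarrow> \<bar>\<tau> u\<bar> \<le> B" "\<And>u. u \<in> I \<Longrightarrow> \<bar>snd (\<gamma> u)\<bar> \<le> B"
      "\<And>v. v \<in> J \<Longrightarrow> \<bar>\<tau>' v\<bar> \<le> B" "\<And>v. v \<in> J \<Longrightarrow> \<bar>snd (\<gamma>' v)\<bar> \<le> B"
  obtains F G where "homeomorphism UNIV UNIV F G"
    "\<And>u. u \<in> I \<Longrightarrow> F (\<gamma> u) = (fst (\<gamma> u), \<tau> u)"
    "\<And>v. v \<in> J \<Longrightarrow> F (\<gamma>' v) = (fst (\<gamma>' v), \<tau>' v)"
proof -
  obtain k1 where k1: "1 \<le> k1" "\<And>u v. u \<in> I \<Longrightarrow> v \<in> I \<Longrightarrow> \<tau> u - \<tau> v \<le> fiber_gauge k1 k1 (1/k1) (\<gamma> u - \<gamma> v)"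
    using assms(1) unfolding gauge_bounded_def by auto
  obtain k2 where k2: "1 \<le> k2" "\<And>u v. u \<in> I \<Longrightarrow> v \<in> J \<Longrightarrow> \<tau> u - \<tau>' v \<le> fiber_gauge k2 k2 (1/k2) (\<gamma> u - \<gamma>' v)"
    using assms(2) unfolding gauge_bounded_def by auto
  obtain k3 where k3: "1 \<le> k3" "\<And>u v. u \<in> J \<Longrightarrow> v \<in> I \<Longrightarrow> \<tau>' u - \<tau> v \<le> fiber_gauge k3 k3 (1/k3) (\<gamma>' u - \<gamma> v)"
    using assms(3) unfolding gauge_bounded_def by auto
  obtain k4 where k4: "1 \<le> k4" "\<And>u v. u \<in> J \<Longrightarrow> v \<in> J \<Longrightarrow> \<tau>' u - \<tau>' v \<le> fiber_gauge k4 k4 (1/k4) (\<gamma>' u - \<gamma>' v)"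
    using assms(4) unfolding gauge_bounded_def by auto
  note k = k1 k2 k3 k4
  define K where "K = k1 + k2 + k3 + k4"
  have K: "k1 \<le> K" "k2 \<le> K" "k3 \<le> K" "k4 \<le> K" "1 \<le> K" using k by (auto simp: K_def)
  define g where "g = case_sum \<gamma> \<gamma>'"
  define t where "t = case_sum \<tau> \<tau>'"
  let ?I = "I <+> J"
  have cond: "t u - t v \<le> fiber_gauge K K (1/K) (g u - g v)" if "u \<in> ?I" "v \<in> ?I" for u v
  proof -
    have *: "a \<le> fiber_gauge K K (1/K) p" if "a \<le> fiber_gauge k k (1/k) p" "1 \<le> k" "k \<le> K" for a k p
      using that(1) fiber_gauge_le[OF that(2,3), of p] by (rule order_trans)
    from \<open>u \<in> ?I\<close> \<open>v \<in> ?I\<close> show ?thesis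
      by (elim PlusE)
        (simp_all add: g_def t_def *[OF k(2) k(1) K(1)] *[OF k(4) k(3) K(2)] *[OF k(6) k(5) K(3)] *[OF k(8) k(7) K(4)])
  qed
  have "1/K \<le> 1" using K by simp
  then have "1/K \<le> K" using K(5) by linarith
  have ne: "?I \<noteq> {}" using \<open>I \<noteq> {}\<close> by auto
  have bt: "\<bar>t u\<bar> \<le> B" and bg: "\<bar>snd (g u)\<bar> \<le> B" if "u \<in> ?I" for u
    using that by (elim PlusE; simp add: g_def t_def bnd)+
  obtain F G where F: "homeomorphism UNIV UNIV F G" "\<And>u. u \<in> ?I \<Longrightarrow> F (g u) = (fst (g u), t u)"
    using fiberwise_homeomorphism[where \<gamma> = g and \<tau> = t and I = ?I and L = K and M = K and \<epsilon> = "1/K" and B = B,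
        OF ne _ _ \<open>1/K \<le> K\<close> bt bg cond] K(5)
    by auto
  show thesis
    using that[OF F(1)] F(2)[of "Inl _"] F(2)[of "Inr _"] by (auto simp: g_def t_def)
qed

section \<open>The model \<open>complex \<times> real\<close> of three-space\<close>

definition embed3 :: "complex \<times> real \<Rightarrow> real^3" where
  "embed3 p = vector [- snd p, Re (fst p), Im (fst p)]"

definition unembed3 :: "real^3 \<Rightarrow> complex \<times> real" where
  "unembed3 v = (Complex (v $ 2) (v $ 3), - (v $ 1))"

lemma embed3_unembed3 [simp]: "embed3 (unembed3 v) = v"
  by (simp add: embed3_def unembed3_def vec_eq_iff forall_3)

lemma unembed3_embed3 [simp]: "unembed3 (embed3 p) = p"
  by (cases p) (simp add: embed3_def unembed3_def complex_eq_iff)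

lemma inj_embed3: "inj embed3"
  by (metis injI unembed3_embed3)

lemma continuous_on_embed3: "continuous_on S embed3"
proof -
  have "linear embed3"
    by (rule linearI) (simp_all add: embed3_def vec_eq_iff forall_3)
  then show ?thesis by (rule linear_continuous_on[OF linear_conv_bounded_linear[THEN iffD1]])
qed

lemma homeomorphism_embed3: "homeomorphism UNIV UNIV embed3 unembed3"
proof (rule homeomorphismI)
  have "linear unembed3"
    by (rule linearI) (simp_all add: unembed3_def complex_eq_iff)
  then show "continuous_on UNIV unembed3"
    by (rule linear_continuous_on[OF linear_conv_bounded_linear[THEN iffD1]])
qed (auto simp: continuous_on_embed3)

text \<open>\<open>embed3\<close> turns the height into the negated first coordinate. Unit circles
  in the plane of real first components, centred at heights 0 and -3, thereby become the two
  standard circles, centred at 0 and 3 on the first axis.\<close>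

lemma trivial_link_embed3:
  assumes H: "homeomorphism UNIV UNIV H K"
    and A: "H ` A = {(complex_of_real x, t) | x t. x\<^sup>2 + t\<^sup>2 = 1}"
    and C: "H ` C = {(complex_of_real x, t) | x t. x\<^sup>2 + (t + 3)\<^sup>2 = 1}"
  shows "trivial_link (embed3 ` A) (embed3 ` C)"
proof -
  have hom: "homeomorphism UNIV UNIV (embed3 \<circ> (H \<circ> unembed3)) ((embed3 \<circ> K) \<circ> unembed3)"
    by (rule homeomorphism_compose[OF homeomorphism_compose[OF homeomorphism_symD[OF homeomorphism_embed3] H]
          homeomorphism_embed3])
  have img: "(embed3 \<circ> (H \<circ> unembed3)) ` (embed3 ` S) = embed3 ` (H ` S)" for S
    by (simp add: image_image o_def)
  have in_img: "v \<in> embed3 ` S \<longleftrightarrow> unembed3 v \<in> S" for v S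
    by (metis embed3_unembed3 image_iff unembed3_embed3)
  have "embed3 ` (H ` A) = unlink_circle1"
    unfolding A unlink_circle1_def set_eq_iff in_img unembed3_def
    by (auto simp: complex_eq_iff add.commute)
  moreover have "embed3 ` (H ` C) = unlink_circle2"
    unfolding C unlink_circle2_def set_eq_iff in_img unembed3_def
    by (auto simp: complex_eq_iff add.commute power2_commute)
  ultimately show ?thesis
    unfolding trivial_link_def using hom img by metis
qed

section \<open>Closed curves made of two strands over an interval of heights\<close>

definition strands :: "(real \<Rightarrow> complex) \<Rightarrow> (real \<Rightarrow> complex) \<Rightarrow> (real \<Rightarrow> complex) \<Rightarrow> bool" where
  "strands a b e \<longleftrightarrow> continuous_on {0..pi} a \<and> continuous_on {0..pi} b \<and> continuous_on {0..pi} e \<and>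
     (\<forall>\<theta>\<in>{0..pi}. e \<theta> \<noteq> 0 \<and> a \<theta> - b \<theta> = e \<theta> * of_real (sin \<theta>))"

definition strand_curve :: "(real \<Rightarrow> complex) \<Rightarrow> (real \<Rightarrow> complex) \<Rightarrow> real \<Rightarrow> (complex \<times> real) set" where
  "strand_curve a b h = (\<lambda>\<theta>. (a \<theta>, cos \<theta> - h)) ` {0..pi} \<union> (\<lambda>\<theta>. (b \<theta>, cos \<theta> - h)) ` {0..pi}"

text \<open>The strands of a round circle are plus and minus the sine. In each horizontal plane the
  similarity that centres the midpoint of the strands and multiplies by \<open>2 / e\<close>
  produces them. Hence the quotient \<open>e\<close> of strand difference and sine has to be
  continuous and non-zero up to both poles, which is what \<open>strands\<close> records.\<close>

lemma strand_curve_image: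
  assumes st: "strands a b e"
    and m: "\<And>\<theta>. \<theta> \<in> {0..pi} \<Longrightarrow> m (cos \<theta> - h) = (a \<theta> + b \<theta>) / 2"
    and c: "\<And>\<theta>. \<theta> \<in> {0..pi} \<Longrightarrow> c (cos \<theta> - h) = 2 / e \<theta>"
  shows "(\<lambda>p. (c (snd p) * (fst p - m (snd p)), snd p)) ` strand_curve a b h
    = {(complex_of_real x, t) | x t. x\<^sup>2 + (t + h)\<^sup>2 = 1}" (is "?H ` _ = ?R")
proof -
  have *: "?H (a \<theta>, cos \<theta> - h) = (of_real (sin \<theta>), cos \<theta> - h)"
    "?H (b \<theta>, cos \<theta> - h) = (of_real (- sin \<theta>), cos \<theta> - h)" if "\<theta> \<in> {0..pi}" for \<theta>
  proof -
    have e: "e \<theta> \<noteq> 0" "a \<theta> - b \<theta> = e \<theta> * of_real (sin \<theta>)"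
      using st that by (auto simp: strands_def)
    have "2 / e \<theta> * (a \<theta> - (a \<theta> + b \<theta>) / 2) = (a \<theta> - b \<theta>) / e \<theta>"
      "2 / e \<theta> * (b \<theta> - (a \<theta> + b \<theta>) / 2) = - ((a \<theta> - b \<theta>) / e \<theta>)"
      using e(1) by (simp_all add: field_simps)
    then have "2 / e \<theta> * (a \<theta> - (a \<theta> + b \<theta>) / 2) = of_real (sin \<theta>)"
      "2 / e \<theta> * (b \<theta> - (a \<theta> + b \<theta>) / 2) = of_real (- sin \<theta>)"
      unfolding e(2) using e(1) by simp_all
    then show "?H (a \<theta>, cos \<theta> - h) = (of_real (sin \<theta>), cos \<theta> - h)"
      "?H (b \<theta>, cos \<theta> - h) = (of_real (- sin \<theta>), cos \<theta> - h)"
      by (simp_all only: fst_conv snd_conv m[OF that] c[OF that])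
  qed
  have "?H ` strand_curve a b h =
    (\<lambda>\<theta>. (of_real (sin \<theta>), cos \<theta> - h)) ` {0..pi} \<union> (\<lambda>\<theta>. (of_real (- sin \<theta>), cos \<theta> - h)) ` {0..pi}"
    unfolding strand_curve_def image_Un image_image
    by (intro arg_cong2[where f = "(\<union>)"] image_cong refl) (use * in auto)
  also have "\<dots> = ?R"
  proof (intro subset_antisym subsetI)
    fix p assume "p \<in> ?R"
    then obtain x t where p: "p = (complex_of_real x, t)" and xt: "x\<^sup>2 + (t + h)\<^sup>2 = 1" by blast
    have "(t + h)\<^sup>2 \<le> 1" using xt zero_le_power2[of x] by linarith
    then have "\<bar>t + h\<bar> \<le> 1" by (simp add: abs_square_le_1)
    then have t: "-1 \<le> t + h" "t + h \<le> 1" by auto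
    define \<theta> where "\<theta> = arccos (t + h)"
    have \<theta>: "\<theta> \<in> {0..pi}" "cos \<theta> = t + h"
      using t by (auto simp: \<theta>_def arccos_lbound arccos_ubound)
    have "(sin \<theta>)\<^sup>2 = x\<^sup>2" using xt sin_squared_eq[of \<theta>] \<theta>(2) by simp
    then have "x = sin \<theta> \<or> x = - sin \<theta>" by (metis power2_eq_iff)
    then show "p \<in> (\<lambda>\<theta>. (complex_of_real (sin \<theta>), cos \<theta> - h)) ` {0..pi} \<union>
        (\<lambda>\<theta>. (complex_of_real (- sin \<theta>), cos \<theta> - h)) ` {0..pi}"
      using \<theta> p by (auto simp: image_iff)
  qed auto
  finally show ?thesis .
qed

lemma continuous_on_arccos_compose:
  assumes "continuous_on {0..pi} f"
  shows "continuous_on {-1..1} (\<lambda>t. f (arccos t))"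
  by (rule continuous_on_compose2[OF assms])
    (auto intro!: continuous_on_arccos' simp: arccos_lbound arccos_ubound)

text \<open>Two strands \<open>a\<close>, \<open>b\<close> at height \<open>cos \<theta>\<close> are moved onto a circle by a similarity of each
  horizontal plane. Multipliers are non-zero, so they can be interpolated between the two curves
  through a logarithm.\<close>

lemma strand_curves_unlink:
  assumes 1: "strands a1 b1 e1" and 2: "strands a2 b2 e2"
  obtains H K where "homeomorphism UNIV UNIV H K"
    "H ` strand_curve a1 b1 0 = {(complex_of_real x, t) | x t. x\<^sup>2 + t\<^sup>2 = 1}"
    "H ` strand_curve a2 b2 3 = {(complex_of_real x, t) | x t. x\<^sup>2 + (t + 3)\<^sup>2 = 1}"
proof -
  have lg: "\<exists>l. continuous_on {0..pi} l \<and> (\<forall>\<theta>\<in>{0..pi}. 2 / e \<theta> = exp (l \<theta>))" if "strands a b e" for a b e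
  proof -
    have c: "continuous_on {0..pi} (\<lambda>\<theta>. 2 / e \<theta>)" and nz: "\<And>\<theta>. \<theta> \<in> {0..pi} \<Longrightarrow> 2 / e \<theta> \<noteq> 0"
      using that by (auto simp: strands_def intro!: continuous_intros)
    obtain l where "continuous_on {0..pi} l" "\<And>\<theta>. \<theta> \<in> {0..pi} \<Longrightarrow> 2 / e \<theta> = exp (l \<theta>)"
      by (rule continuous_logarithm_on_contractible[OF c convex_imp_contractible[OF convex_real_interval(5)] nz])
        (assumption | rule that)+
    then show ?thesis by blast
  qed
  obtain l1 where l1: "continuous_on {0..pi} l1" "\<And>\<theta>. \<theta> \<in> {0..pi} \<Longrightarrow> 2 / e1 \<theta> = exp (l1 \<theta>)"
    using lg[OF 1] by blast
  obtain l2 where l2: "continuous_on {0..pi} l2" "\<And>\<theta>. \<theta> \<in> {0..pi} \<Longrightarrow> 2 / e2 \<theta> = exp (l2 \<theta>)"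
    using lg[OF 2] by blast
  \<comment> \<open>The height ranges of the two curves. They are disjoint, and between them any
    extension will do.\<close>
  let ?S = "{-1..1} \<union> {-4..-2::real}"
  have cl: "closedin (top_of_set UNIV) ?S" by (simp add: closed_Un)
  have ext: "\<exists>g :: real \<Rightarrow> complex. continuous_on UNIV g \<and> (\<forall>\<theta>\<in>{0..pi}. g (cos \<theta> - 0) = f1 \<theta>) \<and>
      (\<forall>\<theta>\<in>{0..pi}. g (cos \<theta> - 3) = f2 \<theta>)"
    if f: "continuous_on {0..pi} f1" "continuous_on {0..pi} f2" for f1 f2
  proof -
    define f where "f t = (if -1 \<le> t then f1 (arccos t) else f2 (arccos (t + 3)))" for t
    have "continuous_on {-1..1} f"
      by (rule continuous_on_eq[OF continuous_on_arccos_compose[OF f(1)]]) (simp add: f_def)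
    moreover have "continuous_on {-4..-2} f"
    proof (rule continuous_on_eq)
      show "continuous_on {-4..-2} (\<lambda>t. f2 (arccos (t + 3)))"
        by (rule continuous_on_compose2[OF continuous_on_arccos_compose[OF f(2)]])
          (auto intro!: continuous_intros)
    qed (simp add: f_def)
    ultimately have "continuous_on ?S f" by (intro continuous_on_closed_Un) auto
    then obtain g where g: "continuous_on UNIV g" "\<And>x. x \<in> ?S \<Longrightarrow> g x = f x"
      using Tietze_unbounded[OF _ cl] by blast
    have "g (cos \<theta> - 0) = f1 \<theta> \<and> g (cos \<theta> - 3) = f2 \<theta>" if "\<theta> \<in> {0..pi}" for \<theta>
    proof -
      have "cos \<theta> \<in> ?S" "cos \<theta> - 3 \<in> ?S" "\<not> -1 \<le> cos \<theta> - 3"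
        using cos_ge_minus_one[of \<theta>] cos_le_one[of \<theta>] unfolding Un_iff atLeastAtMost_iff by linarith+
      then show ?thesis using g(2) that by (auto simp: f_def arccos_cos)
    qed
    then show ?thesis using g(1) by blast
  qed
  obtain l where l: "continuous_on UNIV l" "\<And>\<theta>. \<theta> \<in> {0..pi} \<Longrightarrow> l (cos \<theta> - 0) = l1 \<theta>"
      "\<And>\<theta>. \<theta> \<in> {0..pi} \<Longrightarrow> l (cos \<theta> - 3) = l2 \<theta>"
    using ext[OF l1(1) l2(1)] by auto
  have "continuous_on {0..pi} (\<lambda>\<theta>. (a1 \<theta> + b1 \<theta>) / 2)" "continuous_on {0..pi} (\<lambda>\<theta>. (a2 \<theta> + b2 \<theta>) / 2)"
    using 1 2 by (auto simp: strands_def intro!: continuous_intros)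
  from ext[OF this] obtain m where m: "continuous_on UNIV m"
      "\<And>\<theta>. \<theta> \<in> {0..pi} \<Longrightarrow> m (cos \<theta> - 0) = (a1 \<theta> + b1 \<theta>) / 2"
      "\<And>\<theta>. \<theta> \<in> {0..pi} \<Longrightarrow> m (cos \<theta> - 3) = (a2 \<theta> + b2 \<theta>) / 2"
    by auto
  define H where "H p = (exp (l (snd p)) * (fst p - m (snd p)), snd p)" for p :: "complex \<times> real"
  have cs: "continuous_on UNIV (\<lambda>p :: complex \<times> real. l (snd p))" "continuous_on UNIV (\<lambda>p :: complex \<times> real. m (snd p))"
    by (rule continuous_on_compose2[OF l(1)] continuous_on_compose2[OF m(1)]; auto intro!: continuous_intros)+
  have "continuous_on UNIV H"
    unfolding H_def by (intro continuous_intros cs)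
  moreover have "inj H"
    by (rule injI) (auto simp: H_def prod_eq_iff)
  moreover have "surj H"
    unfolding surj_def
  proof
    fix q :: "complex \<times> real"
    have "q = H (fst q / exp (l (snd q)) + m (snd q), snd q)"
      by (simp add: H_def)
    then show "\<exists>p. q = H p" ..
  qed
  ultimately obtain K where "homeomorphism UNIV UNIV H K"
    by (rule bijective_imp_homeomorphism)
  moreover have "H ` strand_curve a1 b1 0 = {(complex_of_real x, t) | x t. x\<^sup>2 + t\<^sup>2 = 1}"
    using strand_curve_image[OF 1, of m 0 "\<lambda>t. exp (l t)"] m(2) l(2) l1(2)
    unfolding H_def by simp
  moreover have "H ` strand_curve a2 b2 3 = {(complex_of_real x, t) | x t. x\<^sup>2 + (t + 3)\<^sup>2 = 1}"
    using strand_curve_image[OF 2, of m 3 "\<lambda>t. exp (l t)"] m(3) l(3) l2(2)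
    unfolding H_def by simp
  ultimately show thesis by (rule that)
qed

section \<open>Angles between edges at a common vertex\<close>

definition spread :: "complex \<Rightarrow> complex \<Rightarrow> bool" where
  "spread p q \<longleftrightarrow> (\<forall>s t. 0 \<le> s \<longrightarrow> 0 \<le> t \<longrightarrow> s *\<^sub>R p = t *\<^sub>R q \<longrightarrow> s = 0 \<and> t = 0)"

lemma spreadD: "spread p q \<Longrightarrow> 0 \<le> s \<Longrightarrow> 0 \<le> t \<Longrightarrow> s *\<^sub>R p = t *\<^sub>R q \<Longrightarrow> s = 0 \<and> t = 0"
  unfolding spread_def by blast

lemma spread_commute: "spread p q \<Longrightarrow> spread q p"
  unfolding spread_def by (metis (no_types))

lemma spread_nonzero: "spread p q \<Longrightarrow> p \<noteq> 0" "spread p q \<Longrightarrow> q \<noteq> 0"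
  using spreadD[of p q 1 0] spreadD[of p q 0 1] by auto

text \<open>\<open>spread\<close> means that both vectors are non-zero and do not point in the same
  direction; opposite directions are allowed. By homogeneity a positive lower bound on the compact
  set \<open>s + t = 1\<close> is enough.\<close>

lemma spread_bound:
  assumes "spread p q"
  obtains \<kappa> where "0 < \<kappa>" "\<And>s t. 0 \<le> s \<Longrightarrow> 0 \<le> t \<Longrightarrow> \<kappa> * (s + t) \<le> norm (s *\<^sub>R p - t *\<^sub>R q)"
proof -
  define f where "f s = norm (s *\<^sub>R p - (1 - s) *\<^sub>R q)" for s :: real
  have "continuous_on {0..1} f" unfolding f_def by (intro continuous_intros)
  from continuous_attains_inf[OF compact_Icc _ this]
  obtain s0 where s0: "s0 \<in> {0..1}" "\<forall>s\<in>{0..1}. f s0 \<le> f s" by auto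
  have "f s0 \<noteq> 0"
    using spreadD[OF assms, of s0 "1 - s0"] s0(1) by (auto simp: f_def)
  then have pos: "0 < f s0" by (simp add: f_def)
  have "f s0 * (s + t) \<le> norm (s *\<^sub>R p - t *\<^sub>R q)" if "0 \<le> s" "0 \<le> t" for s t
  proof (cases "s + t = 0")
    case True
    then show ?thesis by simp
  next
    case False
    then have r: "0 < s + t" using that by simp
    have "s *\<^sub>R p - t *\<^sub>R q = (s + t) *\<^sub>R ((s / (s + t)) *\<^sub>R p - (1 - s / (s + t)) *\<^sub>R q)"
    proof -
      have "(s + t) * (s / (s + t)) = s" "(s + t) * (1 - s / (s + t)) = t"
        using r by (simp_all add: field_simps)
      then show ?thesis by (simp add: scaleR_diff_right)
    qed
    then have "norm (s *\<^sub>R p - t *\<^sub>R q) = (s + t) * f (s / (s + t))"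
      using r by (simp add: f_def)
    moreover have "f s0 \<le> f (s / (s + t))"
      using s0(2) that r by simp
    ultimately show ?thesis using r by (simp add: mult.commute)
  qed
  with pos show thesis by (rule that)
qed

text \<open>For two edges leaving \<open>z0\<close>, the projected distance is at least a constant
  times the sum of the distances travelled from \<open>z0\<close>. This sum bounds the differences
  of both the old and the new heights.\<close>

lemma gauge_bounded_arms:
  assumes "spread (fst p) (fst q)" "0 \<le> C"
    and u: "\<And>u. u \<in> I \<Longrightarrow> 0 \<le> s u \<and> \<gamma> u = z0 + s u *\<^sub>R p"
    and v: "\<And>v. v \<in> J \<Longrightarrow> 0 \<le> t v \<and> \<gamma>' v = z0 + t v *\<^sub>R q"
    and C: "\<And>u v. u \<in> I \<Longrightarrow> v \<in> J \<Longrightarrow> \<bar>\<tau> u - \<tau>' v\<bar> \<le> C * (s u + t v)"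
  shows "gauge_bounded \<gamma> \<tau> I \<gamma>' \<tau>' J"
proof -
  obtain \<kappa> where \<kappa>: "0 < \<kappa>" "\<And>s t. 0 \<le> s \<Longrightarrow> 0 \<le> t \<Longrightarrow> \<kappa> * (s + t) \<le> norm (s *\<^sub>R fst p - t *\<^sub>R fst q)"
    using spread_bound[OF assms(1)] by blast
  define D where "D = C + \<bar>snd p\<bar> + \<bar>snd q\<bar>"
  have D: "0 \<le> D" "C \<le> D" using assms(2) by (auto simp: D_def)
  have key: "D * (s u + t v) \<le> D / \<kappa> * norm (fst (\<gamma> u) - fst (\<gamma>' v))" if "u \<in> I" "v \<in> J" for u v
  proof -
    have "\<kappa> * (s u + t v) \<le> norm (fst (\<gamma> u) - fst (\<gamma>' v))"
      using \<kappa>(2)[of "s u" "t v"] u[OF that(1)] v[OF that(2)] by simp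
    then have "D / \<kappa> * (\<kappa> * (s u + t v)) \<le> D / \<kappa> * norm (fst (\<gamma> u) - fst (\<gamma>' v))"
      using D \<kappa>(1) by (intro mult_left_mono) auto
    then show ?thesis using \<kappa>(1) by simp
  qed
  show ?thesis
  proof (rule gauge_bounded_lipschitz)
    show "0 \<le> D / \<kappa>" using D \<kappa> by simp
    fix a b assume ab: "a \<in> I" "b \<in> J"
    have st: "0 \<le> s a" "0 \<le> t b" using u[OF ab(1)] v[OF ab(2)] by auto
    have "C * (s a + t b) \<le> D * (s a + t b)" using D st by (intro mult_right_mono) auto
    then show "\<bar>\<tau> a - \<tau>' b\<bar> \<le> D / \<kappa> * norm (fst (\<gamma> a) - fst (\<gamma>' b))"
      using C[OF ab] key[OF ab] by linarith
    have "\<bar>snd (\<gamma> a) - snd (\<gamma>' b)\<bar> = \<bar>s a * snd p - t b * snd q\<bar>"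
      using u[OF ab(1)] v[OF ab(2)] by simp
    also have "\<dots> \<le> \<bar>s a * snd p\<bar> + \<bar>t b * snd q\<bar>" by (rule abs_triangle_ineq4)
    also have "\<dots> = s a * \<bar>snd p\<bar> + t b * \<bar>snd q\<bar>" using st by (simp add: abs_mult)
    also have "\<dots> \<le> s a * D + t b * D"
      using st assms(2) by (intro add_mono mult_left_mono) (auto simp: D_def)
    also have "\<dots> = D * (s a + t b)" by (simp add: algebra_simps)
    finally show "\<bar>snd (\<gamma> a) - snd (\<gamma>' b)\<bar> \<le> D / \<kappa> * norm (fst (\<gamma> a) - fst (\<gamma>' b))"
      using key[OF ab] by linarith
  qed
qed

lemma gauge_bounded_segment:
  assumes "fst p \<noteq> 0" "0 \<le> C"
    and u: "\<And>u. u \<in> I \<Longrightarrow> \<gamma> u = z0 + s u *\<^sub>R p"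
    and C: "\<And>u v. u \<in> I \<Longrightarrow> v \<in> I \<Longrightarrow> \<bar>\<tau> u - \<tau> v\<bar> \<le> C * \<bar>s u - s v\<bar>"
  shows "gauge_bounded \<gamma> \<tau> I \<gamma> \<tau> I"
proof -
  define D where "D = C + \<bar>snd p\<bar>"
  have D: "0 \<le> D" "C \<le> D" using assms(2) by (auto simp: D_def)
  have key: "D / norm (fst p) * norm (fst (\<gamma> a) - fst (\<gamma> b)) = D * \<bar>s a - s b\<bar>" if "a \<in> I" "b \<in> I" for a b
  proof -
    have "fst (\<gamma> a) - fst (\<gamma> b) = (s a - s b) *\<^sub>R fst p"
      using u[OF that(1)] u[OF that(2)] by (simp add: scaleR_diff_left)
    then show ?thesis using assms(1) by simp
  qed
  show ?thesis
  proof (rule gauge_bounded_lipschitz)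
    show "0 \<le> D / norm (fst p)" using D by simp
    fix a b assume ab: "a \<in> I" "b \<in> I"
    have "C * \<bar>s a - s b\<bar> \<le> D * \<bar>s a - s b\<bar>" using D by (intro mult_right_mono) auto
    then show "\<bar>\<tau> a - \<tau> b\<bar> \<le> D / norm (fst p) * norm (fst (\<gamma> a) - fst (\<gamma> b))"
      using C[OF ab] key[OF ab] by linarith
    have "snd (\<gamma> a) - snd (\<gamma> b) = (s a - s b) * snd p"
      using u[OF ab(1)] u[OF ab(2)] by (simp add: algebra_simps)
    then have "\<bar>snd (\<gamma> a) - snd (\<gamma> b)\<bar> = \<bar>snd p\<bar> * \<bar>s a - s b\<bar>" by (simp add: abs_mult)
    also have "\<dots> \<le> D * \<bar>s a - s b\<bar>" using assms(2) by (intro mult_right_mono) (auto simp: D_def)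
    finally show "\<bar>snd (\<gamma> a) - snd (\<gamma> b)\<bar> \<le> D / norm (fst p) * norm (fst (\<gamma> a) - fst (\<gamma> b))"
      using key[OF ab] by linarith
  qed
qed

section \<open>Polygons parametrised by the reals, with new heights\<close>

definition chain :: "(nat \<Rightarrow> 'a::real_vector) \<Rightarrow> real \<Rightarrow> 'a" where
  "chain x u = x (nat \<lfloor>u\<rfloor>) + (u - real (nat \<lfloor>u\<rfloor>)) *\<^sub>R (x (Suc (nat \<lfloor>u\<rfloor>)) - x (nat \<lfloor>u\<rfloor>))"

lemma chain_seg:
  assumes "real i \<le> u" "u \<le> real (Suc i)"
  shows "chain x u = x i + (u - real i) *\<^sub>R (x (Suc i) - x i)"
proof (cases "u = real (Suc i)")
  case True
  have "\<lfloor>u\<rfloor> = int (Suc i)" unfolding True by simp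
  then have "nat \<lfloor>u\<rfloor> = Suc i" by simp
  then show ?thesis using True by (simp add: chain_def)
next
  case False
  then have "\<lfloor>u\<rfloor> = int i" using assms by (intro floor_unique) auto
  then show ?thesis by (simp add: chain_def)
qed

lemma chain_seg_end:
  assumes "real i \<le> u" "u \<le> real (Suc i)"
  shows "chain x u = x (Suc i) + (real (Suc i) - u) *\<^sub>R (x i - x (Suc i))"
  unfolding chain_seg[OF assms] by (simp add: algebra_simps)

lemma chain_image: "chain x ` {real i..real (Suc i)} = closed_segment (x i) (x (Suc i))"
proof -
  have "chain x ` {real i..real (Suc i)} = (\<lambda>u. x i + (u - real i) *\<^sub>R (x (Suc i) - x i)) ` {real i..real (Suc i)}"
    by (intro image_cong refl chain_seg) auto
  also have "\<dots> = (\<lambda>s. x i + s *\<^sub>R (x (Suc i) - x i)) ` ((\<lambda>u. u - real i) ` {real i..real (Suc i)})"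
    by (simp only: image_image)
  also have "(\<lambda>u. u - real i) ` {real i..real (Suc i)} = {0..1}"
    unfolding image_minus_const_atLeastAtMost' by simp
  also have "(\<lambda>s. x i + s *\<^sub>R (x (Suc i) - x i)) ` {0..1} =
      (\<lambda>s. (1 - s) *\<^sub>R x i + s *\<^sub>R x (Suc i)) ` {0..1}"
    by (intro image_cong refl) (simp add: algebra_simps)
  finally show ?thesis
    by (simp only: closed_segment_image_interval)
qed

lemma continuous_on_chain_seg: 
  fixes x :: "nat \<Rightarrow> 'a::real_normed_vector"
  shows "continuous_on {real i..real (Suc i)} (chain x)"
  by (rule continuous_on_eq[of _ "\<lambda>u. x i + (u - real i) *\<^sub>R (x (Suc i) - x i)"])
    (auto simp: chain_seg intro!: continuous_intros)

lemma continuous_on_chain: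
  fixes x :: "nat \<Rightarrow> 'a::real_normed_vector"
  shows "continuous_on {0..real n} (chain x)"
proof (induction n)
  case (Suc n)
  have "{0..real (Suc n)} = {0..real n} \<union> {real n..real (Suc n)}" by auto
  then show ?case using Suc continuous_on_chain_seg[of n x]
    by (metis closed_atLeastAtMost continuous_on_closed_Un)
qed simp

text \<open>The angle runs from 0 to pi along the first \<open>m\<close> edges and from pi to 2 pi
  along one more edge. Its cosine \<open>height\<close> therefore falls from 1 to -1 and a single
  closing edge carries it back up.\<close>

definition turn :: "nat \<Rightarrow> real \<Rightarrow> real" where
  "turn m u = (if u \<le> real m then pi * u / real m else pi * (u - real m) + pi)"

lemma abs_cos_diff_le: "\<bar>cos a - cos b\<bar> \<le> \<bar>a - b\<bar>" for a b :: real
proof -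
  have "\<bar>cos a - cos b\<bar> = 2 * (\<bar>sin ((a + b) / 2)\<bar> * \<bar>sin ((b - a) / 2)\<bar>)"
    by (simp add: cos_diff_cos abs_mult)
  also have "\<dots> \<le> 2 * (1 * \<bar>(b - a) / 2\<bar>)"
    by (intro mult_left_mono mult_mono abs_sin_x_le_abs_x) auto
  finally show ?thesis by simp
qed

lemma turn_lipschitz:
  assumes "1 \<le> m"
  shows "\<bar>turn m u - turn m v\<bar> \<le> pi * \<bar>u - v\<bar>"
proof -
  have m: "1 \<le> real m" using assms by simp
  have *: "\<bar>turn m u - turn m v\<bar> \<le> pi * \<bar>u - v\<bar>" if "u \<le> v" for u v
  proof -
    consider "v \<le> real m" | "real m < u" | "u \<le> real m" "real m < v" using that by linarith
    then show ?thesis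
    proof cases
      case 1
      then have "turn m u - turn m v = - (pi * ((v - u) / real m))"
        using that m by (simp add: turn_def field_simps)
      moreover have "(v - u) / real m \<le> (v - u) / 1"
        using m that by (intro divide_left_mono) auto
      moreover have "0 \<le> (v - u) / real m" using m that by simp
      moreover have "pi * ((v - u) / real m) \<le> pi * (v - u)"
        using calculation by (intro mult_left_mono) auto
      ultimately show ?thesis using that by (simp add: abs_mult)
    next
      case 2
      then show ?thesis using that by (simp add: turn_def abs_mult flip: right_diff_distrib)
    next
      case 3
      have "turn m v - turn m u = pi * ((v - real m) + (real m - u) / real m)"
        using 3 m by (simp add: turn_def field_simps)
      moreover have "(real m - u) / real m \<le> (real m - u) / 1"
        using m 3 by (intro divide_left_mono) auto
      moreover have "0 \<le> (real m - u) / real m" using m 3 by simp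
      ultimately have "0 \<le> turn m v - turn m u" "turn m v - turn m u \<le> pi * (v - u)"
        using 3 by simp_all
      then show ?thesis using that by simp
    qed
  qed
  show ?thesis using *[of u v] *[of v u] by (cases "u \<le> v") (auto simp: abs_minus_commute)
qed

definition height :: "nat \<Rightarrow> real \<Rightarrow> real" where "height m u = cos (turn m u)"

lemma height_lipschitz: "1 \<le> m \<Longrightarrow> \<bar>height m u - height m v\<bar> \<le> pi * \<bar>u - v\<bar>"
  unfolding height_def using abs_cos_diff_le[of "turn m u" "turn m v"] turn_lipschitz[of m u v] by linarith

lemma continuous_on_height:
  assumes "1 \<le> m"
  shows "continuous_on S (height m)"
proof (rule continuous_on_iff[THEN iffD2], intro ballI allI impI)
  fix u and e :: real assume "0 < e"
  show "\<exists>d>0. \<forall>v\<in>S. dist v u < d \<longrightarrow> dist (height m v) (height m u) < e"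
  proof (intro exI[of _ "e / pi"] conjI ballI impI)
    fix v assume "dist v u < e / pi"
    then have "pi * \<bar>v - u\<bar> < e" by (simp add: dist_real_def field_simps)
    then show "dist (height m v) (height m u) < e"
      using height_lipschitz[OF assms, of v u] by (simp add: dist_real_def)
  qed (use \<open>0 < e\<close> in simp)
qed

lemma height_last: "real m \<le> u \<Longrightarrow> 1 \<le> m \<Longrightarrow> height m u = cos (pi * (real (Suc m) - u))"
proof -
  assume "real m \<le> u" "1 \<le> m"
  then have "turn m u = 2 * pi - pi * (real (Suc m) - u)"
    by (auto simp: turn_def algebra_simps)
  then show ?thesis by (simp add: height_def)
qed

lemma height_less:
  assumes "0 \<le> u" "u < v" "v \<le> real m"
  shows "height m v < height m u"
proof -
  have "0 < real m" using assms by linarith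
  then have "pi * u / real m < pi * v / real m" "pi * v / real m \<le> pi" "0 \<le> pi * u / real m"
    using assms by (simp_all add: field_simps)
  then show ?thesis
    using assms cos_monotone_0_pi[of "pi * u / real m" "pi * v / real m"]
    by (simp add: height_def turn_def)
qed

text \<open>The difference of the strands of a polygon vanishes linearly at the poles, that of a
  round circle like the sine. This factor converts one into the other and tends to 1 at both
  ends.\<close>

lemma continuous_on_angle_ratio:
  "continuous_on {0..pi} (\<lambda>\<theta>. if \<theta> = 0 \<or> \<theta> = pi then 1 else min \<theta> (pi - \<theta>) / sin \<theta> :: real)" (is "continuous_on _ ?k")
proof -
  \<comment> \<open>The quotient of sine and angle, continued by its limit, which is the derivative
    of the sine at 0. The half of the interval near pi follows by reflection.\<close>
  define s where "s \<theta> = (if \<theta> = 0 then 1 else sin \<theta> / \<theta>)" for \<theta> :: real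
  have "(\<lambda>h. (sin (0 + h) - sin 0) / h) \<midarrow>0\<rightarrow> (1::real)"
    using DERIV_sin[of "0::real"] by (simp only: DERIV_def cos_zero)
  then have "s \<midarrow>0\<rightarrow> 1"
    by (rule Lim_transform_eventually) (auto simp: s_def eventually_at_filter)
  then have s0: "isCont s 0" by (simp add: isCont_def s_def)
  have cs: "continuous_on {0..pi/2} s"
    unfolding continuous_on_eq_continuous_within
  proof
    fix x :: real assume x: "x \<in> {0..pi/2}"
    show "continuous (at x within {0..pi/2}) s"
    proof (cases "x = 0")
      case True
      then show ?thesis using s0 by (simp add: continuous_at_imp_continuous_at_within)
    next
      case False
      have "continuous (at x) (\<lambda>\<theta>. sin \<theta> / \<theta>)"
        using False by (intro continuous_intros) auto
      moreover have "eventually (\<lambda>\<theta>. sin \<theta> / \<theta> = s \<theta>) (nhds x)"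
        using t1_space_nhds[OF False] by (auto simp: s_def elim!: eventually_mono)
      ultimately have "isCont s x" by (simp add: isCont_cong)
      then show ?thesis by (rule continuous_at_imp_continuous_at_within)
    qed
  qed
  have nz: "s \<theta> \<noteq> 0" if "\<theta> \<in> {0..pi/2}" for \<theta>
    using that sin_gt_zero[of \<theta>] pi_gt_zero by (auto simp: s_def)
  have "continuous_on {0..pi/2} ?k"
  proof (rule continuous_on_eq)
    show "continuous_on {0..pi/2} (\<lambda>\<theta>. 1 / s \<theta>)"
      using nz by (intro continuous_intros cs) auto
    show "1 / s \<theta> = ?k \<theta>" if "\<theta> \<in> {0..pi/2}" for \<theta>
      using that pi_gt_zero by (auto simp: s_def min_def)
  qed
  moreover have "continuous_on {pi/2..pi} ?k"
  proof (rule continuous_on_eq)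
    have "continuous_on {pi/2..pi} (\<lambda>\<theta>. s (pi - \<theta>))"
      by (rule continuous_on_compose2[OF cs]) (auto intro!: continuous_intros)
    then show "continuous_on {pi/2..pi} (\<lambda>\<theta>. 1 / s (pi - \<theta>))"
      using nz by (intro continuous_intros) (auto intro!: nz)
    show "1 / s (pi - \<theta>) = ?k \<theta>" if "\<theta> \<in> {pi/2..pi}" for \<theta>
      using that pi_gt_zero by (auto simp: s_def min_def)
  qed
  ultimately have "continuous_on ({0..pi/2} \<union> {pi/2..pi}) ?k"
    by (intro continuous_on_closed_Un) auto
  moreover have "{0..pi/2} \<union> {pi/2..pi} = {0..pi}" by auto
  ultimately show ?thesis by simp
qed

text \<open>Edge \<open>m\<close> closes the polygon and is the only one that rises once the heights
  are changed. It must not cross any edge it is not adjacent to, because for \<open>j = m\<close>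
  the conclusion is false. At every other crossing the earlier edge is on top.\<close>

definition descending_polygon :: "nat \<Rightarrow> (nat \<Rightarrow> complex \<times> real) \<Rightarrow> bool" where
  "descending_polygon m x \<longleftrightarrow> 2 \<le> m \<and> x (Suc m) = x 0 \<and>
     (\<forall>i<m. spread (fst (x i) - fst (x (Suc i))) (fst (x (Suc (Suc i))) - fst (x (Suc i)))) \<and>
     spread (fst (x m) - fst (x 0)) (fst (x 1) - fst (x 0)) \<and>
     (\<forall>i j. i < j \<longrightarrow> j \<le> m \<longrightarrow> j \<noteq> Suc i \<longrightarrow> \<not> (i = 0 \<and> j = m) \<longrightarrow>
        (\<forall>p\<in>closed_segment (x i) (x (Suc i)). \<forall>q\<in>closed_segment (x j) (x (Suc j)).
           fst p = fst q \<longrightarrow> j < m \<and> snd q < snd p))"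

definition polygon :: "nat \<Rightarrow> (nat \<Rightarrow> 'a::real_vector) \<Rightarrow> 'a set" where
  "polygon m x = (\<Union>i\<le>m. closed_segment (x i) (x (Suc i)))"

lemma Union_unit_intervals: "(\<Union>i\<le>m. {real i..real (Suc i)}) = {0..real (Suc m)}"
proof (induction m)
  case (Suc m)
  have "{0..real (Suc m)} \<union> {real (Suc m)..real (Suc (Suc m))} = {0..real (Suc (Suc m))}" by auto
  then show ?case using Suc by (simp add: atMost_Suc Un_commute)
qed simp

lemma polygon_eq_chain_image: "polygon m x = chain x ` {0..real (Suc m)}"
  unfolding polygon_def Union_unit_intervals[symmetric] image_UN chain_image ..

context
  fixes m :: nat and x :: "nat \<Rightarrow> complex \<times> real"
  assumes ok: "descending_polygon m x"
begin

lemma dp_m: "2 \<le> m" and dp_closed: "x (Suc m) = x 0"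
  and dp_spread: "\<And>i. i < m \<Longrightarrow> spread (fst (x i - x (Suc i))) (fst (x (Suc (Suc i)) - x (Suc i)))"
  and dp_spread0: "spread (fst (x m - x 0)) (fst (x 1 - x 0))"
  using ok unfolding descending_polygon_def by auto

lemma dp_order:
  assumes "i < j" "j \<le> m" "j \<noteq> Suc i" "\<not> (i = 0 \<and> j = m)"
    and u: "real i \<le> u" "u \<le> real (Suc i)" and v: "real j \<le> v" "v \<le> real (Suc j)"
    and eq: "fst (chain x u) = fst (chain x v)"
  shows "j < m \<and> snd (chain x v) < snd (chain x u)"
proof -
  have "chain x u \<in> closed_segment (x i) (x (Suc i))" "chain x v \<in> closed_segment (x j) (x (Suc j))"
    using u v unfolding chain_image[symmetric] by (auto intro!: imageI)
  then show ?thesis using ok assms(1-4) eq unfolding descending_polygon_def by blast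
qed

lemma dp_nonzero: "i \<le> m \<Longrightarrow> fst (x (Suc i) - x i) \<noteq> 0"
proof -
  assume "i \<le> m"
  then consider "i < m" | "i = m" by linarith
  then show ?thesis
  proof cases
    case 1
    then show ?thesis using spread_nonzero(1)[OF dp_spread[OF 1]] by auto
  next
    case 2
    then show ?thesis using spread_nonzero(1)[OF dp_spread0] dp_closed by auto
  qed
qed

text \<open>Two parameters over the same point lie on the falling part. So the closing edge meets
  the rest of the projection only in its ends, and this keeps the two strands apart in every
  horizontal plane.\<close>

lemma chain_crossing:
  assumes "0 \<le> u" "u < v" "v \<le> real (Suc m)" "\<not> (u = 0 \<and> v = real (Suc m))"
    and eq: "fst (chain x u) = fst (chain x v)"
  shows "v \<le> real m \<and> snd (chain x v) < snd (chain x u)"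
proof -
  \<comment> \<open>A parameter at a vertex is assigned to the edge starting there in the case of
    \<open>u\<close> and to the edge ending there in the case of \<open>v\<close>. With
    \<open>u < v\<close> this gives \<open>i \<le> j\<close>.\<close>
  define i where "i = nat \<lfloor>u\<rfloor>"
  define j where "j = nat (\<lceil>v\<rceil> - 1)"
  have i: "real i \<le> u" "u < real (Suc i)" using assms(1) unfolding i_def by linarith+
  have "0 < v" using assms(1,2) by simp
  then have j: "real j < v" "v \<le> real (Suc j)" unfolding j_def by linarith+
  have "i < Suc j" using i(1) assms(2) j(2) by (simp flip: of_nat_less_iff)
  then have ij: "i \<le> j" by simp
  have "j < Suc m" using j(1) assms(3) by (simp flip: of_nat_less_iff)
  then have jm: "j \<le> m" by simp
  have ul: "u \<le> real (Suc i)" and vl: "real j \<le> v" using i j by auto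
  consider "i = j" | "j = Suc i" | "j \<noteq> Suc i" "i = 0" "j = m" "i < j" | "i < j" "j \<noteq> Suc i" "\<not> (i = 0 \<and> j = m)"
    using ij by linarith
  then show ?thesis
  proof cases
    case 1
    then have cv: "chain x v = x i + (v - real i) *\<^sub>R (x (Suc i) - x i)"
      using chain_seg[OF vl j(2), of x] by simp
    have "(u - real i) *\<^sub>R fst (x (Suc i) - x i) = (v - real i) *\<^sub>R fst (x (Suc i) - x i)"
      using eq unfolding cv chain_seg[OF i(1) ul, of x] by simp
    then have "u = v" using dp_nonzero[of i] 1 jm by simp
    then show ?thesis using assms(2) by simp
  next
    case 2
    have "(real (Suc i) - u) *\<^sub>R fst (x i - x (Suc i)) = (v - real (Suc i)) *\<^sub>R fst (x (Suc (Suc i)) - x (Suc i))"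
      using eq chain_seg_end[OF i(1) ul, of x] chain_seg[OF vl j(2), of x] 2 by simp
    then have "real (Suc i) - u = 0"
      using spreadD[OF dp_spread, of i "real (Suc i) - u" "v - real (Suc i)"] 2 jm i j by simp
    then show ?thesis using i by simp
  next
    case 3
    have cu: "chain x u = x 0 + u *\<^sub>R (x 1 - x 0)" using chain_seg[OF i(1) ul, of x] 3 by simp
    have cv: "chain x v = x 0 + (real (Suc m) - v) *\<^sub>R (x m - x 0)"
      using chain_seg_end[OF vl j(2), of x] 3 dp_closed by simp
    have "(real (Suc m) - v) *\<^sub>R fst (x m - x 0) = u *\<^sub>R fst (x 1 - x 0)"
      using eq unfolding cu cv by simp
    then have "real (Suc m) - v = 0 \<and> u = 0"
      using spreadD[OF dp_spread0, of "real (Suc m) - v" u] assms(1,3) by simp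
    then show ?thesis using assms(4) by simp
  next
    case 4
    have *: "j < m \<and> snd (chain x v) < snd (chain x u)"
      by (rule dp_order[OF 4(1) jm 4(2,3) i(1) ul vl j(2) eq])
    moreover have "real (Suc j) \<le> real m" using * by (intro of_nat_mono) auto
    then have "v \<le> real m" using j(2) by linarith
    ultimately show ?thesis by simp
  qed
qed

text \<open>An edge is compared with itself along its line, with an adjacent edge by their angle,
  and with any other edge by compactness and the order of heights.\<close>

lemma chain_self_bounded_aux:
  assumes "i \<le> j" "j \<le> m"
  shows "gauge_bounded (chain x) (height m) {real i..real (Suc i)} (chain x) (height m) {real j..real (Suc j)}"
    and "gauge_bounded (chain x) (height m) {real j..real (Suc j)} (chain x) (height m) {real i..real (Suc i)}"
proof -
  have m1: "1 \<le> m" using dp_m by simp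
  consider "i = j" | "j = Suc i" | "j \<noteq> Suc i" "i = 0" "j = m" "i < j" | "i < j" "j \<noteq> Suc i" "\<not> (i = 0 \<and> j = m)"
    using assms by linarith
  note cases = this
  let ?I = "{real i..real (Suc i)}" and ?J = "{real j..real (Suc j)}"
  have "gauge_bounded (chain x) (height m) ?I (chain x) (height m) ?J \<and>
    gauge_bounded (chain x) (height m) ?J (chain x) (height m) ?I"
    using cases
  proof cases
    case 1
    have "gauge_bounded (chain x) (height m) ?I (chain x) (height m) ?I"
    proof (rule gauge_bounded_segment)
      show "fst (x (Suc i) - x i) \<noteq> 0" using dp_nonzero[of i] assms by simp
      show "chain x u = x i + (u - real i) *\<^sub>R (x (Suc i) - x i)" if "u \<in> ?I" for u
        using that by (intro chain_seg) auto
      show "\<bar>height m u - height m v\<bar> \<le> pi * \<bar>(u - real i) - (v - real i)\<bar>" for u v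
        using height_lipschitz[OF m1, of u v] by simp
    qed simp
    then show ?thesis using 1 by simp
  next
    case 2
    have im: "i < m" using 2 assms by simp
    have u: "0 \<le> real (Suc i) - u \<and> chain x u = x (Suc i) + (real (Suc i) - u) *\<^sub>R (x i - x (Suc i))" if "u \<in> ?I" for u
      using that chain_seg_end[of i u x] by auto
    have v: "0 \<le> v - real (Suc i) \<and> chain x v = x (Suc i) + (v - real (Suc i)) *\<^sub>R (x (Suc (Suc i)) - x (Suc i))"
      if "v \<in> ?J" for v
      using that chain_seg[of "Suc i" v x] 2 by auto
    have h: "\<bar>height m u - height m v\<bar> \<le> pi * ((real (Suc i) - u) + (v - real (Suc i)))"
      "\<bar>height m v - height m u\<bar> \<le> pi * ((v - real (Suc i)) + (real (Suc i) - u))" if "u \<in> ?I" "v \<in> ?J" for u v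
    proof -
      have "\<bar>u - v\<bar> = (real (Suc i) - u) + (v - real (Suc i))" "\<bar>v - u\<bar> = (v - real (Suc i)) + (real (Suc i) - u)"
        using that 2 by auto
      then show "\<bar>height m u - height m v\<bar> \<le> pi * ((real (Suc i) - u) + (v - real (Suc i)))"
        "\<bar>height m v - height m u\<bar> \<le> pi * ((v - real (Suc i)) + (real (Suc i) - u))"
        using height_lipschitz[OF m1, of u v] height_lipschitz[OF m1, of v u] by simp_all
    qed
    show ?thesis
    proof
      show "gauge_bounded (chain x) (height m) ?I (chain x) (height m) ?J"
        by (rule gauge_bounded_arms[where s = "\<lambda>u. real (Suc i) - u" and t = "\<lambda>v. v - real (Suc i)",
            OF dp_spread[OF im] _ u v h(1)]) simp_all
      show "gauge_bounded (chain x) (height m) ?J (chain x) (height m) ?I"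
        by (rule gauge_bounded_arms[where s = "\<lambda>v. v - real (Suc i)" and t = "\<lambda>u. real (Suc i) - u",
            OF spread_commute[OF dp_spread[OF im]] _ v u h(2)]) simp_all
    qed
  next
    case 3
    have u: "0 \<le> u \<and> chain x u = x 0 + u *\<^sub>R (x 1 - x 0)" if "u \<in> ?I" for u
      using that 3 chain_seg[of 0 u x] by auto
    have v: "0 \<le> real (Suc m) - v \<and> chain x v = x 0 + (real (Suc m) - v) *\<^sub>R (x m - x 0)" if "v \<in> ?J" for v
      using that 3 chain_seg_end[of m v x] dp_closed by auto
    \<comment> \<open>The parameters are far apart here, so the Lipschitz bound for
      \<open>height\<close> is too weak. But the turn is a full one, so near \<open>x 0\<close> both
      heights are close to 1 and the distances to \<open>x 0\<close> along the two edges bound the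
      difference.\<close>
    have h: "\<bar>height m u - height m v\<bar> \<le> pi * (u + (real (Suc m) - v))" if "u \<in> ?I" "v \<in> ?J" for u v
    proof -
      have uv: "0 \<le> u" "u \<le> 1" "real m \<le> v" "v \<le> real (Suc m)" using that 3 by auto
      have hu: "height m u = cos (pi * u / real m)" using uv dp_m by (simp add: height_def turn_def)
      have hv: "height m v = cos (pi * (real (Suc m) - v))" by (rule height_last[OF uv(3) m1])
      have "pi * u / real m \<le> pi * u / 1" using uv m1 by (intro divide_left_mono) auto
      moreover have "0 \<le> pi * u / real m" using uv by simp
      moreover have "0 \<le> pi * (real (Suc m) - v)" using uv by simp
      ultimately have "\<bar>pi * u / real m - pi * (real (Suc m) - v)\<bar> \<le> pi * u + pi * (real (Suc m) - v)"
        by linarith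
      then show ?thesis
        unfolding hu hv distrib_left using abs_cos_diff_le by (rule order_trans[rotated])
    qed
    have h': "\<bar>height m v - height m u\<bar> \<le> pi * ((real (Suc m) - v) + u)" if "u \<in> ?I" "v \<in> ?J" for u v
      using h[OF that] by (simp add: abs_minus_commute add.commute)
    show ?thesis
    proof
      show "gauge_bounded (chain x) (height m) ?I (chain x) (height m) ?J"
        by (rule gauge_bounded_arms[where s = "\<lambda>u. u" and t = "\<lambda>v. real (Suc m) - v",
            OF spread_commute[OF dp_spread0] _ u v h]) simp_all
      show "gauge_bounded (chain x) (height m) ?J (chain x) (height m) ?I"
        by (rule gauge_bounded_arms[where s = "\<lambda>v. real (Suc m) - v" and t = "\<lambda>u. u",
            OF dp_spread0 _ v u h']) simp_all
    qed
  next
    case 4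
    have c: "continuous_on ?I (chain x)" "continuous_on ?J (chain x)"
      "continuous_on ?I (height m)" "continuous_on ?J (height m)"
      using continuous_on_chain_seg continuous_on_height[OF m1] by blast+
    have ord: "snd (chain x v) < snd (chain x u) \<and> height m v < height m u"
      if "u \<in> ?I" "v \<in> ?J" "fst (chain x u) = fst (chain x v)" for u v
    proof -
      have *: "j < m \<and> snd (chain x v) < snd (chain x u)"
        by (rule dp_order[OF 4(1) assms(2) 4(2,3)]) (use that in auto)
      \<comment> \<open>Both edges precede the closing one, so their parameters lie on the falling
        part, in this order.\<close>
      have "real (Suc (Suc i)) \<le> real j" using 4 by (intro of_nat_mono) auto
      moreover have "real (Suc j) \<le> real m" using * by (intro of_nat_mono) auto
      ultimately have "0 \<le> u" "u < v" "v \<le> real m" using that(1,2) by auto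
      then show ?thesis using * height_less by blast
    qed
    show ?thesis
    proof
      show "gauge_bounded (chain x) (height m) ?I (chain x) (height m) ?J"
        by (rule gauge_bounded_separated[OF compact_Icc compact_Icc c]) (use ord in \<open>simp add: zero_less_mult_iff\<close>)
      show "gauge_bounded (chain x) (height m) ?J (chain x) (height m) ?I"
        by (rule gauge_bounded_separated[OF compact_Icc compact_Icc c(2,1,4,3)])
          (use ord[OF _ _ sym] in \<open>simp add: zero_less_mult_iff\<close>)
    qed
  qed
  then show "gauge_bounded (chain x) (height m) ?I (chain x) (height m) ?J"
    "gauge_bounded (chain x) (height m) ?J (chain x) (height m) ?I" by auto
qed

lemma chain_self_bounded:
  "gauge_bounded (chain x) (height m) {0..real (Suc m)} (chain x) (height m) {0..real (Suc m)}"
  unfolding Union_unit_intervals[symmetric]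
proof (rule gauge_bounded_UN)
  fix i j assume "i \<in> {..m}" "j \<in> {..m}"
  then show "gauge_bounded (chain x) (height m) {real i..real (Suc i)} (chain x) (height m) {real j..real (Suc j)}"
    using chain_self_bounded_aux[of i j] chain_self_bounded_aux[of j i] by (cases "i \<le> j") auto
qed auto

text \<open>\<open>strand_a\<close> follows the falling part and \<open>strand_b\<close> the closing
  edge, both parametrised so that the new height at \<open>\<theta>\<close> is the cosine of
  \<open>\<theta>\<close>.\<close>

definition strand_a :: "real \<Rightarrow> complex" where "strand_a \<theta> = fst (chain x (real m * \<theta> / pi))"
definition strand_b :: "real \<Rightarrow> complex" where "strand_b \<theta> = fst (x 0) + (\<theta> / pi) *\<^sub>R fst (x m - x 0)"

lemma strand_b_chain:
  assumes "\<theta> \<in> {0..pi}"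
  shows "strand_b \<theta> = fst (chain x (real (Suc m) - \<theta> / pi))"
proof -
  have "0 \<le> \<theta> / pi" "\<theta> / pi \<le> 1" using assms by auto
  then have "chain x (real (Suc m) - \<theta> / pi) = x (Suc m) + (\<theta> / pi) *\<^sub>R (x m - x (Suc m))"
    using chain_seg_end[of m "real (Suc m) - \<theta> / pi" x] by simp
  then show ?thesis by (simp add: strand_b_def dp_closed)
qed

text \<open>Near a pole the strands run along two edges with a common vertex, so their difference is
  linear in the angle with a constant direction.\<close>

lemma strand_a_start:
  assumes "0 \<le> \<theta>" "\<theta> \<le> pi / real m"
  shows "strand_a \<theta> - strand_b \<theta> = (\<theta> / pi) *\<^sub>R (real m *\<^sub>R fst (x 1 - x 0) - fst (x m - x 0))"
proof -
  have "0 \<le> real m * \<theta> / pi" "real m * \<theta> / pi \<le> 1"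
    using assms dp_m pi_gt_zero by (simp_all add: field_simps)
  then have "chain x (real m * \<theta> / pi) = x 0 + (real m * \<theta> / pi) *\<^sub>R (x 1 - x 0)"
    using chain_seg[of 0 "real m * \<theta> / pi" x] by simp
  then show ?thesis
    by (simp add: strand_a_def strand_b_def scaleR_diff_right mult.commute)
qed

lemma strand_a_end:
  assumes "pi - pi / real m \<le> \<theta>" "\<theta> \<le> pi"
  shows "strand_a \<theta> - strand_b \<theta> =
    ((pi - \<theta>) / pi) *\<^sub>R (real m *\<^sub>R fst (x (m - 1) - x m) - fst (x 0 - x m))"
proof -
  have m: "0 < real m" "Suc (m - 1) = m" using dp_m by auto
  have r: "real m - real m * \<theta> / pi = real m * ((pi - \<theta>) / pi)"
    using pi_gt_zero by (simp add: field_simps)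
  have "real (m - 1) = real m - 1" using dp_m by simp
  moreover have "real m * ((pi - \<theta>) / pi) \<le> 1" "0 \<le> real m * ((pi - \<theta>) / pi)"
    using assms m pi_gt_zero by (simp_all add: field_simps)
  ultimately have "real (m - 1) \<le> real m * \<theta> / pi" "real m * \<theta> / pi \<le> real (Suc (m - 1))"
    using r unfolding m(2) by linarith+
  from chain_seg_end[OF this, of x]
  have "chain x (real m * \<theta> / pi) = x m + (real m * ((pi - \<theta>) / pi)) *\<^sub>R (x (m - 1) - x m)"
    using r m by simp
  moreover have "strand_b \<theta> = fst (x m) + ((pi - \<theta>) / pi) *\<^sub>R fst (x 0 - x m)"
  proof -
    have *: "(pi - \<theta>) / pi = 1 - \<theta> / pi" by (simp add: diff_divide_distrib)
    show ?thesis unfolding * strand_b_def by (simp add: algebra_simps)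
  qed
  ultimately show ?thesis
    by (simp add: strand_a_def scaleR_diff_right mult.commute)
qed

lemma continuous_on_strand_a: "continuous_on {0..pi} strand_a"
  unfolding strand_a_def
proof (rule continuous_on_fst, rule continuous_on_compose2[OF continuous_on_chain])
  show "(\<lambda>\<theta>. real m * \<theta> / pi) ` {0..pi} \<subseteq> {0..real m}"
  proof clarsimp
    fix \<theta> :: real assume "0 \<le> \<theta>" "\<theta> \<le> pi"
    then have "real m * \<theta> \<le> real m * pi" by (intro mult_left_mono) auto
    then show "real m * \<theta> / pi \<le> real m" by (simp add: divide_le_eq)
  qed
qed (intro continuous_intros; simp)

text \<open>The strand difference divided by the distance to the nearer pole is constant near both
  poles. These constants are non-zero because of the angles at \<open>x 0\<close> and
  \<open>x m\<close>, and in between the quotient is non-zero by \<open>chain_crossing\<close>.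
  Multiplying by the ratio of that distance to the sine gives \<open>e\<close>.\<close>

lemma strands_exist: "\<exists>e. strands strand_a strand_b e"
proof -
  let ?d = "\<lambda>\<theta>. strand_a \<theta> - strand_b \<theta>"
  let ?min = "\<lambda>\<theta>. min \<theta> (pi - \<theta>)"
  define E0 where "E0 = (1 / pi) *\<^sub>R (real m *\<^sub>R fst (x 1 - x 0) - fst (x m - x 0))"
  define E1 where "E1 = (1 / pi) *\<^sub>R (real m *\<^sub>R fst (x (m - 1) - x m) - fst (x 0 - x m))"
  have m: "2 \<le> real m" "Suc (m - 1) = m" using dp_m by auto
  have E0: "E0 \<noteq> 0"
    using spreadD[OF dp_spread0, of 1 "real m"] m by (auto simp: E0_def)
  have E1: "E1 \<noteq> 0"
    using spreadD[OF dp_spread[of "m - 1"], of "real m" 1] m dp_closed by (auto simp: E1_def)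
  have half: "pi / real m \<le> pi / 2" "0 < pi / real m"
    using m divide_left_mono[OF m(1), of pi] by auto
  define f where "f \<theta> = (if \<theta> = 0 then E0 else if \<theta> = pi then E1 else ?d \<theta> / of_real (?min \<theta>))" for \<theta>
  have f0: "f \<theta> = E0" if "\<theta> \<in> {0..pi / real m}" for \<theta>
  proof -
    have "\<theta> \<le> pi - \<theta>" "\<theta> \<noteq> pi" using that half pi_gt_zero unfolding atLeastAtMost_iff by linarith+
    then have "?min \<theta> = \<theta>" "\<theta> \<noteq> pi" by simp_all
    moreover have "?d \<theta> = of_real \<theta> * E0"
      using strand_a_start[of \<theta>] that by (simp add: E0_def scaleR_conv_of_real)
    ultimately show ?thesis by (simp add: f_def)
  qed
  have f1: "f \<theta> = E1" if "\<theta> \<in> {pi - pi / real m..pi}" for \<theta>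
  proof -
    have "pi - \<theta> \<le> \<theta>" "\<theta> \<noteq> 0" using that half pi_gt_zero unfolding atLeastAtMost_iff by linarith+
    then have "?min \<theta> = pi - \<theta>" "\<theta> \<noteq> 0" by simp_all
    moreover have "?d \<theta> = of_real (pi - \<theta>) * E1"
      using strand_a_end[of \<theta>] that by (simp add: E1_def scaleR_conv_of_real)
    ultimately show ?thesis by (simp add: f_def)
  qed
  have cb: "continuous_on {0..pi} strand_b"
    unfolding strand_b_def by (intro continuous_intros) auto
  let ?M = "{pi / real m..pi - pi / real m}"
  have sub: "?M \<subseteq> {0..pi}" using half by auto
  have "continuous_on {0..pi / real m} f"
    by (rule continuous_on_eq[OF continuous_on_const]) (simp add: f0)
  moreover have "continuous_on ?M f"
  proof (rule continuous_on_eq)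
    show "continuous_on ?M (\<lambda>\<theta>. ?d \<theta> / of_real (?min \<theta>))"
      by (intro continuous_on_divide continuous_on_diff continuous_on_of_real continuous_on_min
          continuous_on_const continuous_on_id continuous_on_subset[OF continuous_on_strand_a sub]
          continuous_on_subset[OF cb sub]) (use half in auto)
  qed (use half in \<open>auto simp: f_def\<close>)
  moreover have "continuous_on {pi - pi / real m..pi} f"
    by (rule continuous_on_eq[OF continuous_on_const]) (simp add: f1)
  ultimately have "continuous_on ({0..pi / real m} \<union> ?M \<union> {pi - pi / real m..pi}) f"
    by (intro continuous_on_closed_Un closed_Un) auto
  moreover have "{0..pi / real m} \<union> ?M \<union> {pi - pi / real m..pi} = {0..pi}"
  proof -
    have "pi / real m \<le> pi - pi / real m" "pi - pi / real m \<le> pi" "pi / real m \<le> pi"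
      using half by linarith+
    then show ?thesis using half(2) by auto
  qed
  ultimately have cf: "continuous_on {0..pi} f" by simp
  have d0: "?d 0 = 0" using strand_a_start[of 0] half by simp
  have d1: "?d pi = 0" using strand_a_end[of pi] half by simp
  have dn: "?d \<theta> \<noteq> 0" if "0 < \<theta>" "\<theta> < pi" for \<theta>
  proof
    assume eq: "?d \<theta> = 0"
    have t: "0 < \<theta> / pi" "\<theta> / pi < 1" using that by auto
    have "real m * \<theta> / pi = real m * (\<theta> / pi)" by simp
    also have "\<dots> < real m * 1" using t m by (intro mult_strict_left_mono) auto
    finally have u: "0 \<le> real m * \<theta> / pi" "real m * \<theta> / pi < real m" using that by auto
    have eq': "fst (chain x (real m * \<theta> / pi)) = fst (chain x (real (Suc m) - \<theta> / pi))"
      using eq strand_b_chain[of \<theta>] that by (simp add: strand_a_def)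
    have "0 < real m * (\<theta> / pi)" using m t by (intro mult_pos_pos) linarith+
    then have pos: "\<not> (real m * \<theta> / pi = 0 \<and> real (Suc m) - \<theta> / pi = real (Suc m))" using t by linarith
    have "real (Suc m) - \<theta> / pi \<le> real m \<and> snd (chain x (real (Suc m) - \<theta> / pi)) < snd (chain x (real m * \<theta> / pi))"
    proof (rule chain_crossing[OF u(1) _ _ pos eq'])
      show "real m * \<theta> / pi < real (Suc m) - \<theta> / pi" "real (Suc m) - \<theta> / pi \<le> real (Suc m)"
        using u(2) t by linarith+
    qed
    then have "1 \<le> \<theta> / pi" by simp
    then show False using t by simp
  qed
  define k where "k \<theta> = (if \<theta> = 0 \<or> \<theta> = pi then 1 else ?min \<theta> / sin \<theta>)" for \<theta>
  have ck: "continuous_on {0..pi} k" unfolding k_def by (rule continuous_on_angle_ratio)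
  define e where "e \<theta> = f \<theta> * of_real (k \<theta>)" for \<theta>
  have "e \<theta> \<noteq> 0 \<and> ?d \<theta> = e \<theta> * of_real (sin \<theta>)" if "\<theta> \<in> {0..pi}" for \<theta>
  proof -
    consider "\<theta> = 0" | "\<theta> = pi" | "0 < \<theta>" "\<theta> < pi" using \<open>\<theta> \<in> {0..pi}\<close> by fastforce
    then show ?thesis
    proof cases
      case 1
      then show ?thesis using E0 d0 by (simp add: e_def f_def k_def)
    next
      case 2
      then show ?thesis using E1 d1 by (simp add: e_def f_def k_def)
    next
      case 3
      then have "0 < sin \<theta>" "0 < ?min \<theta>" by (auto intro: sin_gt_zero)
      then show ?thesis using 3 dn[OF 3] by (auto simp: e_def f_def k_def)
    qed
  qed
  moreover have "continuous_on {0..pi} e"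
    unfolding e_def by (intro continuous_intros cf ck)
  ultimately have "strands strand_a strand_b e"
    unfolding strands_def using continuous_on_strand_a cb by blast
  then show ?thesis by blast
qed

lemma chain_strand_curve:
  "(\<lambda>u. (fst (chain x u), height m u - h)) ` {0..real (Suc m)} = strand_curve strand_a strand_b h"
proof -
  have m: "0 < real m" using dp_m by simp
  have split: "{0..real (Suc m)} = {0..real m} \<union> {real m..real (Suc m)}" by auto
  have A: "(\<lambda>\<theta>. real m * \<theta> / pi) ` {0..pi} = {0..real m}"
  proof -
    have "(\<lambda>\<theta>. real m * \<theta> / pi) ` {0..pi} = (\<lambda>\<theta>. (real m / pi) * \<theta>) ` {0..pi}" by simp
    also have "\<dots> = {0..real m}" using m by (subst image_mult_atLeastAtMost) auto
    finally show ?thesis .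
  qed
  have B: "(\<lambda>\<theta>. real (Suc m) - \<theta> / pi) ` {0..pi} = {real m..real (Suc m)}"
  proof -
    have "(\<lambda>\<theta>. \<theta> / pi) ` {0..pi} = (\<lambda>\<theta>. (1 / pi) * \<theta>) ` {0..pi}" by simp
    also have "\<dots> = {0..1}" using pi_gt_zero by (subst image_mult_atLeastAtMost) auto
    finally have *: "(\<lambda>\<theta>. \<theta> / pi) ` {0..pi} = {0..1}" .
    have "(\<lambda>\<theta>. real (Suc m) - \<theta> / pi) ` {0..pi} = (\<lambda>t. real (Suc m) - t) ` ((\<lambda>\<theta>. \<theta> / pi) ` {0..pi})"
      by (simp only: image_image)
    then show ?thesis unfolding * by simp
  qed
  have hA: "height m (real m * \<theta> / pi) = cos \<theta>" if "\<theta> \<in> {0..pi}" for \<theta>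
  proof -
    have "real m * \<theta> / pi \<in> {0..real m}" unfolding A[symmetric] using that by (rule imageI)
    then have "turn m (real m * \<theta> / pi) = \<theta>" using m by (simp add: turn_def)
    then show ?thesis by (simp add: height_def)
  qed
  have hB: "height m (real (Suc m) - \<theta> / pi) = cos \<theta>" if "\<theta> \<in> {0..pi}" for \<theta>
  proof -
    have "real m \<le> real (Suc m) - \<theta> / pi" using that by simp
    from height_last[OF this] show ?thesis using dp_m by simp
  qed
  show ?thesis
    unfolding split image_Un strand_curve_def A[symmetric] B[symmetric] image_image
    by (intro arg_cong2[where f = "(\<union>)"] image_cong refl)
      (simp_all only: hA hB strand_b_chain strand_a_def)
qed

end

text \<open>The upper polygon receives heights in [-1, 1] and the lower one heights in [-4, -2].
  This agrees with the old order over every common projected point, between the polygons by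
  \<open>above\<close> and within each of them because it descends.\<close>

theorem stacked_descending_polygons_unlinked:
  assumes x: "descending_polygon m x" and y: "descending_polygon n y"
    and above: "\<And>p q. p \<in> polygon m x \<Longrightarrow> q \<in> polygon n y \<Longrightarrow> fst p = fst q \<Longrightarrow> snd q < snd p"
  shows "trivial_link (embed3 ` polygon m x) (embed3 ` polygon n y)"
proof -
  have m: "1 \<le> m" "1 \<le> n" using dp_m[OF x] dp_m[OF y] by auto
  let ?I = "{0..real (Suc m)}" and ?J = "{0..real (Suc n)}"
  let ?h = "\<lambda>v. height n v - 3"
  have c: "continuous_on ?I (chain x)" "continuous_on ?J (chain y)"
    "continuous_on ?I (height m)" "continuous_on ?J ?h"
    by (intro continuous_on_chain continuous_on_height m continuous_intros)+
  have ord: "snd (chain y v) < snd (chain x u) \<and> ?h v < height m u"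
    if "u \<in> ?I" "v \<in> ?J" "fst (chain x u) = fst (chain y v)" for u v
  proof
    show "snd (chain y v) < snd (chain x u)"
      by (rule above) (use that in \<open>auto simp: polygon_eq_chain_image\<close>)
    show "?h v < height m u"
      unfolding height_def using cos_le_one[of "turn n v"] cos_ge_minus_one[of "turn m u"] by linarith
  qed
  have g12: "gauge_bounded (chain x) (height m) ?I (chain y) ?h ?J"
    by (rule gauge_bounded_separated[OF compact_Icc compact_Icc c])
      (use ord in \<open>simp add: zero_less_mult_iff\<close>)
  have g21: "gauge_bounded (chain y) ?h ?J (chain x) (height m) ?I"
    by (rule gauge_bounded_separated[OF compact_Icc compact_Icc c(2,1,4,3)])
      (use ord[OF _ _ sym] in \<open>simp add: zero_less_mult_iff\<close>)
  have g11: "gauge_bounded (chain x) (height m) ?I (chain x) (height m) ?I"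
    by (rule chain_self_bounded[OF x])
  have g22: "gauge_bounded (chain y) ?h ?J (chain y) ?h ?J"
    using chain_self_bounded[OF y] by (simp add: gauge_bounded_def)
  have bd: "bounded (snd ` chain x ` ?I)" "bounded (snd ` chain y ` ?J)"
    using compact_imp_bounded[OF compact_continuous_image[OF c(1) compact_Icc]]
      compact_imp_bounded[OF compact_continuous_image[OF c(2) compact_Icc]]
    by (auto intro: bounded_snd)
  obtain B1 where B1: "\<forall>z\<in>snd ` chain x ` ?I. norm z \<le> B1"
    using bd(1) unfolding bounded_iff by (rule exE)
  obtain B2 where B2: "\<forall>z\<in>snd ` chain y ` ?J. norm z \<le> B2"
    using bd(2) unfolding bounded_iff by (rule exE)
  \<comment> \<open>The new heights of the lower polygon reach down to -4.\<close>
  define B where "B = max 4 (max B1 B2)"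
  have bx: "\<bar>snd (chain x u)\<bar> \<le> B" if "u \<in> ?I" for u
    using bspec[OF B1 imageI[OF imageI[OF that]]] by (simp add: B_def)
  have byy: "\<bar>snd (chain y v)\<bar> \<le> B" if "v \<in> ?J" for v
    using bspec[OF B2 imageI[OF imageI[OF that]]] by (simp add: B_def)
  have tx: "\<bar>height m u\<bar> \<le> B" for u
    unfolding height_def B_def using abs_cos_le_one[of "turn m u"] by linarith
  have ty: "\<bar>?h v\<bar> \<le> B" for v
    unfolding height_def B_def using abs_cos_le_one[of "turn n v"] by linarith
  have ne: "?I \<noteq> {}" by simp
  obtain F G where F: "homeomorphism UNIV UNIV F G"
    "\<And>u. u \<in> ?I \<Longrightarrow> F (chain x u) = (fst (chain x u), height m u)"
    "\<And>v. v \<in> ?J \<Longrightarrow> F (chain y v) = (fst (chain y v), ?h v)"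
    by (rule gauge_bounded_homeomorphism[OF g11 g12 g21 g22 ne tx bx ty byy]) (assumption | rule that)+
  have Fx: "F ` polygon m x = strand_curve (strand_a m x) (strand_b m x) 0"
    unfolding polygon_eq_chain_image image_image chain_strand_curve[OF x, symmetric]
    by (intro image_cong refl) (simp add: F(2))
  have Fy: "F ` polygon n y = strand_curve (strand_a n y) (strand_b n y) 3"
    unfolding polygon_eq_chain_image image_image chain_strand_curve[OF y, symmetric]
    by (intro image_cong refl) (simp add: F(3))
  obtain e1 e2 where "strands (strand_a m x) (strand_b m x) e1" "strands (strand_a n y) (strand_b n y) e2"
    using strands_exist[OF x] strands_exist[OF y] by blast
  then obtain H K where H: "homeomorphism UNIV UNIV H K"
    "H ` strand_curve (strand_a m x) (strand_b m x) 0 = {(complex_of_real x, t) | x t. x\<^sup>2 + t\<^sup>2 = 1}"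
    "H ` strand_curve (strand_a n y) (strand_b n y) 3 = {(complex_of_real x, t) | x t. x\<^sup>2 + (t + 3)\<^sup>2 = 1}"
    by (rule strand_curves_unlink)
  show ?thesis
  proof (rule trivial_link_embed3)
    show "homeomorphism UNIV UNIV (H \<circ> F) (G \<circ> K)"
      by (rule homeomorphism_compose[OF F(1) H(1)])
    show "(H \<circ> F) ` polygon m x = {(complex_of_real x, t) | x t. x\<^sup>2 + t\<^sup>2 = 1}"
      unfolding image_comp[symmetric] Fx by (rule H(2))
    show "(H \<circ> F) ` polygon n y = {(complex_of_real x, t) | x t. x\<^sup>2 + (t + 3)\<^sup>2 = 1}"
      unfolding image_comp[symmetric] Fy by (rule H(3))
  qed
qed

section \<open>Straight drawings of graphs\<close>

definition seg :: "(nat \<Rightarrow> complex \<times> real) \<Rightarrow> nat \<Rightarrow> nat \<Rightarrow> (complex \<times> real) set" where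
  "seg P u v = closed_segment (P u) (P v)"

lemma seg_commute: "seg P u v = seg P v u"
  by (simp add: seg_def closed_segment_commute)

text \<open>Holds vacuously, in both directions, for segments with disjoint projections. Only its
  failure is evidence of a crossing.\<close>

definition over :: "(complex \<times> real) set \<Rightarrow> (complex \<times> real) set \<Rightarrow> bool" where
  "over S T \<longleftrightarrow> (\<forall>p\<in>S. \<forall>q\<in>T. fst p = fst q \<longrightarrow> snd q < snd p)"

text \<open>The degree condition makes projected vertices distinct: given two vertices, the first
  has an edge that does not end at the second, and the second does not lie on that edge.\<close>

definition straight_drawing :: "nat set \<Rightarrow> (nat \<Rightarrow> nat \<Rightarrow> bool) \<Rightarrow> (nat \<Rightarrow> complex \<times> real) \<Rightarrow> bool" where
  "straight_drawing V E P \<longleftrightarrow> simple_graph V E \<and>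
     (\<forall>v\<in>V. \<exists>u w. u \<noteq> w \<and> E v u \<and> E v w) \<and>
     (\<forall>u v w. E u v \<longrightarrow> w \<in> V \<longrightarrow> w \<noteq> u \<longrightarrow> w \<noteq> v \<longrightarrow> fst (P w) \<notin> fst ` seg P u v) \<and>
     (\<forall>u v w. E v u \<longrightarrow> E v w \<longrightarrow> u \<noteq> w \<longrightarrow> spread (fst (P u - P v)) (fst (P w - P v))) \<and>
     (\<forall>u v x y. E u v \<longrightarrow> E x y \<longrightarrow> {u, v} \<inter> {x, y} = {} \<longrightarrow>
        over (seg P u v) (seg P x y) \<or> over (seg P x y) (seg P u v))"

text \<open>A cycle is a periodic sequence over all integers, so that changes of starting point and
  direction are substitutions of the index.\<close>

definition cyclic_walk :: "(nat \<Rightarrow> nat \<Rightarrow> bool) \<Rightarrow> nat \<Rightarrow> (int \<Rightarrow> nat) \<Rightarrow> bool" where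
  "cyclic_walk E k c \<longleftrightarrow> 3 \<le> k \<and> (\<forall>i j. c i = c j \<longleftrightarrow> i mod int k = j mod int k) \<and> (\<forall>i. E (c i) (c (i + 1)))"

definition curve :: "(nat \<Rightarrow> complex \<times> real) \<Rightarrow> (int \<Rightarrow> nat) \<Rightarrow> (complex \<times> real) set" where
  "curve P c = (\<Union>i. seg P (c i) (c (i + 1)))"

text \<open>Edges with a common vertex are exempt: in a straight drawing their projections meet in
  that vertex only.\<close>

definition descending :: "(nat \<Rightarrow> complex \<times> real) \<Rightarrow> nat \<Rightarrow> (int \<Rightarrow> nat) \<Rightarrow> bool" where
  "descending P k c \<longleftrightarrow> (\<forall>i j. 0 \<le> i \<longrightarrow> i < j \<longrightarrow> j < int k \<longrightarrow> {c i, c (i + 1)} \<inter> {c j, c (j + 1)} = {} \<longrightarrow>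
     over (seg P (c i) (c (i + 1))) (seg P (c j) (c (j + 1))))"

definition windable :: "(nat \<Rightarrow> complex \<times> real) \<Rightarrow> nat \<Rightarrow> (int \<Rightarrow> nat) \<Rightarrow> bool" where
  "windable P k c \<longleftrightarrow> (\<exists>s. descending P k (\<lambda>i. c (i + s)) \<or> descending P k (\<lambda>i. c (s - i)))"

lemma curve_shift: "curve P (\<lambda>i. c (i + s)) = curve P c"
proof -
  define f where "f i = seg P (c i) (c (i + 1))" for i
  have "(\<Union>i. f (i + s)) = (\<Union>i. f i)"
    by (auto intro: UN_I[of "_ - s"])
  then show ?thesis by (simp add: curve_def f_def algebra_simps)
qed

lemma curve_reflect: "curve P (\<lambda>i. c (s - i)) = curve P c"
proof -
  have "curve P (\<lambda>i. c (s - i)) = (\<Union>i\<in>UNIV. seg P (c (s - (i + 1))) (c (s - (i + 1) + 1)))"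
    unfolding curve_def by (intro SUP_cong refl) (simp add: seg_commute)
  also have "\<dots> = (\<Union>i\<in>(\<lambda>i. s - (i + 1)) ` UNIV. seg P (c i) (c (i + 1)))" by simp
  also have "(\<lambda>i::int. s - (i + 1)) ` UNIV = UNIV"
    by (rule surjI[of _ "\<lambda>j. s - 1 - j"]) simp
  finally show ?thesis by (simp add: curve_def)
qed

lemma cyclic_walk_shift: "cyclic_walk E k c \<Longrightarrow> cyclic_walk E k (\<lambda>i. c (i + s))"
proof -
  assume c: "cyclic_walk E k c"
  have "(i + s) mod int k = (j + s) mod int k \<longleftrightarrow> i mod int k = j mod int k" for i j
    by (simp add: mod_eq_dvd_iff)
  moreover have "E (c (i + s)) (c (i + 1 + s))" for i
    using c by (metis add.commute add.left_commute cyclic_walk_def)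
  ultimately show ?thesis using c by (simp add: cyclic_walk_def)
qed

lemma cyclic_walk_reflect:
  assumes "simple_graph V E" and c: "cyclic_walk E k c"
  shows "cyclic_walk E k (\<lambda>i. c (s - i))"
proof -
  have "(s - i) mod int k = (s - j) mod int k \<longleftrightarrow> i mod int k = j mod int k" for i j
  proof -
    have "s - i - (s - j) = - (i - j)" by simp
    then have "int k dvd s - i - (s - j) \<longleftrightarrow> int k dvd i - j"
      by (simp only: dvd_minus_iff)
    then show ?thesis by (simp add: mod_eq_dvd_iff)
  qed
  moreover have "E (c (s - i)) (c (s - (i + 1)))" for i
  proof -
    have "E (c (s - (i + 1))) (c (s - (i + 1) + 1))" using c unfolding cyclic_walk_def by blast
    then show ?thesis using assms(1) unfolding simple_graph_def by simp
  qed
  ultimately show ?thesis using c unfolding cyclic_walk_def by blast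
qed

text \<open>The reflection in the plane where the first coordinate is 3/2 exchanges the two standard
  circles.\<close>

lemma trivial_link_sym:
  assumes "trivial_link A B" shows "trivial_link B A"
proof -
  define T :: "real^3 \<Rightarrow> real^3" where "T x = vector [3 - x $ 1, x $ 2, x $ 3]" for x
  have TT: "T (T x) = x" for x by (simp add: T_def vec_eq_iff forall_3)
  have "T x = axis 1 3 + (vector [- x $ 1, x $ 2, x $ 3])" for x
    by (simp add: T_def vec_eq_iff forall_3 axis_def)
  moreover have "linear (\<lambda>x :: real^3. vector [- x $ 1, x $ 2, x $ 3] :: real^3)"
    by (rule linearI) (simp_all add: vec_eq_iff forall_3)
  ultimately have "continuous_on UNIV T"
    by (metis (no_types, lifting) continuous_on_add continuous_on_const continuous_on_cong
        linear_continuous_on linear_conv_bounded_linear)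
  then have T: "homeomorphism UNIV UNIV T T"
    by (intro homeomorphismI) (auto simp: TT)
  have in_img: "v \<in> T ` S \<longleftrightarrow> T v \<in> S" for v S by (metis TT image_iff)
  have "T ` unlink_circle1 = unlink_circle2" "T ` unlink_circle2 = unlink_circle1"
    unfolding set_eq_iff in_img unlink_circle1_def unlink_circle2_def
    by (auto simp: T_def power2_commute)
  moreover obtain h k where "homeomorphism UNIV UNIV h k" "h ` A = unlink_circle1" "h ` B = unlink_circle2"
    using assms unfolding trivial_link_def by blast
  ultimately show ?thesis
    unfolding trivial_link_def using homeomorphism_compose[OF _ T] by (metis image_comp)
qed

section \<open>From cycles of a straight drawing to descending polygons\<close>

context
  fixes V E P
  assumes D: "straight_drawing V E P"
begin

lemma sd_simple: "simple_graph V E" using D by (simp add: straight_drawing_def)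
lemma sd_sym: "E u v \<Longrightarrow> E v u" using sd_simple unfolding simple_graph_def by blast
lemma sd_irrefl: "\<not> E u u" using sd_simple unfolding simple_graph_def by blast
lemma sd_V: "E u v \<Longrightarrow> u \<in> V \<and> v \<in> V" using sd_simple unfolding simple_graph_def by blast
lemma sd_vertex: "E u v \<Longrightarrow> w \<in> V \<Longrightarrow> w \<noteq> u \<Longrightarrow> w \<noteq> v \<Longrightarrow> fst (P w) \<notin> fst ` seg P u v"
  using D unfolding straight_drawing_def by blast
lemma sd_spread: "E v u \<Longrightarrow> E v w \<Longrightarrow> u \<noteq> w \<Longrightarrow> spread (fst (P u - P v)) (fst (P w - P v))"
  using D unfolding straight_drawing_def by blast
lemma sd_over: "E u v \<Longrightarrow> E x y \<Longrightarrow> {u, v} \<inter> {x, y} = {} \<Longrightarrow>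
    over (seg P u v) (seg P x y) \<or> over (seg P x y) (seg P u v)"
  using D unfolding straight_drawing_def by blast

lemma sd_inj: assumes "v \<in> V" "w \<in> V" "v \<noteq> w" shows "fst (P v) \<noteq> fst (P w)"
proof -
  obtain u where "E v u" "u \<noteq> w" using D assms(1) unfolding straight_drawing_def by metis
  then have "fst (P w) \<notin> fst ` seg P v u" using sd_vertex assms by metis
  moreover have "P v \<in> seg P v u" by (simp add: seg_def)
  ultimately show ?thesis by (metis imageI)
qed

lemma sd_adjacent_meet:
  assumes "E v u" "E v w" "u \<noteq> w" "p \<in> seg P v u" "q \<in> seg P v w" "fst p = fst q"
  shows "p = P v \<and> q = P v"
proof -
  obtain s where s: "0 \<le> s" "p = P v + s *\<^sub>R (P u - P v)"
    using assms(4) unfolding seg_def closed_segment_def by (auto simp: algebra_simps)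
  obtain t where t: "0 \<le> t" "q = P v + t *\<^sub>R (P w - P v)"
    using assms(5) unfolding seg_def closed_segment_def by (auto simp: algebra_simps)
  have "s *\<^sub>R fst (P u - P v) = t *\<^sub>R fst (P w - P v)"
    using assms(6) s t by simp
  then have "s = 0 \<and> t = 0" using spreadD[OF sd_spread[OF assms(1-3)]] s t by blast
  then show ?thesis using s t by simp
qed

lemma graph_embedding_linepath:
  "graph_embedding V E (embed3 \<circ> P) (\<lambda>u v. linepath (embed3 (P u)) (embed3 (P v)))"
proof -
  have lin: "linear embed3"
    by (rule linearI) (simp_all add: embed3_def vec_eq_iff forall_3)
  have img: "path_image (linepath (embed3 (P u)) (embed3 (P v))) = embed3 ` seg P u v" for u v
    unfolding path_image_linepath seg_def by (rule closed_segment_linear_image[OF lin])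
  have injP: "inj_on P V" using sd_inj by (metis inj_onI)
  have 1: "inj_on (embed3 \<circ> P) V"
    using injP inj_embed3 by (metis comp_inj_on inj_on_subset subset_UNIV)
  have 2: "arc (linepath (embed3 (P u)) (embed3 (P v)))" if "E u v" for u v
    using sd_inj[of u v] sd_V[OF that] sd_irrefl[of u] that
    by (intro arc_linepath) (metis inj_embed3 injD)
  have 3: "linepath (embed3 (P u)) (embed3 (P v)) t \<notin> (embed3 \<circ> P) ` V" if uv: "E u v" and t: "t \<in> {0<..<1}" for u v t
  proof
    assume "linepath (embed3 (P u)) (embed3 (P v)) t \<in> (embed3 \<circ> P) ` V"
    then obtain w where w: "w \<in> V" "linepath (embed3 (P u)) (embed3 (P v)) t = embed3 (P w)" by auto
    have a: "arc (linepath (embed3 (P u)) (embed3 (P v)))" by (rule 2[OF uv])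
    have "linepath (embed3 (P u)) (embed3 (P v)) t \<in> embed3 ` seg P u v"
      unfolding img[symmetric] path_image_def using t by auto
    then have "P w \<in> seg P u v" unfolding w(2) using inj_embed3 by (auto dest: injD)
    then have "w = u \<or> w = v" using sd_vertex[OF uv w(1)] by auto
    then have "linepath (embed3 (P u)) (embed3 (P v)) t = linepath (embed3 (P u)) (embed3 (P v)) 0 \<or>
        linepath (embed3 (P u)) (embed3 (P v)) t = linepath (embed3 (P u)) (embed3 (P v)) 1"
      using w(2) by (auto simp: linepath_def)
    then show False using a t unfolding arc_def inj_on_def by force
  qed
  have 4: "embed3 ` seg P u v \<inter> embed3 ` seg P x y \<subseteq> (embed3 \<circ> P) ` ({u, v} \<inter> {x, y})"
    if e: "E u v" "E x y" "{u, v} \<noteq> {x, y}" for u v x y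
  proof -
    have star: "seg P v u \<inter> seg P v w \<subseteq> {P v}" if "E v u" "E v w" "u \<noteq> w" for u v w
      using sd_adjacent_meet[OF that] by auto
    have "seg P u v \<inter> seg P x y \<subseteq> P ` ({u, v} \<inter> {x, y})"
    proof (cases "{u, v} \<inter> {x, y} = {}")
      case True
      then have "seg P u v \<inter> seg P x y = {}" using sd_over[OF e(1,2) True] unfolding over_def by auto
      then show ?thesis by simp
    next
      case False
      then consider "u = x" "v \<noteq> y" | "u = y" "v \<noteq> x" | "v = x" "u \<noteq> y" | "v = y" "u \<noteq> x"
        using e(3) by auto
      then show ?thesis
      proof cases
        case 1 then show ?thesis using star[of u v y] e by auto
      next
        case 2 then show ?thesis using star[of u v x] e sd_sym[OF e(2)] seg_commute[of P x y] by auto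
      next
        case 3 then show ?thesis using star[of v u y] e sd_sym[OF e(1)] seg_commute[of P u v] by auto
      next
        case 4 then show ?thesis
          using star[of v u x] sd_sym[OF e(1)] sd_sym[OF e(2)] seg_commute[of P u v] seg_commute[of P x y] by auto
      qed
    qed
    then have "embed3 ` (seg P u v \<inter> seg P x y) \<subseteq> embed3 ` (P ` ({u, v} \<inter> {x, y}))" by (rule image_mono)
    then show ?thesis by (simp add: image_Int[OF inj_embed3] image_comp)
  qed
  show ?thesis
    unfolding graph_embedding_def img
    using 1 2 3 4 by (simp add: seg_commute)
qed

text \<open>A walk that descends on all its edges has no edge left to rise on. The polygon gets an
  additional vertex \<open>z\<close> on the last edge of the walk, so that its edge number
  \<open>k\<close> is a short piece free for this purpose.\<close>

lemma descending_polygon_exists: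
  assumes c: "cyclic_walk E k c" and desc: "descending P k c"
  obtains y where "descending_polygon k y" "polygon k y = curve P c"
proof -
  have k3: "3 \<le> k" and ceq: "\<And>i j. c i = c j \<longleftrightarrow> i mod int k = j mod int k" and edge: "\<And>i. E (c i) (c (i + 1))"
    using c by (auto simp: cyclic_walk_def)
  define x where "x i = P (c (int i))" for i
  have ck: "c (int k) = c 0" by (simp add: ceq)
  have cV: "c i \<in> V" for i using edge sd_V by blast
  have small: "c (int i) = c (int j) \<longleftrightarrow> i = j" if "i < k" "j < k" for i j
    using that by (simp add: ceq)
  have xseg: "closed_segment (x i) (x (Suc i)) = seg P (c (int i)) (c (int i + 1))" for i
    by (simp add: x_def seg_def add.commute)
  have x0: "x k = x 0" by (simp add: x_def ck)
  have edge': "E (c (int i)) (c (int (Suc i)))" for i using edge[of "int i"] by (simp add: add.commute)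
  text \<open>The last edge is cut close to the starting vertex, so that the rising final piece meets
    nothing else in projection.\<close>
  let ?K = "\<Union>i\<in>{1..<k - 1}. fst ` closed_segment (x i) (x (Suc i))"
  have "closed ?K"
    by (auto intro!: closed_UN compact_imp_closed compact_continuous_image continuous_on_fst continuous_on_id)
  moreover have "fst (x 0) \<notin> ?K"
  proof
    assume "fst (x 0) \<in> ?K"
    then obtain i where i0: "i \<in> {1..<k - 1}" "fst (x 0) \<in> fst ` closed_segment (x i) (x (Suc i))"
      by blast
    then have i: "i \<in> {1..<k - 1}" "fst (P (c 0)) \<in> fst ` seg P (c (int i)) (c (int (Suc i)))"
      by (simp_all add: x_def seg_def del: of_nat_Suc)
    have "0 < k" "i < k" "Suc i < k" "0 < i" using i(1) by auto
    then have "c 0 \<noteq> c (int i)" "c 0 \<noteq> c (int (Suc i))"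
      using small[of 0 i] small[of 0 "Suc i"] by (auto simp del: of_nat_Suc)
    then show False using sd_vertex[OF edge' cV] i(2) by blast
  qed
  ultimately obtain r where r: "0 < r" "ball (fst (x 0)) r \<inter> ?K = {}"
    by (metis (no_types, lifting) ComplI Compl_disjoint2 disjoint_eq_subset_Compl inf_commute open_Compl open_contains_ball)
  let ?d = "x (k - 1) - x 0"
  \<comment> \<open>The bound 1/2 keeps \<open>z\<close> away from the other end of the edge. The
    second bound puts the closing piece over the ball of radius \<open>r\<close>; the added 1
    prevents division by zero.\<close>
  define \<mu> where "\<mu> = min (1/2) (r / (2 * (norm (fst ?d) + 1)))"
  have \<mu>: "0 < \<mu>" "\<mu> < 1" "\<mu> * norm (fst ?d) < r"
  proof -
    have n: "0 < 2 * (norm (fst ?d) + 1)" by (simp add: add_nonneg_pos)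
    show "0 < \<mu>" using r(1) n unfolding \<mu>_def by simp
    show "\<mu> < 1" unfolding \<mu>_def by linarith
    have "\<mu> * norm (fst ?d) \<le> \<mu> * (norm (fst ?d) + 1)" using \<open>0 < \<mu>\<close> by simp
    also have "\<dots> \<le> r / (2 * (norm (fst ?d) + 1)) * (norm (fst ?d) + 1)"
      unfolding \<mu>_def by (intro mult_right_mono) auto
    also have "\<dots> = r / 2"
    proof -
      define N where "N = norm (fst ?d) + 1"
      have "N \<noteq> 0" using norm_ge_zero[of "fst ?d"] unfolding N_def by linarith
      then have "r / (2 * N) * N = r / 2" by simp
      then show ?thesis unfolding N_def .
    qed
    finally show "\<mu> * norm (fst ?d) < r" using r(1) by linarith
  qed
  define z where "z = x 0 + \<mu> *\<^sub>R ?d"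
  define y where "y i = (if i < k then x i else if i = k then z else x 0)" for i
  have yx: "y i = x i" if "i < k" for i using that by (simp add: y_def)
  have yk: "y k = z" "y (Suc k) = x 0" by (simp_all add: y_def)
  have k1: "Suc (k - 1) = k" using k3 by simp
  have zin: "z \<in> closed_segment (x (k - 1)) (x k)"
    unfolding z_def closed_segment_def x0 using \<mu> by (auto simp: algebra_simps intro!: exI[of _ "1 - \<mu>"])
  have last: "closed_segment (y (k - 1)) (y k) \<union> closed_segment (y k) (y (Suc k)) = closed_segment (x (k - 1)) (x k)"
    using Un_closed_segment[OF zin] yx[of "k - 1"] yk x0 k3 by simp
  have sub1: "closed_segment (y (k - 1)) (y k) \<subseteq> closed_segment (x (k - 1)) (x k)" using last by blast
  have sub2: "closed_segment (y k) (y (Suc k)) \<subseteq> closed_segment (x (k - 1)) (x k)" using last by blast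
  have yseg: "closed_segment (y i) (y (Suc i)) = closed_segment (x i) (x (Suc i))" if "i < k - 1" for i
    using that by (simp add: yx)
  have ysub: "closed_segment (y i) (y (Suc i)) \<subseteq> closed_segment (x i) (x (Suc i))" if "i < k" for i
  proof (cases "i < k - 1")
    case True
    show ?thesis unfolding yseg[OF True] ..
  next
    case False
    then have "i = k - 1" using that by simp
    then show ?thesis using sub1 k1 by simp
  qed
  have lastE: "E (c (int (k - 1))) (c 0)" using edge'[of "k - 1"] ck k1 by simp
  have firstE: "E (c 0) (c 1)" using edge[of 0] by simp
  have fd: "fst ?d \<noteq> 0"
  proof -
    have "c (int (k - 1)) \<noteq> c 0" using small[of "k - 1" 0] k3 by auto
    then show ?thesis using sd_inj[OF cV cV] by (auto simp: x_def)
  qed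
  have order: "j < k \<and> snd q < snd p"
    if ij: "i < j" "j \<le> k" "j \<noteq> Suc i" "\<not> (i = 0 \<and> j = k)"
      and p: "p \<in> closed_segment (y i) (y (Suc i))" and q: "q \<in> closed_segment (y j) (y (Suc j))"
      and eq: "fst p = fst q" for i j p q
  proof -
    have pi: "p \<in> closed_segment (x i) (x (Suc i))" using ysub[of i] p ij by auto
    show ?thesis
    proof (cases "j = k")
      case True
      then have i: "i \<in> {1..<k - 1}" using ij by auto
      have "q \<in> closed_segment z (x 0)" using q True yk by simp
      then obtain t where t: "0 \<le> t" "t \<le> 1" "q = (1 - t) *\<^sub>R z + t *\<^sub>R x 0" unfolding closed_segment_def by blast
      have "fst q - fst (x 0) = ((1 - t) * \<mu>) *\<^sub>R fst ?d"
        unfolding t(3) z_def by (simp add: algebra_simps)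
      then have "norm (fst q - fst (x 0)) = (1 - t) * (\<mu> * norm (fst ?d))"
        using t \<mu> by (simp add: abs_mult)
      also have "\<dots> \<le> 1 * (\<mu> * norm (fst ?d))" using t \<mu> by (intro mult_right_mono) auto
      finally have "fst q \<in> ball (fst (x 0)) r" using \<mu>(3) by (simp add: dist_norm norm_minus_commute)
      moreover have "fst q \<in> ?K" using pi i eq by (metis (no_types, lifting) UN_iff imageI)
      ultimately show ?thesis using r(2) by blast
    next
      case False
      then have jk: "j < k" using ij by simp
      have qj: "q \<in> closed_segment (x j) (x (Suc j))" using ysub[OF jk] q by auto
      show ?thesis
      \<comment> \<open>The first and the last edge of the walk share \<open>x 0\<close>. Since
        \<open>\<mu>\<close> is positive, the shortened last edge stops before that point.\<close>
      proof (cases "i = 0 \<and> j = k - 1")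
        case True
        have ne: "c 1 \<noteq> c (int (k - 1))" using small[of 1 "k - 1"] k3 by auto
        have "p \<in> seg P (c 0) (c 1)" using pi True xseg[of 0] by simp
        moreover have "q \<in> seg P (c 0) (c (int (k - 1)))"
          using qj True xseg[of "k - 1"] k1 ck by (simp add: seg_commute x_def seg_def closed_segment_commute)
        ultimately have "q = P (c 0)"
          using sd_adjacent_meet[OF firstE sd_sym[OF lastE] ne] eq by blast
        moreover have "q \<in> closed_segment (x (k - 1)) z" using q True yk k1 yx[of "k - 1"] k3 by simp
        ultimately obtain t where t: "0 \<le> t" "t \<le> 1" "x 0 = (1 - t) *\<^sub>R x (k - 1) + t *\<^sub>R z"
          unfolding closed_segment_def by (auto simp: x_def)
        have "x 0 + ((1 - t) + t * \<mu>) *\<^sub>R ?d = (1 - t) *\<^sub>R x (k - 1) + t *\<^sub>R z"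
          unfolding z_def by (simp add: algebra_simps)
        then have "((1 - t) + t * \<mu>) *\<^sub>R ?d = 0" using t(3) by simp
        then have "(1 - t) + t * \<mu> = 0" using fd by auto
        moreover have "0 \<le> t * \<mu>" using t \<mu> by simp
        ultimately have "t = 1" "t * \<mu> = 0" using t by linarith+
        then show ?thesis using \<mu> by simp
      next
        case nadj: False
        have "c (int i) \<noteq> c (int j)" "c (int (Suc i)) \<noteq> c (int j)"
          using small[of i j] small[of "Suc i" j] ij jk by auto
        moreover have "c (int i) \<noteq> c (int (Suc j)) \<and> c (int (Suc i)) \<noteq> c (int (Suc j))"
        proof (cases "Suc j = k")
          case True
          then have "c (int (Suc j)) = c 0" using ck by simp
          then show ?thesis using small[of i 0] small[of "Suc i" 0] ij jk True nadj by auto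
        next
          case False
          then show ?thesis using small[of i "Suc j"] small[of "Suc i" "Suc j"] ij jk by auto
        qed
        ultimately have "{c (int i), c (int i + 1)} \<inter> {c (int j), c (int j + 1)} = {}"
          by (auto simp: add.commute)
        then have "over (seg P (c (int i)) (c (int i + 1))) (seg P (c (int j)) (c (int j + 1)))"
          using desc ij jk unfolding descending_def by auto
        then show ?thesis using pi qj eq jk unfolding over_def xseg by blast
      qed
    qed
  qed
  have scale: "spread (a *\<^sub>R u) (b *\<^sub>R v)" if "spread u v" "0 < a" "0 < b" for u v a b
    unfolding spread_def
  proof (intro allI impI)
    fix s t :: real assume st: "0 \<le> s" "0 \<le> t" "s *\<^sub>R a *\<^sub>R u = t *\<^sub>R b *\<^sub>R v"
    then have "s * a = 0 \<and> t * b = 0" using spreadD[OF that(1), of "s * a" "t * b"] that by simp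
    then show "s = 0 \<and> t = 0" using that by simp
  qed
  have sp1: "spread (fst (y i) - fst (y (Suc i))) (fst (y (Suc (Suc i))) - fst (y (Suc i)))" if "i < k" for i
  proof -
    consider "Suc (Suc i) < k" | "Suc (Suc i) = k" | "Suc i = k" using \<open>i < k\<close> by linarith
    then show ?thesis
    proof cases
      case 1
      have "spread (fst (P (c (int i)) - P (c (int (Suc i))))) (fst (P (c (int (Suc (Suc i)))) - P (c (int (Suc i)))))"
        using small[of i "Suc (Suc i)"] 1 by (intro sd_spread edge' sd_sym[OF edge']) auto
      then show ?thesis using 1 by (simp add: yx x_def)
    next
      case 2
      then have e: "k - 1 = Suc i" by simp
      have *: "spread (fst (P (c (int i)) - P (c (int (Suc i))))) (fst (P (c 0) - P (c (int (Suc i)))))"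
      proof (rule sd_spread[OF sd_sym[OF edge']])
        show "E (c (int (Suc i))) (c 0)" using lastE unfolding e .
        have "i < k" "0 < k" "i \<noteq> 0" using 2 k3 by auto
        then show "c (int i) \<noteq> c 0" using small[of i 0] by simp
      qed
      have "z - x (Suc i) = (1 - \<mu>) *\<^sub>R (x 0 - x (Suc i))"
        unfolding z_def e by (simp add: algebra_simps)
      then have "fst z - fst (x (Suc i)) = (1 - \<mu>) *\<^sub>R fst (x 0 - x (Suc i))" by (metis fst_diff fst_scaleR)
      moreover have "spread (1 *\<^sub>R fst (P (c (int i)) - P (c (int (Suc i))))) ((1 - \<mu>) *\<^sub>R fst (P (c 0) - P (c (int (Suc i)))))"
        by (rule scale[OF *]) (use \<mu> in auto)
      moreover have "y i = x i" "y (Suc i) = x (Suc i)" "y (Suc (Suc i)) = z"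
        using 2 by (auto simp: y_def)
      ultimately show ?thesis by (simp add: x_def)
    next
      case 3
      then have i: "i = k - 1" by simp
      have y: "y i = x (k - 1)" "y (Suc i) = z" "y (Suc (Suc i)) = x 0" using 3 i by (auto simp: y_def)
      \<comment> \<open>The two pieces of the cut edge leave \<open>z\<close> in opposite
        directions, which \<open>spread\<close> permits.\<close>
      have a: "fst (x (k - 1)) - fst z = (1 - \<mu>) *\<^sub>R fst ?d" "fst (x 0) - fst z = - \<mu> *\<^sub>R fst ?d"
        unfolding z_def by (simp_all add: algebra_simps)
      show ?thesis
        unfolding y a spread_def
      proof (intro allI impI)
        fix s t :: real assume st: "0 \<le> s" "0 \<le> t" "s *\<^sub>R (1 - \<mu>) *\<^sub>R fst ?d = t *\<^sub>R - \<mu> *\<^sub>R fst ?d"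
        then have "(s * (1 - \<mu>) + t * \<mu>) *\<^sub>R fst ?d = 0" by (simp add: scaleR_add_left)
        then have "s * (1 - \<mu>) + t * \<mu> = 0" using fd by simp
        moreover have "0 \<le> s * (1 - \<mu>)" "0 \<le> t * \<mu>" using st \<mu> by auto
        ultimately have "s * (1 - \<mu>) = 0" "t * \<mu> = 0" by linarith+
        then show "s = 0 \<and> t = 0" using \<mu> by simp
      qed
    qed
  qed
  have sp0: "spread (fst (y k) - fst (y 0)) (fst (y 1) - fst (y 0))"
  proof -
    have "spread (fst (P (c (int (k - 1))) - P (c 0))) (fst (P (c 1) - P (c 0)))"
      using small[of "k - 1" 1] k3 by (intro sd_spread sd_sym[OF lastE] firstE) auto
    then have "spread (\<mu> *\<^sub>R fst ?d) (1 *\<^sub>R fst (x 1 - x 0))"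
      using \<mu> by (intro scale) (auto simp: x_def)
    moreover have "fst (y k) - fst (y 0) = \<mu> *\<^sub>R fst ?d"
      using k3 by (simp add: yk yx z_def)
    ultimately show ?thesis using k3 by (simp add: yx)
  qed
  have "descending_polygon k y"
    unfolding descending_polygon_def
    using k3 sp1 sp0 order yk yx[of 0] by auto
  moreover have "polygon k y = curve P c"
  proof -
    have "{..k} = {..<k - 1} \<union> {k - 1, k}" using k3 by auto
    then have "polygon k y = (\<Union>i\<in>{..<k - 1}. closed_segment (y i) (y (Suc i))) \<union>
        (closed_segment (y (k - 1)) (y (Suc (k - 1))) \<union> closed_segment (y k) (y (Suc k)))"
      unfolding polygon_def by (simp only: UN_Un UN_insert UN_empty Un_empty_right)
    also have "\<dots> = (\<Union>i\<in>{..<k - 1}. closed_segment (x i) (x (Suc i))) \<union> closed_segment (x (k - 1)) (x (Suc (k - 1)))"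
      unfolding k1 last[symmetric] by (intro arg_cong2[where f = "(\<union>)"] SUP_cong refl) (simp only: yseg lessThan_iff)
    also have "\<dots> = (\<Union>i\<in>insert (k - 1) {..<k - 1}. closed_segment (x i) (x (Suc i)))"
      by (simp add: Un_commute)
    also have "insert (k - 1) {..<k - 1} = {..<k}" using k3 by auto
    also have "(\<Union>i\<in>{..<k}. closed_segment (x i) (x (Suc i))) = curve P c"
    proof
      show "(\<Union>i\<in>{..<k}. closed_segment (x i) (x (Suc i))) \<subseteq> curve P c"
        unfolding curve_def xseg by blast
      show "curve P c \<subseteq> (\<Union>i\<in>{..<k}. closed_segment (x i) (x (Suc i)))"
        unfolding curve_def xseg
      proof (intro UN_least)
        fix j :: int
        define i where "i = nat (j mod int k)"
        have i: "i < k" "int i = j mod int k" using k3 by (auto simp: i_def nat_less_iff)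
        have "c j = c (int i)" unfolding ceq i(2) by simp
        moreover have "c (j + 1) = c (int i + 1)" unfolding ceq i(2) by (simp add: mod_add_left_eq)
        ultimately have "seg P (c j) (c (j + 1)) = seg P (c (int i)) (c (int i + 1))" by simp
        then show "seg P (c j) (c (j + 1)) \<subseteq> (\<Union>i\<in>{..<k}. seg P (c (int i)) (c (int i + 1)))"
          using i(1) by blast
      qed
    qed
    finally show ?thesis .
  qed
  ultimately show thesis by (rule that)
qed

lemma windable_polygon:
  assumes c: "cyclic_walk E k c" and "windable P k c"
  obtains y where "descending_polygon k y" "polygon k y = curve P c"
proof -
  obtain s where "descending P k (\<lambda>i. c (i + s)) \<or> descending P k (\<lambda>i. c (s - i))"
    using assms(2) unfolding windable_def by blast
  then show thesis
  proof
    assume "descending P k (\<lambda>i. c (i + s))"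
    from descending_polygon_exists[OF cyclic_walk_shift[OF c] this] show thesis
      using that unfolding curve_shift by blast
  next
    assume "descending P k (\<lambda>i. c (s - i))"
    from descending_polygon_exists[OF cyclic_walk_reflect[OF sd_simple c] this] show thesis
      using that unfolding curve_reflect by blast
  qed
qed

lemma graph_cycle_walk:
  assumes "graph_cycle V E cs"
  obtains c where "cyclic_walk E (length cs) c" "range c = set cs"
    "cycle_image (\<lambda>u v. linepath (embed3 (P u)) (embed3 (P v))) cs = embed3 ` curve P c"
proof -
  let ?k = "length cs"
  define c where "c i = cs ! nat (i mod int ?k)" for i
  have k: "3 \<le> ?k" "distinct cs" and e: "\<And>i. i < ?k \<Longrightarrow> E (cs ! i) (cs ! ((i + 1) mod ?k))"
    using assms by (auto simp: graph_cycle_def)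
  have idx: "nat (i mod int ?k) < ?k" for i
  proof -
    have "i mod int ?k < int ?k" using k by (intro pos_mod_bound) auto
    then show ?thesis using k by linarith
  qed
  have suc: "c (i + 1) = cs ! ((nat (i mod int ?k) + 1) mod ?k)" for i
  proof -
    have "0 \<le> i mod int ?k" using k by (intro pos_mod_sign) auto
    then have "int ((nat (i mod int ?k) + 1) mod ?k) = (i mod int ?k + 1) mod int ?k"
      by (simp add: zmod_int add.commute)
    also have "\<dots> = (i + 1) mod int ?k" by (rule mod_add_left_eq)
    finally have "int ((nat (i mod int ?k) + 1) mod ?k) = (i + 1) mod int ?k" .
    then show ?thesis unfolding c_def by (metis nat_int)
  qed
  have "cyclic_walk E ?k c"
    unfolding cyclic_walk_def
  proof (intro conjI allI)
    fix i j
    show "c i = c j \<longleftrightarrow> i mod int ?k = j mod int ?k"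
      unfolding c_def nth_eq_iff_index_eq[OF k(2) idx idx]
      by (rule eq_nat_nat_iff) (use k in \<open>auto intro!: pos_mod_sign\<close>)
    show "E (c i) (c (i + 1))" unfolding suc using e[OF idx] by (simp add: c_def)
  qed (rule k(1))
  moreover have cn: "c (int i) = cs ! i" if "i < ?k" for i using that by (simp add: c_def)
  have "range c = set cs"
  proof
    show "range c \<subseteq> set cs" using idx by (auto simp: c_def)
    show "set cs \<subseteq> range c" using cn by (metis in_set_conv_nth rangeI subsetI)
  qed
  moreover have "cycle_image (\<lambda>u v. linepath (embed3 (P u)) (embed3 (P v))) cs = embed3 ` curve P c"
  proof -
    have lin: "linear embed3"
      by (rule linearI) (simp_all add: embed3_def vec_eq_iff forall_3)
    have img: "path_image (linepath (embed3 (P u)) (embed3 (P v))) = embed3 ` seg P u v" for u v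
      unfolding path_image_linepath seg_def by (rule closed_segment_linear_image[OF lin])
    have "curve P c = (\<Union>i<?k. seg P (cs ! i) (cs ! ((i + 1) mod ?k)))"
    proof
      show "curve P c \<subseteq> (\<Union>i<?k. seg P (cs ! i) (cs ! ((i + 1) mod ?k)))"
        unfolding curve_def suc using idx by (auto simp: c_def)
      have "seg P (cs ! i) (cs ! ((i + 1) mod ?k)) = seg P (c (int i)) (c (int i + 1))" if "i < ?k" for i
        using suc[of "int i"] cn[OF that] that by simp
      then show "(\<Union>i<?k. seg P (cs ! i) (cs ! ((i + 1) mod ?k))) \<subseteq> curve P c"
        unfolding curve_def by auto
    qed
    then show ?thesis unfolding cycle_image_def img by (simp add: image_UN)
  qed
  ultimately show thesis by (rule that)
qed

text \<open>Winding is demanded only of a cycle that has a disjoint partner. This is what allows a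
  search to abandon a path as soon as no cycle is left in its complement.\<close>

theorem straight_drawing_linkless:
  assumes wind: "\<And>k c l d. cyclic_walk E k c \<Longrightarrow> cyclic_walk E l d \<Longrightarrow> range c \<inter> range d = {} \<Longrightarrow> windable P k c"
    and stack: "\<And>k c l d. cyclic_walk E k c \<Longrightarrow> cyclic_walk E l d \<Longrightarrow> range c \<inter> range d = {} \<Longrightarrow>
      (\<forall>i j. over (seg P (c i) (c (i + 1))) (seg P (d j) (d (j + 1)))) \<or>
      (\<forall>i j. over (seg P (d j) (d (j + 1))) (seg P (c i) (c (i + 1))))"
  shows "linklessly_embeddable V E"
proof -
  let ?g = "\<lambda>u v. linepath (embed3 (P u)) (embed3 (P v))"
  have link: "trivial_link (embed3 ` curve P c) (embed3 ` curve P d)"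
    if c: "cyclic_walk E k c" and d: "cyclic_walk E l d" and dis: "range c \<inter> range d = {}"
      and ov: "\<forall>i j. over (seg P (c i) (c (i + 1))) (seg P (d j) (d (j + 1)))" for k c l d
  proof -
    have dis': "range d \<inter> range c = {}" using dis by blast
    obtain x where x: "descending_polygon k x" "polygon k x = curve P c"
      by (rule windable_polygon[OF c wind[OF c d dis]])
    obtain y where y: "descending_polygon l y" "polygon l y = curve P d"
      by (rule windable_polygon[OF d wind[OF d c dis']])
    have "trivial_link (embed3 ` polygon k x) (embed3 ` polygon l y)"
    proof (rule stacked_descending_polygons_unlinked[OF x(1) y(1)])
      fix p q assume "p \<in> polygon k x" "q \<in> polygon l y" "fst p = fst q"
      then show "snd q < snd p" using ov unfolding x(2) y(2) curve_def over_def by blast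
    qed
    then show ?thesis unfolding x(2) y(2) .
  qed
  have "trivial_link (cycle_image ?g c1) (cycle_image ?g c2)"
    if c1: "graph_cycle V E c1" and c2: "graph_cycle V E c2" and dis: "set c1 \<inter> set c2 = {}" for c1 c2
  proof -
    obtain c where c: "cyclic_walk E (length c1) c" "range c = set c1" "cycle_image ?g c1 = embed3 ` curve P c"
      by (rule graph_cycle_walk[OF c1])
    obtain d where d: "cyclic_walk E (length c2) d" "range d = set c2" "cycle_image ?g c2 = embed3 ` curve P d"
      by (rule graph_cycle_walk[OF c2])
    have dis': "range c \<inter> range d = {}" "range d \<inter> range c = {}" using dis c(2) d(2) by auto
    show ?thesis
      unfolding c(3) d(3) using stack[OF c(1) d(1) dis'(1)]
    proof
      assume "\<forall>i j. over (seg P (c i) (c (i + 1))) (seg P (d j) (d (j + 1)))"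
      then show "trivial_link (embed3 ` curve P c) (embed3 ` curve P d)" by (rule link[OF c(1) d(1) dis'(1)])
    next
      assume "\<forall>i j. over (seg P (d j) (d (j + 1))) (seg P (c i) (c (i + 1)))"
      then have "\<forall>j i. over (seg P (d j) (d (j + 1))) (seg P (c i) (c (i + 1)))" by blast
      then show "trivial_link (embed3 ` curve P c) (embed3 ` curve P d)"
        by (rule trivial_link_sym[OF link[OF d(1) c(1) dis'(2)]])
    qed
  qed
  then show ?thesis
    unfolding linklessly_embeddable_def linkless_embedding_def using graph_embedding_linepath by blast
qed

end

section \<open>Lists of crossings and the choice of a starting point\<close>

definition ends :: "nat \<times> nat \<Rightarrow> nat set" where "ends e = {fst e, snd e}"

text \<open>An entry of \<open>X\<close> names the upper edge first. \<open>X\<close> has to contain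
  every disjoint pair whose reversed order fails; additional entries only make the later conditions
  stricter. The second part says that no two entries contradict each other.\<close>

definition crossings_covered ::
  "(nat \<Rightarrow> nat \<Rightarrow> bool) \<Rightarrow> (nat \<Rightarrow> complex \<times> real) \<Rightarrow> ((nat \<times> nat) \<times> (nat \<times> nat)) list \<Rightarrow> bool" where
  "crossings_covered E P X \<longleftrightarrow> (\<forall>u v x y. E u v \<longrightarrow> E x y \<longrightarrow> {u, v} \<inter> {x, y} = {} \<longrightarrow>
     \<not> over (seg P x y) (seg P u v) \<longrightarrow> (\<exists>z\<in>set X. ends (fst z) = {u, v} \<and> ends (snd z) = {x, y})) \<and>
   (\<forall>z\<in>set X. \<forall>z'\<in>set X. \<not> (ends (fst z) = ends (snd z') \<and> ends (snd z) = ends (fst z')) \<and> ends (fst z) \<noteq> ends (snd z))"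

definition walk_edges :: "(int \<Rightarrow> nat) \<Rightarrow> nat set set" where
  "walk_edges c = range (\<lambda>i. {c i, c (i + 1)})"

lemma walk_edgesD: "e \<in> walk_edges c \<Longrightarrow> \<exists>i. e = {c i, c (i + 1)}"
  unfolding walk_edges_def by auto

text \<open>If two indices gave the same edge in opposite directions, \<open>k\<close> would divide
  2.\<close>

lemma walk_edge_index:
  assumes "cyclic_walk E k c" "0 \<le> a" "a < int k" "0 \<le> b" "b < int k" "{c a, c (a + 1)} = {c b, c (b + 1)}"
  shows "a = b"
proof -
  have k: "3 \<le> k" and ceq: "\<And>i j. c i = c j \<longleftrightarrow> i mod int k = j mod int k"
    using assms(1) by (auto simp: cyclic_walk_def)
  have "c a = c b \<or> c a = c (b + 1) \<and> c (a + 1) = c b" using assms(6) by (auto simp: doubleton_eq_iff)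
  then show ?thesis
  proof
    assume "c a = c b"
    then show ?thesis using assms by (simp add: ceq)
  next
    assume "c a = c (b + 1) \<and> c (a + 1) = c b"
    then have "int k dvd a - (b + 1)" "int k dvd a + 1 - b" by (auto simp: ceq mod_eq_dvd_iff)
    then have "int k dvd (a + 1 - b) - (a - (b + 1))" by (rule dvd_diff[rotated])
    then have "int k dvd 2" by simp
    then have "int k \<le> 2" by (rule zdvd_imp_le) simp
    then show ?thesis using k by simp
  qed
qed

lemma walk_edge_mod:
  assumes "cyclic_walk E k c"
  shows "0 \<le> i mod int k" "i mod int k < int k" "c (i mod int k) = c i" "c (i mod int k + 1) = c (i + 1)"
proof -
  have k: "3 \<le> k" and ceq: "\<And>i j. c i = c j \<longleftrightarrow> i mod int k = j mod int k"
    using assms by (auto simp: cyclic_walk_def)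
  show "0 \<le> i mod int k" "i mod int k < int k" using k by (auto intro: pos_mod_sign pos_mod_bound)
  show "c (i mod int k) = c i" by (simp add: ceq)
  show "c (i mod int k + 1) = c (i + 1)" unfolding ceq by (rule mod_add_left_eq)
qed

text \<open>If an earlier edge fails to be over a later one, then the pair is listed with the later
  edge on top. So it is enough to compare positions at the listed crossings with both edges on the
  walk.\<close>

lemma descending_shiftI:
  assumes X: "crossings_covered E P X" and c: "cyclic_walk E k c"
    and ord: "\<And>z a b. z \<in> set X \<Longrightarrow> 0 \<le> a \<Longrightarrow> a < int k \<Longrightarrow> 0 \<le> b \<Longrightarrow> b < int k \<Longrightarrow>
      {c a, c (a + 1)} = ends (fst z) \<Longrightarrow> {c b, c (b + 1)} = ends (snd z) \<Longrightarrow> (a - s) mod int k < (b - s) mod int k"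
  shows "descending P k (\<lambda>i. c (i + s))"
  unfolding descending_def
proof (intro allI impI, rule ccontr)
  fix i j :: int
  assume ij: "0 \<le> i" "i < j" "j < int k"
    and dis: "{c (i + s), c (i + 1 + s)} \<inter> {c (j + s), c (j + 1 + s)} = {}"
    and no: "\<not> over (seg P (c (i + s)) (c (i + 1 + s))) (seg P (c (j + s)) (c (j + 1 + s)))"
  have sw: "c (i + 1 + s) = c (i + s + 1)" "c (j + 1 + s) = c (j + s + 1)" by (simp_all add: algebra_simps)
  have e: "E (c (j + s)) (c (j + s + 1))" "E (c (i + s)) (c (i + s + 1))"
    using c by (auto simp: cyclic_walk_def)
  obtain z where z: "z \<in> set X" "ends (fst z) = {c (j + s), c (j + s + 1)}" "ends (snd z) = {c (i + s), c (i + s + 1)}"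
    using X e dis no unfolding crossings_covered_def sw by (metis inf_commute)
  have "((j + s) mod int k - s) mod int k < ((i + s) mod int k - s) mod int k"
    by (rule ord[OF z(1)]) (use walk_edge_mod[OF c] z in auto)
  then have "j mod int k < i mod int k" by (simp add: mod_simps)
  then show False using ij by simp
qed

lemma descending_reflectI:
  assumes X: "crossings_covered E P X" and "simple_graph V E" and c: "cyclic_walk E k c"
    and ord: "\<And>z a b. z \<in> set X \<Longrightarrow> 0 \<le> a \<Longrightarrow> a < int k \<Longrightarrow> 0 \<le> b \<Longrightarrow> b < int k \<Longrightarrow>
      {c a, c (a + 1)} = ends (fst z) \<Longrightarrow> {c b, c (b + 1)} = ends (snd z) \<Longrightarrow> (s - a) mod int k < (s - b) mod int k"
  shows "descending P k (\<lambda>i. c (s + 1 - i))"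
proof -
  let ?d = "\<lambda>i. c (s + 1 - i)"
  have d: "cyclic_walk E k ?d" by (rule cyclic_walk_reflect[OF assms(2) c])
  have "descending P k (\<lambda>i. ?d (i + 0))"
  proof (rule descending_shiftI[OF X d])
    fix z a b
    assume z: "z \<in> set X" and ab: "0 \<le> a" "a < int k" "0 \<le> b" "b < int k"
      and e: "{?d a, ?d (a + 1)} = ends (fst z)" "{?d b, ?d (b + 1)} = ends (snd z)"
    \<comment> \<open>Edge \<open>i\<close> of the reversed walk joins \<open>c (s + 1 - i)\<close>
      to \<open>c (s - i)\<close>, hence is edge \<open>s - i\<close> of \<open>c\<close>. This
      explains the additional 1 in the walk.\<close>
    have e': "{c ((s - i) mod int k), c ((s - i) mod int k + 1)} = {?d i, ?d (i + 1)}" for i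
      using walk_edge_mod(3,4)[OF c, of "s - i"] by (simp add: insert_commute algebra_simps)
    have "(s - (s - a) mod int k) mod int k < (s - (s - b) mod int k) mod int k"
      by (rule ord[OF z]) (use walk_edge_mod(1,2)[OF c] e e' in auto)
    then show "(a - 0) mod int k < (b - 0) mod int k" by (simp add: mod_simps)
  qed
  then show ?thesis by simp
qed

lemma mod_diff_window:
  fixes a s k :: int
  assumes "0 \<le> a" "a < k" "0 \<le> s" "s < k"
  shows "(a - s) mod k = (if s \<le> a then a - s else a - s + k)"
proof (cases "s \<le> a")
  case True
  then show ?thesis using assms by simp
next
  case False
  have "(a - s) mod k = (a - s + k) mod k" by simp
  also have "\<dots> = a - s + k" using assms False by (intro mod_pos_pos_trivial) auto
  finally show ?thesis using False by simp
qed

text \<open>A closed curve with at most two self-crossings can be traversed, from a suitable starting point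
  and in a suitable direction, so that each crossing is first passed on the upper branch.\<close>

lemma two_crossings_order:
  fixes k :: int
  assumes "0 \<le> o1" "o1 < k" "0 \<le> u1" "u1 < k" "0 \<le> o2" "o2 < k" "0 \<le> u2" "u2 < k"
    and "o1 \<noteq> u1" "o2 \<noteq> u2" "\<not> (u2 = o1 \<and> u1 = o2)"
  shows "\<exists>s. ((o1 - s) mod k < (u1 - s) mod k \<and> (o2 - s) mod k < (u2 - s) mod k) \<or>
             ((s - o1) mod k < (s - u1) mod k \<and> (s - o2) mod k < (s - u2) mod k)"
proof -
  note w = mod_diff_window
  \<comment> \<open>Starting at the upper branch of one crossing settles that crossing, and the two
    directions from there put the branches of the other crossing in opposite orders. Both can fail
    only if the starting edge is the lower branch of the other crossing, and by assumption this does
    not happen for both crossings at once.\<close>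
  have "((o1 - o1) mod k < (u1 - o1) mod k \<and> (o2 - o1) mod k < (u2 - o1) mod k) \<or>
        ((o1 - o2) mod k < (u1 - o2) mod k \<and> (o2 - o2) mod k < (u2 - o2) mod k) \<or>
        ((o1 - o1) mod k < (o1 - u1) mod k \<and> (o1 - o2) mod k < (o1 - u2) mod k) \<or>
        ((o2 - o1) mod k < (o2 - u1) mod k \<and> (o2 - o2) mod k < (o2 - u2) mod k)"
    using assms by (simp add: w)
  then show ?thesis by blast
qed

definition self_crossings :: "(int \<Rightarrow> nat) \<Rightarrow> ((nat \<times> nat) \<times> (nat \<times> nat)) list \<Rightarrow> ((nat \<times> nat) \<times> (nat \<times> nat)) list" where
  "self_crossings c X = filter (\<lambda>z. ends (fst z) \<in> walk_edges c \<and> ends (snd z) \<in> walk_edges c) X"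

lemma self_crossingsI:
  "z \<in> set X \<Longrightarrow> {c a, c (a + 1)} = ends (fst z) \<Longrightarrow> {c b, c (b + 1)} = ends (snd z) \<Longrightarrow> z \<in> set (self_crossings c X)"
  unfolding self_crossings_def walk_edges_def by auto

lemma windable_two_crossings:
  assumes X: "crossings_covered E P X" and "simple_graph V E" and c: "cyclic_walk E k c"
    and few: "length (self_crossings c X) \<le> 2"
  shows "windable P k c"
proof -
  obtain z1 z2 where sub: "set (self_crossings c X) \<subseteq> {z1, z2}" and z: "set (self_crossings c X) \<noteq> {} \<longrightarrow> {z1, z2} \<subseteq> set (self_crossings c X)"
  proof (cases "self_crossings c X")
    case Nil then show ?thesis using that by simp
  next
    case (Cons z1 l)
    show ?thesis
    proof (cases l)
      \<comment> \<open>A single crossing is used twice: \<open>two_crossings_order\<close> does not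
        require the crossings to be different.\<close>
      case Nil then show ?thesis using Cons that[of z1 z1] by simp
    next
      case (Cons z2 l')
      then have "self_crossings c X = [z1, z2]" using few \<open>self_crossings c X = z1 # l\<close> by simp
      then show ?thesis using that[of z1 z2] by simp
    qed
  qed
  show ?thesis
  proof (cases "set (self_crossings c X) = {}")
    case True
    have "descending P k (\<lambda>i. c (i + 0))"
    proof (rule descending_shiftI[OF X c])
      fix z a b
      assume "z \<in> set X" "{c a, c (a + 1)} = ends (fst z)" "{c b, c (b + 1)} = ends (snd z)"
      then have "z \<in> set (self_crossings c X)" by (rule self_crossingsI)
      then show "(a - 0) mod int k < (b - 0) mod int k" unfolding True by simp
    qed
    then show ?thesis unfolding windable_def by blast
  next
    case False
    then have zin: "z1 \<in> set (self_crossings c X)" "z2 \<in> set (self_crossings c X)" using z by auto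
    have pos: "\<exists>a. 0 \<le> a \<and> a < int k \<and> {c a, c (a + 1)} = e" if we: "e \<in> walk_edges c" for e
    proof -
      obtain i where i: "e = {c i, c (i + 1)}" using walk_edgesD[OF we] by (rule exE)
      show ?thesis
        by (rule exI[of _ "i mod int k"]) (simp add: i walk_edge_mod[OF c, of i])
    qed
    obtain o1 where o1: "0 \<le> o1" "o1 < int k" "{c o1, c (o1 + 1)} = ends (fst z1)"
      using pos zin(1) by (auto simp: self_crossings_def)
    obtain u1 where u1: "0 \<le> u1" "u1 < int k" "{c u1, c (u1 + 1)} = ends (snd z1)"
      using pos zin(1) by (auto simp: self_crossings_def)
    obtain o2 where o2: "0 \<le> o2" "o2 < int k" "{c o2, c (o2 + 1)} = ends (fst z2)"
      using pos zin(2) by (auto simp: self_crossings_def)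
    obtain u2 where u2: "0 \<le> u2" "u2 < int k" "{c u2, c (u2 + 1)} = ends (snd z2)"
      using pos zin(2) by (auto simp: self_crossings_def)
    have zX: "z1 \<in> set X" "z2 \<in> set X" using zin by (auto simp: self_crossings_def)
    have asym: "\<not> (ends (fst z) = ends (snd z') \<and> ends (snd z) = ends (fst z'))" "ends (fst z) \<noteq> ends (snd z)"
      if z: "z \<in> set X" "z' \<in> set X" for z z'
      using bspec[OF bspec[OF conjunct2[OF X[unfolded crossings_covered_def]] z(1)] z(2)] by simp_all
    have ne1: "o1 \<noteq> u1" using asym(2)[OF zX(1,1)] o1(3) u1(3) by metis
    have ne2: "o2 \<noteq> u2" using asym(2)[OF zX(2,2)] o2(3) u2(3) by metis
    have ne3: "\<not> (u2 = o1 \<and> u1 = o2)"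
    proof
      assume "u2 = o1 \<and> u1 = o2"
      then have "ends (fst z1) = ends (snd z2) \<and> ends (snd z1) = ends (fst z2)"
        using o1(3) u1(3) o2(3) u2(3) by (simp only:)
      then show False using asym(1)[OF zX(1,2)] by blast
    qed
    note ne = ne1 ne2 ne3
    obtain s where s: "((o1 - s) mod int k < (u1 - s) mod int k \<and> (o2 - s) mod int k < (u2 - s) mod int k) \<or>
             ((s - o1) mod int k < (s - u1) mod int k \<and> (s - o2) mod int k < (s - u2) mod int k)"
      using two_crossings_order[OF o1(1,2) u1(1,2) o2(1,2) u2(1,2) ne] by blast
    have pins: "(a = o1 \<and> b = u1) \<or> (a = o2 \<and> b = u2)"
      if "z \<in> set X" "0 \<le> a" "a < int k" "0 \<le> b" "b < int k" "{c a, c (a + 1)} = ends (fst z)" "{c b, c (b + 1)} = ends (snd z)" for z a b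
    proof -
      have "z = z1 \<or> z = z2" using self_crossingsI[OF that(1,6,7)] sub by blast
      then show ?thesis
      proof
        assume "z = z1"
        then have "a = o1" "b = u1"
          using walk_edge_index[OF c that(2,3) o1(1,2)] walk_edge_index[OF c that(4,5) u1(1,2)] that(6,7) o1(3) u1(3)
          by simp_all
        then show ?thesis by simp
      next
        assume "z = z2"
        then have "a = o2" "b = u2"
          using walk_edge_index[OF c that(2,3) o2(1,2)] walk_edge_index[OF c that(4,5) u2(1,2)] that(6,7) o2(3) u2(3)
          by simp_all
        then show ?thesis by simp
      qed
    qed
    from s show ?thesis
    proof
      assume s: "(o1 - s) mod int k < (u1 - s) mod int k \<and> (o2 - s) mod int k < (u2 - s) mod int k"
      have "descending P k (\<lambda>i. c (i + s))"
        by (rule descending_shiftI[OF X c]) (use pins s in blast)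
      then show ?thesis unfolding windable_def by blast
    next
      assume s: "(s - o1) mod int k < (s - u1) mod int k \<and> (s - o2) mod int k < (s - u2) mod int k"
      have "descending P k (\<lambda>i. c (s + 1 - i))"
        by (rule descending_reflectI[OF X assms(2) c]) (use pins s in blast)
      then show ?thesis unfolding windable_def by blast
    qed
  qed
qed

lemma windable_shift: "windable P k (\<lambda>i. c (i + s)) \<Longrightarrow> windable P k c"
proof -
  assume "windable P k (\<lambda>i. c (i + s))"
  then obtain r where "descending P k (\<lambda>i. c (i + (r + s))) \<or> descending P k (\<lambda>i. c ((r + s) - i))"
    unfolding windable_def by (auto simp: algebra_simps)
  then show ?thesis unfolding windable_def by blast
qed

lemma windable_reflect: "windable P k (\<lambda>i. c (s - i)) \<Longrightarrow> windable P k c"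
proof -
  assume "windable P k (\<lambda>i. c (s - i))"
  then obtain r where "descending P k (\<lambda>i. c ((s - r) - i)) \<or> descending P k (\<lambda>i. c (i + (s - r)))"
    unfolding windable_def by (auto simp: algebra_simps)
  then show ?thesis unfolding windable_def by blast
qed

text \<open>The searches start along a prescribed edge. Rotating and possibly reversing the walk
  achieves this without changing its edges.\<close>

lemma walk_from_edge:
  assumes G: "simple_graph V E" and c: "cyclic_walk E k c" and e: "ends e \<in> walk_edges c"
  obtains c' where "cyclic_walk E k c'" "range c' = range c" "walk_edges c' = walk_edges c"
    "c' 0 = fst e" "c' 1 = snd e" "windable P k c' \<Longrightarrow> windable P k c"
proof -
  obtain m where m: "{fst e, snd e} = {c m, c (m + 1)}" using e by (auto simp: walk_edges_def ends_def)
  then consider "c m = fst e" "c (m + 1) = snd e" | "c m = snd e" "c (m + 1) = fst e"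
    by (auto simp: doubleton_eq_iff)
  then show thesis
  proof cases
    case 1
    let ?c = "\<lambda>i. c (i + m)"
    have "range ?c = range c" by (auto intro: image_eqI[of _ _ "_ - m"])
    moreover have "walk_edges ?c = walk_edges c"
    proof -
      define f where "f i = {c i, c (i + 1)}" for i
      have "walk_edges ?c = range (\<lambda>i. f (i + m))"
        unfolding walk_edges_def f_def by (simp add: add.commute add.left_commute)
      also have "\<dots> = range f" by (auto intro: image_eqI[of _ _ "_ - m"])
      finally show ?thesis by (simp add: walk_edges_def f_def)
    qed
    ultimately show thesis
      using that[of ?c] cyclic_walk_shift[OF c, of m] windable_shift[of P k c m] 1 by (simp add: add.commute)
  next
    case 2
    let ?c = "\<lambda>i. c (m + 1 - i)"
    have "range ?c = range c" by (auto intro: image_eqI[of _ _ "m + 1 - _"])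
    moreover have "walk_edges ?c = walk_edges c"
    proof -
      define f where "f i = {c i, c (i + 1)}" for i
      have "{?c i, ?c (i + 1)} = f (m - i)" for i by (simp add: f_def insert_commute algebra_simps)
      then have "walk_edges ?c = range (\<lambda>i. f (m - i))" unfolding walk_edges_def by simp
      also have "\<dots> = range f" by (auto intro: image_eqI[of _ _ "m - _"])
      finally show ?thesis by (simp add: walk_edges_def f_def)
    qed
    ultimately show thesis
      using that[of ?c] cyclic_walk_reflect[OF G c, of "m + 1"] windable_reflect[of P k c "m + 1"] 2 by simp
  qed
qed

section \<open>Exhaustive search for cycles\<close>

primrec mem :: "nat \<Rightarrow> nat list \<Rightarrow> bool" where
  "mem w [] = False"
| "mem w (x # xs) = (if w = x then True else mem w xs)"

lemma mem_iff: "mem w xs \<longleftrightarrow> w \<in> set xs"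
  by (induction xs) auto

text \<open>These tests use conditionals instead of boolean connectives: under
  \<open>if_weak_cong\<close>, rewriting then decides the condition first and evaluates only the
  branch that is needed.\<close>

primrec all_mem :: "nat list \<Rightarrow> nat list \<Rightarrow> bool" where
  "all_mem [] S = True"
| "all_mem (w # ws) S = (if mem w S then all_mem ws S else False)"

lemma all_mem_iff: "all_mem ws S \<longleftrightarrow> set ws \<subseteq> set S"
  by (induction ws) (auto simp: mem_iff)

primrec any_mem :: "nat list \<Rightarrow> nat list \<Rightarrow> bool" where
  "any_mem [] S = False"
| "any_mem (w # ws) S = (if mem w S then True else any_mem ws S)"

lemma any_mem_iff: "any_mem ws S \<longleftrightarrow> set ws \<inter> set S \<noteq> {}"
  by (induction ws) (auto simp: mem_iff)

primrec two_mem :: "nat list \<Rightarrow> nat list \<Rightarrow> bool" where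
  "two_mem [] S = False"
| "two_mem (w # ws) S = (if mem w S then any_mem ws S else two_mem ws S)"

lemma two_memI: "a \<in> set ws \<Longrightarrow> b \<in> set ws \<Longrightarrow> a \<noteq> b \<Longrightarrow> a \<in> set S \<Longrightarrow> b \<in> set S \<Longrightarrow> two_mem ws S"
  by (induction ws) (auto simp: mem_iff any_mem_iff)

primrec keep :: "(nat \<Rightarrow> nat list) \<Rightarrow> nat list \<Rightarrow> nat list \<Rightarrow> nat list" where
  "keep nb S [] = []"
| "keep nb S (v # vs) = (if two_mem (nb v) S then v # keep nb S vs else keep nb S vs)"

definition peel_next :: "(nat list \<Rightarrow> nat list) \<Rightarrow> nat list \<Rightarrow> nat list \<Rightarrow> nat list" where
  "peel_next f S T = (if length T = length S then S else f T)"

text \<open>Approximates the 2-core of \<open>S\<close> from above by deleting vertices with fewer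
  than two neighbours in what is left. The first list bounds the number of rounds; stopping early
  would merely leave a larger set.\<close>

primrec peel :: "(nat \<Rightarrow> nat list) \<Rightarrow> nat list \<Rightarrow> nat list \<Rightarrow> nat list" where
  "peel nb [] S = S"
| "peel nb (x # xs) S = peel_next (peel nb xs) S (keep nb S S)"

primrec remove_all :: "nat list \<Rightarrow> nat list \<Rightarrow> nat list" where
  "remove_all W [] = []"
| "remove_all W (x # xs) = (if mem x W then remove_all W xs else x # remove_all W xs)"

lemma set_remove_all: "set (remove_all W xs) = set xs - set W"
  by (induction xs) (auto simp: mem_iff)

text \<open>The vertex set of a cycle has this property, so a second cycle survives all peeling as
  long as the path avoids it.\<close>

definition two_cored :: "(nat \<Rightarrow> nat list) \<Rightarrow> nat set \<Rightarrow> bool" where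
  "two_cored nb D \<longleftrightarrow> (\<forall>v\<in>D. \<exists>a b. a \<noteq> b \<and> a \<in> D \<and> b \<in> D \<and> a \<in> set (nb v) \<and> b \<in> set (nb v))"

lemma keep_superset: "two_cored nb D \<Longrightarrow> D \<subseteq> set S \<Longrightarrow> D \<inter> set vs \<subseteq> set (keep nb S vs)"
proof (induction vs)
  case (Cons v vs)
  have "two_mem (nb v) S" if "v \<in> D"
    using that Cons.prems two_memI[of _ "nb v" _ S] unfolding two_cored_def by blast
  then show ?case using Cons by auto
qed simp

lemma peel_superset: "two_cored nb D \<Longrightarrow> D \<subseteq> set S \<Longrightarrow> D \<subseteq> set (peel nb xs S)"
proof (induction xs arbitrary: S)
  case (Cons x xs)
  have "D \<subseteq> set (keep nb S S)" using keep_superset[OF Cons.prems, of S] Cons.prems(2) by blast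
  then show ?case using Cons by (simp add: peel_next_def)
qed simp

definition shrink :: "(nat \<Rightarrow> nat list) \<Rightarrow> nat \<Rightarrow> nat list \<Rightarrow> nat list" where
  "shrink nb w S = (if mem w S then peel nb S (remove_all [w] S) else S)"

definition visit :: "(nat list \<Rightarrow> bool) \<Rightarrow> (nat list \<Rightarrow> nat list \<Rightarrow> bool) \<Rightarrow> nat list \<Rightarrow> nat list \<Rightarrow> bool" where
  "visit good f S p = (if good S then f S p else True)"

text \<open>\<open>True\<close> means that nothing remains to be checked on a branch. The path is
  stored backwards, so \<open>hd p\<close> is its current end. The test
  \<open>tl (tl p) = []\<close> recognises a path of two vertices, which must not be closed along
  its own edge.\<close>

primrec scan :: "(nat \<Rightarrow> nat list) \<Rightarrow> (nat \<Rightarrow> nat \<Rightarrow> nat \<Rightarrow> bool) \<Rightarrow> (nat list \<Rightarrow> bool) \<Rightarrow>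
    (nat list \<Rightarrow> nat list \<Rightarrow> bool) \<Rightarrow> nat \<Rightarrow> (nat list \<Rightarrow> nat list \<Rightarrow> bool) \<Rightarrow> nat list \<Rightarrow> nat list \<Rightarrow> nat list \<Rightarrow> bool" where
  "scan nb ok good fin t f S p [] = True"
| "scan nb ok good fin t f S p (w # ws) =
    ((if w = t then (if tl (tl p) = [] then True else if ok t (hd p) (hd (tl p)) then fin S p else True)
      else if mem w p then True
      else if ok w (hd p) (hd (tl p)) then visit good f (shrink nb w S) (w # p)
      else True) \<and> scan nb ok good fin t f S p ws)"

text \<open>\<open>search\<close> extends a reversed path \<open>p\<close> from \<open>t\<close> in all admissible ways and applies \<open>fin\<close> to each
  closed cycle; \<open>S\<close> bounds the vertices available to a second, disjoint cycle.\<close>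

primrec search :: "(nat \<Rightarrow> nat list) \<Rightarrow> (nat \<Rightarrow> nat \<Rightarrow> nat \<Rightarrow> bool) \<Rightarrow> (nat list \<Rightarrow> bool) \<Rightarrow>
    (nat list \<Rightarrow> nat list \<Rightarrow> bool) \<Rightarrow> nat \<Rightarrow> nat list \<Rightarrow> nat list \<Rightarrow> nat list \<Rightarrow> bool" where
  "search nb ok good fin t [] S p = False"
| "search nb ok good fin t (x # xs) S p = scan nb ok good fin t (search nb ok good fin t xs) S p (nb (hd p))"

definition rev_path :: "(int \<Rightarrow> nat) \<Rightarrow> nat \<Rightarrow> nat list" where
  "rev_path c j = map (\<lambda>i. c (int i)) (rev [0..<Suc j])"

lemma rev_path_0: "rev_path c 0 = [c 0]"
  by (simp add: rev_path_def)

lemma rev_path_Suc: "rev_path c (Suc j) = c (int (Suc j)) # rev_path c j"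
  by (simp add: rev_path_def)

lemma set_rev_path: "set (rev_path c j) = (\<lambda>i. c (int i)) ` {0..j}"
  by (simp add: rev_path_def atLeast0AtMost lessThan_Suc_atMost atLeast0LessThan del: upt_Suc)

lemma scan_step:
  "scan nb ok good fin t f S p ws \<Longrightarrow> w \<in> set ws \<Longrightarrow>
    (if w = t then (if tl (tl p) = [] then True else if ok t (hd p) (hd (tl p)) then fin S p else True)
      else if mem w p then True
      else if ok w (hd p) (hd (tl p)) then visit good f (shrink nb w S) (w # p)
      else True)"
  by (induction ws) auto

text \<open>The walk itself is one of the explored branches. It is never pruned, because its steps
  are admissible and the remaining set keeps containing \<open>D\<close>. Exhausted fuel counts as
  failure of the search, so the lemma needs no bound on the length of the cycle.\<close>

lemma search_sound:
  assumes c: "cyclic_walk E k c" and nb: "\<And>u v. E u v \<Longrightarrow> v \<in> set (nb u)"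
    and ok: "\<And>i. ok (c (i + 1)) (c i) (c (i - 1))"
    and D: "D \<inter> range c = {}" "two_cored nb D" and good: "\<And>S. D \<subseteq> set S \<Longrightarrow> good S"
  shows "search nb ok good fin (c 0) xs S (rev_path c (Suc j)) \<Longrightarrow> D \<subseteq> set S \<Longrightarrow> Suc j < k \<Longrightarrow>
    \<exists>S'. D \<subseteq> set S' \<and> fin S' (rev_path c (k - 1))"
proof (induction xs arbitrary: S j)
  case Nil
  then show ?case by simp
next
  case (Cons x xs)
  have k3: "3 \<le> k" and ceq: "\<And>i j. c i = c j \<longleftrightarrow> i mod int k = j mod int k"
    using c by (auto simp: cyclic_walk_def)
  let ?p = "rev_path c (Suc j)"
  let ?w = "c (int (Suc (Suc j)))"
  have hd: "hd ?p = c (int (Suc j))" "hd (tl ?p) = c (int j)"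
    by (simp_all add: rev_path_Suc) (cases j; simp add: rev_path_0 rev_path_Suc)
  have "E (c (int (Suc j))) (c (int (Suc j) + 1))" using c unfolding cyclic_walk_def by blast
  then have "?w \<in> set (nb (hd ?p))" using nb unfolding hd by (simp add: add.commute)
  then have step: "if ?w = c 0 then (if tl (tl ?p) = [] then True else if ok (c 0) (hd ?p) (hd (tl ?p)) then fin S ?p else True)
      else if mem ?w ?p then True
      else if ok ?w (hd ?p) (hd (tl ?p)) then visit good (search nb ok good fin (c 0) xs) (shrink nb ?w S) (?w # ?p)
      else True"
    using scan_step[OF Cons.prems(1)[unfolded search.simps]] by blast
  have okw: "ok ?w (hd ?p) (hd (tl ?p))" using ok[of "int (Suc j)"] unfolding hd by (simp add: add.commute)
  show ?case
  proof (cases "Suc (Suc j) = k")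
    case True
    have "?w = c 0" unfolding True by (simp add: ceq)
    moreover have "tl (tl ?p) \<noteq> []"
    proof -
      obtain i where "j = Suc i" using True k3 by (cases j) auto
      then show ?thesis by (cases i) (simp_all add: rev_path_Suc rev_path_0)
    qed
    ultimately have "fin S ?p" using step okw by simp
    moreover have "Suc j = k - 1" using True by simp
    ultimately show ?thesis using Cons.prems(2) by metis
  next
    case False
    then have lt: "Suc (Suc j) < k" using Cons.prems(3) by simp
    have inj: "c (int a) = c (int b) \<longleftrightarrow> a = b" if "a < k" "b < k" for a b using that by (simp add: ceq)
    have "?w \<noteq> c 0" using inj[of "Suc (Suc j)" 0] lt by simp
    moreover have "\<not> mem ?w ?p"
    proof
      assume "mem ?w ?p"
      then obtain i where "i \<le> Suc j" "?w = c (int i)" unfolding mem_iff set_rev_path by auto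
      then show False using inj[of "Suc (Suc j)" i] lt by simp
    qed
    ultimately have v: "visit good (search nb ok good fin (c 0) xs) (shrink nb ?w S) (?w # ?p)"
      using step okw by simp
    have "D \<subseteq> set S - {?w}" using Cons.prems(2) D(1) by blast
    then have DS: "D \<subseteq> set (shrink nb ?w S)"
      using Cons.prems(2) by (auto simp: shrink_def set_remove_all intro!: subsetD[OF peel_superset[OF D(2)]])
    have "search nb ok good fin (c 0) xs (shrink nb ?w S) (rev_path c (Suc (Suc j)))"
      using v good[OF DS] by (simp add: visit_def rev_path_Suc)
    from Cons.IH[OF this DS lt] show ?thesis .
  qed
qed

text \<open>A local condition for using the edges of \<open>F\<close>: a path that comes from
  \<open>u\<close> through \<open>v\<close> to \<open>w\<close>, with \<open>v\<close> an end of
  such an edge, must have its other end among \<open>u\<close> and \<open>w\<close>. Paths that miss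
  both ends pass, so the ends are tested again once a cycle is closed.\<close>

primrec forced :: "(nat \<times> nat) list \<Rightarrow> nat \<Rightarrow> nat \<Rightarrow> nat \<Rightarrow> bool" where
  "forced [] w v u = True"
| "forced (e # F) w v u = (if v = fst e then (if w = snd e then forced F w v u else if u = snd e then forced F w v u else False)
     else if v = snd e then (if w = fst e then forced F w v u else if u = fst e then forced F w v u else False)
     else forced F w v u)"

definition admissible :: "(nat \<times> nat) list \<Rightarrow> nat list \<Rightarrow> nat \<Rightarrow> nat \<Rightarrow> nat \<Rightarrow> bool" where
  "admissible F av w v u = (if mem w av then False else forced F w v u)"

lemma admissible_walk:
  assumes c: "cyclic_walk E k c" and F: "\<And>e. e \<in> set F \<Longrightarrow> ends e \<in> walk_edges c" and av: "set av \<inter> range c = {}"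
  shows "admissible F av (c (i + 1)) (c i) (c (i - 1))"
proof -
  have ceq: "\<And>i j. c i = c j \<longleftrightarrow> i mod int k = j mod int k" using c by (auto simp: cyclic_walk_def)
  have nbr: "c (i + 1) = y \<or> c (i - 1) = y" if we: "{c i, y} \<in> walk_edges c" for y
  proof -
    obtain m where m: "{c i, y} = {c m, c (m + 1)}" using walk_edgesD[OF we] by (rule exE)
    then have "c i = c m \<and> y = c (m + 1) \<or> c i = c (m + 1) \<and> y = c m" by (simp only: doubleton_eq_iff)
    then show ?thesis
    proof
      assume a: "c i = c m \<and> y = c (m + 1)"
      then have "(i + 1) mod int k = (m + 1) mod int k" by (simp add: ceq mod_eq_dvd_iff)
      then have "c (i + 1) = c (m + 1)" by (simp only: ceq)
      with a have "c (i + 1) = y" by (elim conjE) (rule trans[OF _ sym])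
      then show ?thesis ..
    next
      assume a: "c i = c (m + 1) \<and> y = c m"
      then have "int k dvd i - (m + 1)" by (simp add: ceq mod_eq_dvd_iff)
      moreover have "i - 1 - m = i - (m + 1)" by simp
      ultimately have "(i - 1) mod int k = m mod int k" by (simp only: mod_eq_dvd_iff)
      then have "c (i - 1) = c m" by (simp only: ceq)
      with a have "c (i - 1) = y" by (elim conjE) (rule trans[OF _ sym])
      then show ?thesis ..
    qed
  qed
  have "forced F (c (i + 1)) (c i) (c (i - 1))"
    using F
  proof (induction F)
    case (Cons e F)
    have "ends e \<in> walk_edges c" using Cons.prems by simp
    then have "c i = fst e \<longrightarrow> c (i + 1) = snd e \<or> c (i - 1) = snd e" "c i = snd e \<longrightarrow> c (i + 1) = fst e \<or> c (i - 1) = fst e"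
      using nbr by (auto simp: ends_def insert_commute)
    then show ?case using Cons by auto
  qed simp
  then show ?thesis using av by (auto simp: admissible_def mem_iff)
qed

lemma walk_two_cored:
  assumes G: "simple_graph V E" and c: "cyclic_walk E k c" and nb: "\<And>u v. E u v \<Longrightarrow> v \<in> set (nb u)"
  shows "two_cored nb (range c)"
  unfolding two_cored_def
proof
  fix v assume "v \<in> range c"
  then obtain i where v: "v = c i" by blast
  have k3: "3 \<le> k" and ceq: "\<And>i j. c i = c j \<longleftrightarrow> i mod int k = j mod int k"
    using c by (auto simp: cyclic_walk_def)
  have "\<not> int k dvd (i + 1) - (i - 1)"
    using k3 zdvd_imp_le[of "int k" 2] by auto
  then have "c (i + 1) \<noteq> c (i - 1)" by (simp add: ceq mod_eq_dvd_iff)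
  moreover have "E (c i) (c (i + 1))" "E (c i) (c (i - 1))"
    using c G unfolding cyclic_walk_def simple_graph_def by (metis diff_add_cancel)+
  ultimately show "\<exists>a b. a \<noteq> b \<and> a \<in> range c \<and> b \<in> range c \<and> a \<in> set (nb v) \<and> b \<in> set (nb v)"
    unfolding v using nb by blast
qed

lemma walk_edge_range: "ends e \<in> walk_edges c \<Longrightarrow> fst e \<in> range c \<and> snd e \<in> range c"
  unfolding walk_edges_def ends_def by (auto simp: doubleton_eq_iff)

lemma range_rev_path:
  assumes "cyclic_walk E k c" shows "set (rev_path c (k - 1)) = range c"
proof
  have k3: "3 \<le> k" using assms by (auto simp: cyclic_walk_def)
  show "range c \<subseteq> set (rev_path c (k - 1))"
  proof
    fix v assume "v \<in> range c"
    then obtain i where "v = c i" by blast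
    then have "v = c (int (nat (i mod int k)))" using walk_edge_mod[OF assms, of i] by simp
    moreover have "nat (i mod int k) \<in> {0..k - 1}"
      unfolding atLeastAtMost_iff using walk_edge_mod[OF assms, of i] by linarith
    ultimately show "v \<in> set (rev_path c (k - 1))" unfolding set_rev_path by (rule image_eqI)
  qed
qed (auto simp: set_rev_path)

lemma rev_path_1: "rev_path c (Suc 0) = [c 1, c 0]"
  by (simp add: rev_path_Suc rev_path_0)

definition misses :: "nat \<times> nat \<Rightarrow> nat list \<Rightarrow> nat list \<Rightarrow> bool" where
  "misses e S p = (if all_mem [fst e, snd e] p then False else True)"

text \<open>The inner search, for a second cycle through \<open>f\<close> and \<open>f'\<close> that
  avoids the closed cycle \<open>p\<close>. No further cycle has to fit in, hence the empty list for
  the remaining vertices.\<close>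

definition quad_fin :: "(nat \<Rightarrow> nat list) \<Rightarrow> nat list \<Rightarrow> nat \<times> nat \<Rightarrow> nat \<times> nat \<Rightarrow> nat \<times> nat \<Rightarrow> nat list \<Rightarrow> nat list \<Rightarrow> bool" where
  "quad_fin nb V f f' e' S p = (if all_mem [fst e', snd e'] p
     then search nb (admissible [f'] p) (all_mem []) (misses f') (fst f) V [] [snd f, fst f] else True)"

text \<open>Two disjoint cycles fail to be stacked only if the first passes over the second at some
  crossing \<open>z\<close> and under it at some crossing \<open>z'\<close>. The search shows that
  no such pair exists. While the first cycle is built, the four ends belonging to the second must
  stay in the 2-core of the rest.\<close>

definition quad_free :: "(nat \<Rightarrow> nat list) \<Rightarrow> nat list \<Rightarrow> (nat \<times> nat) \<times> (nat \<times> nat) \<Rightarrow> (nat \<times> nat) \<times> (nat \<times> nat) \<Rightarrow> bool" where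
  "quad_free nb V z z' =
    (if any_mem [fst (fst z), snd (fst z), fst (snd z'), snd (snd z')] [fst (snd z), snd (snd z), fst (fst z'), snd (fst z')] then True
     else visit (all_mem [fst (snd z), snd (snd z), fst (fst z'), snd (fst z')])
       (search nb (admissible [snd z'] [fst (snd z), snd (snd z), fst (fst z'), snd (fst z')])
         (all_mem [fst (snd z), snd (snd z), fst (fst z'), snd (fst z')])
         (quad_fin nb V (snd z) (fst z') (snd z')) (fst (fst z)) V)
       (peel nb V (remove_all [fst (fst z), snd (fst z), fst (snd z'), snd (snd z')] V))
       [snd (fst z), fst (fst z)])"

lemma quad_free_sound:
  assumes G: "simple_graph (set V) E" and nb: "\<And>u v. E u v \<Longrightarrow> v \<in> set (nb u)"
    and c: "cyclic_walk E k c" and d: "cyclic_walk E l d" and dis: "range c \<inter> range d = {}"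
    and q: "quad_free nb V z z'"
    and zc: "ends (fst z) \<in> walk_edges c" "ends (snd z') \<in> walk_edges c"
    and zd: "ends (snd z) \<in> walk_edges d" "ends (fst z') \<in> walk_edges d"
  shows False
proof -
  let ?A = "[fst (fst z), snd (fst z), fst (snd z'), snd (snd z')]"
  let ?C = "[fst (snd z), snd (snd z), fst (fst z'), snd (fst z')]"
  have A: "set ?A \<subseteq> range c" using walk_edge_range[OF zc(1)] walk_edge_range[OF zc(2)] by auto
  have C: "set ?C \<subseteq> range d" using walk_edge_range[OF zd(1)] walk_edge_range[OF zd(2)] by auto
  have any: "\<not> any_mem ?A ?C" unfolding any_mem_iff using A C dis by blast
  have D: "two_cored nb (range d)" by (rule walk_two_cored[OF G d nb])
  have dV: "range d \<subseteq> set V" using d G unfolding cyclic_walk_def simple_graph_def by blast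
  obtain c' where c': "cyclic_walk E k c'" "range c' = range c" "walk_edges c' = walk_edges c"
    "c' 0 = fst (fst z)" "c' 1 = snd (fst z)"
    using walk_from_edge[OF G c zc(1)] by metis
  obtain d' where d': "cyclic_walk E l d'" "range d' = range d" "walk_edges d' = walk_edges d"
    "d' 0 = fst (snd z)" "d' 1 = snd (snd z)"
    using walk_from_edge[OF G d zd(1)] by metis
  let ?S = "peel nb V (remove_all ?A V)"
  have "range d \<subseteq> set (remove_all ?A V)" unfolding set_remove_all using dV A dis by blast
  then have S: "range d \<subseteq> set ?S" by (rule peel_superset[OF D])
  have good: "all_mem ?C S" if "range d \<subseteq> set S" for S unfolding all_mem_iff using that C by blast
  have s: "search nb (admissible [snd z'] ?C) (all_mem ?C) (quad_fin nb V (snd z) (fst z') (snd z')) (c' 0) V ?S (rev_path c' (Suc 0))"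
    using q any good[OF S] unfolding quad_free_def visit_def rev_path_1 c'(4,5) by (simp only: if_False if_True)
  have adm: "admissible [snd z'] ?C (c' (i + 1)) (c' i) (c' (i - 1))" for i
    by (rule admissible_walk[OF c'(1)]) (use zc c' C dis in auto)
  have "\<exists>S'. range d \<subseteq> set S' \<and> quad_fin nb V (snd z) (fst z') (snd z') S' (rev_path c' (k - 1))"
    by (rule search_sound[where nb = nb and ok = "admissible [snd z'] ?C" and good = "all_mem ?C" and D = "range d",
        OF c'(1) nb adm _ D good s S]) (use dis c' c in \<open>auto simp: cyclic_walk_def\<close>)
  then have "search nb (admissible [fst z'] (rev_path c' (k - 1))) (all_mem []) (misses (fst z')) (fst (snd z)) V [] [snd (snd z), fst (snd z)]"
    using A unfolding quad_fin_def all_mem_iff range_rev_path[OF c'(1)] c'(2) by (auto split: if_splits)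
  then have s2: "search nb (admissible [fst z'] (rev_path c' (k - 1))) (all_mem []) (misses (fst z')) (d' 0) V [] (rev_path d' (Suc 0))"
    unfolding rev_path_1 d'(4,5) .
  have adm2: "admissible [fst z'] (rev_path c' (k - 1)) (d' (i + 1)) (d' i) (d' (i - 1))" for i
    by (rule admissible_walk[OF d'(1)]) (use zd d' c' dis range_rev_path[OF c'(1)] in auto)
  have "\<exists>S'. {} \<subseteq> set S' \<and> misses (fst z') S' (rev_path d' (l - 1))"
    by (rule search_sound[where nb = nb and ok = "admissible [fst z'] (rev_path c' (k - 1))" and good = "all_mem []" and D = "{}",
        OF d'(1) nb adm2 _ _ _ s2]) (use d in \<open>auto simp: cyclic_walk_def two_cored_def\<close>)
  then show False
    using C unfolding misses_def all_mem_iff range_rev_path[OF d'(1)] d'(2) by auto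
qed

section \<open>Positions of crossings along a cycle\<close>

definition same_edge :: "nat \<times> nat \<Rightarrow> nat \<Rightarrow> nat \<Rightarrow> bool" where
  "same_edge e v u = (if fst e = v then snd e = u else if fst e = u then snd e = v else False)"

lemma same_edge_iff: "same_edge e v u \<longleftrightarrow> {v, u} = ends e"
  by (auto simp: same_edge_def ends_def doubleton_eq_iff)

text \<open>The list runs backwards, so the edge ending the walk from \<open>c i\<close> to
  \<open>c (i + 1)\<close> is followed by exactly \<open>i\<close> further vertices. The default 99
  marks an edge outside the cycle; it exceeds all cycle lengths that occur, and \<open>ahead\<close>
  and \<open>behind\<close> accept it.\<close>

primrec edge_index :: "nat \<times> nat \<Rightarrow> nat \<Rightarrow> nat list \<Rightarrow> nat" where
  "edge_index e v [] = 99"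
| "edge_index e v (u # us) = (if same_edge e v u then length us else edge_index e u us)"

definition cycle_index :: "nat \<times> nat \<Rightarrow> nat list \<Rightarrow> nat" where
  "cycle_index e p = (if same_edge e (hd p) (last p) then length p - 1 else edge_index e (hd p) (tl p))"

lemma edge_index_rev_path:
  assumes c: "cyclic_walk E k c" and i: "i < j" "j < k" and e: "{c (int i), c (int i + 1)} = ends e"
  shows "edge_index e (c (int j)) (tl (rev_path c j)) = i"
  using i
proof (induction j)
  case (Suc j)
  have tl: "tl (rev_path c (Suc j)) = c (int j) # tl (rev_path c j)"
    by (cases j) (simp_all add: rev_path_Suc rev_path_0)
  have len: "length (tl (rev_path c j)) = j" by (simp add: rev_path_def)
  have "same_edge e (c (int (Suc j))) (c (int j)) \<longleftrightarrow> i = j"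
  proof
    assume "same_edge e (c (int (Suc j))) (c (int j))"
    then have "{c (int j), c (int j + 1)} = {c (int i), c (int i + 1)}"
      unfolding same_edge_iff e by (simp add: insert_commute add.commute)
    then show "i = j" using walk_edge_index[OF c, of "int j" "int i"] Suc.prems by simp
  next
    assume "i = j"
    then show "same_edge e (c (int (Suc j))) (c (int j))"
      unfolding same_edge_iff e[symmetric] by (simp add: insert_commute add.commute)
  qed
  then show ?case using Suc len unfolding tl by auto
qed simp

lemma cycle_index_rev_path:
  assumes c: "cyclic_walk E k c" and a: "0 \<le> a" "a < int k" and e: "{c a, c (a + 1)} = ends e"
  shows "int (cycle_index e (rev_path c (k - 1))) = a"
proof -
  have k3: "3 \<le> k" and ceq: "\<And>i j. c i = c j \<longleftrightarrow> i mod int k = j mod int k"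
    using c by (auto simp: cyclic_walk_def)
  have hd: "hd (rev_path c (k - 1)) = c (int (k - 1))" by (simp add: rev_path_def)
  have last: "last (rev_path c (k - 1)) = c 0" by (simp add: rev_path_def last_map last_rev)
  have len: "length (rev_path c (k - 1)) = k" using k3 by (simp add: rev_path_def)
  have close: "same_edge e (c (int (k - 1))) (c 0) \<longleftrightarrow> a = int k - 1"
  proof -
    have "c 0 = c (int (k - 1) + 1)" using k3 by (simp add: ceq of_nat_diff)
    then have "same_edge e (c (int (k - 1))) (c 0) \<longleftrightarrow> {c (int (k - 1)), c (int (k - 1) + 1)} = {c a, c (a + 1)}"
      unfolding same_edge_iff e by simp
    also have "\<dots> \<longleftrightarrow> a = int (k - 1)"
      using walk_edge_index[OF c a, of "int (k - 1)"] k3 by auto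
    finally show ?thesis using k3 by (simp add: of_nat_diff)
  qed
  show ?thesis
  proof (cases "a = int k - 1")
    case True
    then show ?thesis using close k3 unfolding cycle_index_def hd last len by (simp add: of_nat_diff)
  next
    case False
    define i where "i = nat a"
    have i: "a = int i" "i < k - 1" using False a k3 by (auto simp: i_def)
    have "edge_index e (c (int (k - 1))) (tl (rev_path c (k - 1))) = i"
      by (rule edge_index_rev_path[OF c i(2)]) (use e i k3 in auto)
    then show ?thesis using close False i(1) unfolding cycle_index_def hd last by simp
  qed
qed

text \<open>The comparison of \<open>a - s\<close> and \<open>b - s\<close> modulo \<open>k\<close>,
  without arithmetic; \<open>behind\<close> is the same for \<open>s - a\<close> and
  \<open>s - b\<close>.\<close>

definition ahead :: "nat \<Rightarrow> nat \<Rightarrow> nat \<Rightarrow> nat \<Rightarrow> bool" where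
  "ahead k s a b = (if k \<le> a then True else if k \<le> b then True
     else if s \<le> a then (if s \<le> b then a < b else True) else (if s \<le> b then False else a < b))"

definition behind :: "nat \<Rightarrow> nat \<Rightarrow> nat \<Rightarrow> nat \<Rightarrow> bool" where
  "behind k s a b = (if k \<le> a then True else if k \<le> b then True
     else if a \<le> s then (if b \<le> s then b < a else True) else (if b \<le> s then False else b < a))"

primrec all_pairs :: "(nat \<Rightarrow> nat \<Rightarrow> bool) \<Rightarrow> (nat \<times> nat) list \<Rightarrow> bool" where
  "all_pairs f [] = True"
| "all_pairs f (x # xs) = (if f (fst x) (snd x) then all_pairs f xs else False)"

lemma all_pairs_iff: "all_pairs f xs \<longleftrightarrow> (\<forall>x\<in>set xs. f (fst x) (snd x))"
  by (induction xs) auto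

primrec try_starts :: "nat \<Rightarrow> (nat \<times> nat) list \<Rightarrow> nat list \<Rightarrow> bool" where
  "try_starts k ps [] = False"
| "try_starts k ps (s # ss) = (if s < k then (if all_pairs (ahead k s) ps then True
     else if all_pairs (behind k s) ps then True else try_starts k ps ss) else try_starts k ps ss)"

primrec positions :: "nat list \<Rightarrow> ((nat \<times> nat) \<times> (nat \<times> nat)) list \<Rightarrow> (nat \<times> nat) list" where
  "positions p [] = []"
| "positions p (z # zs) = (cycle_index (fst z) p, cycle_index (snd z) p) # positions p zs"

lemma positions_eq: "positions p X = map (\<lambda>z. (cycle_index (fst z) p, cycle_index (snd z) p)) X"
  by (induction X) auto

lemma try_startsD: "try_starts k ps ss \<Longrightarrow> \<exists>s<k. all_pairs (ahead k s) ps \<or> all_pairs (behind k s) ps"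
  by (induction ss) (auto split: if_splits)

lemma windable_by_positions:
  assumes X: "crossings_covered E P X" and G: "simple_graph V E" and c: "cyclic_walk E k c"
    and t: "try_starts k (positions (rev_path c (k - 1)) X) ss"
  shows "windable P k c"
proof -
  obtain s where s: "s < k" "all_pairs (ahead k s) (positions (rev_path c (k - 1)) X) \<or>
      all_pairs (behind k s) (positions (rev_path c (k - 1)) X)"
    using try_startsD[OF t] by blast
  let ?ix = "\<lambda>e. cycle_index e (rev_path c (k - 1))"
  note ix = cycle_index_rev_path[OF c]
  from s(2) show ?thesis
  proof
    assume al: "all_pairs (ahead k s) (positions (rev_path c (k - 1)) X)"
    have "descending P k (\<lambda>i. c (i + int s))"
    proof (rule descending_shiftI[OF X c])
      fix z a b
      assume z: "z \<in> set X" and ab: "0 \<le> a" "a < int k" "0 \<le> b" "b < int k"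
        and e: "{c a, c (a + 1)} = ends (fst z)" "{c b, c (b + 1)} = ends (snd z)"
      have "ahead k s (?ix (fst z)) (?ix (snd z))" using al z unfolding positions_eq all_pairs_iff by auto
      then show "(a - int s) mod int k < (b - int s) mod int k"
        using ix[OF ab(1,2) e(1)] ix[OF ab(3,4) e(2)] ab s(1)
        by (auto simp: ahead_def mod_diff_window split: if_splits)
    qed
    then show ?thesis unfolding windable_def by blast
  next
    assume al: "all_pairs (behind k s) (positions (rev_path c (k - 1)) X)"
    have "descending P k (\<lambda>i. c (int s + 1 - i))"
    proof (rule descending_reflectI[OF X G c])
      fix z a b
      assume z: "z \<in> set X" and ab: "0 \<le> a" "a < int k" "0 \<le> b" "b < int k"
        and e: "{c a, c (a + 1)} = ends (fst z)" "{c b, c (b + 1)} = ends (snd z)"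
      have "behind k s (?ix (fst z)) (?ix (snd z))" using al z unfolding positions_eq all_pairs_iff by auto
      then show "(int s - a) mod int k < (int s - b) mod int k"
        using ix[OF ab(1,2) e(1)] ix[OF ab(3,4) e(2)] ab s(1)
        by (auto simp: behind_def mod_diff_window split: if_splits)
    qed
    then show ?thesis unfolding windable_def by blast
  qed
qed

text \<open>The vertex list also supplies the starting positions to be tried, as the labels are the
  numbers below n. The positions are tested against all of \<open>X\<close>, so crossings beyond the
  given three are taken into account.\<close>

definition triple_fin :: "((nat \<times> nat) \<times> (nat \<times> nat)) list \<Rightarrow> nat list \<Rightarrow> nat list \<Rightarrow> nat list \<Rightarrow> nat list \<Rightarrow> bool" where
  "triple_fin X V W S p = (if all_mem W p then try_starts (length p) (positions p X) V else True)"

definition nonempty :: "nat list \<Rightarrow> bool" where "nonempty S = (if S = [] then False else True)"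

definition edge_vertices :: "(nat \<times> nat) \<Rightarrow> (nat \<times> nat) \<Rightarrow> (nat \<times> nat) \<Rightarrow> (nat \<times> nat) \<Rightarrow> (nat \<times> nat) \<Rightarrow> (nat \<times> nat) \<Rightarrow> nat list" where
  "edge_vertices a b c d e f = [fst a, snd a, fst b, snd b, fst c, snd c, fst d, snd d, fst e, snd e, fst f, snd f]"

text \<open>Enumerates the cycles through the six edges of three crossings. Cycles whose complement
  has an empty 2-core are dropped, since they have no disjoint partner.\<close>

definition triple_ok ::
  "(nat \<Rightarrow> nat list) \<Rightarrow> nat list \<Rightarrow> ((nat \<times> nat) \<times> (nat \<times> nat)) list \<Rightarrow> (nat \<times> nat) \<times> (nat \<times> nat) \<Rightarrow>
    (nat \<times> nat) \<times> (nat \<times> nat) \<Rightarrow> (nat \<times> nat) \<times> (nat \<times> nat) \<Rightarrow> bool" where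
  "triple_ok nb V X x y z =
    visit nonempty
      (search nb (admissible [fst x, snd x, fst y, snd y, fst z, snd z] []) nonempty
        (triple_fin X V (edge_vertices (fst x) (snd x) (fst y) (snd y) (fst z) (snd z))) (fst (fst x)) V)
      (peel nb V (remove_all (edge_vertices (fst x) (snd x) (fst y) (snd y) (fst z) (snd z)) V))
      [snd (fst x), fst (fst x)]"

lemma triple_ok_sound:
  assumes X: "crossings_covered E P X" and G: "simple_graph (set V) E" and nb: "\<And>u v. E u v \<Longrightarrow> v \<in> set (nb u)"
    and c: "cyclic_walk E k c" and d: "cyclic_walk E l d" and dis: "range c \<inter> range d = {}"
    and t: "triple_ok nb V X x y z"
    and e: "\<And>a. a \<in> {x, y, z} \<Longrightarrow> ends (fst a) \<in> walk_edges c \<and> ends (snd a) \<in> walk_edges c"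
  shows "windable P k c"
proof -
  let ?F = "[fst x, snd x, fst y, snd y, fst z, snd z]"
  let ?W = "edge_vertices (fst x) (snd x) (fst y) (snd y) (fst z) (snd z)"
  have eF: "ends a \<in> walk_edges c" if "a \<in> set ?F" for a using that e[of x] e[of y] e[of z] by auto
  have W: "set ?W \<subseteq> range c"
    using walk_edge_range[OF eF] unfolding edge_vertices_def by simp
  have D: "two_cored nb (range d)" by (rule walk_two_cored[OF G d nb])
  have dV: "range d \<subseteq> set V" using d G unfolding cyclic_walk_def simple_graph_def by blast
  have e0: "ends (fst x) \<in> walk_edges c" using e by blast
  obtain c' where c': "cyclic_walk E k c'" "range c' = range c" "walk_edges c' = walk_edges c"
    "c' 0 = fst (fst x)" "c' 1 = snd (fst x)" "windable P k c' \<Longrightarrow> windable P k c"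
    using walk_from_edge[OF G c e0] by metis
  let ?S = "peel nb V (remove_all ?W V)"
  have "range d \<subseteq> set (remove_all ?W V)" unfolding set_remove_all using dV W dis by blast
  then have S: "range d \<subseteq> set ?S" by (rule peel_superset[OF D])
  have good: "nonempty S" if "range d \<subseteq> set S" for S using that by (auto simp: nonempty_def)
  have s: "search nb (admissible ?F []) nonempty (triple_fin X V ?W) (c' 0) V ?S (rev_path c' (Suc 0))"
    using t good[OF S] unfolding triple_ok_def visit_def rev_path_1 c'(4,5) by (simp only: if_True)
  have adm: "admissible ?F [] (c' (i + 1)) (c' i) (c' (i - 1))" for i
    by (rule admissible_walk[OF c'(1)]) (use eF c' in auto)
  have "\<exists>S'. range d \<subseteq> set S' \<and> triple_fin X V ?W S' (rev_path c' (k - 1))"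
    by (rule search_sound[where nb = nb and ok = "admissible ?F []" and good = nonempty and D = "range d",
        OF c'(1) nb adm _ D good s S]) (use dis c' c in \<open>auto simp: cyclic_walk_def\<close>)
  moreover have "length (rev_path c' (k - 1)) = k"
    using c by (simp add: rev_path_def cyclic_walk_def)
  ultimately have "try_starts k (positions (rev_path c' (k - 1)) X) V"
    using W unfolding triple_fin_def all_mem_iff range_rev_path[OF c'(1)] c'(2) by (auto split: if_splits)
  then show ?thesis using windable_by_positions[OF X G c'(1)] c'(6) by blast
qed

primrec pairwise_ok :: "('a \<Rightarrow> 'a \<Rightarrow> bool) \<Rightarrow> 'a list \<Rightarrow> bool" where
  "pairwise_ok f [] = True"
| "pairwise_ok f (x # xs) = (list_all (f x) xs \<and> pairwise_ok f xs)"

primrec triplewise_ok :: "('a \<Rightarrow> 'a \<Rightarrow> 'a \<Rightarrow> bool) \<Rightarrow> 'a list \<Rightarrow> bool" where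
  "triplewise_ok f [] = True"
| "triplewise_ok f (x # xs) = (pairwise_ok (f x) xs \<and> triplewise_ok f xs)"

lemma pairwise_okD: "pairwise_ok f xs \<Longrightarrow> x \<in> set xs \<Longrightarrow> y \<in> set xs \<Longrightarrow> x \<noteq> y \<Longrightarrow> f x y \<or> f y x"
  by (induction xs) (auto simp: list_all_iff)

lemma pairwise_ok_filter: "pairwise_ok f xs \<Longrightarrow> filter Q xs = x # y # l \<Longrightarrow> f x y"
proof (induction xs)
  case (Cons a xs)
  show ?case
  proof (cases "Q a")
    case True
    then have "a = x" "filter Q xs = y # l" using Cons.prems(2) by auto
    then have "y \<in> set (filter Q xs)" by simp
    then have "y \<in> set xs" by simp
    then show ?thesis using Cons.prems(1) \<open>a = x\<close> by (simp add: list_all_iff)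
  next
    case False
    then show ?thesis using Cons by simp
  qed
qed simp

lemma triplewise_ok_filter: "triplewise_ok f xs \<Longrightarrow> filter Q xs = x # y # z # l \<Longrightarrow> f x y z"
proof (induction xs)
  case (Cons a xs)
  show ?case
  proof (cases "Q a")
    case True
    then have "a = x" "filter Q xs = y # z # l" using Cons.prems(2) by auto
    then show ?thesis using Cons.prems(1) pairwise_ok_filter[of "f x" xs Q y z l] by simp
  next
    case False
    then show ?thesis using Cons by simp
  qed
qed simp

text \<open>A cycle with more than two self-crossings is caught by the first three of them in the
  order of \<open>X\<close>. Two cycles that cannot be stacked yield one crossing for each order,
  which \<open>quad_free\<close> excludes.\<close>

theorem checked_drawing_linkless:
  assumes D: "straight_drawing (set V) E P" and X: "crossings_covered E P X"
    and nb: "\<And>u v. E u v \<Longrightarrow> v \<in> set (nb u)"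
    and quads: "pairwise_ok (quad_free nb V) X" and triples: "triplewise_ok (triple_ok nb V X) X"
  shows "linklessly_embeddable (set V) E"
proof (rule straight_drawing_linkless[OF D])
  note G = sd_simple[OF D]
  fix k c l d
  assume c: "cyclic_walk E k c" and d: "cyclic_walk E l d" and dis: "range c \<inter> range d = {}"
  show "windable P k c"
  proof (cases "length (self_crossings c X) \<le> 2")
    case True
    then show ?thesis by (rule windable_two_crossings[OF X G c])
  next
    case False
    then obtain x y z r where xyz: "self_crossings c X = x # y # z # r"
      by (metis One_nat_def Suc_1 Suc_le_mono bot_nat_0.extremum length_Cons list.exhaust list.size(3))
    have t: "triple_ok nb V X x y z"
      by (rule triplewise_ok_filter[OF triples xyz[unfolded self_crossings_def]])
    have "{x, y, z} \<subseteq> set (self_crossings c X)" unfolding xyz by auto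
    then show ?thesis
      by (intro triple_ok_sound[OF X G nb c d dis t]) (auto simp: self_crossings_def)
  qed
  have edges: "E (c i) (c (i + 1))" "E (d i) (d (i + 1))" for i using c d by (auto simp: cyclic_walk_def)
  show "(\<forall>i j. over (seg P (c i) (c (i + 1))) (seg P (d j) (d (j + 1)))) \<or>
      (\<forall>i j. over (seg P (d j) (d (j + 1))) (seg P (c i) (c (i + 1))))"
  proof (rule ccontr)
    assume "\<not> ?thesis"
    then obtain i j i' j' where no: "\<not> over (seg P (c i) (c (i + 1))) (seg P (d j) (d (j + 1)))"
        "\<not> over (seg P (d j') (d (j' + 1))) (seg P (c i') (c (i' + 1)))" by blast
    have disj: "{c i, c (i + 1)} \<inter> {d j, d (j + 1)} = {}" for i j using dis by auto
    \<comment> \<open>Where \<open>c\<close> is not over \<open>d\<close>, an edge of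
      \<open>d\<close> is listed as passing over an edge of \<open>c\<close>; the other failure
      gives the opposite crossing \<open>z\<close>.\<close>
    obtain z' where z': "z' \<in> set X" "ends (fst z') = {d j, d (j + 1)}" "ends (snd z') = {c i, c (i + 1)}"
      using X edges disj[of i j] no(1) unfolding crossings_covered_def by (metis inf_commute)
    obtain z where z: "z \<in> set X" "ends (fst z) = {c i', c (i' + 1)}" "ends (snd z) = {d j', d (j' + 1)}"
      using X edges disj[of i' j'] no(2) unfolding crossings_covered_def by metis
    have we: "ends (fst z) \<in> walk_edges c" "ends (snd z') \<in> walk_edges c"
      "ends (snd z) \<in> walk_edges d" "ends (fst z') \<in> walk_edges d"
      unfolding z z' walk_edges_def by auto
    have "z \<noteq> z'"
    proof
      assume "z = z'"
      then have "{c i', c (i' + 1)} = {d j, d (j + 1)}" using z z' by simp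
      then have "c i' \<in> range d" by (auto simp: doubleton_eq_iff)
      then show False using dis by blast
    qed
    then have "quad_free nb V z z' \<or> quad_free nb V z' z" using pairwise_okD[OF quads] z(1) z'(1) by blast
    then show False
    proof
      assume "quad_free nb V z z'"
      from quad_free_sound[OF G nb c d dis this we] show False .
    next
      assume q: "quad_free nb V z' z"
      have dis': "range d \<inter> range c = {}" using dis by blast
      from quad_free_sound[OF G nb d c dis' q we(4,3,2,1)] show False .
    qed
  qed
qed

section \<open>Exact tests on integer coordinates\<close>

definition point_of :: "int \<times> int \<times> int \<Rightarrow> complex \<times> real" where
  "point_of p = (Complex (of_int (fst p)) (of_int (fst (snd p))), of_int (snd (snd p)))"

text \<open>Twice the signed area of the projected triangle.\<close>

definition orient :: "int \<times> int \<times> int \<Rightarrow> int \<times> int \<times> int \<Rightarrow> int \<times> int \<times> int \<Rightarrow> int" where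
  "orient p q r = (fst q - fst p) * (fst (snd r) - fst (snd p)) - (fst (snd q) - fst (snd p)) * (fst r - fst p)"

definition cross_z :: "int \<times> int \<times> int \<Rightarrow> int \<times> int \<times> int \<Rightarrow> int \<times> int \<times> int \<Rightarrow> int \<times> int \<times> int \<Rightarrow> int" where
  "cross_z p q r s = (fst q - fst p) * (fst (snd s) - fst (snd r)) - (fst (snd q) - fst (snd p)) * (fst s - fst r)"

text \<open>The triple product of both edge directions and the vector from \<open>r\<close> to
  \<open>p\<close>. Divided by \<open>cross_z\<close>, it is the signed height of the first line
  over the second where their projections cross.\<close>

definition gap :: "int \<times> int \<times> int \<Rightarrow> int \<times> int \<times> int \<Rightarrow> int \<times> int \<times> int \<Rightarrow> int \<times> int \<times> int \<Rightarrow> int" where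
  "gap p q r s =
    ((fst (snd q) - fst (snd p)) * (snd (snd s) - snd (snd r)) - (snd (snd q) - snd (snd p)) * (fst (snd s) - fst (snd r))) * (fst p - fst r)
    + ((snd (snd q) - snd (snd p)) * (fst s - fst r) - (fst q - fst p) * (snd (snd s) - snd (snd r))) * (fst (snd p) - fst (snd r))
    + cross_z p q r s * (snd (snd p) - snd (snd r))"

definition above_test :: "int \<times> int \<times> int \<Rightarrow> int \<times> int \<times> int \<Rightarrow> int \<times> int \<times> int \<Rightarrow> int \<times> int \<times> int \<Rightarrow> bool" where
  "above_test p q r s = (if 0 < orient p q r * orient p q s then True
     else if 0 < orient r s p * orient r s q then True else 0 < gap p q r s * cross_z p q r s)"

text \<open>Farkas certificate: an affine functional, non-decreasing in the height, that separates the segments.\<close>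

lemma over_affine:
  fixes \<alpha> \<beta> \<kappa> \<delta> :: real
  defines "f \<equiv> \<lambda>p :: complex \<times> real. \<alpha> * Re (fst p) + \<beta> * Im (fst p) + \<kappa> * snd p + \<delta>"
  assumes "0 \<le> \<kappa>" and f: "0 \<le> f a \<and> 0 \<le> f b \<and> f c < 0 \<and> f d < 0 \<or> 0 < f a \<and> 0 < f b \<and> f c \<le> 0 \<and> f d \<le> 0"
  shows "over (closed_segment a b) (closed_segment c d)"
  unfolding over_def
proof (intro ballI impI)
  fix p q assume p: "p \<in> closed_segment a b" and q: "q \<in> closed_segment c d" and eq: "fst p = fst q"
  have conv: "\<exists>u. 0 \<le> u \<and> u \<le> 1 \<and> f x = (1 - u) * f y + u * f z" if "x \<in> closed_segment y z" for x y z
  proof -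
    obtain u where u: "0 \<le> u" "u \<le> 1" "x = (1 - u) *\<^sub>R y + u *\<^sub>R z" using \<open>x \<in> closed_segment y z\<close> unfolding closed_segment_def by blast
    have "f x = (1 - u) * f y + u * f z" unfolding u(3) f_def by (simp add: algebra_simps)
    then show ?thesis using u by blast
  qed
  obtain u where u: "0 \<le> u" "u \<le> 1" "f p = (1 - u) * f a + u * f b" using conv[OF p] by blast
  obtain v where v: "0 \<le> v" "v \<le> 1" "f q = (1 - v) * f c + v * f d" using conv[OF q] by blast
  have "f q < f p"
    using f
  proof
    assume h: "0 \<le> f a \<and> 0 \<le> f b \<and> f c < 0 \<and> f d < 0"
    then have "0 \<le> f p" unfolding u(3) using u by simp
    moreover have "f q < 0" unfolding v(3) using v h by (intro convex_bound_lt[of "f c" 0 "f d" "1 - v" v, simplified]) auto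
    ultimately show ?thesis by linarith
  next
    assume h: "0 < f a \<and> 0 < f b \<and> f c \<le> 0 \<and> f d \<le> 0"
    have "- f p < 0" unfolding u(3) using u h convex_bound_lt[of "- f a" 0 "- f b" "1 - u" u] by simp
    moreover have "f q \<le> 0" unfolding v(3) using v h by (simp add: add_nonpos_nonpos mult_nonneg_nonpos)
    ultimately show ?thesis by linarith
  qed
  then have "0 < \<kappa> * (snd p - snd q)" unfolding f_def using eq by (simp add: algebra_simps)
  then show "snd q < snd p" using assms(2) by (simp add: zero_less_mult_iff)
qed

lemma above_test_over:
  assumes "above_test p q r s"
  shows "over (closed_segment (point_of p) (point_of q)) (closed_segment (point_of r) (point_of s))"
proof -
  obtain px py pz qx qy qz rx ry rz sx sy sz where pts: "p = (px, py, pz)" "q = (qx, qy, qz)" "r = (rx, ry, rz)" "s = (sx, sy, sz)"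
    by (metis prod.collapse)
  note defs = pts point_of_def orient_def cross_z_def gap_def
  consider "0 < orient p q r \<and> 0 < orient p q s" | "orient p q r < 0 \<and> orient p q s < 0"
    | "0 < orient r s p \<and> 0 < orient r s q" | "orient r s p < 0 \<and> orient r s q < 0"
    | "0 < gap p q r s * cross_z p q r s"
    using assms by (auto simp: above_test_def zero_less_mult_iff split: if_splits)
  then show ?thesis
  proof cases
    \<comment> \<open>In the first four cases the projected line through one of the segments
      separates, so the functional does not involve the height.\<close>
    case 1
    then have "0 < real_of_int (orient p q r)" "0 < real_of_int (orient p q s)" by auto
    then show ?thesis
      by (intro over_affine[where \<alpha> = "of_int (qy - py)" and \<beta> = "of_int (px - qx)" and \<kappa> = 0 and \<delta> = "of_int ((qx - px) * py - (qy - py) * px)"])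
        (simp_all add: defs algebra_simps)
  next
    case 2
    then have "real_of_int (orient p q r) < 0" "real_of_int (orient p q s) < 0" by auto
    then show ?thesis
      by (intro over_affine[where \<alpha> = "- of_int (qy - py)" and \<beta> = "of_int (qx - px)" and \<kappa> = 0 and \<delta> = "of_int ((qy - py) * px - (qx - px) * py)"])
        (simp_all add: defs algebra_simps)
  next
    case 3
    then have "0 < real_of_int (orient r s p)" "0 < real_of_int (orient r s q)" by auto
    then show ?thesis
      by (intro over_affine[where \<alpha> = "- of_int (sy - ry)" and \<beta> = "of_int (sx - rx)" and \<kappa> = 0 and \<delta> = "of_int ((sy - ry) * rx - (sx - rx) * ry)"])
        (simp_all add: defs algebra_simps)
  next
    case 4
    then have "real_of_int (orient r s p) < 0" "real_of_int (orient r s q) < 0" by auto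
    then show ?thesis
      by (intro over_affine[where \<alpha> = "of_int (sy - ry)" and \<beta> = "of_int (rx - sx)" and \<kappa> = 0 and \<delta> = "of_int ((sx - rx) * ry - (sy - ry) * rx)"])
        (simp_all add: defs algebra_simps)
  next
    case 5
    define n where "n = cross_z p q r s"
    \<comment> \<open>The plane through the lower segment parallel to the upper one. Its normal
      vector is multiplied by its own third component \<open>n\<close>, which makes the coefficient
      of the height a square.\<close>
    define A where "A = n * ((qy - py) * (sz - rz) - (qz - pz) * (sy - ry))"
    define B where "B = n * ((qz - pz) * (sx - rx) - (qx - px) * (sz - rz))"
    define G where "G = - (A * rx + B * ry + n * n * rz)"
    have n: "n = (qx - px) * (sy - ry) - (qy - py) * (sx - rx)" by (simp add: n_def pts cross_z_def)
    have "A * rx + B * ry + n * n * rz + G = 0" by (simp add: G_def)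
    moreover have "A * sx + B * sy + n * n * sz + G = 0"
      unfolding G_def A_def B_def n by algebra
    moreover have "A * px + B * py + n * n * pz + G = gap p q r s * n"
      unfolding G_def A_def B_def gap_def n_def[symmetric] unfolding pts by (simp add: algebra_simps)
    moreover have "A * qx + B * qy + n * n * qz + G = A * px + B * py + n * n * pz + G"
      unfolding A_def B_def n by algebra
    ultimately have i: "A * rx + B * ry + n * n * rz + G = 0" "A * sx + B * sy + n * n * sz + G = 0"
      "0 < A * px + B * py + n * n * pz + G" "0 < A * qx + B * qy + n * n * qz + G"
      using 5 by (simp_all add: n_def)
    have ii: "real_of_int (A * rx + B * ry + n * n * rz + G) = 0" "real_of_int (A * sx + B * sy + n * n * sz + G) = 0"
      "0 < real_of_int (A * px + B * py + n * n * pz + G)" "0 < real_of_int (A * qx + B * qy + n * n * qz + G)"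
      using i by (simp_all only: of_int_0 of_int_0_less_iff)
    show ?thesis
      by (rule over_affine[where \<alpha> = "of_int A" and \<beta> = "of_int B" and \<kappa> = "of_int (n * n)" and \<delta> = "of_int G"])
        (use ii in \<open>simp_all add: point_of_def pts\<close>)
  qed
qed

lemma orient_spread:
  assumes "orient v u w \<noteq> 0"
  shows "spread (fst (point_of u - point_of v)) (fst (point_of w - point_of v))"
  unfolding spread_def
proof (intro allI impI)
  fix s t :: real
  obtain ux uy uz vx vy vz wx wy wz where pts: "u = (ux, uy, uz)" "v = (vx, vy, vz)" "w = (wx, wy, wz)"
    by (metis prod.collapse)
  define a b c d :: real where "a = of_int (ux - vx)" and "b = of_int (uy - vy)" and "c = of_int (wx - vx)" and "d = of_int (wy - vy)"
  assume "0 \<le> s" "0 \<le> t" "s *\<^sub>R fst (point_of u - point_of v) = t *\<^sub>R fst (point_of w - point_of v)"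
  then have e: "s * a = t * c" "s * b = t * d"
    by (simp_all add: pts point_of_def complex_eq_iff a_def b_def c_def d_def)
  have "a * d - b * c = of_int (orient v u w)" by (simp add: a_def b_def c_def d_def orient_def pts)
  then have nz: "a * d - b * c \<noteq> 0" using assms by simp
  have "s * (a * d - b * c) = 0"
  proof -
    have "s * (a * d - b * c) = (s * a) * d - (s * b) * c" by algebra
    also have "\<dots> = 0" unfolding e by algebra
    finally show ?thesis .
  qed
  moreover have "t * (a * d - b * c) = 0"
  proof -
    have "t * (a * d - b * c) = a * (t * d) - b * (t * c)" by algebra
    also have "\<dots> = 0" unfolding e[symmetric] by algebra
    finally show ?thesis .
  qed
  ultimately show "s = 0 \<and> t = 0" using nz by simp
qed

lemma orient_not_on_segment:
  assumes "orient u v w \<noteq> 0"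
  shows "fst (point_of w) \<notin> fst ` closed_segment (point_of u) (point_of v)"
proof
  obtain ux uy uz vx vy vz wx wy wz where pts: "u = (ux, uy, uz)" "v = (vx, vy, vz)" "w = (wx, wy, wz)"
    by (metis prod.collapse)
  assume "fst (point_of w) \<in> fst ` closed_segment (point_of u) (point_of v)"
  then obtain t where t: "fst (point_of w) = fst ((1 - t) *\<^sub>R point_of u + t *\<^sub>R point_of v)"
    unfolding closed_segment_def by auto
  have x: "real_of_int wx - ux = t * (real_of_int vx - ux)" and y: "real_of_int wy - uy = t * (real_of_int vy - uy)"
    using t by (simp_all add: point_of_def pts complex_eq_iff algebra_simps)
  have "real_of_int (orient u v w) = (real_of_int vx - ux) * (real_of_int wy - uy) - (real_of_int vy - uy) * (real_of_int wx - ux)"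
    by (simp add: orient_def pts)
  also have "\<dots> = 0" unfolding x y by simp
  finally show False using assms by simp
qed

section \<open>Graphs given by neighbour lists\<close>

definition list_graph :: "nat list \<Rightarrow> (nat \<Rightarrow> nat list) \<Rightarrow> nat \<Rightarrow> nat \<Rightarrow> bool" where
  "list_graph V nb u v \<longleftrightarrow> u \<in> set V \<and> v \<in> set (nb u)"

definition two_distinct :: "nat list \<Rightarrow> bool" where
  "two_distinct xs = (if xs = [] then False else if tl xs = [] then False else hd xs \<noteq> hd (tl xs))"

text \<open>Disjoint neighbour lists of adjacent vertices mean that there are no triangles. Looking
  at the first two entries of a list is enough for degree at least 2.\<close>

primrec list_graph_ok :: "nat list \<Rightarrow> (nat \<Rightarrow> nat list) \<Rightarrow> nat list \<Rightarrow> bool" where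
  "list_graph_ok V nb [] = True"
| "list_graph_ok V nb (u # us) = ((two_distinct (nb u) \<and> list_all (\<lambda>v. mem v V \<and> mem u (nb v) \<and> v \<noteq> u \<and> \<not> any_mem (nb u) (nb v)) (nb u))
     \<and> list_graph_ok V nb us)"

lemma list_graph_okD:
  "list_graph_ok V nb us \<Longrightarrow> u \<in> set us \<Longrightarrow> two_distinct (nb u) \<and>
    (\<forall>v\<in>set (nb u). v \<in> set V \<and> u \<in> set (nb v) \<and> v \<noteq> u \<and> set (nb u) \<inter> set (nb v) = {})"
  by (induction us) (auto simp: list_all_iff mem_iff any_mem_iff)

lemma list_graph_simple:
  assumes "list_graph_ok V nb V"
  shows "simple_graph (set V) (list_graph V nb)" "triangle_free (list_graph V nb)"
    "\<forall>v\<in>set V. \<exists>u w. u \<noteq> w \<and> list_graph V nb v u \<and> list_graph V nb v w"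
proof -
  note * = list_graph_okD[OF assms]
  show "simple_graph (set V) (list_graph V nb)"
    unfolding simple_graph_def list_graph_def using * by blast
  show "triangle_free (list_graph V nb)"
    unfolding triangle_free_def list_graph_def using * by blast
  show "\<forall>v\<in>set V. \<exists>u w. u \<noteq> w \<and> list_graph V nb v u \<and> list_graph V nb v w"
  proof
    fix v assume v: "v \<in> set V"
    then have "two_distinct (nb v)" using * by blast
    then obtain a b r where "nb v = a # b # r" "a \<noteq> b"
      by (cases "nb v"; cases "tl (nb v)") (auto simp: two_distinct_def split: if_splits)
    then show "\<exists>u w. u \<noteq> w \<and> list_graph V nb v u \<and> list_graph V nb v w"
      using v unfolding list_graph_def by (intro exI[of _ a] exI[of _ b]) simp
  qed
qed

primrec edge_list_for :: "(nat \<times> nat) list \<Rightarrow> nat \<Rightarrow> nat list \<Rightarrow> bool" where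
  "edge_list_for Es u [] = True"
| "edge_list_for Es u (v # vs) = ((if u < v then (u, v) \<in> set Es else True) \<and> edge_list_for Es u vs)"

lemma edge_list_for_iff: "edge_list_for Es u vs \<longleftrightarrow> (\<forall>v\<in>set vs. u < v \<longrightarrow> (u, v) \<in> set Es)"
  by (induction vs) auto

definition vertex_test :: "(nat \<Rightarrow> int \<times> int \<times> int) \<Rightarrow> nat \<times> nat \<Rightarrow> nat \<Rightarrow> bool" where
  "vertex_test co e w = (if w = fst e then True else if w = snd e then True else orient (co (fst e)) (co (snd e)) (co w) \<noteq> 0)"

text \<open>Applied to all ordered pairs of edges. When \<open>e\<close> is the lower edge of a
  genuine crossing, the pair must occur in the list, with the upper edge \<open>f\<close>
  first.\<close>

definition edge_test :: "(nat \<Rightarrow> int \<times> int \<times> int) \<Rightarrow> ((nat \<times> nat) \<times> (nat \<times> nat)) list \<Rightarrow> nat \<times> nat \<Rightarrow> nat \<times> nat \<Rightarrow> bool" where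
  "edge_test co X e f = (if fst e = fst f then True else if fst e = snd f then True else if snd e = fst f then True
     else if snd e = snd f then True
     else if above_test (co (fst e)) (co (snd e)) (co (fst f)) (co (snd f)) then True else (f, e) \<in> set X)"

text \<open>Requiring increasing ends lets an unordered edge determine its pair, so that comparing
  pairs suffices to exclude contradictory entries.\<close>

definition crossing_test :: "(nat \<Rightarrow> int \<times> int \<times> int) \<Rightarrow> ((nat \<times> nat) \<times> (nat \<times> nat)) list \<Rightarrow> (nat \<times> nat) \<times> (nat \<times> nat) \<Rightarrow> bool" where
  "crossing_test co X z = (above_test (co (fst (fst z))) (co (snd (fst z))) (co (fst (snd z))) (co (snd (snd z)))
     \<and> fst (fst z) < snd (fst z) \<and> fst (snd z) < snd (snd z) \<and> fst z \<noteq> snd z \<and> (snd z, fst z) \<notin> set X)"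

lemma checked_straight_drawing:
  assumes g: "list_graph_ok V nb V" and es: "list_all (\<lambda>u. edge_list_for Es u (nb u)) V"
    and vt: "list_all (\<lambda>e. list_all (vertex_test co e) V) Es"
    and et: "list_all (\<lambda>e. list_all (edge_test co X e) Es) Es"
    and xt: "list_all (crossing_test co X) X"
  shows "straight_drawing (set V) (list_graph V nb) (\<lambda>v. point_of (co v))" (is ?A)
    and "crossings_covered (list_graph V nb) (\<lambda>v. point_of (co v)) X" (is ?B)
proof -
  let ?E = "list_graph V nb" and ?P = "\<lambda>v. point_of (co v)"
  note G = list_graph_simple[OF g]
  have irr: "\<not> ?E u u" and sym: "?E u v \<Longrightarrow> ?E v u" and inV: "?E u v \<Longrightarrow> u \<in> set V \<and> v \<in> set V" for u v
    using G(1) unfolding simple_graph_def by blast+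
  have edge: "(u, v) \<in> set Es" if "?E u v" "u < v" for u v
    using es that unfolding list_all_iff edge_list_for_iff list_graph_def by blast
  have norm: "\<exists>e\<in>set Es. ends e = {u, v} \<and> (e = (u, v) \<or> e = (v, u))" if "?E u v" for u v
  proof (cases "u < v")
    case True
    show ?thesis by (rule bexI[OF _ edge[OF that True]]) (simp add: ends_def)
  next
    case False
    have "u \<noteq> v" using irr[of u] that by auto
    then have "v < u" using False by simp
    show ?thesis by (rule bexI[OF _ edge[OF sym[OF that] \<open>v < u\<close>]]) (auto simp: ends_def)
  qed
  have vtx: "orient (co u) (co v) (co w) \<noteq> 0" if e: "?E u v" and w: "w \<in> set V" "w \<noteq> u" "w \<noteq> v" for u v w
  proof -
    obtain e where e: "e \<in> set Es" "e = (u, v) \<or> e = (v, u)" using norm[OF e] by blast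
    have "vertex_test co e w" using vt e(1) w(1) unfolding list_all_iff by blast
    then have "orient (co u) (co v) (co w) \<noteq> 0 \<or> orient (co v) (co u) (co w) \<noteq> 0"
      using e(2) w(2,3) unfolding vertex_test_def by (elim disjE) simp_all
    moreover have "orient (co v) (co u) (co w) = - orient (co u) (co v) (co w)"
      by (simp add: orient_def algebra_simps)
    ultimately show ?thesis by simp
  qed
  have seg: "seg ?P (fst e) (snd e) = seg ?P u v" if "e = (u, v) \<or> e = (v, u)" for e u v
    using that by (elim disjE) (simp, simp add: seg_commute)
  have ov: "over (seg ?P u v) (seg ?P x y) \<or> (\<exists>e f. ends e = {u, v} \<and> ends f = {x, y} \<and> (f, e) \<in> set X)"
    if uv: "?E u v" and xy: "?E x y" and dis: "{u, v} \<inter> {x, y} = {}" for u v x y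
  proof -
    obtain e where e: "e \<in> set Es" "ends e = {u, v}" "e = (u, v) \<or> e = (v, u)" using norm[OF uv] by blast
    obtain f where f: "f \<in> set Es" "ends f = {x, y}" "f = (x, y) \<or> f = (y, x)" using norm[OF xy] by blast
    have "edge_test co X e f" using et e(1) f(1) unfolding list_all_iff by blast
    moreover have "fst e \<noteq> fst f" "fst e \<noteq> snd f" "snd e \<noteq> fst f" "snd e \<noteq> snd f" using e(3) f(3) dis by auto
    ultimately have "above_test (co (fst e)) (co (snd e)) (co (fst f)) (co (snd f)) \<or> (f, e) \<in> set X"
      unfolding edge_test_def by (simp split: if_splits)
    then show ?thesis
    proof
      assume "above_test (co (fst e)) (co (snd e)) (co (fst f)) (co (snd f))"
      from above_test_over[OF this] have "over (seg ?P (fst e) (snd e)) (seg ?P (fst f) (snd f))" by (simp add: seg_def)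
      then show ?thesis unfolding seg[OF e(3)] seg[OF f(3)] by blast
    next
      assume "(f, e) \<in> set X" then show ?thesis using e f by blast
    qed
  qed
  have xprop: "above_test (co (fst (fst z))) (co (snd (fst z))) (co (fst (snd z))) (co (snd (snd z)))"
    "fst (fst z) < snd (fst z)" "fst (snd z) < snd (snd z)" "fst z \<noteq> snd z" "(snd z, fst z) \<notin> set X" if "z \<in> set X" for z
    using xt that unfolding list_all_iff crossing_test_def by blast+
  have ends_eq: "e = f" if "ends e = ends f" "fst e < snd e" "fst f < snd f" for e f
    using that by (cases e; cases f) (auto simp: ends_def doubleton_eq_iff)
  show ?A
    unfolding straight_drawing_def
  proof (intro conjI allI impI)
    fix u v w assume "?E u v" "w \<in> set V" "w \<noteq> u" "w \<noteq> v"
    then show "fst (?P w) \<notin> fst ` seg ?P u v"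
      unfolding seg_def by (intro orient_not_on_segment vtx)
  next
    fix u v w assume a: "?E v u" "?E v w" "u \<noteq> w"
    have "w \<noteq> v" using irr a by blast
    then show "spread (fst (?P u - ?P v)) (fst (?P w - ?P v))"
      using a inV[OF a(2)] by (intro orient_spread vtx) auto
  next
    fix u v x y assume a: "?E u v" "?E x y" "{u, v} \<inter> {x, y} = {}"
    from ov[OF this] show "over (seg ?P u v) (seg ?P x y) \<or> over (seg ?P x y) (seg ?P u v)"
    proof
      assume "\<exists>e f. ends e = {u, v} \<and> ends f = {x, y} \<and> (f, e) \<in> set X"
      then obtain e f where z: "ends e = {u, v}" "ends f = {x, y}" "(f, e) \<in> set X" by blast
      have "e = (u, v) \<or> e = (v, u)" "f = (x, y) \<or> f = (y, x)"
        using z(1,2) by (cases e; cases f; auto simp: ends_def doubleton_eq_iff)+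
      moreover have "over (seg ?P (fst f) (snd f)) (seg ?P (fst e) (snd e))"
        using above_test_over[OF xprop(1)[OF z(3)]] by (simp add: seg_def)
      ultimately show ?thesis using seg by metis
    qed blast
  qed (use G in auto)
  show ?B
    unfolding crossings_covered_def
  proof (intro conjI allI impI ballI)
    fix u v x y assume a: "?E u v" "?E x y" "{u, v} \<inter> {x, y} = {}" and no: "\<not> over (seg ?P x y) (seg ?P u v)"
    have "{x, y} \<inter> {u, v} = {}" using a(3) by blast
    from ov[OF a(2,1) this] no obtain e f where "ends e = {x, y}" "ends f = {u, v}" "(f, e) \<in> set X" by blast
    then show "\<exists>z\<in>set X. ends (fst z) = {u, v} \<and> ends (snd z) = {x, y}" by (intro bexI[of _ "(f, e)"]) auto
  next
    fix z z' assume z: "z \<in> set X" "z' \<in> set X"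
    show "ends (fst z) \<noteq> ends (snd z)" using ends_eq[OF _ xprop(2,3)[OF z(1)]] xprop(4)[OF z(1)] by blast
    show "\<not> (ends (fst z) = ends (snd z') \<and> ends (snd z) = ends (fst z'))"
    proof
      assume "ends (fst z) = ends (snd z') \<and> ends (snd z) = ends (fst z')"
      then have "fst z = snd z'" "snd z = fst z'"
        using ends_eq[OF _ xprop(2)[OF z(1)] xprop(3)[OF z(2)]] ends_eq[OF _ xprop(3)[OF z(1)] xprop(2)[OF z(2)]] by blast+
      then have "(snd z', fst z') = z" by (simp add: prod_eq_iff)
      then show False using xprop(5)[OF z(2)] z(1) by simp
    qed
  qed
qed

section \<open>Checking 4-connectivity\<close>

primrec sweep :: "(nat \<Rightarrow> nat list) \<Rightarrow> (nat list \<Rightarrow> nat list \<Rightarrow> bool) \<Rightarrow> nat list \<Rightarrow> nat list \<Rightarrow> nat list \<Rightarrow> bool" where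
  "sweep nb f [] acc rest = f acc rest"
| "sweep nb f (v # vs) acc rest = (if any_mem (nb v) acc then sweep nb f vs (v # acc) rest else sweep nb f vs acc (v # rest))"

text \<open>Grows the component of \<open>acc\<close> by repeated sweeps through the vertices not
  yet reached. The list of rounds may run out only when nothing is left, so a positive answer is
  reliable in any case.\<close>

primrec absorbs :: "(nat \<Rightarrow> nat list) \<Rightarrow> nat list \<Rightarrow> nat list \<Rightarrow> nat list \<Rightarrow> bool" where
  "absorbs nb [] acc rest = (rest = [])"
| "absorbs nb (x # xs) acc rest = (if rest = [] then True else sweep nb (absorbs nb xs) rest acc [])"

lemma sweep_sound:
  assumes "sweep nb f vs acc rest"
    and step: "\<And>acc rest. f acc rest \<Longrightarrow> \<forall>v\<in>set acc. R v \<Longrightarrow> \<forall>v\<in>set rest. Q v \<Longrightarrow> \<forall>v\<in>set rest. R v"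
    and grow: "\<And>v w. Q v \<Longrightarrow> w \<in> set (nb v) \<Longrightarrow> R w \<Longrightarrow> R v"
    and "\<forall>v\<in>set acc. R v" "\<forall>v\<in>set vs \<union> set rest. Q v"
  shows "\<forall>v\<in>set vs \<union> set rest. R v"
  using assms(1,4,5)
proof (induction vs arbitrary: acc rest)
  case Nil
  then show ?case using step by simp
next
  case (Cons v vs)
  show ?case
  proof (cases "any_mem (nb v) acc")
    case True
    then obtain w where "w \<in> set (nb v)" "w \<in> set acc" unfolding any_mem_iff by blast
    then have "R v" using grow[of v w] Cons.prems by simp
    then show ?thesis using Cons.IH[of "v # acc" rest] Cons.prems True by simp
  next
    case False
    then show ?thesis using Cons.IH[of acc "v # rest"] Cons.prems by simp
  qed
qed

lemma absorbs_sound: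
  assumes grow: "\<And>v w. Q v \<Longrightarrow> w \<in> set (nb v) \<Longrightarrow> R w \<Longrightarrow> R v"
  shows "absorbs nb xs acc rest \<Longrightarrow> \<forall>v\<in>set acc. R v \<Longrightarrow> \<forall>v\<in>set rest. Q v \<Longrightarrow> \<forall>v\<in>set rest. R v"
proof (induction xs arbitrary: acc rest)
  case (Cons x xs)
  show ?case
  proof (cases "rest = []")
    case False
    then have "sweep nb (absorbs nb xs) rest acc []" using Cons.prems(1) by simp
    then have "\<forall>v\<in>set rest \<union> set []. R v"
    proof (rule sweep_sound[where Q = Q])
      show "\<forall>v\<in>set acc'. R v \<Longrightarrow> \<forall>v\<in>set rest'. Q v \<Longrightarrow> \<forall>v\<in>set rest'. R v" if "absorbs nb xs acc' rest'" for acc' rest'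
        by (rule Cons.IH[OF that])
      show "R v" if "Q v" "w \<in> set (nb v)" "R w" for v w by (rule grow[OF that])
    qed (use Cons.prems in simp_all)
    then show ?thesis by simp
  qed simp
qed simp

definition survives :: "(nat \<Rightarrow> nat list) \<Rightarrow> nat list \<Rightarrow> nat \<Rightarrow> nat \<Rightarrow> nat \<Rightarrow> bool" where
  "survives nb V i j k = (if i < j then if j < k then absorbs nb V [hd (remove_all [i, j, k] V)] (remove_all [i, j, k] V) else True else True)"

text \<open>With at least five vertices, a smaller cut can be enlarged to exactly three vertices
  without touching the two that are to be joined. A path avoiding the larger set avoids the smaller
  one.\<close>

lemma k_connected_4I:
  assumes G: "simple_graph V E" and card: "5 \<le> card V"
    and 3: "\<And>X. X \<subseteq> V \<Longrightarrow> card X = 3 \<Longrightarrow> graph_connected (V - X) E"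
  shows "k_connected V E 4"
  unfolding k_connected_def
proof (intro conjI allI impI)
  show "4 < card V" using card by simp
  fix X assume X: "X \<subseteq> V \<and> card X < 4"
  have fin: "finite V" using G by (simp add: simple_graph_def)
  show "graph_connected (V - X) E"
    unfolding graph_connected_def
  proof (intro ballI)
    fix u v assume uv: "u \<in> V - X" "v \<in> V - X"
    have fX: "finite X" using X fin finite_subset by blast
    have "5 \<le> card (V - {u, v}) + 2"
      using card card_Diff_subset[of "{u, v}" V] uv fin by (cases "u = v") (auto simp: card_Diff_subset)
    then have c3: "3 \<le> card (V - {u, v})" by simp
    have sub: "X \<subseteq> V - {u, v}" using X uv by blast
    have "card X \<le> 3" using X by simp
    from exists_subset_between[OF this c3 sub] fin
    obtain Y where Y: "X \<subseteq> Y" "Y \<subseteq> V - {u, v}" "card Y = 3" by auto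
    have "graph_connected (V - Y) E" using 3[of Y] Y by blast
    then have "(\<lambda>x y. E x y \<and> x \<in> V - Y \<and> y \<in> V - Y)\<^sup>*\<^sup>* u v"
      using uv Y unfolding graph_connected_def by blast
    then show "(\<lambda>x y. E x y \<and> x \<in> V - X \<and> y \<in> V - X)\<^sup>*\<^sup>* u v"
      by (rule rtranclp_mono[THEN predicate2D, rotated]) (use Y(1) in auto)
  qed
qed

lemma graph_connectedI:
  assumes G: "simple_graph V E" and r: "\<And>v. v \<in> S \<Longrightarrow> (\<lambda>x y. E x y \<and> x \<in> S \<and> y \<in> S)\<^sup>*\<^sup>* r v"
  shows "graph_connected S E"
  unfolding graph_connected_def
proof (intro ballI)
  let ?R = "\<lambda>x y. E x y \<and> x \<in> S \<and> y \<in> S"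
  fix u v assume uv: "u \<in> S" "v \<in> S"
  have "symp ?R" using G unfolding simple_graph_def symp_def by blast
  then have "symp ?R\<^sup>*\<^sup>*" by (rule symp_rtranclp)
  then have "?R\<^sup>*\<^sup>* u r" using r[OF uv(1)] by (meson sympD)
  then show "?R\<^sup>*\<^sup>* u v" using r[OF uv(2)] by simp
qed

lemma survives_connected:
  assumes G: "simple_graph (set V) (list_graph V nb)" and ch: "survives nb V i j k" and ijk: "i < j" "j < k"
  shows "graph_connected (set V - {i, j, k}) (list_graph V nb)"
proof -
  let ?S = "set V - {i, j, k}"
  let ?R = "\<lambda>x y. list_graph V nb x y \<and> x \<in> ?S \<and> y \<in> ?S"
  define W where "W = remove_all [i, j, k] V"
  have W: "set W = ?S" by (simp add: W_def set_remove_all)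
  have ab: "absorbs nb V [hd W] W" using ch ijk by (simp add: survives_def W_def)
  show ?thesis
  proof (rule graph_connectedI[OF G, of _ "hd W"])
    fix v assume v: "v \<in> ?S"
    have ne: "W \<noteq> []" using v unfolding W[symmetric] by (cases W) simp_all
    have h: "hd W \<in> ?S" using hd_in_set[OF ne] unfolding W .
    have grow: "?R\<^sup>*\<^sup>* (hd W) x" if x: "x \<in> ?S" and y: "y \<in> set (nb x)" and r: "y \<in> ?S \<and> ?R\<^sup>*\<^sup>* (hd W) y" for x y
    proof -
      have "list_graph V nb x y" using x y by (simp add: list_graph_def)
      then have yx: "list_graph V nb y x" using G unfolding simple_graph_def by blast
      have Ryx: "?R y x" by (rule conjI[OF yx conjI[OF conjunct1[OF r] x]])
      have "?R\<^sup>*\<^sup>* (hd W) y" using r by (rule conjunct2)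
      then show ?thesis using Ryx by (rule rtranclp.rtrancl_into_rtrancl)
    qed
    have "\<forall>v\<in>set W. v \<in> ?S \<and> ?R\<^sup>*\<^sup>* (hd W) v"
    proof (rule absorbs_sound[where Q = "\<lambda>x. x \<in> ?S" and nb = nb, OF _ ab])
      show "x \<in> ?S \<and> ?R\<^sup>*\<^sup>* (hd W) x" if "x \<in> ?S" "y \<in> set (nb x)" "y \<in> ?S \<and> ?R\<^sup>*\<^sup>* (hd W) y" for x y
        by (rule conjI[OF that(1) grow[OF that]])
      show "\<forall>v\<in>set [hd W]. v \<in> ?S \<and> ?R\<^sup>*\<^sup>* (hd W) v" using h by simp
      show "\<forall>v\<in>set W. v \<in> ?S" unfolding W by (rule ballI)
    qed
    from bspec[OF this v[folded W]] show "?R\<^sup>*\<^sup>* (hd W) v" by (rule conjunct2)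
  qed
qed

lemma checked_4_connected:
  assumes G: "simple_graph (set V) (list_graph V nb)" and len: "distinct V" "5 \<le> length V"
    and ch: "list_all (\<lambda>i. list_all (\<lambda>j. list_all (survives nb V i j) V) V) V"
  shows "k_connected (set V) (list_graph V nb) 4"
proof (rule k_connected_4I[OF G])
  show "5 \<le> card (set V)" using len by (simp add: distinct_card)
  fix X assume X: "X \<subseteq> set V" "card X = 3"
  have sorted: "graph_connected (set V - {i, j, k}) (list_graph V nb)"
    if ijk: "i \<in> set V" "j \<in> set V" "k \<in> set V" "i < j" "j < k" for i j k
  proof (rule survives_connected[OF G _ ijk(4,5)])
    show "survives nb V i j k" using ch ijk(1-3) unfolding list_all_iff by blast
  qed
  obtain x y z where xyz: "X = {x, y, z}" "x \<noteq> y" "y \<noteq> z" "x \<noteq> z" using X(2) by (auto simp: card_3_iff)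
  have xs: "x \<in> set V" "y \<in> set V" "z \<in> set V" using X(1) xyz by auto
  have perm: "X = {x, z, y}" "X = {y, x, z}" "X = {y, z, x}" "X = {z, x, y}" "X = {z, y, x}" using xyz by auto
  consider "x < y" "y < z" | "x < z" "z < y" | "y < x" "x < z" | "y < z" "z < x" | "z < x" "x < y" | "z < y" "y < x"
    using xyz by linarith
  then show "graph_connected (set V - X) (list_graph V nb)"
  proof cases
    case 1 from sorted[OF xs(1,2,3) 1] show ?thesis unfolding xyz(1) .
  next
    case 2 from sorted[OF xs(1,3,2) 2] show ?thesis unfolding perm(1) .
  next
    case 3 from sorted[OF xs(2,1,3) 3] show ?thesis unfolding perm(2) .
  next
    case 4 from sorted[OF xs(2,3,1) 4] show ?thesis unfolding perm(3) .
  next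
    case 5 from sorted[OF xs(3,1,2) 5] show ?thesis unfolding perm(4) .
  next
    case 6 from sorted[OF xs(3,2,1) 6] show ?thesis unfolding perm(5) .
  qed
qed

section \<open>Apex graphs over vertex-face graphs of plane maps\<close>

text \<open>Minimum degree 4 in a convenient form: there is a further vertex outside
  \<open>W\<close>, and a path to it from \<open>v\<close> has a first step.\<close>

lemma nbr_outside:
  assumes G: "simple_graph V E" and k: "k_connected V E 4" and v: "v \<in> V" and W: "finite W" "card W < 4" "v \<notin> W"
  shows "\<exists>y\<in>V. y \<notin> W \<and> E v y"
proof -
  have fV: "finite V" and cV: "4 < card V" using G k by (auto simp: simple_graph_def k_connected_def)
  have "card (W \<inter> V) \<le> card W" by (rule card_mono[OF W(1)]) simp
  then have "card (W \<inter> V) < 4" using W(2) by simp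
  moreover have "W \<inter> V \<subseteq> V" by simp
  ultimately have con: "graph_connected (V - W \<inter> V) E" using k unfolding k_connected_def by blast
  have "card (insert v W) \<le> 4" using card_insert_le_m1[of 4 W v] W by simp
  then have "\<not> V \<subseteq> insert v W" using card_mono[of "insert v W" V] W(1) cV by auto
  then obtain x where x: "x \<in> V" "x \<notin> W" "x \<noteq> v" by blast
  have "(\<lambda>x y. E x y \<and> x \<in> V - W \<inter> V \<and> y \<in> V - W \<inter> V)\<^sup>*\<^sup>* v x"
    using con v W(3) x unfolding graph_connected_def by simp
  then obtain y where "E v y" "y \<in> V - W \<inter> V"
    using x(3) by (cases rule: converse_rtranclpE) auto
  then show ?thesis by blast
qed

text \<open>In the map whose vertex-face graph is refined, the column insertion subdivides an edge at \<open>r\<close> and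
  joins \<open>r\<close> to the third vertices \<open>h\<close>, \<open>h'\<close> of the two triangles \<open>p\<close>, \<open>q\<close> at that edge; \<open>t\<close> and \<open>b\<close> are the two new faces.\<close>

definition insert_column ::
  "nat \<Rightarrow> nat \<Rightarrow> nat \<Rightarrow> nat \<Rightarrow> (nat \<Rightarrow> nat \<Rightarrow> bool) \<Rightarrow> nat \<Rightarrow> nat \<Rightarrow> nat \<Rightarrow> nat \<Rightarrow> nat \<Rightarrow> nat \<Rightarrow> nat \<Rightarrow> bool" where
  "insert_column a h h' z E p q r t b u v \<longleftrightarrow>
     (E u v \<and> {u, v} \<noteq> {p, z} \<and> {u, v} \<noteq> {q, z}) \<or>
     {u, v} \<in> {{r, p}, {r, q}, {r, t}, {r, b}, {t, h}, {t, z}, {t, a}, {b, h'}, {b, z}, {b, a}}"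

context
  fixes V :: "nat set" and E :: "nat \<Rightarrow> nat \<Rightarrow> bool" and a h h' z p q r t b :: nat
  assumes G: "simple_graph V E" and tf: "triangle_free E" and con: "k_connected V E 4"
    and pE: "E p h" "E p z" "E p a" and qE: "E q h'" "E q z" "E q a"
    and dist: "distinct [a, h, h', z, p, q]" and new: "r \<notin> V" "t \<notin> V" "b \<notin> V" "distinct [r, t, b]"
begin

private abbreviation "E' \<equiv> insert_column a h h' z E p q r t b"
private abbreviation "V' \<equiv> V \<union> {r, t, b}"

private lemma old: "a \<in> V" "h \<in> V" "h' \<in> V" "z \<in> V" "p \<in> V" "q \<in> V"
  using G pE qE unfolding simple_graph_def by blast+

private lemma Esym: "E u v \<Longrightarrow> E v u" using G unfolding simple_graph_def by blast
private lemma EV: "E u v \<Longrightarrow> u \<in> V \<and> v \<in> V" using G unfolding simple_graph_def by blast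
private lemma Eirr: "\<not> E u u" using G unfolding simple_graph_def by blast
private lemma E3: "E u v \<Longrightarrow> E v w \<Longrightarrow> \<not> E w u" using tf unfolding triangle_free_def by blast

private lemma neqs: "r \<noteq> a" "r \<noteq> h" "r \<noteq> h'" "r \<noteq> z" "r \<noteq> p" "r \<noteq> q" "t \<noteq> a" "t \<noteq> h" "t \<noteq> h'" "t \<noteq> z" "t \<noteq> p" "t \<noteq> q"
  "b \<noteq> a" "b \<noteq> h" "b \<noteq> h'" "b \<noteq> z" "b \<noteq> p" "b \<noteq> q" "r \<noteq> t" "r \<noteq> b" "t \<noteq> b"
  using old new by auto

private lemma sym': "E' u v \<Longrightarrow> E' v u"
proof -
  have e: "{v, u} = {u, v}" by (rule insert_commute)
  have "E v u = E u v" by (blast intro: Esym)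
  then have "E' v u = E' u v" unfolding insert_column_def e by (simp only:)
  then show "E' u v \<Longrightarrow> E' v u" by (simp only:)
qed

lemma insert_column_simple: "simple_graph V' E'"
  unfolding simple_graph_def
proof (intro conjI allI impI)
  show "finite V'" using G by (simp add: simple_graph_def)
  show "u \<in> V'" "v \<in> V'" if "E' u v" for u v
    using that EV old unfolding insert_column_def by (auto simp: doubleton_eq_iff)
  show "E' v u" if "E' u v" for u v by (rule sym'[OF that])
  show "\<not> E' u u" for u unfolding insert_column_def using Eirr neqs by (auto simp: doubleton_eq_iff)
qed

private lemma nbr_r: "E' r y \<Longrightarrow> y \<in> {p, q, t, b}"
  unfolding insert_column_def using EV new neqs by (auto simp: doubleton_eq_iff)
private lemma nbr_t: "E' t y \<Longrightarrow> y \<in> {r, h, z, a}"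
  unfolding insert_column_def using EV new neqs by (auto simp: doubleton_eq_iff)
private lemma nbr_b: "E' b y \<Longrightarrow> y \<in> {r, h', z, a}"
  unfolding insert_column_def using EV new neqs by (auto simp: doubleton_eq_iff)
private lemma nbr_old: "E' x y \<Longrightarrow> x \<in> V \<Longrightarrow> y \<in> V \<Longrightarrow> E x y"
  unfolding insert_column_def using new by (auto simp: doubleton_eq_iff)

text \<open>The old neighbours of a new vertex have a common old neighbour: \<open>z\<close> in the
  case of \<open>r\<close>, \<open>p\<close> in that of \<open>t\<close>, \<open>q\<close> in that
  of \<open>b\<close>. An edge between two of them would close a triangle of the old graph.\<close>

lemma insert_column_triangle_free: "triangle_free E'"
proof -
  have R: False if "E' r y" "E' y w" "E' w r" for y w
  proof -
    have y: "y \<in> {p, q, t, b}" by (rule nbr_r[OF that(1)])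
    have w: "w \<in> {p, q, t, b}" by (rule nbr_r[OF sym'[OF that(3)]])
    have "y \<noteq> t" using nbr_t[of w] that(2) w neqs dist by auto
    moreover have "y \<noteq> b" using nbr_b[of w] that(2) w neqs dist by auto
    moreover have "w \<noteq> t" using nbr_t[OF sym'[of y t]] that(2) y neqs dist by auto
    moreover have "w \<noteq> b" using nbr_b[OF sym'[of y b]] that(2) y neqs dist by auto
    ultimately have "y \<in> {p, q}" "w \<in> {p, q}" using y w by auto
    then have "E y w" "E y z" "E w z" using nbr_old[OF that(2)] old pE qE by auto
    then show False using E3[of y w z] Esym by blast
  qed
  have T: False if "E' t y" "E' y w" "E' w t" for y w
  proof -
    have y: "y \<in> {r, h, z, a}" by (rule nbr_t[OF that(1)])
    have w: "w \<in> {r, h, z, a}" by (rule nbr_t[OF sym'[OF that(3)]])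
    have "y \<noteq> r" using R[of w t] that sym' by blast
    moreover have "w \<noteq> r" using R[of t y] that sym' by blast
    ultimately have "y \<in> {h, z, a}" "w \<in> {h, z, a}" using y w by auto
    then have "E y w" "E p y" "E p w" using nbr_old[OF that(2)] old pE by auto
    then show False using E3[of y w p] Esym by blast
  qed
  have B: False if "E' b y" "E' y w" "E' w b" for y w
  proof -
    have y: "y \<in> {r, h', z, a}" by (rule nbr_b[OF that(1)])
    have w: "w \<in> {r, h', z, a}" by (rule nbr_b[OF sym'[OF that(3)]])
    have "y \<noteq> r" using R[of w b] that sym' by blast
    moreover have "w \<noteq> r" using R[of b y] that sym' by blast
    ultimately have "y \<in> {h', z, a}" "w \<in> {h', z, a}" using y w by auto
    then have "E y w" "E q y" "E q w" using nbr_old[OF that(2)] old qE by auto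
    then show False using E3[of y w q] Esym by blast
  qed
  have N: "x \<in> V" if c: "E' x y" "E' y w" "E' w x" for x y w
  proof -
    have "x \<in> V'" using insert_column_simple c(1) unfolding simple_graph_def by blast
    moreover have "x \<noteq> r" using R[of y w] c by blast
    moreover have "x \<noteq> t" using T[of y w] c by blast
    moreover have "x \<noteq> b" using B[of y w] c by blast
    ultimately show ?thesis by blast
  qed
  show ?thesis
    unfolding triangle_free_def
  proof clarify
    fix x y w assume c: "E' x y" "E' y w" "E' w x"
    have "x \<in> V" "y \<in> V" "w \<in> V" by (rule N[OF c], rule N[OF c(2,3,1)], rule N[OF c(3,1,2)])
    then have "E x y" "E y w" "E w x" by (auto intro: nbr_old c)
    then show False using E3 by blast
  qed
qed

private lemma new_edges: "E' p r" "E' q r" "E' t r" "E' b r" "E' h t" "E' z t" "E' a t" "E' h' b" "E' z b" "E' a b"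
  unfolding insert_column_def by (simp_all add: insert_commute)

private lemma kept: "E u v \<Longrightarrow> u \<noteq> z \<Longrightarrow> v \<noteq> z \<Longrightarrow> E' u v"
  unfolding insert_column_def by (auto simp: doubleton_eq_iff)

text \<open>The insertion deletes only the edges from \<open>z\<close> to \<open>p\<close> and
  \<open>q\<close>. If \<open>X\<close> avoids \<open>z\<close> and the new vertices, the path
  through \<open>t\<close> and \<open>r\<close> replaces them. Otherwise \<open>z\<close> can be
  added to the old part of the cut, after which the old graph stays connected without the deleted
  edges, and at most four vertices remain to be attached.\<close>

lemma insert_column_4_connected: "k_connected V' E' 4"
  unfolding k_connected_def
proof (intro conjI allI impI)
  have fV: "finite V" and cV: "4 < card V" using G con by (auto simp: simple_graph_def k_connected_def)
  have "card V \<le> card V'" by (rule card_mono) (use fV in auto)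
  then show "4 < card V'" using cV by simp
  fix X assume X: "X \<subseteq> V' \<and> card X < 4"
  have fX: "finite X" using X fV finite_subset[of X V'] by simp
  let ?S = "V' - X"
  let ?R = "\<lambda>x y. E' x y \<and> x \<in> ?S \<and> y \<in> ?S"
  show "graph_connected ?S E'"
  proof (cases "X \<inter> {z, r, t, b} = {}")
    case True
    then have XV: "X \<subseteq> V" and ns: "z \<in> ?S" "r \<in> ?S" "t \<in> ?S" "b \<in> ?S" using X old by auto
    have cX: "graph_connected (V - X) E" using con X XV unfolding k_connected_def by blast
    show ?thesis
    proof (rule graph_connectedI[OF insert_column_simple, of _ z])
      have zt: "?R z t" and tr: "?R t r" and zb: "?R z b" using new_edges ns by blast+
      have zr: "?R\<^sup>*\<^sup>* z r" by (rule rtranclp.rtrancl_into_rtrancl[OF r_into_rtranclp[of ?R, OF zt] tr])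
      fix v assume v: "v \<in> ?S"
      show "?R\<^sup>*\<^sup>* z v"
      proof (cases "v \<in> V")
        case True
        have "(\<lambda>x y. E x y \<and> x \<in> V - X \<and> y \<in> V - X)\<^sup>*\<^sup>* z v"
          using cX True v ns old unfolding graph_connected_def by blast
        then show ?thesis
        proof (induction rule: rtranclp_induct)
          case (step y w)
          show ?case
          proof (cases "E' y w")
            case True
            have "?R y w" using True step.hyps(2) by blast
            then show ?thesis using step.IH by (rule rtranclp.rtrancl_into_rtrancl[rotated])
          next
            case False
            moreover have "E y w" using step.hyps(2) by (rule conjunct1)
            \<comment> \<open>A deleted edge leads to \<open>p\<close>, \<open>q\<close> or
              \<open>z\<close>, and each of these is reached from \<open>z\<close> directly or
              through \<open>t\<close> and \<open>r\<close>.\<close>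
            ultimately have "{y, w} = {p, z} \<or> {y, w} = {q, z}" unfolding insert_column_def by argo
            moreover have "w \<in> {y, w}" by simp
            ultimately have "w \<in> {p, z} \<or> w \<in> {q, z}" by (elim disjE) (simp_all only: simp_thms)
            then have "w = z \<or> (w = p \<or> w = q)" unfolding insert_iff empty_iff by argo
            then show ?thesis
            proof
              assume wz: "w = z"
              show ?thesis unfolding wz by (rule rtranclp.rtrancl_refl)
            next
              assume "w = p \<or> w = q"
              then have "E' r w" using sym'[OF new_edges(1)] sym'[OF new_edges(2)] by (elim disjE) simp_all
              moreover have "r \<in> ?S" "w \<in> ?S" using ns step.hyps(2) by blast+
              ultimately have rw: "?R r w" by (intro conjI)
              show ?thesis by (rule rtranclp.rtrancl_into_rtrancl[OF zr rw])
            qed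
          qed
        qed simp
      next
        case False
        then have "v = r \<or> v = t \<or> v = b" using v by blast
        then show ?thesis using zr r_into_rtranclp[of ?R, OF zt] r_into_rtranclp[of ?R, OF zb] by blast
      qed
    qed
  next
    case False
    \<comment> \<open>The set has fewer than four elements: either \<open>z\<close> is in
      \<open>X\<close> already, or \<open>X\<close> spends an element outside
      \<open>V\<close>.\<close>
    define Y where "Y = insert z (X \<inter> V)"
    have YV: "Y \<subseteq> V" using old by (auto simp: Y_def)
    have fX': "finite (X \<inter> V)" using fX by simp
    have cY: "card Y < 4"
    proof (cases "z \<in> X")
      case True
      then have "Y \<subseteq> X" using old by (auto simp: Y_def)
      then show ?thesis using card_mono[OF fX] X by (meson order.strict_trans1)
    next
      case z: False
      then obtain s where s: "s \<in> X" "s \<notin> V" using False new by blast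
      have "X \<inter> V \<subset> X" using s by blast
      then have "card (X \<inter> V) < card X" by (rule psubset_card_mono[OF fX])
      then show ?thesis using X fX' card_insert_le_m1[of 3 "X \<inter> V" z] by (simp add: Y_def card_insert_if)
    qed
    have cC: "graph_connected (V - Y) E" using con cY YV unfolding k_connected_def by blast
    have "\<not> V \<subseteq> Y" using card_mono[of Y V] fX' cY cV unfolding Y_def by fastforce
    then obtain c where c: "c \<in> V - Y" by blast
    have core: "?R\<^sup>*\<^sup>* c v" if v: "v \<in> V - Y" for v
    proof (rule rtranclp_mono[THEN predicate2D])
      show "(\<lambda>x y. E x y \<and> x \<in> V - Y \<and> y \<in> V - Y)\<^sup>*\<^sup>* c v"
        using cC c v unfolding graph_connected_def by blast
      show "(\<lambda>x y. E x y \<and> x \<in> V - Y \<and> y \<in> V - Y) \<le> ?R"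
        using kept by (auto simp: Y_def)
    qed
    define D where "D = {x. x \<in> ?S \<and> ?R\<^sup>*\<^sup>* c x}"
    have DX: "x \<in> D \<Longrightarrow> x \<notin> X" for x by (simp add: D_def)
    have grow: "y \<in> D" if "x \<in> D" "E' x y" "y \<notin> X" for x y
    proof -
      have y: "y \<in> ?S" using insert_column_simple that unfolding simple_graph_def by blast
      have "?R x y" using that y by (simp add: D_def)
      moreover have "?R\<^sup>*\<^sup>* c x" using that(1) by (simp add: D_def)
      ultimately have "?R\<^sup>*\<^sup>* c y" by (rule rtranclp.rtrancl_into_rtrancl[rotated])
      then show ?thesis using y by (simp add: D_def)
    qed
    have inD: "v \<in> D" if "v \<in> V" "v \<noteq> z" "v \<notin> X" for v
      using core[of v] that by (simp add: D_def Y_def)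
    have 4: False if "distinct [u, v, w, x]" "u \<in> X" "v \<in> X" "w \<in> X" "x \<in> X" for u v w x
    proof -
      have "card {u, v, w, x} \<le> card X" by (rule card_mono[OF fX]) (use that in blast)
      then show False using that(1) X by simp
    qed
    have hD: "h \<notin> X \<Longrightarrow> h \<in> D" and h'D: "h' \<notin> X \<Longrightarrow> h' \<in> D" and aD: "a \<notin> X \<Longrightarrow> a \<in> D"
      and pD: "p \<notin> X \<Longrightarrow> p \<in> D" and qD: "q \<notin> X \<Longrightarrow> q \<in> D"
      using inD old dist by auto
    have tr: "t \<in> D \<Longrightarrow> r \<notin> X \<Longrightarrow> r \<in> D" and rt: "r \<in> D \<Longrightarrow> t \<notin> X \<Longrightarrow> t \<in> D"
      and br: "b \<in> D \<Longrightarrow> r \<notin> X \<Longrightarrow> r \<in> D" and rb: "r \<in> D \<Longrightarrow> b \<notin> X \<Longrightarrow> b \<in> D"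
      and tz: "t \<in> D \<Longrightarrow> z \<notin> X \<Longrightarrow> z \<in> D" and zt: "z \<in> D \<Longrightarrow> t \<notin> X \<Longrightarrow> t \<in> D"
      and bz: "b \<in> D \<Longrightarrow> z \<notin> X \<Longrightarrow> z \<in> D" and zb: "z \<in> D \<Longrightarrow> b \<notin> X \<Longrightarrow> b \<in> D"
      by (rule grow, assumption, intro new_edges sym', assumption)+
    have t1: "h \<in> X \<and> a \<in> X" if "t \<notin> X" "t \<notin> D"
      using grow[OF hD new_edges(5)] grow[OF aD new_edges(7)] that by blast
    have b1: "h' \<in> X \<and> a \<in> X" if "b \<notin> X" "b \<notin> D"
      using grow[OF h'D new_edges(8)] grow[OF aD new_edges(10)] that by blast
    have r1: "p \<in> X \<and> q \<in> X" if "r \<notin> X" "r \<notin> D"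
      using grow[OF pD new_edges(1)] grow[OF qD new_edges(2)] that by blast
    have dd: "distinct [a, h, h', z, p, q, r, t, b]" using dist neqs new by auto
    obtain s where s: "s \<in> X" "s \<in> {z, r, t, b}" using False by blast
    \<comment> \<open>If \<open>r\<close> were cut off, \<open>p\<close> and \<open>q\<close> would
      be deleted. Together with \<open>s\<close> this exhausts the three vertices, so
      \<open>h\<close> and \<open>h'\<close> remain, and they would connect \<open>r\<close> through
      \<open>t\<close> or \<open>b\<close> unless both of these were deleted too.\<close>
    have rD: "r \<in> D" if rX: "r \<notin> X"
    proof (rule ccontr)
      assume rn: "r \<notin> D"
      have pq: "p \<in> X" "q \<in> X" using r1 rX rn by blast+
      have hX: "h \<notin> X" using 4[of p q s h] pq s dd by auto
      have h'X: "h' \<notin> X" using 4[of p q s h'] pq s dd by auto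
      have "t \<in> X" using t1 tr rX rn hX by blast
      moreover have "b \<in> X" using b1 br rX rn h'X by blast
      ultimately show False using 4[of p q t b] pq dd by auto
    qed
    have tD: "t \<in> D" if tX: "t \<notin> X"
    proof (rule ccontr)
      assume tn: "t \<notin> D"
      have ha: "h \<in> X" "a \<in> X" using t1 tX tn by blast+
      have h'X: "h' \<notin> X" using 4[of h a s h'] ha s dd by auto
      have "r \<in> X" using rD rt tX tn by blast
      moreover have "b \<in> X \<or> z \<in> X" using b1 bz zt tX tn h'X by blast
      ultimately show False using 4[of h a r b] 4[of h a r z] ha dd by auto
    qed
    have bD: "b \<in> D" if bX: "b \<notin> X"
    proof (rule ccontr)
      assume bn: "b \<notin> D"
      have ha: "h' \<in> X" "a \<in> X" using b1 bX bn by blast+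
      have hX: "h \<notin> X" using 4[of h' a s h] ha s dd by auto
      have "r \<in> X" using rD rb bX bn by blast
      moreover have "t \<in> X \<or> z \<in> X" using t1 tz zb bX bn hX by blast
      ultimately show False using 4[of h' a r t] 4[of h' a r z] ha dd by auto
    qed
    \<comment> \<open>If \<open>z\<close> were cut off, \<open>t\<close> and \<open>b\<close> would
      be deleted, leaving at most one deleted old vertex \<open>d\<close>. Having degree at least 4,
      \<open>z\<close> keeps an edge to a vertex other than \<open>p\<close>, \<open>q\<close> and
      \<open>d\<close>.\<close>
    have zD: "z \<in> D" if zX: "z \<notin> X"
    proof (rule ccontr)
      assume zn: "z \<notin> D"
      have tb: "t \<in> X" "b \<in> X" using tD bD tz bz zX zn by blast+
      have "\<exists>d. X \<inter> V \<subseteq> {d}"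
      proof (rule ccontr)
        assume no: "\<nexists>d. X \<inter> V \<subseteq> {d}"
        then obtain d where d: "d \<in> X \<inter> V" by blast
        from no obtain e where e: "e \<in> X \<inter> V" "e \<noteq> d" by blast
        have "distinct [t, b, d, e]" using d e new by auto
        then show False using 4[of t b d e] tb d e by blast
      qed
      then obtain d where d: "X \<inter> V \<subseteq> {d}" by blast
      define W where "W = {p, q, d} - {z}"
      have "card W \<le> card {p, q, d}" unfolding W_def by (rule card_mono) auto
      also have "\<dots> \<le> 3" by (simp add: card_insert_if)
      finally have "card W < 4" by simp
      then obtain y where y: "y \<in> V" "y \<notin> W" "E z y"
        using nbr_outside[OF G con old(4), of W] by (auto simp: W_def)
      have yz: "y \<noteq> z" using y(3) Eirr by blast
      then have ypq: "y \<noteq> p" "y \<noteq> q" "y \<noteq> d" using y(2) by (auto simp: W_def)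
      have "E' y z" unfolding insert_column_def using Esym[OF y(3)] ypq yz by (auto simp: doubleton_eq_iff)
      moreover have "y \<in> D" using inD[OF y(1) yz] d ypq y(1) by blast
      ultimately show False using grow zX zn by blast
    qed
    show ?thesis
    proof (rule graph_connectedI[OF insert_column_simple, of _ c])
      fix v assume v: "v \<in> ?S"
      have "v \<in> D"
      proof (cases "v \<in> V \<and> v \<noteq> z")
        case True then show ?thesis using inD v by blast
      next
        case False
        then have "v = r \<or> v = t \<or> v = b \<or> v = z" using v by blast
        then show ?thesis using rD tD bD zD v by blast
      qed
      then show "?R\<^sup>*\<^sup>* c v" by (simp add: D_def)
    qed
  qed
qed

end

text \<open>A cut that spares the apex \<open>a\<close> cannot disconnect: the remaining faces are
  joined to \<open>a\<close>, and a vertex of the map has four faces, of which at most three are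
  deleted. So only cuts containing \<open>a\<close> are checked.\<close>

lemma four_connected_apexI:
  assumes G: "simple_graph (set V) (list_graph V nb)" and len: "distinct V" "5 \<le> length V"
    and a: "a \<in> set V" and least: "list_all (\<lambda>v. a \<le> v) V"
    and faces: "list_all (\<lambda>v. v = a \<or> mem v (nb a) \<or> (all_mem (nb v) (nb a) \<and> distinct (nb v) \<and> 4 \<le> length (nb v))) V"
    and ch: "list_all (\<lambda>j. list_all (survives nb V a j) V) V"
  shows "k_connected (set V) (list_graph V nb) 4"
proof (rule k_connected_4I[OF G])
  show "5 \<le> card (set V)" using len by (simp add: distinct_card)
  let ?E = "list_graph V nb"
  fix X assume X: "X \<subseteq> set V" "card X = 3"
  have fX: "finite X" using X(2) card.infinite by fastforce
  show "graph_connected (set V - X) ?E"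
  proof (cases "a \<in> X")
    case True
    have "card (X - {a}) = 2" using X(2) True fX by simp
    then obtain x y where xy: "X - {a} = {x, y}" "x \<noteq> y" by (auto simp: card_2_iff)
    define j where "j = min x y"
    define k where "k = max x y"
    have jk: "X = {a, j, k}" "j < k" using xy True by (auto simp: j_def k_def min_def max_def)
    have jV: "j \<in> set V" "k \<in> set V" "j \<noteq> a" using X(1) jk xy by (auto simp: j_def min_def)
    \<comment> \<open>\<open>survives\<close> says something only about increasing triples, which is
      why \<open>a\<close> has the least label.\<close>
    then have "a < j" using least unfolding list_all_iff by (metis le_neq_implies_less)
    moreover have "survives nb V a j k" using ch jV unfolding list_all_iff by blast
    ultimately show ?thesis using survives_connected[OF G] jk jV a by simp
  next
    case False
    have aS: "a \<in> set V - X" using a False by simp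
    let ?R = "\<lambda>x y. ?E x y \<and> x \<in> set V - X \<and> y \<in> set V - X"
    have face: "?R a v" if "v \<in> set (nb a)" "v \<notin> X" for v
    proof -
      have "?E a v" using that a by (simp add: list_graph_def)
      moreover from this have "v \<in> set V" using G unfolding simple_graph_def by blast
      ultimately show ?thesis using that aS by blast
    qed
    show ?thesis
    proof (rule graph_connectedI[OF G, of _ a])
      fix v assume v: "v \<in> set V - X"
      then consider "v = a" | "v \<in> set (nb a)" | "set (nb v) \<subseteq> set (nb a)" "distinct (nb v)" "4 \<le> length (nb v)"
        using faces unfolding list_all_iff mem_iff all_mem_iff by blast
      then show "?R\<^sup>*\<^sup>* a v"
      proof cases
        case 2
        have "?R a v" using face 2 v by blast
        then show ?thesis by (rule r_into_rtranclp)
      next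
        case 3
        have "\<not> set (nb v) \<subseteq> X"
        proof
          assume "set (nb v) \<subseteq> X"
          from card_mono[OF fX this] show False using 3 X(2) distinct_card[of "nb v"] by simp
        qed
        then obtain w where w: "w \<in> set (nb v)" "w \<notin> X" by blast
        have aw: "?R a w" using face[of w] w 3(1) by blast
        have "?E v w" using w(1) v by (simp add: list_graph_def)
        then have "?E w v" using G unfolding simple_graph_def by blast
        then have "?R w v" using aw v by blast
        then show ?thesis by (rule rtranclp.rtrancl_into_rtrancl[OF r_into_rtranclp[of ?R, OF aw]])
      qed simp
    qed
  qed
qed

section \<open>Plane drawings with an apex above them\<close>

lemma spread_if_not_on_segments:
  fixes u v w :: complex
  assumes "u \<notin> closed_segment v w" "w \<notin> closed_segment v u"
  shows "spread (u - v) (w - v)"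
proof -
  have scale: "x \<in> closed_segment v y" if "0 \<le> t" "t \<le> s" "0 < s" and e: "s *\<^sub>R (x - v) = t *\<^sub>R (y - v)" for s t :: real and x y
  proof -
    have "x - v = (1 / s) *\<^sub>R (s *\<^sub>R (x - v))" using that(3) by simp
    also have "\<dots> = (t / s) *\<^sub>R (y - v)" unfolding e by simp
    finally have "x = (1 - t / s) *\<^sub>R v + (t / s) *\<^sub>R y" by (simp add: algebra_simps)
    then show ?thesis unfolding in_segment using that by (intro exI[of _ "t / s"]) simp
  qed
  show ?thesis
    unfolding spread_def
  proof (intro allI impI)
    fix s t :: real assume st: "0 \<le> s" "0 \<le> t" "s *\<^sub>R (u - v) = t *\<^sub>R (w - v)"
    have "\<not> (t \<le> s \<and> 0 < s)" using scale[OF st(2) _ _ st(3)] assms(1) by blast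
    moreover have "\<not> (s \<le> t \<and> 0 < t)" using scale[OF st(1) _ _ st(3)[symmetric]] assms(2) by blast
    ultimately show "s = 0 \<and> t = 0" using st(1,2) by linarith
  qed
qed

text \<open>A line meets the parabola in at most two points.\<close>

lemma generic_point:
  assumes "finite (S :: complex set)"
  shows "\<exists>z. \<forall>x\<in>S. \<forall>y\<in>S. x \<noteq> y \<longrightarrow> Im (cnj (x - z) * (y - z)) \<noteq> 0"
proof -
  define f where "f x y = [:Re x * Im y - Im x * Re y, Im x - Im y, Re y - Re x:]" for x y :: complex
  define B where "B = (\<Union>x\<in>S. \<Union>y\<in>S - {x}. {s. poly (f x y) s = 0})"
  have "finite {s. poly (f x y) s = 0}" if "y \<in> S - {x}" for x y
    using that by (intro poly_roots_finite) (auto simp: f_def complex_eq_iff)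
  then have "finite B" unfolding B_def using assms by (intro finite_UN_I) auto
  then obtain s where s: "s \<notin> B" using ex_new_if_finite[OF infinite_UNIV_char_0] by blast
  have "Im (cnj (x - Complex s (s * s)) * (y - Complex s (s * s))) = poly (f x y) s" for x y
    by (simp add: f_def algebra_simps)
  then show ?thesis using s unfolding B_def by (intro exI[of _ "Complex s (s * s)"]) auto
qed

lemma collinear_on_segment:
  fixes z :: complex
  assumes "z \<in> closed_segment x y"
  shows "Im (cnj (x - z) * (y - z)) = 0" "Im (cnj (z - x) * (y - x)) = 0"
proof -
  obtain t where t: "z = (1 - t) *\<^sub>R x + t *\<^sub>R y" using assms unfolding in_segment by blast
  show "Im (cnj (x - z) * (y - z)) = 0" "Im (cnj (z - x) * (y - x)) = 0" unfolding t by (simp_all add: algebra_simps)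
qed

lemma fst_closed_segment: "fst ` closed_segment p r = closed_segment (fst p) (fst (r :: complex \<times> real))"
  using closed_segment_linear_image[OF linear_fst, of p r] by simp

text \<open>Without the apex there are no crossings, so only edges at the apex pass over anything. A
  cycle descends if its edges at the apex come first, and of two disjoint cycles the one through the
  apex is on top.\<close>

theorem apex_linklessly_embeddable:
  fixes V :: "nat set" and q :: "nat \<Rightarrow> complex"
  assumes G: "simple_graph V E" and two: "\<forall>v\<in>V. \<exists>u w. u \<noteq> w \<and> E v u \<and> E v w" and inj: "inj_on q (V - {a})"
    and vtx: "\<And>u v w. E u v \<Longrightarrow> u \<noteq> a \<Longrightarrow> v \<noteq> a \<Longrightarrow> w \<in> V \<Longrightarrow> w \<noteq> a \<Longrightarrow> w \<noteq> u \<Longrightarrow> w \<noteq> v \<Longrightarrow> q w \<notin> closed_segment (q u) (q v)"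
    and dis: "\<And>u v x y. E u v \<Longrightarrow> E x y \<Longrightarrow> a \<notin> {u, v} \<Longrightarrow> a \<notin> {x, y} \<Longrightarrow> {u, v} \<inter> {x, y} = {} \<Longrightarrow>
      closed_segment (q u) (q v) \<inter> closed_segment (q x) (q y) = {}"
  shows "linklessly_embeddable V E"
proof -
  have fin: "finite V" and EV: "E u v \<Longrightarrow> u \<in> V \<and> v \<in> V" and Esym: "E u v \<Longrightarrow> E v u" and irr: "\<not> E u u" for u v
    using G unfolding simple_graph_def by blast+
  \<comment> \<open>The apex is projected to a point that is not collinear with any two vertices, so
    its edges avoid vertices and form proper angles.\<close>
  obtain \<alpha> where "\<forall>x\<in>q ` (V - {a}). \<forall>y\<in>q ` (V - {a}). x \<noteq> y \<longrightarrow> Im (cnj (x - \<alpha>) * (y - \<alpha>)) \<noteq> 0"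
    using generic_point[of "q ` (V - {a})"] fin by blast
  then have gen: "Im (cnj (q u - \<alpha>) * (q w - \<alpha>)) \<noteq> 0" if "u \<in> V - {a}" "w \<in> V - {a}" "u \<noteq> w" for u w
    using that inj unfolding inj_on_def by blast
  define P where "P v = (if v = a then (\<alpha>, 1) else (q v, 0 :: real))" for v
  have Pa: "P a = (\<alpha>, 1)" and Pq: "v \<noteq> a \<Longrightarrow> P v = (q v, 0)" for v by (simp_all add: P_def)
  have proj: "fst ` seg P u v = closed_segment (fst (P u)) (fst (P v))" for u v
    unfolding seg_def by (rule fst_closed_segment)
  have va: "fst (P w) \<notin> closed_segment (fst (P a)) (fst (P v))" if "E a v" "w \<in> V" "w \<noteq> a" "w \<noteq> v" for v w
  proof
    assume *: "fst (P w) \<in> closed_segment (fst (P a)) (fst (P v))"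
    have v: "v \<noteq> a" "v \<in> V" using irr EV that(1) by blast+
    have "q w \<in> closed_segment \<alpha> (q v)" using * v that(3) by (simp add: Pa Pq)
    from collinear_on_segment(2)[OF this] show False using gen[of w v] that v by simp
  qed
  have vert: "fst (P w) \<notin> closed_segment (fst (P u)) (fst (P v))" if e: "E u v" and w: "w \<in> V" "w \<noteq> u" "w \<noteq> v" for u v w
  proof -
    consider "u = a" | "v = a" | "u \<noteq> a" "v \<noteq> a" "w = a" | "u \<noteq> a" "v \<noteq> a" "w \<noteq> a" by blast
    then show ?thesis
    proof cases
      case 1 show ?thesis unfolding 1 by (rule va) (use e w 1 in simp_all)
    next
      case 2 show ?thesis unfolding 2 closed_segment_commute[of "fst (P u)"] by (rule va) (use Esym[OF e] w 2 in simp_all)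
    next
      case 3
      have uv: "u \<in> V - {a}" "v \<in> V - {a}" "u \<noteq> v" using 3 EV[OF e] irr e by blast+
      have "\<alpha> \<notin> closed_segment (q u) (q v)" using collinear_on_segment(1) gen[OF uv] by blast
      then show ?thesis using 3 by (simp add: Pa Pq)
    next
      case 4
      then show ?thesis using vtx[OF e 4(1,2) w(1) 4(3) w(2,3)] by (simp add: Pq)
    qed
  qed
  have flat: "snd r = 0" if "r \<in> seg P x y" "x \<noteq> a" "y \<noteq> a" for r x y
    using that unfolding seg_def in_segment by (auto simp: Pq)
  have over_a: "over (seg P a v) (seg P x y)" if e: "E a v" "E x y" and d: "{a, v} \<inter> {x, y} = {}" for v x y
    unfolding over_def
  proof (intro ballI impI)
    fix p r assume p: "p \<in> seg P a v" and r: "r \<in> seg P x y" and pr: "fst p = fst r"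
    have v: "v \<noteq> a" "v \<in> V" using e(1) irr EV by blast+
    obtain t where t: "0 \<le> t" "t \<le> 1" "p = (1 - t) *\<^sub>R P a + t *\<^sub>R P v" using p unfolding seg_def in_segment by blast
    have "snd r = 0" using flat[OF r] d by blast
    moreover have "snd p = 1 - t" unfolding t(3) using v by (simp add: Pa Pq)
    moreover have "t \<noteq> 1"
    proof
      assume "t = 1"
      then have "fst (P v) = fst r" using t(3) pr by simp
      then have "fst (P v) \<in> fst ` seg P x y" using r by simp
      then have "fst (P v) \<in> closed_segment (fst (P x)) (fst (P y))" unfolding proj .
      moreover have "v \<noteq> x" "v \<noteq> y" using d by auto
      ultimately show False using vert[OF e(2) v(2)] by blast
    qed
    ultimately show "snd r < snd p" using t(2) by simp
  qed
  have ov: "over (seg P u v) (seg P x y)" if e: "E u v" "E x y" and d: "{u, v} \<inter> {x, y} = {}" and xa: "x \<noteq> a" "y \<noteq> a" for u v x y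
  proof -
    consider "u = a" | "v = a" | "u \<noteq> a" "v \<noteq> a" by blast
    then show ?thesis
    proof cases
      case 1 then show ?thesis using over_a[of v x y] e d by simp
    next
      case 2 then show ?thesis using over_a[OF Esym, of u x y] e d unfolding seg_commute[of P u v] by (simp add: insert_commute)
    next
      case 3
      have "fst ` seg P u v \<inter> fst ` seg P x y = {}"
        unfolding proj using dis[OF e _ _ d] 3 xa by (simp add: Pq)
      then show ?thesis unfolding over_def by blast
    qed
  qed
  have D: "straight_drawing V E P"
    unfolding straight_drawing_def
  proof (intro conjI allI impI)
    fix u v w assume "E u v" "w \<in> V" "w \<noteq> u" "w \<noteq> v"
    then show "fst (P w) \<notin> fst ` seg P u v" unfolding proj by (rule vert)
  next
    fix u v w assume e: "E v u" "E v w" "u \<noteq> w"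
    have "fst (P u) \<notin> closed_segment (fst (P v)) (fst (P w))" using vert[OF e(2), of u] e irr EV by blast
    moreover have "fst (P w) \<notin> closed_segment (fst (P v)) (fst (P u))" using vert[OF e(1), of w] e irr EV by blast
    ultimately show "spread (fst (P u - P v)) (fst (P w - P v))" using spread_if_not_on_segments by simp
  next
    fix u v x y assume e: "E u v" "E x y" and d: "{u, v} \<inter> {x, y} = {}"
    show "over (seg P u v) (seg P x y) \<or> over (seg P x y) (seg P u v)"
    proof (cases "x \<noteq> a \<and> y \<noteq> a")
      case True then show ?thesis using ov[OF e d] by blast
    next
      case False
      then have "u \<noteq> a" "v \<noteq> a" using d by auto
      moreover have "{x, y} \<inter> {u, v} = {}" using d by blast
      ultimately show ?thesis using ov[OF e(2,1)] by blast
    qed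
  qed (use G two in auto)
  have walk: "E (c i) (c (i + 1))" "3 \<le> k" "c i = c j \<longleftrightarrow> i mod int k = j mod int k" if "cyclic_walk E k c" for c k i j
    using that unfolding cyclic_walk_def by blast+
  show ?thesis
  proof (rule straight_drawing_linkless[OF D])
    fix k c l d
    assume c: "cyclic_walk E k c" and d: "cyclic_walk E l d" and cd: "range c \<inter> range d = {}"
    have sep: "{c i, c (i + 1)} \<inter> {d j, d (j + 1)} = {}" for i j using cd by blast
    show "(\<forall>i j. over (seg P (c i) (c (i + 1))) (seg P (d j) (d (j + 1)))) \<or>
        (\<forall>i j. over (seg P (d j) (d (j + 1))) (seg P (c i) (c (i + 1))))"
    proof (cases "a \<in> range d")
      case False
      then have "d j \<noteq> a" for j by blast
      then show ?thesis using ov[OF walk(1)[OF c] walk(1)[OF d] sep] by blast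
    next
      case True
      then have ca: "c j \<noteq> a" for j using cd by (metis Int_iff empty_iff rangeI)
      have sep': "{d j, d (j + 1)} \<inter> {c i, c (i + 1)} = {}" for i j using sep[of i j] by blast
      show ?thesis using ov[OF walk(1)[OF d] walk(1)[OF c] sep'] ca by blast
    qed
    obtain s where s: "\<forall>j. 2 \<le> j \<longrightarrow> j \<le> int k \<longrightarrow> c (j + s) \<noteq> a"
    proof (cases "a \<in> range c")
      case False
      then have "\<forall>j. 2 \<le> j \<longrightarrow> j \<le> int k \<longrightarrow> c (j + 0) \<noteq> a" by blast
      then show ?thesis by (rule that)
    next
      case True
      then obtain i where i: "c i = a" by blast
      \<comment> \<open>The shift gives the apex index 1, so that exactly the edges 0 and 1 end
        there. These two are adjacent, and every later edge is flat.\<close>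
      have "\<forall>j. 2 \<le> j \<longrightarrow> j \<le> int k \<longrightarrow> c (j + (i - 1)) \<noteq> a"
      proof (intro allI impI notI)
        fix j assume j: "2 \<le> j" "j \<le> int k" "c (j + (i - 1)) = a"
        then have "c (j + (i - 1)) = c i" using i by simp
        then have "(j + (i - 1)) mod int k = i mod int k" unfolding walk(3)[OF c] .
        then have "int k dvd j - 1" by (simp add: mod_eq_dvd_iff algebra_simps)
        then show False using j zdvd_imp_le[of "int k" "j - 1"] by simp
      qed
      then show ?thesis by (rule that)
    qed
    have "descending P k (\<lambda>i. c (i + s))"
      unfolding descending_def
    proof (intro allI impI)
      fix i j assume ij: "0 \<le> i" "i < j" "j < int k" and sep: "{c (i + s), c (i + 1 + s)} \<inter> {c (j + s), c (j + 1 + s)} = {}"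
      have "j \<noteq> i + 1" using sep by auto
      then have j2: "2 \<le> j" using ij by simp
      have E1: "E (c (x + s)) (c (x + 1 + s))" for x using walk(1)[OF c, of "x + s"] by (simp add: algebra_simps)
      show "over (seg P (c (i + s)) (c (i + 1 + s))) (seg P (c (j + s)) (c (j + 1 + s)))"
        by (rule ov[OF E1 E1 sep]) (use s j2 ij(3) in auto)
    qed
    then show "windable P k c" unfolding windable_def by blast
  qed
qed

section \<open>The strip of inserted columns\<close>

definition hub :: "bool \<Rightarrow> nat" where "hub \<sigma> = (if \<sigma> then 1 else 2)"

text \<open>Column \<open>j \<ge> 1\<close> has the labels \<open>m + 3 * j - 3\<close> (rib),
  \<open>m + 3 * j - 2\<close> and \<open>m + 3 * j - 1\<close> (cells). The original triangles 5
  and 6 act as the cells of column 0.\<close>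

definition cell :: "nat \<Rightarrow> bool \<Rightarrow> nat \<Rightarrow> nat" where
  "cell m \<sigma> j = (if j = 0 then if \<sigma> then 5 else 6 else m + 3 * j - (if \<sigma> then 2 else 1))"

definition rib :: "nat \<Rightarrow> nat \<Rightarrow> nat" where "rib m j = (if j = 0 then 3 else m + 3 * j - 3)"

text \<open>The strip between \<open>3\<close> and \<open>4\<close> ends at \<open>4\<close>, so the last rail is not a rib.\<close>

definition rail :: "nat \<Rightarrow> nat \<Rightarrow> nat \<Rightarrow> nat" where "rail m K j = (if j = Suc K then 4 else rib m j)"

text \<open>Always the two cells next to 4 are split, so the strip grows from 3 towards 4, with the
  hubs 1 and 2 on its two sides.\<close>

primrec columns :: "nat \<Rightarrow> (nat \<Rightarrow> nat \<Rightarrow> bool) \<Rightarrow> nat \<Rightarrow> nat \<Rightarrow> nat \<Rightarrow> bool" where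
  "columns m E 0 = E"
| "columns m E (Suc j) = insert_column 0 1 2 4 (columns m E j) (cell m True j) (cell m False j)
     (rib m (Suc j)) (cell m True (Suc j)) (cell m False (Suc j))"

lemma new_column: "rib m (Suc j) = m + 3 * j" "cell m True (Suc j) = m + 3 * j + 1" "cell m False (Suc j) = m + 3 * j + 2"
  by (simp_all add: rib_def cell_def)

text \<open>The last two cells keep a hub, 4 and the apex 0 as neighbours; this is the invariant
  that permits the next insertion.\<close>

lemma columns_tutte:
  assumes m: "7 \<le> m" and G: "simple_graph {0..<m} E" "tutte_4_connected {0..<m} E"
    and E5: "E 5 1" "E 5 4" "E 5 0" and E6: "E 6 2" "E 6 4" "E 6 0"
  shows "simple_graph {0..<m + 3 * K} (columns m E K) \<and> triangle_free (columns m E K) \<and>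
    k_connected {0..<m + 3 * K} (columns m E K) 4 \<and>
    columns m E K (cell m True K) 1 \<and> columns m E K (cell m True K) 4 \<and> columns m E K (cell m True K) 0 \<and>
    columns m E K (cell m False K) 2 \<and> columns m E K (cell m False K) 4 \<and> columns m E K (cell m False K) 0"
proof (induction K)
  case 0
  then show ?case using G E5 E6 by (simp add: cell_def tutte_4_connected_def)
next
  case (Suc K)
  let ?p = "cell m True K" and ?q = "cell m False K"
  have d: "distinct [0, 1, 2, 4, ?p, ?q]" using m by (auto simp: cell_def)
  have new: "m + 3 * K \<notin> {0..<m + 3 * K}" "m + 3 * K + 1 \<notin> {0..<m + 3 * K}" "m + 3 * K + 2 \<notin> {0..<m + 3 * K}"
    "distinct [m + 3 * K, m + 3 * K + 1, m + 3 * K + 2]" by auto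
  have V: "{0..<m + 3 * Suc K} = {0..<m + 3 * K} \<union> {m + 3 * K, m + 3 * K + 1, m + 3 * K + 2}" by auto
  have IH: "simple_graph {0..<m + 3 * K} (columns m E K)" "triangle_free (columns m E K)" "k_connected {0..<m + 3 * K} (columns m E K) 4"
    "columns m E K ?p 1" "columns m E K ?p 4" "columns m E K ?p 0" "columns m E K ?q 2" "columns m E K ?q 4" "columns m E K ?q 0"
    using Suc.IH by blast+
  note facts = IH d new
  have "insert_column 0 1 2 4 (columns m E K) ?p ?q (m + 3 * K) (m + 3 * K + 1) (m + 3 * K + 2) x y"
    if "{x, y} \<in> {{m + 3 * K + 1, 1}, {m + 3 * K + 1, 4}, {m + 3 * K + 1, 0}, {m + 3 * K + 2, 2}, {m + 3 * K + 2, 4}, {m + 3 * K + 2, 0}}" for x y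
    using that unfolding insert_column_def by blast
  then show ?case
    unfolding V columns.simps new_column
    using insert_column_simple[OF facts] insert_column_triangle_free[OF facts] insert_column_4_connected[OF facts] by simp
qed

text \<open>All that the drawing has to know: an edge avoiding the apex is an old one away from 5
  and 6, or it joins a cell to its hub or to one of the two rails beside it.\<close>

lemma columns_edges:
  assumes E5: "\<And>y. E 5 y \<Longrightarrow> y \<in> {0, 1, 3, 4}" and E6: "\<And>y. E 6 y \<Longrightarrow> y \<in> {0, 2, 3, 4}" and sym: "\<And>u v. E u v \<Longrightarrow> E v u"
  shows "columns m E K u v \<Longrightarrow> u \<noteq> 0 \<Longrightarrow> v \<noteq> 0 \<Longrightarrow> (E u v \<and> u \<notin> {5, 6} \<and> v \<notin> {5, 6}) \<or>
    (\<exists>\<sigma> i. i \<le> K \<and> ({u, v} = {hub \<sigma>, cell m \<sigma> i} \<or> (\<exists>j. (j = i \<or> j = Suc i) \<and> {u, v} = {rail m K j, cell m \<sigma> i})))"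
    (is "_ \<Longrightarrow> _ \<Longrightarrow> _ \<Longrightarrow> ?old u v \<or> ?strip K u v")
proof (induction K arbitrary: u v)
  case 0
  then have e: "E u v" by simp
  have *: "?strip 0 x y" if xy: "E x y" "x = 5 \<or> x = 6" "y \<noteq> 0" for x y
  proof -
    have "(x = 5 \<and> y \<in> {1, 3, 4}) \<or> (x = 6 \<and> y \<in> {2, 3, 4})" using E5[of y] E6[of y] xy by auto
    then have "(\<exists>\<sigma>. {x, y} = {hub \<sigma>, cell m \<sigma> 0} \<or> {x, y} = {rail m 0 0, cell m \<sigma> 0} \<or> {x, y} = {rail m 0 (Suc 0), cell m \<sigma> 0})"
      by (elim disjE conjE; intro exI[of _ "x = 5"]) (auto simp: hub_def cell_def rail_def rib_def)
    then show ?thesis by blast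
  qed
  have "{v, u} = {u, v}" by (rule insert_commute)
  then show ?case using *[OF e] *[OF sym[OF e]] 0(2,3) e by (cases "u = 5 \<or> u = 6"; cases "v = 5 \<or> v = 6") auto
next
  case (Suc K)
  have stripI: "?strip (Suc K) u v" if "i \<le> Suc K" "{u, v} = {hub \<sigma>, cell m \<sigma> i}" for \<sigma> i using that by blast
  have stripR: "?strip (Suc K) u v" if "i \<le> Suc K" "j = i \<or> j = Suc i" "{u, v} = {rail m (Suc K) j, cell m \<sigma> i}" for \<sigma> i j using that by blast
  have r: "rail m (Suc K) (Suc K) = rib m (Suc K)" "rail m (Suc K) (Suc (Suc K)) = 4" by (simp_all add: rail_def)
  from Suc.prems(1)[unfolded columns.simps insert_column_def] show ?case
  proof
    assume *: "columns m E K u v \<and> {u, v} \<noteq> {cell m True K, 4} \<and> {u, v} \<noteq> {cell m False K, 4}"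
    from Suc.IH[OF conjunct1[OF *] Suc.prems(2,3)] show ?thesis
    proof
      assume "?strip K u v"
      then obtain \<sigma> i where i: "i \<le> K" and c: "{u, v} = {hub \<sigma>, cell m \<sigma> i} \<or> (\<exists>j. (j = i \<or> j = Suc i) \<and> {u, v} = {rail m K j, cell m \<sigma> i})"
        by blast
      have i': "i \<le> Suc K" using i by simp
      from c have "?strip (Suc K) u v"
      proof
        assume "{u, v} = {hub \<sigma>, cell m \<sigma> i}" then show ?thesis by (rule stripI[OF i'])
      next
        assume "\<exists>j. (j = i \<or> j = Suc i) \<and> {u, v} = {rail m K j, cell m \<sigma> i}"
        then obtain j where j: "j = i \<or> j = Suc i" "{u, v} = {rail m K j, cell m \<sigma> i}" by blast
        \<comment> \<open>The last rail before the insertion is 4, and its edges to the last two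
          cells are the deleted ones.\<close>
        have "j \<noteq> Suc K"
        proof
          assume "j = Suc K"
          then have "i = K" "rail m K j = 4" using j(1) i by (auto simp: rail_def)
          then have "{u, v} = {cell m \<sigma> K, 4}" using j(2) by (simp add: insert_commute)
          then show False using * by (cases \<sigma>) simp_all
        qed
        then have "rail m K j = rail m (Suc K) j" using j(1) i by (auto simp: rail_def)
        then show ?thesis using stripR[OF i' j(1)] j(2) by simp
      qed
      then show ?thesis by (rule disjI2)
    qed (rule disjI1)
  next
    let ?r = "rib m (Suc K)" and ?t = "cell m True (Suc K)" and ?b = "cell m False (Suc K)"
    assume "{u, v} \<in> {{?r, cell m True K}, {?r, cell m False K}, {?r, ?t}, {?r, ?b}, {?t, 1}, {?t, 4}, {?t, 0}, {?b, 2}, {?b, 4}, {?b, 0}}"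
    then consider "{u, v} = {?r, cell m True K}" | "{u, v} = {?r, cell m False K}" | "{u, v} = {?r, ?t}" | "{u, v} = {?r, ?b}"
      | "{u, v} = {1, ?t}" | "{u, v} = {4, ?t}" | "{u, v} = {2, ?b}" | "{u, v} = {4, ?b}" | "0 \<in> {u, v}"
      by (elim insertE emptyE) (simp_all only: insert_commute[of ?t] insert_commute[of ?b] insertI1 insertI2 simp_thms)
    then have "?strip (Suc K) u v"
    proof cases
      case 1 show ?thesis by (rule stripR[of K "Suc K" True]) (simp_all add: 1 r)
    next
      case 2 show ?thesis by (rule stripR[of K "Suc K" False]) (simp_all add: 2 r)
    next
      case 3 show ?thesis by (rule stripR[of "Suc K" "Suc K" True]) (simp_all add: 3 r)
    next
      case 4 show ?thesis by (rule stripR[of "Suc K" "Suc K" False]) (simp_all add: 4 r)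
    next
      case 5 show ?thesis by (rule stripI[of "Suc K" True]) (simp_all add: 5 hub_def)
    next
      case 6 show ?thesis by (rule stripR[of "Suc K" "Suc (Suc K)" True]) (simp_all add: 6 r)
    next
      case 7 show ?thesis by (rule stripI[of "Suc K" False]) (simp_all add: 7 hub_def)
    next
      case 8 show ?thesis by (rule stripR[of "Suc K" "Suc (Suc K)" False]) (simp_all add: 8 r)
    next
      case 9 then show ?thesis using Suc.prems(2,3) by simp
    qed
    then show ?thesis by (rule disjI2)
  qed
qed

section \<open>Coordinates of the strip\<close>

definition strip_x :: "nat \<Rightarrow> nat \<Rightarrow> real" where "strip_x K k = 4 * real k / real (Suc K) - 4"
definition sign :: "bool \<Rightarrow> real" where "sign \<sigma> = (if \<sigma> then 1 else - 1)"
definition rail_at :: "nat \<Rightarrow> nat \<Rightarrow> complex" where "rail_at K j = Complex (strip_x K (2 * j)) 0"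
definition cell_at :: "nat \<Rightarrow> bool \<Rightarrow> nat \<Rightarrow> complex" where "cell_at K \<sigma> i = Complex (strip_x K (2 * i + 1)) (sign \<sigma> * (2 / real (Suc K)))"
definition hub_at :: "bool \<Rightarrow> complex" where "hub_at \<sigma> = Complex 0 (sign \<sigma> * 4)"
text \<open>The strip is drawn in the ball of radius 4 of this norm, a diamond with the hubs and the
  vertices 3 and 4 at its corners.\<close>

definition l1 :: "complex \<Rightarrow> real" where "l1 z = \<bar>Re z\<bar> + \<bar>Im z\<bar>"

lemma strip_x_less: "k < l \<Longrightarrow> strip_x K k < strip_x K l"
  unfolding strip_x_def by (simp add: divide_strict_right_mono)

lemma strip_x_inj: "strip_x K k = strip_x K l \<Longrightarrow> k = l"
  using strip_x_less[of k l K] strip_x_less[of l k K] by (metis less_irrefl nat_neq_iff)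

lemma strip_x_ends: "strip_x K 0 = - 4" "strip_x K (2 * Suc K) = 4"
  unfolding strip_x_def by (simp_all add: field_simps)

lemma height: "0 < 2 / real (Suc K)" "2 / real (Suc K) < 4"
  by (simp_all add: field_simps)

lemma sign_mult: "sign \<sigma> * sign \<sigma> = 1" "\<bar>sign \<sigma>\<bar> = 1" "sign (\<not> \<sigma>) = - sign \<sigma>" by (simp_all add: sign_def)

text \<open>The height \<open>2 / real (Suc K)\<close> is half of what the sides of the diamond
  allow over the outermost cells.\<close>

lemma l1_cell: "i \<le> K \<Longrightarrow> l1 (cell_at K \<sigma> i) < 4"
proof -
  assume "i \<le> K"
  define N where "N = real (Suc K)"
  have N: "0 < N" "real i + 1 \<le> N" using \<open>i \<le> K\<close> by (simp_all add: N_def)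
  have h: "\<bar>sign \<sigma> * (2 / N)\<bar> = 2 / N" using N by (simp add: abs_mult sign_mult)
  have "4 * (2 * real i + 1) / N - 4 + 2 / N < 4" "- (4 * (2 * real i + 1) / N - 4) + 2 / N < 4"
    using N by (simp_all add: field_simps)
  moreover have "l1 (cell_at K \<sigma> i) = \<bar>strip_x K (2 * i + 1)\<bar> + 2 / N"
    by (simp only: l1_def cell_at_def complex.sel h N_def[symmetric])
  moreover have "strip_x K (2 * i + 1) = 4 * (2 * real i + 1) / N - 4" by (simp add: strip_x_def N_def)
  ultimately show ?thesis by linarith
qed

lemma l1_rail: "j \<le> Suc K \<Longrightarrow> l1 (rail_at K j) \<le> 4" "0 < j \<Longrightarrow> j \<le> K \<Longrightarrow> l1 (rail_at K j) < 4"
proof -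
  show "l1 (rail_at K j) \<le> 4" if "j \<le> Suc K"
  proof -
    have "strip_x K 0 \<le> strip_x K (2 * j)" "strip_x K (2 * j) \<le> strip_x K (2 * Suc K)"
      using that strip_x_less[of 0 "2 * j" K] strip_x_less[of "2 * j" "2 * Suc K" K] by (cases "j = 0"; cases "j = Suc K"; simp)+
    then show ?thesis unfolding strip_x_ends by (simp add: l1_def rail_at_def)
  qed
  show "l1 (rail_at K j) < 4" if "0 < j" "j \<le> K"
    using strip_x_less[of 0 "2 * j" K] strip_x_less[of "2 * j" "2 * Suc K" K] that
    unfolding strip_x_ends by (simp add: l1_def rail_at_def abs_if)
qed

lemma l1_hub: "l1 (hub_at \<sigma>) = 4" by (simp add: l1_def hub_at_def abs_mult sign_mult)

lemma l1_segment: "z \<in> closed_segment x y \<Longrightarrow> l1 x \<le> 4 \<Longrightarrow> l1 y \<le> 4 \<Longrightarrow> l1 z \<le> 4"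
proof -
  assume z: "z \<in> closed_segment x y" and xy: "l1 x \<le> 4" "l1 y \<le> 4"
  obtain t where t: "0 \<le> t" "t \<le> 1" "z = (1 - t) *\<^sub>R x + t *\<^sub>R y" using z unfolding in_segment by blast
  have "\<bar>(1 - t) * a + t * b\<bar> \<le> (1 - t) * \<bar>a\<bar> + t * \<bar>b\<bar>" for a b
    using abs_triangle_ineq[of "(1 - t) * a" "t * b"] t by (simp add: abs_mult)
  from this[of "Re x" "Re y"] this[of "Im x" "Im y"] have "l1 z \<le> (1 - t) * l1 x + t * l1 y"
    unfolding t(3) l1_def by (simp add: algebra_simps)
  also have "\<dots> \<le> (1 - t) * 4 + t * 4" using t xy by (intro add_mono mult_left_mono) auto
  finally show ?thesis by simp
qed

text \<open>The level \<open>2 / real (Suc K)\<close> of the cells separates the kinds of edges: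
  those to a hub lie above it, those to a rail between it and 0. On the dividing levels there are
  only vertices, so most pairs of strip edges are disjoint by level alone.\<close>

lemma hub_cell_segment:
  assumes "z \<in> closed_segment (hub_at \<sigma>) (cell_at K \<sigma> i)"
  shows "2 / real (Suc K) \<le> sign \<sigma> * Im z" "sign \<sigma> * Im z = 2 / real (Suc K) \<Longrightarrow> z = cell_at K \<sigma> i"
    "sign \<sigma> * Im z = 4 \<Longrightarrow> z = hub_at \<sigma>"
proof -
  define h where "h = 2 / real (Suc K)"
  have h: "h < 4" using height by (simp add: h_def)
  obtain t where t: "0 \<le> t" "t \<le> 1" "z = (1 - t) *\<^sub>R hub_at \<sigma> + t *\<^sub>R cell_at K \<sigma> i" using assms unfolding in_segment by blast
  have "sign \<sigma> * Im z = (sign \<sigma> * sign \<sigma>) * ((1 - t) * 4 + t * h)" unfolding t(3) by (simp add: hub_at_def cell_at_def h_def algebra_simps)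
  then have Im: "sign \<sigma> * Im z = 4 - t * (4 - h)" by (simp add: sign_mult algebra_simps)
  have "t * (4 - h) \<le> 1 * (4 - h)" using t h by (intro mult_right_mono) auto
  then show "2 / real (Suc K) \<le> sign \<sigma> * Im z" using Im by (simp add: h_def)
  show "z = cell_at K \<sigma> i" if "sign \<sigma> * Im z = 2 / real (Suc K)"
  proof -
    have "(1 - t) * (4 - h) = 0" using that Im unfolding h_def[symmetric] by (simp add: algebra_simps)
    then show ?thesis using t(3) h by simp
  qed
  show "z = hub_at \<sigma>" if "sign \<sigma> * Im z = 4"
    using that Im t(3) h by simp
qed

lemma rail_cell_segment:
  assumes "z \<in> closed_segment (rail_at K j) (cell_at K \<sigma> i)"
  obtains t where "0 \<le> t" "t \<le> 1" "Re z = (1 - t) * strip_x K (2 * j) + t * strip_x K (2 * i + 1)" "sign \<sigma> * Im z = t * (2 / real (Suc K))"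
proof -
  obtain t where t: "0 \<le> t" "t \<le> 1" "z = (1 - t) *\<^sub>R rail_at K j + t *\<^sub>R cell_at K \<sigma> i" using assms unfolding in_segment by blast
  have "sign \<sigma> * Im z = (sign \<sigma> * sign \<sigma>) * (t * (2 / real (Suc K)))" unfolding t(3) by (simp add: rail_at_def cell_at_def)
  then have "sign \<sigma> * Im z = t * (2 / real (Suc K))" by (simp add: sign_mult)
  moreover have "Re z = (1 - t) * strip_x K (2 * j) + t * strip_x K (2 * i + 1)" unfolding t(3) by (simp add: rail_at_def cell_at_def)
  ultimately show ?thesis using that t(1,2) by blast
qed

lemma rail_cell_level:
  assumes "z \<in> closed_segment (rail_at K j) (cell_at K \<sigma> i)"
  shows "0 \<le> sign \<sigma> * Im z" "sign \<sigma> * Im z \<le> 2 / real (Suc K)" "Im z = 0 \<Longrightarrow> z = rail_at K j"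
    "sign \<sigma> * Im z = 2 / real (Suc K) \<Longrightarrow> z = cell_at K \<sigma> i"
proof -
  define h where "h = 2 / real (Suc K)"
  have h: "0 < h" using height by (simp add: h_def)
  from assms obtain t where t: "0 \<le> t" "t \<le> 1" "Re z = (1 - t) * strip_x K (2 * j) + t * strip_x K (2 * i + 1)" "sign \<sigma> * Im z = t * h"
    unfolding h_def by (rule rail_cell_segment)
  show "0 \<le> sign \<sigma> * Im z" using t h by simp
  show "sign \<sigma> * Im z \<le> 2 / real (Suc K)" using t h unfolding h_def[symmetric] by (simp add: mult_left_le_one_le)
  show "z = rail_at K j" if "Im z = 0" using that t h by (simp add: complex_eq_iff rail_at_def)
  show "z = cell_at K \<sigma> i" if "sign \<sigma> * Im z = 2 / real (Suc K)"
  proof -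
    have "t = 1" using that t(4) h unfolding h_def[symmetric] by simp
    moreover have "Im z = sign \<sigma> * h" using that unfolding h_def[symmetric] by (auto simp: sign_def split: if_splits)
    ultimately show ?thesis using t(3) by (simp add: complex_eq_iff cell_at_def h_def)
  qed
qed

text \<open>On each level the zigzag edges of one side keep their order from left to right, as
  convex combinations of ordered end points with equal weights.\<close>

lemma rail_cell_disjoint:
  assumes z: "z \<in> closed_segment (rail_at K j) (cell_at K \<sigma> i)" "z \<in> closed_segment (rail_at K j') (cell_at K \<sigma> i')"
    and ij: "i < i'" "j < j'"
  shows False
proof -
  define h where "h = 2 / real (Suc K)"
  have h: "0 < h" using height by (simp add: h_def)
  from z(1) obtain t where t: "0 \<le> t" "t \<le> 1" "Re z = (1 - t) * strip_x K (2 * j) + t * strip_x K (2 * i + 1)" "sign \<sigma> * Im z = t * h"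
    unfolding h_def by (rule rail_cell_segment)
  from z(2) obtain t' where t': "0 \<le> t'" "t' \<le> 1" "Re z = (1 - t') * strip_x K (2 * j') + t' * strip_x K (2 * i' + 1)" "sign \<sigma> * Im z = t' * h"
    unfolding h_def by (rule rail_cell_segment)
  have tt: "t' = t" using t(4) t'(4) h by simp
  have s: "strip_x K (2 * j) < strip_x K (2 * j')" "strip_x K (2 * i + 1) < strip_x K (2 * i' + 1)"
    using ij by (auto intro: strip_x_less)
  have "(1 - t) * (strip_x K (2 * j') - strip_x K (2 * j)) + t * (strip_x K (2 * i' + 1) - strip_x K (2 * i + 1)) = 0"
    using t(3) t'(3) unfolding tt by (simp add: algebra_simps)
  moreover have "0 \<le> (1 - t) * (strip_x K (2 * j') - strip_x K (2 * j))" "0 \<le> t * (strip_x K (2 * i' + 1) - strip_x K (2 * i + 1))"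
    using t s by simp_all
  ultimately have "(1 - t) * (strip_x K (2 * j') - strip_x K (2 * j)) = 0" "t * (strip_x K (2 * i' + 1) - strip_x K (2 * i + 1)) = 0"
    by linarith+
  then show False using s by auto
qed

text \<open>\<open>C\<close> is the value at the centre of the diamond and the other four
  expressions are the values at its corners. A linear function that is non-negative there and
  positive in the centre is positive throughout the interior.\<close>

lemma separating_interior:
  fixes A B C :: real
  assumes "0 < C" "0 \<le> C - 4 * A" "0 \<le> C + 4 * A" "0 \<le> C - 4 * B" "0 \<le> C + 4 * B" "l1 w < 4"
  shows "0 < A * Re w + B * Im w + C"
proof -
  have "\<bar>A\<bar> * \<bar>Re w\<bar> \<le> C / 4 * \<bar>Re w\<bar>" "\<bar>B\<bar> * \<bar>Im w\<bar> \<le> C / 4 * \<bar>Im w\<bar>"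
    using assms by (intro mult_right_mono; simp add: abs_le_iff)+
  then have "\<bar>A * Re w\<bar> + \<bar>B * Im w\<bar> \<le> C / 4 * l1 w" by (simp add: abs_mult l1_def algebra_simps)
  also have "\<dots> < C / 4 * 4" using assms(1,6) by (intro mult_strict_left_mono) auto
  finally show ?thesis by (simp add: abs_if split: if_splits)
qed

lemma affine_segment:
  fixes A B C :: real
  defines "f \<equiv> \<lambda>z. A * Re z + B * Im z + C"
  assumes z: "z \<in> closed_segment x y"
  shows "f x \<le> 0 \<Longrightarrow> f y \<le> 0 \<Longrightarrow> f z \<le> 0" "0 < f x \<Longrightarrow> 0 < f y \<Longrightarrow> 0 < f z"
proof -
  obtain t where t: "0 \<le> t" "t \<le> 1" "z = (1 - t) *\<^sub>R x + t *\<^sub>R y" using z unfolding in_segment by blast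
  have e: "f z = (1 - t) * f x + t * f y" unfolding t(3) f_def by (simp add: algebra_simps)
  show "f z \<le> 0" if "f x \<le> 0" "f y \<le> 0"
    using that t unfolding e by (intro add_nonpos_nonpos mult_nonneg_nonpos) auto
  show "0 < f z" if "0 < f x" "0 < f y"
  proof (cases "t = 0")
    case False
    then have "0 < t * f y" "0 \<le> (1 - t) * f x" using that t by simp_all
    then show ?thesis unfolding e by linarith
  qed (use that e in simp)
qed

text \<open>A line with the edge on one side and the diamond on the other. It may touch the diamond
  only at a corner where the edge ends.\<close>

definition separated :: "(nat \<Rightarrow> complex) \<Rightarrow> nat \<Rightarrow> nat \<Rightarrow> bool" where
  "separated q u v \<longleftrightarrow> (\<exists>A B C. 0 < C \<and> A * Re (q u) + B * Im (q u) + C \<le> 0 \<and> A * Re (q v) + B * Im (q v) + C \<le> 0 \<and>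
     (\<forall>c\<in>{1, 2, 3, 4}. 0 \<le> A * Re (q c) + B * Im (q c) + C \<and> (c \<noteq> u \<longrightarrow> c \<noteq> v \<longrightarrow> 0 < A * Re (q c) + B * Im (q c) + C)))"

text \<open>The base drawing leaves the diamond empty and the strip fills it, whatever its number of
  columns. The separating lines keep the two parts apart, so the base is checked once and for all
  \<open>K\<close>.\<close>

theorem columns_linklessly_embeddable:
  fixes q :: "nat \<Rightarrow> complex"
  assumes m: "7 \<le> m" and G: "simple_graph {0..<m} E" "tutte_4_connected {0..<m} E"
    and E5: "E 5 1" "E 5 4" "E 5 0" and E6: "E 6 2" "E 6 4" "E 6 0"
    and nbr5: "\<And>y. E 5 y \<Longrightarrow> y \<in> {0, 1, 3, 4}" and nbr6: "\<And>y. E 6 y \<Longrightarrow> y \<in> {0, 2, 3, 4}"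
    and corners: "q 1 = hub_at True" "q 2 = hub_at False" "q 3 = Complex (- 4) 0" "q 4 = Complex 4 0"
    and outside: "\<And>v. v < m \<Longrightarrow> v \<notin> {0, 1, 2, 3, 4, 5, 6} \<Longrightarrow> 4 < l1 (q v)"
    and sep: "\<And>u v. E u v \<Longrightarrow> u \<notin> {0, 5, 6} \<Longrightarrow> v \<notin> {0, 5, 6} \<Longrightarrow> separated q u v"
    and vtx: "\<And>u v w. E u v \<Longrightarrow> u \<notin> {0, 5, 6} \<Longrightarrow> v \<notin> {0, 5, 6} \<Longrightarrow> w < m \<Longrightarrow> w \<notin> {0, 5, 6} \<Longrightarrow> w \<noteq> u \<Longrightarrow> w \<noteq> v \<Longrightarrow>
      q w \<notin> closed_segment (q u) (q v)"
    and dis: "\<And>u v x y. E u v \<Longrightarrow> E x y \<Longrightarrow> u \<notin> {0, 5, 6} \<Longrightarrow> v \<notin> {0, 5, 6} \<Longrightarrow> x \<notin> {0, 5, 6} \<Longrightarrow> y \<notin> {0, 5, 6} \<Longrightarrow>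
      {u, v} \<inter> {x, y} = {} \<Longrightarrow> closed_segment (q u) (q v) \<inter> closed_segment (q x) (q y) = {}"
  shows "linklessly_embeddable {0..<m + 3 * K} (columns m E K)"
proof -
  let ?V = "{0..<m + 3 * K}" and ?E = "columns m E K"
  have T: "simple_graph ?V ?E" "k_connected ?V ?E 4" using columns_tutte[OF m G E5 E6, of K] by blast+
  have EV: "E u v \<Longrightarrow> u < m \<and> v < m" and Esym: "E u v \<Longrightarrow> E v u" for u v using G(1) unfolding simple_graph_def by auto
  \<comment> \<open>Beyond \<open>m\<close> the remainder modulo 3 tells rib, upper cell and lower
    cell, and the quotient is the column number less one.\<close>
  define P where "P v = (if v = 5 then cell_at K True 0 else if v = 6 then cell_at K False 0 else if v < m then q v
     else if (v - m) mod 3 = 0 then rail_at K (Suc ((v - m) div 3)) else cell_at K ((v - m) mod 3 = 1) (Suc ((v - m) div 3)))" for v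
  have Pq: "P v = q v" if "v < m" "v \<notin> {0, 5, 6}" for v using that by (simp add: P_def)
  have Pcell: "P (cell m \<sigma> i) = cell_at K \<sigma> i" for \<sigma> i
  proof (cases i)
    case 0 then show ?thesis by (simp add: P_def cell_def)
  next
    case (Suc j)
    have "(3 * j + 1) div 3 = j" "(3 * j + 1) mod 3 = 1" "(3 * j + 2) div 3 = j" "(3 * j + 2) mod 3 = 2" by presburger+
    then show ?thesis unfolding Suc using m by (cases \<sigma>) (simp_all add: new_column P_def)
  qed
  have Prail: "P (rail m K j) = rail_at K j" if "j \<le> Suc K" for j
  proof (cases "j = Suc K")
    case True then show ?thesis using m corners(4) strip_x_ends(2)[of K] by (simp add: P_def rail_def rail_at_def)
  next
    case False
    then show ?thesis
    proof (cases j)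
      case 0 then show ?thesis using m corners(3) strip_x_ends(1)[of K] by (simp add: P_def rail_def rib_def rail_at_def)
    next
      case (Suc i) then show ?thesis using m False by (simp add: P_def rail_def new_column)
    qed
  qed
  have Phub: "P (hub \<sigma>) = hub_at \<sigma>" for \<sigma> using m corners by (cases \<sigma>) (simp_all add: P_def hub_def)
  have corner: "(\<exists>\<sigma>. c = hub \<sigma>) \<or> (\<exists>j\<le>Suc K. c = rail m K j)" if "c \<in> {1, 2, 3, 4}" for c
  proof -
    have "hub True = 1" "hub False = 2" "rail m K 0 = 3" "rail m K (Suc K) = 4" by (simp_all add: hub_def rail_def rib_def)
    then show ?thesis using that by (metis empty_iff insert_iff le0 order_refl)
  qed
  have kinds: "(v < m \<and> v \<notin> {0, 5, 6}) \<or> (\<exists>\<sigma> i. i \<le> K \<and> v = cell m \<sigma> i) \<or> (\<exists>j. 0 < j \<and> j \<le> K \<and> v = rail m K j)"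
    if v: "v \<in> ?V" "v \<noteq> 0" for v
  proof (cases "v < m")
    case True
    have "v = 5 \<Longrightarrow> v = cell m True 0" "v = 6 \<Longrightarrow> v = cell m False 0" by (simp_all add: cell_def)
    then show ?thesis using True v by (metis empty_iff insert_iff le0)
  next
    case False
    define j where "j = (v - m) div 3"
    have j: "j < K" using v False unfolding j_def by auto
    have vm: "v = m + 3 * j + (v - m) mod 3" using False unfolding j_def by simp
    have "(v - m) mod 3 < 3" by simp
    then consider "v = m + 3 * j" | "v = m + 3 * j + 1" | "v = m + 3 * j + 2" using vm by linarith
    then show ?thesis
    proof cases
      case 1
      have "v = rail m K (Suc j)" using 1 j by (simp add: rail_def new_column)
      then show ?thesis using j by (metis Suc_leI zero_less_Suc)
    next
      case 2
      have "v = cell m True (Suc j)" unfolding 2 new_column ..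
      then show ?thesis using j by (metis Suc_leI)
    next
      case 3
      have "v = cell m False (Suc j)" unfolding 3 new_column ..
      then show ?thesis using j by (metis Suc_leI)
    qed
  qed
  have inner: "l1 (P v) < 4" if "(\<exists>\<sigma> i. i \<le> K \<and> v = cell m \<sigma> i) \<or> (\<exists>j. 0 < j \<and> j \<le> K \<and> v = rail m K j)" for v
    using that
  proof (elim disjE exE conjE)
    show ?thesis if "i \<le> K" "v = cell m \<sigma> i" for \<sigma> i unfolding that(2) Pcell by (rule l1_cell[OF that(1)])
    show ?thesis if "0 < j" "j \<le> K" "v = rail m K j" for j
      unfolding that(3) using Prail[of j] l1_rail(2)[OF that(1,2)] that(2) by simp
  qed
  \<comment> \<open>Strip edges, directed towards their cell.\<close>
  define SE where "SE x y \<longleftrightarrow> (\<exists>\<sigma> i. i \<le> K \<and> y = cell m \<sigma> i \<and> (x = hub \<sigma> \<or> (\<exists>j\<le>Suc K. (j = i \<or> j = Suc i) \<and> x = rail m K j)))" for x y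
  have SEcases: thesis if "SE x y"
      and "\<And>\<sigma> i. i \<le> K \<Longrightarrow> y = cell m \<sigma> i \<Longrightarrow> x = hub \<sigma> \<Longrightarrow> P x = hub_at \<sigma> \<Longrightarrow> P y = cell_at K \<sigma> i \<Longrightarrow> thesis"
      and "\<And>\<sigma> i j. i \<le> K \<Longrightarrow> j \<le> Suc K \<Longrightarrow> j = i \<or> j = Suc i \<Longrightarrow> y = cell m \<sigma> i \<Longrightarrow> x = rail m K j \<Longrightarrow>
        P x = rail_at K j \<Longrightarrow> P y = cell_at K \<sigma> i \<Longrightarrow> thesis" for x y thesis
    using that(1) unfolding SE_def
  proof (elim exE conjE disjE)
    show thesis if "i \<le> K" "y = cell m \<sigma> i" "x = hub \<sigma>" for \<sigma> i
      by (rule \<open>\<And>\<sigma> i. i \<le> K \<Longrightarrow> y = cell m \<sigma> i \<Longrightarrow> x = hub \<sigma> \<Longrightarrow> P x = hub_at \<sigma> \<Longrightarrow> P y = cell_at K \<sigma> i \<Longrightarrow> thesis\<close>[OF that])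
        (simp_all add: that Phub Pcell)
    show thesis if "i \<le> K" "y = cell m \<sigma> i" "j \<le> Suc K" "j = i" "x = rail m K j" for \<sigma> i j
      by (rule \<open>\<And>\<sigma> i j. i \<le> K \<Longrightarrow> j \<le> Suc K \<Longrightarrow> j = i \<or> j = Suc i \<Longrightarrow> y = cell m \<sigma> i \<Longrightarrow> x = rail m K j \<Longrightarrow>
        P x = rail_at K j \<Longrightarrow> P y = cell_at K \<sigma> i \<Longrightarrow> thesis\<close>[OF that(1,3) disjI1[OF that(4)] that(2,5)])
        (simp_all only: that(2,5) Prail[OF that(3)] Pcell)
    show thesis if "i \<le> K" "y = cell m \<sigma> i" "j \<le> Suc K" "j = Suc i" "x = rail m K j" for \<sigma> i j
      by (rule \<open>\<And>\<sigma> i j. i \<le> K \<Longrightarrow> j \<le> Suc K \<Longrightarrow> j = i \<or> j = Suc i \<Longrightarrow> y = cell m \<sigma> i \<Longrightarrow> x = rail m K j \<Longrightarrow>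
        P x = rail_at K j \<Longrightarrow> P y = cell_at K \<sigma> i \<Longrightarrow> thesis\<close>[OF that(1,3) disjI2[OF that(4)] that(2,5)])
        (simp_all only: that(2,5) Prail[OF that(3)] Pcell)
  qed
  have edges: "(E u v \<and> u \<notin> {0, 5, 6} \<and> v \<notin> {0, 5, 6}) \<or> (\<exists>x y. SE x y \<and> {u, v} = {x, y})"
    if e: "?E u v" "u \<noteq> 0" "v \<noteq> 0" for u v
  proof -
    have "(E u v \<and> u \<notin> {5, 6} \<and> v \<notin> {5, 6}) \<or> (\<exists>\<sigma> i. i \<le> K \<and>
        ({u, v} = {hub \<sigma>, cell m \<sigma> i} \<or> (\<exists>j. (j = i \<or> j = Suc i) \<and> {u, v} = {rail m K j, cell m \<sigma> i})))"
      by (rule columns_edges[OF _ _ _ e]) (erule nbr5, erule nbr6, erule Esym)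
    then show ?thesis
    proof (elim disjE exE conjE)
      show ?thesis if "E u v" "u \<notin> {5, 6}" "v \<notin> {5, 6}" using that e by blast
      show ?thesis if "i \<le> K" "{u, v} = {hub \<sigma>, cell m \<sigma> i}" for \<sigma> i
      proof -
        have "SE (hub \<sigma>) (cell m \<sigma> i)"
          unfolding SE_def by (intro exI[of _ \<sigma>] exI[of _ i] conjI disjI1) (use that in simp_all)
        then show ?thesis using that(2) by (intro disjI2 exI[of _ "hub \<sigma>"] exI[of _ "cell m \<sigma> i"] conjI)
      qed
      show ?thesis if "i \<le> K" "j = i" "{u, v} = {rail m K j, cell m \<sigma> i}" for \<sigma> i j
      proof -
        have "SE (rail m K j) (cell m \<sigma> i)"
          unfolding SE_def
          by (rule exI[of _ \<sigma>], rule exI[of _ i], intro conjI, rule that(1), rule refl, rule disjI2, rule exI[of _ j]) (use that in simp)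
        then show ?thesis using that(3) by (intro disjI2 exI[of _ "rail m K j"] exI[of _ "cell m \<sigma> i"] conjI)
      qed
      show ?thesis if "i \<le> K" "j = Suc i" "{u, v} = {rail m K j, cell m \<sigma> i}" for \<sigma> i j
      proof -
        have "SE (rail m K j) (cell m \<sigma> i)"
          unfolding SE_def
          by (rule exI[of _ \<sigma>], rule exI[of _ i], intro conjI, rule that(1), rule refl, rule disjI2, rule exI[of _ j]) (use that in simp)
        then show ?thesis using that(3) by (intro disjI2 exI[of _ "rail m K j"] exI[of _ "cell m \<sigma> i"] conjI)
      qed
    qed
  qed
  have seg_eq: "closed_segment (P u) (P v) = closed_segment (P x) (P y)" if "{u, v} = {x, y}" for u v x y
    using that unfolding doubleton_eq_iff by (elim disjE conjE) (simp, simp only: closed_segment_commute)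
  define h where "h = 2 / real (Suc K)"
  have h: "0 < h" "h < 4" using height by (simp_all add: h_def)
  note hub_seg = hub_cell_segment[of _ _ K, folded h_def] and rail_seg = rail_cell_level[of _ K, folded h_def]
  have sgn: "sign \<sigma>' = sign \<sigma> \<and> \<sigma>' = \<sigma> \<or> sign \<sigma>' = - sign \<sigma> \<and> \<sigma>' \<noteq> \<sigma>" for \<sigma> \<sigma>' by (simp add: sign_def)
  have sq: "sign \<sigma> * (sign \<sigma> * x) = x" for \<sigma> and x :: real by (simp add: sign_def)
  have Im_at: "Im (hub_at \<sigma>) = sign \<sigma> * 4" "Im (cell_at K \<sigma> i) = sign \<sigma> * h" "Im (rail_at K j) = 0" for \<sigma> i j
    by (simp_all add: hub_at_def cell_at_def rail_at_def h_def)
  have cell_inj: "i = i'" if "cell_at K \<sigma> i = cell_at K \<sigma>' i'" for \<sigma> \<sigma>' i i'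
    using that strip_x_inj[of K "2 * i + 1" "2 * i' + 1"] by (simp add: cell_at_def)
  have rail_inj: "j = j'" if "rail_at K j = rail_at K j'" for j j'
    using that strip_x_inj[of K "2 * j" "2 * j'"] by (simp add: rail_at_def)
  have strip_hub: "P (hub \<sigma>') \<notin> closed_segment (P x) (P y)" if s: "SE x y" and n: "hub \<sigma>' \<noteq> x" for x y \<sigma>'
    using s
  proof (rule SEcases)
    fix \<sigma> i assume a: "x = hub \<sigma>" "P x = hub_at \<sigma>" "P y = cell_at K \<sigma> i"
    have "sign \<sigma>' = - sign \<sigma>" using sgn[of \<sigma>' \<sigma>] n a(1) by auto
    then show ?thesis unfolding a(2,3) Phub using hub_seg(1)[of "hub_at \<sigma>'" \<sigma> i] h by (auto simp: Im_at sq sign_mult(1))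
  next
    fix \<sigma> i j assume a: "P x = rail_at K j" "P y = cell_at K \<sigma> i"
    show ?thesis unfolding a Phub using rail_seg(1,2)[of "hub_at \<sigma>'" j \<sigma> i] h sgn[of \<sigma>' \<sigma>] by (auto simp: Im_at sq sign_mult(1))
  qed
  have strip_rail: "P (rail m K j') \<notin> closed_segment (P x) (P y)" if s: "SE x y" and n: "rail m K j' \<noteq> x" and j': "j' \<le> Suc K" for x y j'
    using s
  proof (rule SEcases)
    fix \<sigma> i assume a: "P x = hub_at \<sigma>" "P y = cell_at K \<sigma> i"
    show ?thesis unfolding a Prail[OF j'] using hub_seg(1)[of "rail_at K j'" \<sigma> i] h by (auto simp: Im_at)
  next
    fix \<sigma> i j assume a: "x = rail m K j" "P x = rail_at K j" "P y = cell_at K \<sigma> i"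
    show ?thesis unfolding a(2,3) Prail[OF j'] using rail_seg(3)[of "rail_at K j'" j \<sigma> i] rail_inj[of j' j] n a(1) by (auto simp: Im_at)
  qed
  have strip_cell: "P (cell m \<sigma>' i') \<notin> closed_segment (P x) (P y)" if s: "SE x y" and n: "cell m \<sigma>' i' \<noteq> y" for x y \<sigma>' i'
    using s
  proof (rule SEcases)
    fix \<sigma> i assume a: "y = cell m \<sigma> i" "P x = hub_at \<sigma>" "P y = cell_at K \<sigma> i"
    show ?thesis unfolding a(2,3) Pcell using sgn[of \<sigma>' \<sigma>] n a(1) hub_seg(1,2)[of "cell_at K \<sigma>' i'" \<sigma> i] cell_inj[of \<sigma>' i' \<sigma> i] h
      by (auto simp: Im_at sq sign_mult(1))
  next
    fix \<sigma> i j assume a: "y = cell m \<sigma> i" "P x = rail_at K j" "P y = cell_at K \<sigma> i"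
    show ?thesis unfolding a(2,3) Pcell using sgn[of \<sigma>' \<sigma>] n a(1) rail_seg(1,4)[of "cell_at K \<sigma>' i'" j \<sigma> i] cell_inj[of \<sigma>' i' \<sigma> i] h
      by (auto simp: Im_at sq sign_mult(1))
  qed
  have strip_l1: "l1 z \<le> 4" if s: "SE x y" and z: "z \<in> closed_segment (P x) (P y)" for x y z
    using s
  proof (rule SEcases)
    fix \<sigma> i assume a: "i \<le> K" "P x = hub_at \<sigma>" "P y = cell_at K \<sigma> i"
    show ?thesis using l1_segment[OF z] l1_hub[of \<sigma>] l1_cell[OF a(1), of \<sigma>] unfolding a(2,3) by simp
  next
    fix \<sigma> i j assume a: "i \<le> K" "j \<le> Suc K" "P x = rail_at K j" "P y = cell_at K \<sigma> i"
    show ?thesis using l1_segment[OF z] l1_rail(1)[OF a(2)] l1_cell[OF a(1), of \<sigma>] unfolding a(3,4) by simp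
  qed
  have sepP: "\<exists>A B C. A * Re (P u) + B * Im (P u) + C \<le> 0 \<and> A * Re (P v) + B * Im (P v) + C \<le> 0 \<and>
      (\<forall>w. l1 (P w) < 4 \<longrightarrow> 0 < A * Re (P w) + B * Im (P w) + C) \<and>
      (\<forall>c\<in>{1, 2, 3, 4}. c \<noteq> u \<longrightarrow> c \<noteq> v \<longrightarrow> 0 < A * Re (P c) + B * Im (P c) + C)"
    if e: "E u v" "u \<notin> {0, 5, 6}" "v \<notin> {0, 5, 6}" for u v
  proof -
    from sep[OF e, unfolded separated_def] obtain A B C where C: "0 < C" "A * Re (q u) + B * Im (q u) + C \<le> 0"
      "A * Re (q v) + B * Im (q v) + C \<le> 0" and c: "\<forall>c\<in>{1, 2, 3, 4}. 0 \<le> A * Re (q c) + B * Im (q c) + C \<and>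
        (c \<noteq> u \<longrightarrow> c \<noteq> v \<longrightarrow> 0 < A * Re (q c) + B * Im (q c) + C)" by (elim exE conjE)
    have "0 \<le> C - 4 * A" "0 \<le> C + 4 * A" "0 \<le> C - 4 * B" "0 \<le> C + 4 * B"
      using c corners by (simp_all add: hub_at_def sign_def)
    note pos = separating_interior[OF C(1) this]
    have uv: "u < m" "v < m" using EV[OF e(1)] by simp_all
    have "P c = q c" if "c \<in> {1, 2, 3, 4}" for c by (rule Pq) (use that m in auto)
    then show ?thesis using C c pos Pq[OF uv(1) e(2)] Pq[OF uv(2) e(3)] by (intro exI[of _ A] exI[of _ B] exI[of _ C]) simp
  qed
  \<comment> \<open>The separating functional is non-positive on the outer edge. It is positive at
    both ends of the strip edge: the cell and the inner rails lie inside the diamond, and a corner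
    is not shared with the outer edge.\<close>
  have outer_strip: "closed_segment (P u) (P v) \<inter> closed_segment (P x) (P y) = {}"
    if e: "E u v" "u \<notin> {0, 5, 6}" "v \<notin> {0, 5, 6}" and s: "SE x y" and d: "{u, v} \<inter> {x, y} = {}" for u v x y
  proof -
    from sepP[OF e] obtain A B C where f: "A * Re (P u) + B * Im (P u) + C \<le> 0" "A * Re (P v) + B * Im (P v) + C \<le> 0"
      and pos': "\<forall>w. l1 (P w) < 4 \<longrightarrow> 0 < A * Re (P w) + B * Im (P w) + C"
      and c': "\<forall>c\<in>{1, 2, 3, 4}. c \<noteq> u \<longrightarrow> c \<noteq> v \<longrightarrow> 0 < A * Re (P c) + B * Im (P c) + C" by (elim exE conjE)
    have pos: "0 < A * Re (P w) + B * Im (P w) + C" if "l1 (P w) < 4" for w using pos' that by (elim allE impE)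
    have c: "0 < A * Re (P c) + B * Im (P c) + C" if "c \<in> {1, 2, 3, 4}" "c \<noteq> u" "c \<noteq> v" for c
      using bspec[OF c' that(1)] that(2,3) by (elim impE)
    have xy: "x \<noteq> u" "x \<noteq> v" using d by auto
    have "0 < A * Re (P x) + B * Im (P x) + C \<and> 0 < A * Re (P y) + B * Im (P y) + C"
      using s
    proof (rule SEcases)
      fix \<sigma> i assume a: "i \<le> K" "y = cell m \<sigma> i" "x = hub \<sigma>"
      have "x \<in> {1, 2, 3, 4}" using a(3) by (simp add: hub_def)
      moreover have "l1 (P y) < 4" using inner a(1,2) by blast
      ultimately show ?thesis using c[of x] xy pos[of y] by (intro conjI)
    next
      fix \<sigma> i j assume a: "i \<le> K" "j \<le> Suc K" "y = cell m \<sigma> i" "x = rail m K j"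
      have "x \<in> {1, 2, 3, 4} \<or> l1 (P x) < 4"
      proof (cases "0 < j \<and> j \<le> K")
        case True then show ?thesis using inner a(4) by blast
      next
        case False
        then have "j = 0 \<or> j = Suc K" using a(2) by linarith
        then show ?thesis using a(4) by (auto simp: rail_def rib_def)
      qed
      then have "0 < A * Re (P x) + B * Im (P x) + C"
        by (elim disjE) (rule c[OF _ xy], assumption, rule pos)
      moreover have "l1 (P y) < 4" using inner a(1,3) by blast
      ultimately show ?thesis using pos[of y] by (intro conjI)
    qed
    note xy_pos = conjunct1[OF this] conjunct2[OF this]
    show ?thesis
    proof (intro equals0I, elim IntE)
      fix z assume z: "z \<in> closed_segment (P u) (P v)" "z \<in> closed_segment (P x) (P y)"
      show False using affine_segment(1)[OF z(1) f] affine_segment(2)[OF z(2) xy_pos] by linarith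
    qed
  qed
  have strip_strip: "closed_segment (P x) (P y) \<inter> closed_segment (P x') (P y') = {}"
    if s: "SE x y" "SE x' y'" and d: "{x, y} \<inter> {x', y'} = {}" for x y x' y'
  proof (rule ccontr)
    assume "closed_segment (P x) (P y) \<inter> closed_segment (P x') (P y') \<noteq> {}"
    then obtain z where z: "z \<in> closed_segment (P x) (P y)" "z \<in> closed_segment (P x') (P y')" by blast
    \<comment> \<open>An edge to a hub and one to a rail can meet only on the level of the cells,
      hence in a common cell.\<close>
    have hr: False if z: "z \<in> closed_segment (hub_at \<sigma>) (cell_at K \<sigma> i)" "z \<in> closed_segment (rail_at K j') (cell_at K \<sigma>' i')"
      and n: "cell m \<sigma> i \<noteq> cell m \<sigma>' i'" for \<sigma> i j' \<sigma>' i'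
    proof (cases "\<sigma>' = \<sigma>")
      case True
      then have "sign \<sigma> * Im z = h" using hub_seg(1)[OF z(1)] rail_seg(2)[OF z(2)] by simp
      then have "cell_at K \<sigma> i = cell_at K \<sigma>' i'" using hub_seg(2)[OF z(1)] rail_seg(4)[OF z(2)] True by simp
      from cell_inj[OF this] show False using n True by simp
    next
      case False
      then have "sign \<sigma>' = - sign \<sigma>" using sgn[of \<sigma>' \<sigma>] by auto
      then show False using hub_seg(1)[OF z(1)] rail_seg(1)[OF z(2)] h(1) by simp
    qed
    from s(1) show False
    proof (rule SEcases)
      fix \<sigma> i assume a: "y = cell m \<sigma> i" "x = hub \<sigma>" "P x = hub_at \<sigma>" "P y = cell_at K \<sigma> i"
      note za = z(1)[unfolded a(3,4)]
      from s(2) show False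
      proof (rule SEcases)
        fix \<sigma>' i' assume b: "y' = cell m \<sigma>' i'" "x' = hub \<sigma>'" "P x' = hub_at \<sigma>'" "P y' = cell_at K \<sigma>' i'"
        note zb = z(2)[unfolded b(3,4)]
        have "sign \<sigma>' = - sign \<sigma>" using sgn[of \<sigma>' \<sigma>] d a(2) b(2) by auto
        then show False using hub_seg(1)[OF za] hub_seg(1)[OF zb] h by simp
      next
        fix \<sigma>' i' j' assume b: "y' = cell m \<sigma>' i'" "x' = rail m K j'" "P x' = rail_at K j'" "P y' = cell_at K \<sigma>' i'"
        show False by (rule hr[OF za z(2)[unfolded b(3,4)]]) (use d a(1) b(1) in auto)
      qed
    next
      fix \<sigma> i j assume a: "j = i \<or> j = Suc i" "y = cell m \<sigma> i" "x = rail m K j" "P x = rail_at K j" "P y = cell_at K \<sigma> i"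
      note za = z(1)[unfolded a(4,5)]
      from s(2) show False
      proof (rule SEcases)
        fix \<sigma>' i' assume b: "y' = cell m \<sigma>' i'" "x' = hub \<sigma>'" "P x' = hub_at \<sigma>'" "P y' = cell_at K \<sigma>' i'"
        show False by (rule hr[OF z(2)[unfolded b(3,4)] za]) (use d a(2) b(1) in auto)
      next
        fix \<sigma>' i' j' assume b: "j' = i' \<or> j' = Suc i'" "y' = cell m \<sigma>' i'" "x' = rail m K j'" "P x' = rail_at K j'" "P y' = cell_at K \<sigma>' i'"
        note zb = z(2)[unfolded b(4,5)]
        have jj: "j \<noteq> j'" using d a(3) b(3) by auto
        show False
        proof (cases "\<sigma>' = \<sigma>")
          case True
          have ii: "i \<noteq> i'" using d a(2) b(2) True by auto
          note zb' = zb[unfolded True]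
          show False
          proof (cases "i < i'")
            case True
            then have "j < j'" using a(1) b(1) jj by linarith
            then show False using rail_cell_disjoint[OF za zb' True] by blast
          next
            case False
            then have i: "i' < i" using ii by simp
            then have "j' < j" using a(1) b(1) jj by linarith
            then show False using rail_cell_disjoint[OF zb' za i] by blast
          qed
        next
          case False
          then have "sign \<sigma>' = - sign \<sigma>" using sgn[of \<sigma>' \<sigma>] by auto
          then have "sign \<sigma> * Im z = 0" using rail_seg(1)[OF za] rail_seg(1)[OF zb] by simp
          then have "Im z = 0" by (simp add: sign_def split: if_splits)
          then show False using rail_seg(3)[OF za] rail_seg(3)[OF zb] rail_inj jj by simp
        qed
      qed
    qed
  qed
  have vtxP: "P w \<notin> closed_segment (P u) (P v)"
    if e: "?E u v" "u \<noteq> 0" "v \<noteq> 0" and w: "w \<in> ?V" "w \<noteq> 0" "w \<noteq> u" "w \<noteq> v" for u v w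
    using edges[OF e]
  proof
    assume a: "E u v \<and> u \<notin> {0, 5, 6} \<and> v \<notin> {0, 5, 6}"
    then have a': "E u v" "u \<notin> {0, 5, 6}" "v \<notin> {0, 5, 6}" by blast+
    have uv: "u < m" "v < m" using EV[OF a'(1)] by blast+
    show ?thesis
    proof (cases "w < m \<and> w \<notin> {0, 5, 6}")
      case True
      then have w': "w < m" "w \<notin> {0, 5, 6}" by blast+
      show ?thesis
        unfolding Pq[OF w'] Pq[OF uv(1) a'(2)] Pq[OF uv(2) a'(3)] by (rule vtx[OF a' w' w(3,4)])
    next
      case False
      then have "l1 (P w) < 4" using kinds[OF w(1,2)] inner by blast
      moreover from sepP[OF a'] obtain A B C where f: "A * Re (P u) + B * Im (P u) + C \<le> 0" "A * Re (P v) + B * Im (P v) + C \<le> 0"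
        and pos: "\<forall>w. l1 (P w) < 4 \<longrightarrow> 0 < A * Re (P w) + B * Im (P w) + C" by (elim exE conjE)
      ultimately have "0 < A * Re (P w) + B * Im (P w) + C" by (elim allE impE)
      then show ?thesis using affine_segment(1)[of "P w", OF _ f(1,2)] by linarith
    qed
  next
    assume "\<exists>x y. SE x y \<and> {u, v} = {x, y}"
    then obtain x y where s: "SE x y" and xy: "{u, v} = {x, y}" by blast
    have "w \<notin> {x, y}" unfolding xy[symmetric] using w(3,4) by simp
    then have wxy: "w \<noteq> x" "w \<noteq> y" by simp_all
    have "P w \<notin> closed_segment (P x) (P y)"
      using kinds[OF w(1,2)]
    proof (elim disjE exE conjE)
      assume w': "w < m" "w \<notin> {0, 5, 6}"
      show ?thesis
      proof (cases "w \<in> {1, 2, 3, 4}")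
        case True
        from corner[OF this] show ?thesis
        proof (elim disjE exE conjE)
          fix \<sigma>' assume a: "w = hub \<sigma>'"
          show ?thesis unfolding a by (rule strip_hub[OF s wxy(1)[unfolded a]])
        next
          fix j' assume j': "j' \<le> Suc K" and a: "w = rail m K j'"
          show ?thesis unfolding a by (rule strip_rail[OF s wxy(1)[unfolded a] j'])
        qed
      next
        case False
        then have "4 < l1 (P w)" using outside[OF w'(1)] w'(2) Pq[OF w'] by simp
        then show ?thesis using strip_l1[OF s, of "P w"] by linarith
      qed
    next
      fix \<sigma>' i' assume a: "w = cell m \<sigma>' i'"
      show ?thesis unfolding a by (rule strip_cell[OF s wxy(2)[unfolded a]])
    next
      fix j' assume j': "j' \<le> K" and a: "w = rail m K j'"
      show ?thesis unfolding a by (rule strip_rail[OF s wxy(1)[unfolded a] le_SucI[OF j']])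
    qed
    then show ?thesis unfolding seg_eq[OF xy] .
  qed
  show ?thesis
  proof (rule apex_linklessly_embeddable[OF T(1), where a = 0 and q = P])
    have nb: "\<exists>y\<in>?V. y \<notin> W \<and> ?E v y" if "v \<in> ?V" "finite W" "card W < 4" "v \<notin> W" for v W
      by (rule nbr_outside[OF T that])
    show "\<forall>v\<in>?V. \<exists>u w. u \<noteq> w \<and> ?E v u \<and> ?E v w"
    proof
      fix v assume v: "v \<in> ?V"
      obtain u where u: "?E v u" using nb[OF v, of "{}"] by auto
      then have "v \<noteq> u" using T(1) unfolding simple_graph_def by blast
      then obtain w where "w \<noteq> u" "?E v w" using nb[OF v, of "{u}"] by auto
      then show "\<exists>u w. u \<noteq> w \<and> ?E v u \<and> ?E v w" using u by blast
    qed
    show "inj_on P (?V - {0})"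
    proof (rule inj_onI, rule ccontr)
      fix v w assume v: "v \<in> ?V - {0}" and w: "w \<in> ?V - {0}" and e: "P v = P w" "v \<noteq> w"
      have "card {0, w} \<le> 2" by (simp add: card_insert_if)
      then obtain y where y: "y \<notin> {0, w}" "?E v y" using nb[of v "{0, w}"] v e(2) by auto
      \<comment> \<open>Distinct positions follow from the vertex condition, applied to an edge at
        \<open>v\<close> that avoids \<open>w\<close> and the apex; minimum degree 4 provides
        it.\<close>
      have "P w \<notin> closed_segment (P v) (P y)" by (rule vtxP) (use y v w e(2) in auto)
      then show False using e(1) by (metis ends_in_segment(1))
    qed
    show "P w \<notin> closed_segment (P u) (P v)"
      if "?E u v" "u \<noteq> 0" "v \<noteq> 0" "w \<in> ?V" "w \<noteq> 0" "w \<noteq> u" "w \<noteq> v" for u v w by (rule vtxP[OF that])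
    show "closed_segment (P u) (P v) \<inter> closed_segment (P x) (P y) = {}"
      if e: "?E u v" "?E x y" "0 \<notin> {u, v}" "0 \<notin> {x, y}" and d: "{u, v} \<inter> {x, y} = {}" for u v x y
    proof -
      have n: "u \<noteq> 0" "v \<noteq> 0" "x \<noteq> 0" "y \<noteq> 0" using e(3,4) by auto
      from edges[OF e(1) n(1,2)] show ?thesis
      proof
        assume a: "E u v \<and> u \<notin> {0, 5, 6} \<and> v \<notin> {0, 5, 6}"
        then have a': "E u v" "u \<notin> {0, 5, 6}" "v \<notin> {0, 5, 6}" by blast+
        from edges[OF e(2) n(3,4)] show ?thesis
        proof
          assume "E x y \<and> x \<notin> {0, 5, 6} \<and> y \<notin> {0, 5, 6}"
          then have b': "E x y" "x \<notin> {0, 5, 6}" "y \<notin> {0, 5, 6}" by blast+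
          have m4: "u < m" "v < m" "x < m" "y < m" using EV[OF a'(1)] EV[OF b'(1)] by simp_all
          show ?thesis
            unfolding Pq[OF m4(1) a'(2)] Pq[OF m4(2) a'(3)] Pq[OF m4(3) b'(2)] Pq[OF m4(4) b'(3)]
            by (rule dis[OF a'(1) b'(1) a'(2,3) b'(2,3) d])
        next
          assume "\<exists>x' y'. SE x' y' \<and> {x, y} = {x', y'}"
          then obtain x' y' where s: "SE x' y'" and xy: "{x, y} = {x', y'}" by blast
          show ?thesis unfolding seg_eq[OF xy] by (rule outer_strip[OF a' s d[unfolded xy]])
        qed
      next
        assume "\<exists>x' y'. SE x' y' \<and> {u, v} = {x', y'}"
        then obtain u' v' where s: "SE u' v'" and uv: "{u, v} = {u', v'}" by blast
        from edges[OF e(2) n(3,4)] show ?thesis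
        proof
          assume "E x y \<and> x \<notin> {0, 5, 6} \<and> y \<notin> {0, 5, 6}"
          then have b': "E x y" "x \<notin> {0, 5, 6}" "y \<notin> {0, 5, 6}" by blast+
          have d': "{x, y} \<inter> {u', v'} = {}" using d unfolding uv by blast
          show ?thesis unfolding seg_eq[OF uv] using outer_strip[OF b' s d'] by blast
        next
          assume "\<exists>x' y'. SE x' y' \<and> {x, y} = {x', y'}"
          then obtain x' y' where s': "SE x' y'" and xy: "{x, y} = {x', y'}" by blast
          show ?thesis unfolding seg_eq[OF uv] seg_eq[OF xy] by (rule strip_strip[OF s s' d[unfolded uv xy]])
        qed
      qed
    qed
  qed
qed

section \<open>Certificates for a base graph\<close>

definition separation_test :: "(nat \<Rightarrow> int \<times> int \<times> int) \<Rightarrow> nat \<times> nat \<Rightarrow> int \<times> int \<times> int \<Rightarrow> bool" where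
  "separation_test co e k =
    (let f = (\<lambda>v. fst k * fst (co v) + fst (snd k) * fst (snd (co v)) + snd (snd k)) in
     0 < snd (snd k) \<and> f (fst e) \<le> 0 \<and> f (snd e) \<le> 0 \<and>
     list_all (\<lambda>c. 0 \<le> f c \<and> (c = fst e \<or> c = snd e \<or> 0 < f c)) [1, 2, 3, 4])"

lemma separation_test_separated:
  assumes "separation_test co (u, v) k"
  shows "separated (\<lambda>v. fst (point_of (co v))) u v" "separated (\<lambda>v. fst (point_of (co v))) v u"
proof -
  obtain A B C where k: "k = (A, B, C)" by (cases k) auto
  define f where "f w = A * fst (co w) + B * fst (snd (co w)) + C" for w
  have t: "0 < C" "f u \<le> 0" "f v \<le> 0" and c: "\<And>c. c \<in> {1, 2, 3, 4} \<Longrightarrow> 0 \<le> f c \<and> (c = u \<or> c = v \<or> 0 < f c)"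
    using assms unfolding separation_test_def k Let_def by (auto simp: f_def)
  have e: "real_of_int A * Re (fst (point_of (co w))) + real_of_int B * Im (fst (point_of (co w))) + real_of_int C = real_of_int (f w)" for w
    by (simp add: point_of_def f_def)
  have *: "separated (\<lambda>v. fst (point_of (co v))) x y" if "f x \<le> 0" "f y \<le> 0" "{x, y} = {u, v}" for x y
    unfolding separated_def
  proof (rule exI[of _ "real_of_int A"], rule exI[of _ "real_of_int B"], rule exI[of _ "real_of_int C"], intro conjI ballI)
    fix w :: nat assume "w \<in> {1, 2, 3, 4}"
    from c[OF this] that(3) show "w \<noteq> x \<longrightarrow> w \<noteq> y \<longrightarrow>
        0 < real_of_int A * Re (fst (point_of (co w))) + real_of_int B * Im (fst (point_of (co w))) + real_of_int C"
      "0 \<le> real_of_int A * Re (fst (point_of (co w))) + real_of_int B * Im (fst (point_of (co w))) + real_of_int C"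
      unfolding e by (auto simp: doubleton_eq_iff)
  qed (use that t in \<open>simp_all add: e\<close>)
  show "separated (\<lambda>v. fst (point_of (co v))) u v" by (rule *) (use t in auto)
  show "separated (\<lambda>v. fst (point_of (co v))) v u" by (rule *) (use t in auto)
qed

text \<open>\<open>W\<close>, \<open>nb'\<close> describe the base graph without the apex \<open>0\<close> and the two triangles \<open>5\<close>, \<open>6\<close>
  that are filled by the strip.\<close>

lemma checked_columns:
  assumes g: "list_graph_ok V nb V" and V: "V = [0..<m]" and m: "7 \<le> m"
    and faces: "list_all (\<lambda>v. v = 0 \<or> mem v (nb 0) \<or> (all_mem (nb v) (nb 0) \<and> distinct (nb v) \<and> 4 \<le> length (nb v))) V"
    and ch: "list_all (\<lambda>j. list_all (survives nb V 0 j) V) V"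
    and nb5: "nb 5 = [0, 1, 3, 4]" and nb6: "nb 6 = [0, 2, 3, 4]"
    and W: "W = [1, 2, 3, 4] @ [7..<m]"
    and sub: "list_all (\<lambda>u. list_all (\<lambda>v. mem v [0, 5, 6] \<or> mem v (nb' u)) (nb u)) W"
    and g': "list_graph_ok W nb' W" and es: "list_all (\<lambda>u. edge_list_for Es u (nb' u)) W"
    and vt: "list_all (\<lambda>e. list_all (vertex_test co e) W) Es" and et: "list_all (\<lambda>e. list_all (edge_test co [] e) Es) Es"
    and corners: "co 1 = (0, 4, 0)" "co 2 = (0, - 4, 0)" "co 3 = (- 4, 0, 0)" "co 4 = (4, 0, 0)"
    and out: "list_all (\<lambda>v. snd (snd (co v)) = 0 \<and> 4 < \<bar>fst (co v)\<bar> + \<bar>fst (snd (co v))\<bar>) [7..<m]"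
    and sep: "list_all2 (separation_test co) Es ks"
  shows "\<exists>E. simple_graph {0..<m + 3 * K} E \<and> linklessly_embeddable {0..<m + 3 * K} E \<and> tutte_4_connected {0..<m + 3 * K} E"
proof -
  let ?E = "list_graph V nb" and ?H = "list_graph W nb'"
  define q where "q v = fst (point_of (co v))" for v
  have setV: "set V = {0..<m}" unfolding V by simp
  note G = list_graph_simple[OF g]
  have con: "k_connected (set V) ?E 4"
    by (rule four_connected_apexI[OF G(1) _ _ _ _ faces ch]) (use m in \<open>simp_all add: V list_all_iff\<close>)
  have tutte: "simple_graph {0..<m} ?E" "tutte_4_connected {0..<m} ?E"
    using G(1,2) con unfolding setV tutte_4_connected_def by blast+
  have E5: "?E 5 y \<longleftrightarrow> y \<in> {0, 1, 3, 4}" and E6: "?E 6 y \<longleftrightarrow> y \<in> {0, 2, 3, 4}" for y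
    using m by (simp_all add: list_graph_def setV nb5 nb6)
  have W': "v \<in> set W" if "v < m" "v \<notin> {0, 5, 6}" for v using that unfolding W by auto
  have EH: "?H u v" if "?E u v" "u \<notin> {0, 5, 6}" "v \<notin> {0, 5, 6}" for u v
  proof -
    have "u \<in> set W" "v \<in> set (nb u)" using that(1,2) W' setV by (auto simp: list_graph_def)
    then have "mem v [0, 5, 6] \<or> mem v (nb' u)" using sub unfolding list_all_iff by blast
    then show ?thesis using \<open>u \<in> set W\<close> that(3) by (simp add: list_graph_def mem_iff)
  qed
  have flat: "point_of (co v) = (q v, 0)" if "v \<in> set W" for v
  proof -
    have "snd (snd (co v)) = 0" using that out corners unfolding W list_all_iff by auto
    then show ?thesis by (simp add: q_def point_of_def)
  qed
  \<comment> \<open>The flat outer graph is checked as a drawing without any crossing.\<close>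
  note D = checked_straight_drawing(1)[OF g' es vt et, simplified]
  have HW: "u \<in> set W \<and> v \<in> set W" if "?H u v" for u v using sd_V[OF D that] .
  have seg: "seg (\<lambda>v. point_of (co v)) u v = closed_segment (q u, 0) (q v, 0)" if "?H u v" for u v
    using HW[OF that] flat by (simp add: seg_def)
  have proj: "fst ` closed_segment (q u, 0 :: real) (q v, 0) = closed_segment (q u) (q v)" for u v
    by (simp add: fst_closed_segment)
  have sepE: "separated q u v" if e: "?E u v" "u \<notin> {0, 5, 6}" "v \<notin> {0, 5, 6}" for u v
  proof -
    have Hs: "?H u v" "?H v u" using EH[OF e] sd_sym[OF D EH[OF e]] by blast+
    have test: "\<exists>k. separation_test co e k" if "e \<in> set Es" for e
    proof -
      from that obtain i where "i < length Es" "e = Es ! i" by (auto simp: in_set_conv_nth)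
      then show ?thesis using list_all2_nthD[OF sep, of i] by blast
    qed
    have "(u, v) \<in> set Es \<or> (v, u) \<in> set Es"
    proof -
      have ne: "u \<noteq> v" using sd_irrefl[OF D] Hs by blast
      have "(x, y) \<in> set Es" if "?H x y" "x < y" for x y
        using es that unfolding list_all_iff edge_list_for_iff list_graph_def by blast
      then show ?thesis using Hs ne by (meson nat_neq_iff)
    qed
    then show ?thesis unfolding q_def using test separation_test_separated by blast
  qed
  have "linklessly_embeddable {0..<m + 3 * K} (columns m ?E K)"
  proof (rule columns_linklessly_embeddable[OF m tutte, where q = q])
    show "?E 5 1" "?E 5 4" "?E 5 0" "?E 6 2" "?E 6 4" "?E 6 0" unfolding E5 E6 by simp_all
    show "y \<in> {0, 1, 3, 4}" if "?E 5 y" for y using that unfolding E5 .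
    show "y \<in> {0, 2, 3, 4}" if "?E 6 y" for y using that unfolding E6 .
    show "q 1 = hub_at True" "q 2 = hub_at False" "q 3 = Complex (- 4) 0" "q 4 = Complex 4 0"
      using corners by (simp_all add: q_def point_of_def hub_at_def sign_def)
    show "separated q u v" if "?E u v" "u \<notin> {0, 5, 6}" "v \<notin> {0, 5, 6}" for u v by (rule sepE[OF that])
  next
    fix v :: nat assume v: "v < m" "v \<notin> {0, 1, 2, 3, 4, 5, 6}"
    then have "v \<in> set [7..<m]" by auto
    then have "4 < \<bar>fst (co v)\<bar> + \<bar>fst (snd (co v))\<bar>" using out unfolding list_all_iff by blast
    then have "real_of_int 4 < real_of_int (\<bar>fst (co v)\<bar> + \<bar>fst (snd (co v))\<bar>)" by (simp only: of_int_less_iff)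
    then show "4 < l1 (q v)" by (simp add: l1_def q_def point_of_def)
  next
    fix u v w assume e: "?E u v" "u \<notin> {0, 5, 6}" "v \<notin> {0, 5, 6}" and w: "w < m" "w \<notin> {0, 5, 6}" "w \<noteq> u" "w \<noteq> v"
    from sd_vertex[OF D EH[OF e] W'[OF w(1,2)] w(3,4)] show "q w \<notin> closed_segment (q u) (q v)"
      unfolding seg[OF EH[OF e]] proj by (simp add: q_def)
  next
    fix u v x y assume e: "?E u v" "?E x y" "u \<notin> {0, 5, 6}" "v \<notin> {0, 5, 6}" "x \<notin> {0, 5, 6}" "y \<notin> {0, 5, 6}"
      and d: "{u, v} \<inter> {x, y} = {}"
    note H1 = EH[OF e(1,3,4)] and H2 = EH[OF e(2,5,6)]
    have flat0: "snd p = 0" if "p \<in> closed_segment (q u, 0) (q v, 0 :: real)" for p u v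
      using that unfolding in_segment by auto
    \<comment> \<open>With all heights 0, \<open>over\<close> can hold only vacuously, so the
      drawing conditions amount to disjoint projections.\<close>
    have "fst ` closed_segment (q u, 0 :: real) (q v, 0) \<inter> fst ` closed_segment (q x, 0 :: real) (q y, 0) = {}"
    proof (intro equals0I, elim IntE imageE)
      fix z p r assume p: "z = fst p" "p \<in> closed_segment (q u, 0) (q v, 0 :: real)"
        and r: "z = fst r" "r \<in> closed_segment (q x, 0) (q y, 0 :: real)"
      have "snd r < snd p \<or> snd p < snd r"
        using sd_over[OF D H1 H2 d] p r unfolding seg[OF H1] seg[OF H2] over_def by metis
      then show False using flat0[OF p(2)] flat0[OF r(2)] by simp
    qed
    then show "closed_segment (q u) (q v) \<inter> closed_segment (q x) (q y) = {}" unfolding proj .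
  qed
  moreover have "simple_graph {0..<m + 3 * K} (columns m ?E K) \<and> tutte_4_connected {0..<m + 3 * K} (columns m ?E K)"
    using columns_tutte[OF m tutte, of K] E5 E6 unfolding tutte_4_connected_def by simp
  ultimately show ?thesis by blast
qed

section \<open>Explicit drawings\<close>

lemma checked_drawing_tutte:
  assumes g: "list_graph_ok V nb V" and es: "list_all (\<lambda>u. edge_list_for Es u (nb u)) V"
    and vt: "list_all (\<lambda>e. list_all (vertex_test co e) V) Es"
    and et: "list_all (\<lambda>e. list_all (edge_test co X e) Es) Es"
    and xt: "list_all (crossing_test co X) X"
    and quads: "pairwise_ok (quad_free nb V) X" and triples: "triplewise_ok (triple_ok nb V X) X"
    and con: "list_all (\<lambda>i. list_all (\<lambda>j. list_all (survives nb V i j) V) V) V"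
    and len: "distinct V" "5 \<le> length V"
  shows "\<exists>E. simple_graph (set V) E \<and> linklessly_embeddable (set V) E \<and> tutte_4_connected (set V) E"
proof (intro exI conjI)
  show "simple_graph (set V) (list_graph V nb)" by (rule list_graph_simple(1)[OF g])
  show "linklessly_embeddable (set V) (list_graph V nb)"
    by (rule checked_drawing_linkless[OF checked_straight_drawing[OF g es vt et xt] _ quads triples]) (simp add: list_graph_def)
  show "tutte_4_connected (set V) (list_graph V nb)"
    unfolding tutte_4_connected_def
    by (intro conjI checked_4_connected[OF list_graph_simple(1)[OF g] len con] list_graph_simple(2)[OF g])
qed

text \<open>Named labels with tables of their equalities keep the evaluation of the searches by rewriting short.\<close>

definition x0 :: nat where "x0 = 0"
definition x1 :: nat where "x1 = 1"
definition x2 :: nat where "x2 = 2"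
definition x3 :: nat where "x3 = 3"
definition x4 :: nat where "x4 = 4"
definition x5 :: nat where "x5 = 5"
definition x6 :: nat where "x6 = 6"
definition x7 :: nat where "x7 = 7"
definition x8 :: nat where "x8 = 8"
definition x9 :: nat where "x9 = 9"
definition x10 :: nat where "x10 = 10"
definition x11 :: nat where "x11 = 11"
definition x12 :: nat where "x12 = 12"
definition x13 :: nat where "x13 = 13"
definition x14 :: nat where "x14 = 14"
definition x15 :: nat where "x15 = 15"
definition x16 :: nat where "x16 = 16"
definition x17 :: nat where "x17 = 17"
definition x18 :: nat where "x18 = 18"
definition x19 :: nat where "x19 = 19"

lemmas label_defs =
  x0_def x1_def x2_def x3_def x4_def x5_def x6_def x7_def x8_def x9_def x10_def x11_def x12_def x13_def x14_def x15_def x16_def x17_def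
  x18_def x19_def

lemma label_eq:
  "(x0 = x0) = True" "(x0 = x1) = False" "(x0 = x2) = False" "(x0 = x3) = False" "(x0 = x4) = False" "(x0 = x5) = False"
  "(x0 = x6) = False" "(x0 = x7) = False" "(x0 = x8) = False" "(x0 = x9) = False" "(x0 = x10) = False" "(x0 = x11) = False"
  "(x0 = x12) = False" "(x0 = x13) = False" "(x0 = x14) = False" "(x0 = x15) = False" "(x0 = x16) = False" "(x0 = x17) = False"
  "(x0 = x18) = False" "(x0 = x19) = False" "(x1 = x0) = False" "(x1 = x1) = True" "(x1 = x2) = False" "(x1 = x3) = False"
  "(x1 = x4) = False" "(x1 = x5) = False" "(x1 = x6) = False" "(x1 = x7) = False" "(x1 = x8) = False" "(x1 = x9) = False"
  "(x1 = x10) = False" "(x1 = x11) = False" "(x1 = x12) = False" "(x1 = x13) = False" "(x1 = x14) = False" "(x1 = x15) = False"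
  "(x1 = x16) = False" "(x1 = x17) = False" "(x1 = x18) = False" "(x1 = x19) = False" "(x2 = x0) = False" "(x2 = x1) = False"
  "(x2 = x2) = True" "(x2 = x3) = False" "(x2 = x4) = False" "(x2 = x5) = False" "(x2 = x6) = False" "(x2 = x7) = False"
  "(x2 = x8) = False" "(x2 = x9) = False" "(x2 = x10) = False" "(x2 = x11) = False" "(x2 = x12) = False" "(x2 = x13) = False"
  "(x2 = x14) = False" "(x2 = x15) = False" "(x2 = x16) = False" "(x2 = x17) = False" "(x2 = x18) = False" "(x2 = x19) = False"
  "(x3 = x0) = False" "(x3 = x1) = False" "(x3 = x2) = False" "(x3 = x3) = True" "(x3 = x4) = False" "(x3 = x5) = False"
  "(x3 = x6) = False" "(x3 = x7) = False" "(x3 = x8) = False" "(x3 = x9) = False" "(x3 = x10) = False" "(x3 = x11) = False"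
  "(x3 = x12) = False" "(x3 = x13) = False" "(x3 = x14) = False" "(x3 = x15) = False" "(x3 = x16) = False" "(x3 = x17) = False"
  "(x3 = x18) = False" "(x3 = x19) = False" "(x4 = x0) = False" "(x4 = x1) = False" "(x4 = x2) = False" "(x4 = x3) = False"
  "(x4 = x4) = True" "(x4 = x5) = False" "(x4 = x6) = False" "(x4 = x7) = False" "(x4 = x8) = False" "(x4 = x9) = False"
  "(x4 = x10) = False" "(x4 = x11) = False" "(x4 = x12) = False" "(x4 = x13) = False" "(x4 = x14) = False" "(x4 = x15) = False"
  "(x4 = x16) = False" "(x4 = x17) = False" "(x4 = x18) = False" "(x4 = x19) = False" "(x5 = x0) = False" "(x5 = x1) = False"
  "(x5 = x2) = False" "(x5 = x3) = False" "(x5 = x4) = False" "(x5 = x5) = True" "(x5 = x6) = False" "(x5 = x7) = False"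
  "(x5 = x8) = False" "(x5 = x9) = False" "(x5 = x10) = False" "(x5 = x11) = False" "(x5 = x12) = False" "(x5 = x13) = False"
  "(x5 = x14) = False" "(x5 = x15) = False" "(x5 = x16) = False" "(x5 = x17) = False" "(x5 = x18) = False" "(x5 = x19) = False"
  "(x6 = x0) = False" "(x6 = x1) = False" "(x6 = x2) = False" "(x6 = x3) = False" "(x6 = x4) = False" "(x6 = x5) = False"
  "(x6 = x6) = True" "(x6 = x7) = False" "(x6 = x8) = False" "(x6 = x9) = False" "(x6 = x10) = False" "(x6 = x11) = False"
  "(x6 = x12) = False" "(x6 = x13) = False" "(x6 = x14) = False" "(x6 = x15) = False" "(x6 = x16) = False" "(x6 = x17) = False"
  "(x6 = x18) = False" "(x6 = x19) = False" "(x7 = x0) = False" "(x7 = x1) = False" "(x7 = x2) = False" "(x7 = x3) = False"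
  "(x7 = x4) = False" "(x7 = x5) = False" "(x7 = x6) = False" "(x7 = x7) = True" "(x7 = x8) = False" "(x7 = x9) = False"
  "(x7 = x10) = False" "(x7 = x11) = False" "(x7 = x12) = False" "(x7 = x13) = False" "(x7 = x14) = False" "(x7 = x15) = False"
  "(x7 = x16) = False" "(x7 = x17) = False" "(x7 = x18) = False" "(x7 = x19) = False" "(x8 = x0) = False" "(x8 = x1) = False"
  "(x8 = x2) = False" "(x8 = x3) = False" "(x8 = x4) = False" "(x8 = x5) = False" "(x8 = x6) = False" "(x8 = x7) = False"
  "(x8 = x8) = True" "(x8 = x9) = False" "(x8 = x10) = False" "(x8 = x11) = False" "(x8 = x12) = False" "(x8 = x13) = False"
  "(x8 = x14) = False" "(x8 = x15) = False" "(x8 = x16) = False" "(x8 = x17) = False" "(x8 = x18) = False" "(x8 = x19) = False"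
  "(x9 = x0) = False" "(x9 = x1) = False" "(x9 = x2) = False" "(x9 = x3) = False" "(x9 = x4) = False" "(x9 = x5) = False"
  "(x9 = x6) = False" "(x9 = x7) = False" "(x9 = x8) = False" "(x9 = x9) = True" "(x9 = x10) = False" "(x9 = x11) = False"
  "(x9 = x12) = False" "(x9 = x13) = False" "(x9 = x14) = False" "(x9 = x15) = False" "(x9 = x16) = False" "(x9 = x17) = False"
  "(x9 = x18) = False" "(x9 = x19) = False" "(x10 = x0) = False" "(x10 = x1) = False" "(x10 = x2) = False" "(x10 = x3) = False"
  "(x10 = x4) = False" "(x10 = x5) = False" "(x10 = x6) = False" "(x10 = x7) = False" "(x10 = x8) = False" "(x10 = x9) = False"
  "(x10 = x10) = True" "(x10 = x11) = False" "(x10 = x12) = False" "(x10 = x13) = False" "(x10 = x14) = False" "(x10 = x15) = False"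
  "(x10 = x16) = False" "(x10 = x17) = False" "(x10 = x18) = False" "(x10 = x19) = False" "(x11 = x0) = False" "(x11 = x1) = False"
  "(x11 = x2) = False" "(x11 = x3) = False" "(x11 = x4) = False" "(x11 = x5) = False" "(x11 = x6) = False" "(x11 = x7) = False"
  "(x11 = x8) = False" "(x11 = x9) = False" "(x11 = x10) = False" "(x11 = x11) = True" "(x11 = x12) = False" "(x11 = x13) = False"
  "(x11 = x14) = False" "(x11 = x15) = False" "(x11 = x16) = False" "(x11 = x17) = False" "(x11 = x18) = False" "(x11 = x19) = False"
  "(x12 = x0) = False" "(x12 = x1) = False" "(x12 = x2) = False" "(x12 = x3) = False" "(x12 = x4) = False" "(x12 = x5) = False"
  "(x12 = x6) = False" "(x12 = x7) = False" "(x12 = x8) = False" "(x12 = x9) = False" "(x12 = x10) = False" "(x12 = x11) = False"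
  "(x12 = x12) = True" "(x12 = x13) = False" "(x12 = x14) = False" "(x12 = x15) = False" "(x12 = x16) = False" "(x12 = x17) = False"
  "(x12 = x18) = False" "(x12 = x19) = False" "(x13 = x0) = False" "(x13 = x1) = False" "(x13 = x2) = False" "(x13 = x3) = False"
  "(x13 = x4) = False" "(x13 = x5) = False" "(x13 = x6) = False" "(x13 = x7) = False" "(x13 = x8) = False" "(x13 = x9) = False"
  "(x13 = x10) = False" "(x13 = x11) = False" "(x13 = x12) = False" "(x13 = x13) = True" "(x13 = x14) = False" "(x13 = x15) = False"
  "(x13 = x16) = False" "(x13 = x17) = False" "(x13 = x18) = False" "(x13 = x19) = False" "(x14 = x0) = False" "(x14 = x1) = False"
  "(x14 = x2) = False" "(x14 = x3) = False" "(x14 = x4) = False" "(x14 = x5) = False" "(x14 = x6) = False" "(x14 = x7) = False"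
  "(x14 = x8) = False" "(x14 = x9) = False" "(x14 = x10) = False" "(x14 = x11) = False" "(x14 = x12) = False" "(x14 = x13) = False"
  "(x14 = x14) = True" "(x14 = x15) = False" "(x14 = x16) = False" "(x14 = x17) = False" "(x14 = x18) = False" "(x14 = x19) = False"
  "(x15 = x0) = False" "(x15 = x1) = False" "(x15 = x2) = False" "(x15 = x3) = False" "(x15 = x4) = False" "(x15 = x5) = False"
  "(x15 = x6) = False" "(x15 = x7) = False" "(x15 = x8) = False" "(x15 = x9) = False" "(x15 = x10) = False" "(x15 = x11) = False"
  "(x15 = x12) = False" "(x15 = x13) = False" "(x15 = x14) = False" "(x15 = x15) = True" "(x15 = x16) = False" "(x15 = x17) = False"
  "(x15 = x18) = False" "(x15 = x19) = False" "(x16 = x0) = False" "(x16 = x1) = False" "(x16 = x2) = False" "(x16 = x3) = False"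
  "(x16 = x4) = False" "(x16 = x5) = False" "(x16 = x6) = False" "(x16 = x7) = False" "(x16 = x8) = False" "(x16 = x9) = False"
  "(x16 = x10) = False" "(x16 = x11) = False" "(x16 = x12) = False" "(x16 = x13) = False" "(x16 = x14) = False" "(x16 = x15) = False"
  "(x16 = x16) = True" "(x16 = x17) = False" "(x16 = x18) = False" "(x16 = x19) = False" "(x17 = x0) = False" "(x17 = x1) = False"
  "(x17 = x2) = False" "(x17 = x3) = False" "(x17 = x4) = False" "(x17 = x5) = False" "(x17 = x6) = False" "(x17 = x7) = False"
  "(x17 = x8) = False" "(x17 = x9) = False" "(x17 = x10) = False" "(x17 = x11) = False" "(x17 = x12) = False" "(x17 = x13) = False"
  "(x17 = x14) = False" "(x17 = x15) = False" "(x17 = x16) = False" "(x17 = x17) = True" "(x17 = x18) = False" "(x17 = x19) = False"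
  "(x18 = x0) = False" "(x18 = x1) = False" "(x18 = x2) = False" "(x18 = x3) = False" "(x18 = x4) = False" "(x18 = x5) = False"
  "(x18 = x6) = False" "(x18 = x7) = False" "(x18 = x8) = False" "(x18 = x9) = False" "(x18 = x10) = False" "(x18 = x11) = False"
  "(x18 = x12) = False" "(x18 = x13) = False" "(x18 = x14) = False" "(x18 = x15) = False" "(x18 = x16) = False" "(x18 = x17) = False"
  "(x18 = x18) = True" "(x18 = x19) = False" "(x19 = x0) = False" "(x19 = x1) = False" "(x19 = x2) = False" "(x19 = x3) = False"
  "(x19 = x4) = False" "(x19 = x5) = False" "(x19 = x6) = False" "(x19 = x7) = False" "(x19 = x8) = False" "(x19 = x9) = False"
  "(x19 = x10) = False" "(x19 = x11) = False" "(x19 = x12) = False" "(x19 = x13) = False" "(x19 = x14) = False" "(x19 = x15) = False"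
  "(x19 = x16) = False" "(x19 = x17) = False" "(x19 = x18) = False" "(x19 = x19) = True"
  by (simp_all add: label_defs)

lemma label_less:
  "(x0 < x0) = False" "(x0 < x1) = True" "(x0 < x2) = True" "(x0 < x3) = True" "(x0 < x4) = True" "(x0 < x5) = True" "(x0 < x6) = True"
  "(x0 < x7) = True" "(x0 < x8) = True" "(x0 < x9) = True" "(x0 < x10) = True" "(x0 < x11) = True" "(x0 < x12) = True" "(x0 < x13) = True"
  "(x0 < x14) = True" "(x0 < x15) = True" "(x0 < x16) = True" "(x0 < x17) = True" "(x0 < x18) = True" "(x0 < x19) = True"
  "(x1 < x0) = False" "(x1 < x1) = False" "(x1 < x2) = True" "(x1 < x3) = True" "(x1 < x4) = True" "(x1 < x5) = True" "(x1 < x6) = True"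
  "(x1 < x7) = True" "(x1 < x8) = True" "(x1 < x9) = True" "(x1 < x10) = True" "(x1 < x11) = True" "(x1 < x12) = True" "(x1 < x13) = True"
  "(x1 < x14) = True" "(x1 < x15) = True" "(x1 < x16) = True" "(x1 < x17) = True" "(x1 < x18) = True" "(x1 < x19) = True"
  "(x2 < x0) = False" "(x2 < x1) = False" "(x2 < x2) = False" "(x2 < x3) = True" "(x2 < x4) = True" "(x2 < x5) = True" "(x2 < x6) = True"
  "(x2 < x7) = True" "(x2 < x8) = True" "(x2 < x9) = True" "(x2 < x10) = True" "(x2 < x11) = True" "(x2 < x12) = True" "(x2 < x13) = True"
  "(x2 < x14) = True" "(x2 < x15) = True" "(x2 < x16) = True" "(x2 < x17) = True" "(x2 < x18) = True" "(x2 < x19) = True"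
  "(x3 < x0) = False" "(x3 < x1) = False" "(x3 < x2) = False" "(x3 < x3) = False" "(x3 < x4) = True" "(x3 < x5) = True" "(x3 < x6) = True"
  "(x3 < x7) = True" "(x3 < x8) = True" "(x3 < x9) = True" "(x3 < x10) = True" "(x3 < x11) = True" "(x3 < x12) = True" "(x3 < x13) = True"
  "(x3 < x14) = True" "(x3 < x15) = True" "(x3 < x16) = True" "(x3 < x17) = True" "(x3 < x18) = True" "(x3 < x19) = True"
  "(x4 < x0) = False" "(x4 < x1) = False" "(x4 < x2) = False" "(x4 < x3) = False" "(x4 < x4) = False" "(x4 < x5) = True" "(x4 < x6) = True"
  "(x4 < x7) = True" "(x4 < x8) = True" "(x4 < x9) = True" "(x4 < x10) = True" "(x4 < x11) = True" "(x4 < x12) = True" "(x4 < x13) = True"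
  "(x4 < x14) = True" "(x4 < x15) = True" "(x4 < x16) = True" "(x4 < x17) = True" "(x4 < x18) = True" "(x4 < x19) = True"
  "(x5 < x0) = False" "(x5 < x1) = False" "(x5 < x2) = False" "(x5 < x3) = False" "(x5 < x4) = False" "(x5 < x5) = False"
  "(x5 < x6) = True" "(x5 < x7) = True" "(x5 < x8) = True" "(x5 < x9) = True" "(x5 < x10) = True" "(x5 < x11) = True" "(x5 < x12) = True"
  "(x5 < x13) = True" "(x5 < x14) = True" "(x5 < x15) = True" "(x5 < x16) = True" "(x5 < x17) = True" "(x5 < x18) = True"
  "(x5 < x19) = True" "(x6 < x0) = False" "(x6 < x1) = False" "(x6 < x2) = False" "(x6 < x3) = False" "(x6 < x4) = False"
  "(x6 < x5) = False" "(x6 < x6) = False" "(x6 < x7) = True" "(x6 < x8) = True" "(x6 < x9) = True" "(x6 < x10) = True" "(x6 < x11) = True"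
  "(x6 < x12) = True" "(x6 < x13) = True" "(x6 < x14) = True" "(x6 < x15) = True" "(x6 < x16) = True" "(x6 < x17) = True"
  "(x6 < x18) = True" "(x6 < x19) = True" "(x7 < x0) = False" "(x7 < x1) = False" "(x7 < x2) = False" "(x7 < x3) = False"
  "(x7 < x4) = False" "(x7 < x5) = False" "(x7 < x6) = False" "(x7 < x7) = False" "(x7 < x8) = True" "(x7 < x9) = True" "(x7 < x10) = True"
  "(x7 < x11) = True" "(x7 < x12) = True" "(x7 < x13) = True" "(x7 < x14) = True" "(x7 < x15) = True" "(x7 < x16) = True"
  "(x7 < x17) = True" "(x7 < x18) = True" "(x7 < x19) = True" "(x8 < x0) = False" "(x8 < x1) = False" "(x8 < x2) = False"
  "(x8 < x3) = False" "(x8 < x4) = False" "(x8 < x5) = False" "(x8 < x6) = False" "(x8 < x7) = False" "(x8 < x8) = False"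
  "(x8 < x9) = True" "(x8 < x10) = True" "(x8 < x11) = True" "(x8 < x12) = True" "(x8 < x13) = True" "(x8 < x14) = True"
  "(x8 < x15) = True" "(x8 < x16) = True" "(x8 < x17) = True" "(x8 < x18) = True" "(x8 < x19) = True" "(x9 < x0) = False"
  "(x9 < x1) = False" "(x9 < x2) = False" "(x9 < x3) = False" "(x9 < x4) = False" "(x9 < x5) = False" "(x9 < x6) = False"
  "(x9 < x7) = False" "(x9 < x8) = False" "(x9 < x9) = False" "(x9 < x10) = True" "(x9 < x11) = True" "(x9 < x12) = True"
  "(x9 < x13) = True" "(x9 < x14) = True" "(x9 < x15) = True" "(x9 < x16) = True" "(x9 < x17) = True" "(x9 < x18) = True"
  "(x9 < x19) = True" "(x10 < x0) = False" "(x10 < x1) = False" "(x10 < x2) = False" "(x10 < x3) = False" "(x10 < x4) = False"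
  "(x10 < x5) = False" "(x10 < x6) = False" "(x10 < x7) = False" "(x10 < x8) = False" "(x10 < x9) = False" "(x10 < x10) = False"
  "(x10 < x11) = True" "(x10 < x12) = True" "(x10 < x13) = True" "(x10 < x14) = True" "(x10 < x15) = True" "(x10 < x16) = True"
  "(x10 < x17) = True" "(x10 < x18) = True" "(x10 < x19) = True" "(x11 < x0) = False" "(x11 < x1) = False" "(x11 < x2) = False"
  "(x11 < x3) = False" "(x11 < x4) = False" "(x11 < x5) = False" "(x11 < x6) = False" "(x11 < x7) = False" "(x11 < x8) = False"
  "(x11 < x9) = False" "(x11 < x10) = False" "(x11 < x11) = False" "(x11 < x12) = True" "(x11 < x13) = True" "(x11 < x14) = True"
  "(x11 < x15) = True" "(x11 < x16) = True" "(x11 < x17) = True" "(x11 < x18) = True" "(x11 < x19) = True" "(x12 < x0) = False"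
  "(x12 < x1) = False" "(x12 < x2) = False" "(x12 < x3) = False" "(x12 < x4) = False" "(x12 < x5) = False" "(x12 < x6) = False"
  "(x12 < x7) = False" "(x12 < x8) = False" "(x12 < x9) = False" "(x12 < x10) = False" "(x12 < x11) = False" "(x12 < x12) = False"
  "(x12 < x13) = True" "(x12 < x14) = True" "(x12 < x15) = True" "(x12 < x16) = True" "(x12 < x17) = True" "(x12 < x18) = True"
  "(x12 < x19) = True" "(x13 < x0) = False" "(x13 < x1) = False" "(x13 < x2) = False" "(x13 < x3) = False" "(x13 < x4) = False"
  "(x13 < x5) = False" "(x13 < x6) = False" "(x13 < x7) = False" "(x13 < x8) = False" "(x13 < x9) = False" "(x13 < x10) = False"
  "(x13 < x11) = False" "(x13 < x12) = False" "(x13 < x13) = False" "(x13 < x14) = True" "(x13 < x15) = True" "(x13 < x16) = True"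
  "(x13 < x17) = True" "(x13 < x18) = True" "(x13 < x19) = True" "(x14 < x0) = False" "(x14 < x1) = False" "(x14 < x2) = False"
  "(x14 < x3) = False" "(x14 < x4) = False" "(x14 < x5) = False" "(x14 < x6) = False" "(x14 < x7) = False" "(x14 < x8) = False"
  "(x14 < x9) = False" "(x14 < x10) = False" "(x14 < x11) = False" "(x14 < x12) = False" "(x14 < x13) = False" "(x14 < x14) = False"
  "(x14 < x15) = True" "(x14 < x16) = True" "(x14 < x17) = True" "(x14 < x18) = True" "(x14 < x19) = True" "(x15 < x0) = False"
  "(x15 < x1) = False" "(x15 < x2) = False" "(x15 < x3) = False" "(x15 < x4) = False" "(x15 < x5) = False" "(x15 < x6) = False"
  "(x15 < x7) = False" "(x15 < x8) = False" "(x15 < x9) = False" "(x15 < x10) = False" "(x15 < x11) = False" "(x15 < x12) = False"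
  "(x15 < x13) = False" "(x15 < x14) = False" "(x15 < x15) = False" "(x15 < x16) = True" "(x15 < x17) = True" "(x15 < x18) = True"
  "(x15 < x19) = True" "(x16 < x0) = False" "(x16 < x1) = False" "(x16 < x2) = False" "(x16 < x3) = False" "(x16 < x4) = False"
  "(x16 < x5) = False" "(x16 < x6) = False" "(x16 < x7) = False" "(x16 < x8) = False" "(x16 < x9) = False" "(x16 < x10) = False"
  "(x16 < x11) = False" "(x16 < x12) = False" "(x16 < x13) = False" "(x16 < x14) = False" "(x16 < x15) = False" "(x16 < x16) = False"
  "(x16 < x17) = True" "(x16 < x18) = True" "(x16 < x19) = True" "(x17 < x0) = False" "(x17 < x1) = False" "(x17 < x2) = False"
  "(x17 < x3) = False" "(x17 < x4) = False" "(x17 < x5) = False" "(x17 < x6) = False" "(x17 < x7) = False" "(x17 < x8) = False"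
  "(x17 < x9) = False" "(x17 < x10) = False" "(x17 < x11) = False" "(x17 < x12) = False" "(x17 < x13) = False" "(x17 < x14) = False"
  "(x17 < x15) = False" "(x17 < x16) = False" "(x17 < x17) = False" "(x17 < x18) = True" "(x17 < x19) = True" "(x18 < x0) = False"
  "(x18 < x1) = False" "(x18 < x2) = False" "(x18 < x3) = False" "(x18 < x4) = False" "(x18 < x5) = False" "(x18 < x6) = False"
  "(x18 < x7) = False" "(x18 < x8) = False" "(x18 < x9) = False" "(x18 < x10) = False" "(x18 < x11) = False" "(x18 < x12) = False"
  "(x18 < x13) = False" "(x18 < x14) = False" "(x18 < x15) = False" "(x18 < x16) = False" "(x18 < x17) = False" "(x18 < x18) = False"
  "(x18 < x19) = True" "(x19 < x0) = False" "(x19 < x1) = False" "(x19 < x2) = False" "(x19 < x3) = False" "(x19 < x4) = False"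
  "(x19 < x5) = False" "(x19 < x6) = False" "(x19 < x7) = False" "(x19 < x8) = False" "(x19 < x9) = False" "(x19 < x10) = False"
  "(x19 < x11) = False" "(x19 < x12) = False" "(x19 < x13) = False" "(x19 < x14) = False" "(x19 < x15) = False" "(x19 < x16) = False"
  "(x19 < x17) = False" "(x19 < x18) = False" "(x19 < x19) = False"
  by (simp_all add: label_defs)

lemmas eval = list.pred_inject list.distinct list.inject list.sel length_Cons list.size(3) nat.inject nat.distinct simp_thms if_True if_False fst_conv snd_conv
  label_eq label_less

lemmas search_eval = mem.simps all_mem.simps any_mem.simps two_mem.simps keep.simps peel_next_def peel.simps
  remove_all.simps shrink_def visit_def scan.simps search.simps forced.simps admissible_def misses_def
  quad_fin_def quad_free_def triple_fin_def nonempty_def edge_vertices_def triple_ok_def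
  pairwise_ok.simps triplewise_ok.simps eval

lemmas winding_eval = same_edge_def edge_index.simps cycle_index_def ahead_def behind_def
  all_pairs.simps try_starts.simps positions.simps label_defs

lemmas drawing_eval = above_test_def orient_def cross_z_def gap_def vertex_test_def edge_test_def crossing_test_def
  list_graph_ok.simps two_distinct_def edge_list_for.simps mem.simps any_mem.simps label_eq label_less

lemmas connectivity_eval = survives_def sweep.simps absorbs.simps remove_all.simps mem.simps any_mem.simps eval

section \<open>The graph on 13 vertices\<close>

definition vs13 :: "nat list" where "vs13 = [x0, x1, x2, x3, x4, x5, x6, x7, x8, x9, x10, x11, x12]"

text \<open>The circulant graph on the integers modulo 13 with differences 1 and 3.\<close>

definition nb13 :: "nat \<Rightarrow> nat list" where
  "nb13 v = [[x1, x3, x10, x12], [x0, x2, x4, x11], [x1, x3, x5, x12], [x0, x2, x4, x6], [x1, x3, x5, x7], [x2, x4, x6, x8], [x3, x5, x7, x9], [x4, x6, x8, x10], [x5, x7, x9, x11], [x6, x8, x10, x12], [x0, x7, x9, x11], [x1, x8, x10, x12], [x0, x2, x9, x11]] ! v"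

definition co13 :: "nat \<Rightarrow> int \<times> int \<times> int" where
  "co13 v = [(4, -8, 1), (0, -1, 0), (0, -2, 7), (-7, -2, 5), (-4, 0, 4), (-7, 0, 7), (-13, 15, 3), (3, 7, 1), (-10, 8, 6), (10, 9, 4), (7, 7, 1), (3, 6, 7), (5, 2, 3)] ! v"

definition es13 :: "(nat \<times> nat) list" where
  "es13 = [(x0, x1), (x0, x3), (x0, x10), (x0, x12), (x1, x2), (x1, x4), (x1, x11), (x2, x3), (x2, x5), (x2, x12), (x3, x4), (x3, x6), (x4, x5), (x4, x7), (x5, x6), (x5, x8), (x6, x7), (x6, x9), (x7, x8), (x7, x10), (x8, x9), (x8, x11), (x9, x10), (x9, x12), (x10, x11), (x11, x12)]"

definition cr13 :: "((nat \<times> nat) \<times> (nat \<times> nat)) list" where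
  "cr13 = [((x2, x12), (x0, x1)), ((x2, x5), (x3, x4)), ((x8, x9), (x6, x7)), ((x8, x11), (x4, x7)), ((x9, x12), (x0, x10))]"

lemma nb13_simps:
  "nb13 x0 = [x1, x3, x10, x12]" "nb13 x1 = [x0, x2, x4, x11]" "nb13 x2 = [x1, x3, x5, x12]" "nb13 x3 = [x0, x2, x4, x6]"
  "nb13 x4 = [x1, x3, x5, x7]" "nb13 x5 = [x2, x4, x6, x8]" "nb13 x6 = [x3, x5, x7, x9]" "nb13 x7 = [x4, x6, x8, x10]"
  "nb13 x8 = [x5, x7, x9, x11]" "nb13 x9 = [x6, x8, x10, x12]" "nb13 x10 = [x0, x7, x9, x11]" "nb13 x11 = [x1, x8, x10, x12]"
  "nb13 x12 = [x0, x2, x9, x11]"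
  by (simp_all add: nb13_def label_defs)

lemma co13_simps:
  "co13 x0 = (4, -8, 1)" "co13 x1 = (0, -1, 0)" "co13 x2 = (0, -2, 7)" "co13 x3 = (-7, -2, 5)" "co13 x4 = (-4, 0, 4)"
  "co13 x5 = (-7, 0, 7)" "co13 x6 = (-13, 15, 3)" "co13 x7 = (3, 7, 1)" "co13 x8 = (-10, 8, 6)" "co13 x9 = (10, 9, 4)"
  "co13 x10 = (7, 7, 1)" "co13 x11 = (3, 6, 7)" "co13 x12 = (5, 2, 3)"
  by (simp_all add: co13_def label_defs)

lemma graph13: "list_graph_ok vs13 nb13 vs13" "list_all (\<lambda>u. edge_list_for es13 u (nb13 u)) vs13"
  by (simp_all add: vs13_def es13_def nb13_simps drawing_eval)

lemma drawing13: "list_all (\<lambda>e. list_all (vertex_test co13 e) vs13) es13"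
    "list_all (\<lambda>e. list_all (edge_test co13 cr13 e) es13) es13"
    "list_all (crossing_test co13 cr13) cr13"
  by (simp_all add: vs13_def es13_def cr13_def co13_simps drawing_eval)

lemma quads13: "pairwise_ok (quad_free nb13 vs13) cr13"
  by (simp only: vs13_def cr13_def nb13_simps search_eval cong: if_weak_cong)

lemma triples13: "triplewise_ok (triple_ok nb13 vs13 cr13) cr13"
  by (simp only: vs13_def cr13_def nb13_simps search_eval cong: if_weak_cong, (simp add: winding_eval)?)

lemma connected13: "list_all (\<lambda>i. list_all (\<lambda>j. list_all (survives nb13 vs13 i j) vs13) vs13) vs13"
  by (simp only: vs13_def nb13_simps connectivity_eval cong: if_weak_cong)

lemma sporadic13: "\<exists>E. simple_graph {0..<13::nat} E \<and> linklessly_embeddable {0..<13} E \<and> tutte_4_connected {0..<13} E"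
proof -
  have upt: "vs13 = [0..<13]" by (simp add: vs13_def label_defs upt_rec)
  have vs: "set vs13 = {0..<13}" unfolding upt by (rule set_upt)
  show ?thesis
    by (rule checked_drawing_tutte[OF graph13 drawing13 quads13 triples13 connected13, unfolded vs])
      (simp_all add: vs13_def label_eq)
qed

section \<open>The graph on 14 vertices\<close>

definition vs14 :: "nat list" where "vs14 = [x0, x1, x2, x3, x4, x5, x6, x7, x8, x9, x10, x11, x12, x13]"

text \<open>Two cube graphs, each \<open>K_{4,4}\<close> without a perfect matching, glued along the
  colour class 0 to 3. The other colour classes are joined to the vertices 12 and 13. The graph is
  bipartite.\<close>

definition nb14 :: "nat \<Rightarrow> nat list" where
  "nb14 v = [[x5, x6, x7, x9, x10, x11], [x4, x6, x7, x8, x10, x11], [x4, x5, x7, x8, x9, x11], [x4, x5, x6, x8, x9, x10], [x1, x2, x3, x12], [x0, x2, x3, x12], [x0, x1, x3, x12], [x0, x1, x2, x12], [x1, x2, x3, x13], [x0, x2, x3, x13], [x0, x1, x3, x13], [x0, x1, x2, x13], [x4, x5, x6, x7], [x8, x9, x10, x11]] ! v"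

definition co14 :: "nat \<Rightarrow> int \<times> int \<times> int" where
  "co14 v = [(-9, -14, 2), (16, 8, 4), (3, -2, 3), (-26, 25, 0), (-4, 13, 1), (-5, -3, 1), (-22, 20, 1), (1, 1, 7), (19, 8, 3), (-7, -21, 1), (-28, 27, 0), (0, -11, 3), (-15, 12, 6), (21, 9, 1)] ! v"

definition es14 :: "(nat \<times> nat) list" where
  "es14 = [(x0, x5), (x0, x6), (x0, x7), (x0, x9), (x0, x10), (x0, x11), (x1, x4), (x1, x6), (x1, x7), (x1, x8), (x1, x10), (x1, x11), (x2, x4), (x2, x5), (x2, x7), (x2, x8), (x2, x9), (x2, x11), (x3, x4), (x3, x5), (x3, x6), (x3, x8), (x3, x9), (x3, x10), (x4, x12), (x5, x12), (x6, x12), (x7, x12), (x8, x13), (x9, x13), (x10, x13), (x11, x13)]"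

definition cr14 :: "((nat \<times> nat) \<times> (nat \<times> nat)) list" where
  "cr14 = [((x1, x7), (x2, x4)), ((x0, x7), (x2, x5)), ((x1, x11), (x2, x8)), ((x0, x11), (x2, x9)), ((x1, x6), (x3, x4)), ((x0, x6), (x3, x5)), ((x1, x10), (x3, x8)), ((x0, x10), (x3, x9))]"

lemma nb14_simps:
  "nb14 x0 = [x5, x6, x7, x9, x10, x11]" "nb14 x1 = [x4, x6, x7, x8, x10, x11]" "nb14 x2 = [x4, x5, x7, x8, x9, x11]"
  "nb14 x3 = [x4, x5, x6, x8, x9, x10]" "nb14 x4 = [x1, x2, x3, x12]" "nb14 x5 = [x0, x2, x3, x12]" "nb14 x6 = [x0, x1, x3, x12]"
  "nb14 x7 = [x0, x1, x2, x12]" "nb14 x8 = [x1, x2, x3, x13]" "nb14 x9 = [x0, x2, x3, x13]" "nb14 x10 = [x0, x1, x3, x13]"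
  "nb14 x11 = [x0, x1, x2, x13]" "nb14 x12 = [x4, x5, x6, x7]" "nb14 x13 = [x8, x9, x10, x11]"
  by (simp_all add: nb14_def label_defs)

lemma co14_simps:
  "co14 x0 = (-9, -14, 2)" "co14 x1 = (16, 8, 4)" "co14 x2 = (3, -2, 3)" "co14 x3 = (-26, 25, 0)" "co14 x4 = (-4, 13, 1)"
  "co14 x5 = (-5, -3, 1)" "co14 x6 = (-22, 20, 1)" "co14 x7 = (1, 1, 7)" "co14 x8 = (19, 8, 3)" "co14 x9 = (-7, -21, 1)"
  "co14 x10 = (-28, 27, 0)" "co14 x11 = (0, -11, 3)" "co14 x12 = (-15, 12, 6)" "co14 x13 = (21, 9, 1)"
  by (simp_all add: co14_def label_defs)

lemma graph14: "list_graph_ok vs14 nb14 vs14" "list_all (\<lambda>u. edge_list_for es14 u (nb14 u)) vs14"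
  by (simp_all add: vs14_def es14_def nb14_simps drawing_eval)

lemma drawing14: "list_all (\<lambda>e. list_all (vertex_test co14 e) vs14) es14"
    "list_all (\<lambda>e. list_all (edge_test co14 cr14 e) es14) es14"
    "list_all (crossing_test co14 cr14) cr14"
  by (simp_all add: vs14_def es14_def cr14_def co14_simps drawing_eval)

lemma quads14: "pairwise_ok (quad_free nb14 vs14) cr14"
  by (simp only: vs14_def cr14_def nb14_simps search_eval cong: if_weak_cong)

lemma triples14: "triplewise_ok (triple_ok nb14 vs14 cr14) cr14"
  by (simp only: vs14_def cr14_def nb14_simps search_eval cong: if_weak_cong, (simp add: winding_eval)?)

lemma connected14: "list_all (\<lambda>i. list_all (\<lambda>j. list_all (survives nb14 vs14 i j) vs14) vs14) vs14"
  by (simp only: vs14_def nb14_simps connectivity_eval cong: if_weak_cong)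

lemma sporadic14: "\<exists>E. simple_graph {0..<14::nat} E \<and> linklessly_embeddable {0..<14} E \<and> tutte_4_connected {0..<14} E"
proof -
  have upt: "vs14 = [0..<14]" by (simp add: vs14_def label_defs upt_rec)
  have vs: "set vs14 = {0..<14}" unfolding upt by (rule set_upt)
  show ?thesis
    by (rule checked_drawing_tutte[OF graph14 drawing14 quads14 triples14 connected14, unfolded vs])
      (simp_all add: vs14_def label_eq)
qed

section \<open>The graph on 16 vertices\<close>

definition vs16 :: "nat list" where "vs16 = [x0, x1, x2, x3, x4, x5, x6, x7, x8, x9, x10, x11, x12, x13, x14, x15]"

text \<open>The same cube graph with a cap, on 0 to 3 and 11 to 15, completed on the other side of
  the separating set 0 to 3 by the vertices 4 to 10. Again bipartite, with 0, 1, 2, 3, 5, 10, 15 as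
  one class.\<close>

definition nb16 :: "nat \<Rightarrow> nat list" where
  "nb16 v = [[x6, x7, x8, x9, x12, x13, x14], [x8, x11, x13, x14], [x4, x7, x8, x9, x11, x12, x14], [x4, x6, x9, x11, x12, x13], [x2, x3, x5, x10], [x4, x6, x7, x9], [x0, x3, x5, x10], [x0, x2, x5, x10], [x0, x1, x2, x10], [x0, x2, x3, x5], [x4, x6, x7, x8], [x1, x2, x3, x15], [x0, x2, x3, x15], [x0, x1, x3, x15], [x0, x1, x2, x15], [x11, x12, x13, x14]] ! v"

definition co16 :: "nat \<Rightarrow> int \<times> int \<times> int" where
  "co16 v = [(10, -25, 6), (15, 7, 5), (0, 16, 7), (1, 7, 1), (-2, 15, 0), (-5, 8, 4), (6, -15, 0), (-12, 18, 7), (19, 17, 2), (-3, 11, 7), (-17, 20, 5), (8, 1, 5), (3, 2, 7), (9, -16, 5), (12, -1, 5), (7, -5, 5)] ! v"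

definition es16 :: "(nat \<times> nat) list" where
  "es16 = [(x0, x6), (x0, x7), (x0, x8), (x0, x9), (x0, x12), (x0, x13), (x0, x14), (x1, x8), (x1, x11), (x1, x13), (x1, x14), (x2, x4), (x2, x7), (x2, x8), (x2, x9), (x2, x11), (x2, x12), (x2, x14), (x3, x4), (x3, x6), (x3, x9), (x3, x11), (x3, x12), (x3, x13), (x4, x5), (x4, x10), (x5, x6), (x5, x7), (x5, x9), (x6, x10), (x7, x10), (x8, x10), (x11, x15), (x12, x15), (x13, x15), (x14, x15)]"

definition cr16 :: "((nat \<times> nat) \<times> (nat \<times> nat)) list" where
  "cr16 = [((x0, x14), (x1, x13)), ((x2, x14), (x1, x11)), ((x2, x9), (x3, x4)), ((x0, x9), (x3, x6)), ((x2, x12), (x3, x11)), ((x0, x12), (x3, x13)), ((x2, x7), (x4, x10)), ((x0, x7), (x6, x10))]"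

lemma nb16_simps:
  "nb16 x0 = [x6, x7, x8, x9, x12, x13, x14]" "nb16 x1 = [x8, x11, x13, x14]" "nb16 x2 = [x4, x7, x8, x9, x11, x12, x14]"
  "nb16 x3 = [x4, x6, x9, x11, x12, x13]" "nb16 x4 = [x2, x3, x5, x10]" "nb16 x5 = [x4, x6, x7, x9]" "nb16 x6 = [x0, x3, x5, x10]"
  "nb16 x7 = [x0, x2, x5, x10]" "nb16 x8 = [x0, x1, x2, x10]" "nb16 x9 = [x0, x2, x3, x5]" "nb16 x10 = [x4, x6, x7, x8]"
  "nb16 x11 = [x1, x2, x3, x15]" "nb16 x12 = [x0, x2, x3, x15]" "nb16 x13 = [x0, x1, x3, x15]" "nb16 x14 = [x0, x1, x2, x15]"
  "nb16 x15 = [x11, x12, x13, x14]"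
  by (simp_all add: nb16_def label_defs)

lemma co16_simps:
  "co16 x0 = (10, -25, 6)" "co16 x1 = (15, 7, 5)" "co16 x2 = (0, 16, 7)" "co16 x3 = (1, 7, 1)" "co16 x4 = (-2, 15, 0)"
  "co16 x5 = (-5, 8, 4)" "co16 x6 = (6, -15, 0)" "co16 x7 = (-12, 18, 7)" "co16 x8 = (19, 17, 2)" "co16 x9 = (-3, 11, 7)"
  "co16 x10 = (-17, 20, 5)" "co16 x11 = (8, 1, 5)" "co16 x12 = (3, 2, 7)" "co16 x13 = (9, -16, 5)" "co16 x14 = (12, -1, 5)"
  "co16 x15 = (7, -5, 5)"
  by (simp_all add: co16_def label_defs)

lemma graph16: "list_graph_ok vs16 nb16 vs16" "list_all (\<lambda>u. edge_list_for es16 u (nb16 u)) vs16"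
  by (simp_all add: vs16_def es16_def nb16_simps drawing_eval)

lemma drawing16: "list_all (\<lambda>e. list_all (vertex_test co16 e) vs16) es16"
    "list_all (\<lambda>e. list_all (edge_test co16 cr16 e) es16) es16"
    "list_all (crossing_test co16 cr16) cr16"
  by (simp_all add: vs16_def es16_def cr16_def co16_simps drawing_eval)

lemma quads16: "pairwise_ok (quad_free nb16 vs16) cr16"
  by (simp only: vs16_def cr16_def nb16_simps search_eval cong: if_weak_cong)

lemma triples16: "triplewise_ok (triple_ok nb16 vs16 cr16) cr16"
  by (simp only: vs16_def cr16_def nb16_simps search_eval cong: if_weak_cong, (simp add: winding_eval)?)

lemma connected16: "list_all (\<lambda>i. list_all (\<lambda>j. list_all (survives nb16 vs16 i j) vs16) vs16) vs16"
  by (simp only: vs16_def nb16_simps connectivity_eval cong: if_weak_cong)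

lemma sporadic16: "\<exists>E. simple_graph {0..<16::nat} E \<and> linklessly_embeddable {0..<16} E \<and> tutte_4_connected {0..<16} E"
proof -
  have upt: "vs16 = [0..<16]" by (simp add: vs16_def label_defs upt_rec)
  have vs: "set vs16 = {0..<16}" unfolding upt by (rule set_upt)
  show ?thesis
    by (rule checked_drawing_tutte[OF graph16 drawing16 quads16 triples16 connected16, unfolded vs])
      (simp_all add: vs16_def label_eq)
qed

section \<open>The graph on 17 vertices\<close>

definition vs17 :: "nat list" where "vs17 = [x0, x1, x2, x3, x4, x5, x6, x7, x8, x9, x10, x11, x12, x13, x14, x15, x16]"

text \<open>A capped cube graph on 0 to 3 and 12 to 16. The other side is \<open>K_{4,4}\<close> on
  4 to 7 and 8 to 11 without three disjoint edges, whose ends 5, 6, 7 are joined to 0 and whose ends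
  8, 10, 11 are joined to 3, 2, 1.\<close>

definition nb17 :: "nat \<Rightarrow> nat list" where
  "nb17 v = [[x5, x6, x7, x13, x14, x15], [x11, x12, x14, x15], [x10, x12, x13, x15], [x8, x12, x13, x14], [x8, x9, x10, x11], [x0, x8, x9, x11], [x0, x9, x10, x11], [x0, x8, x9, x10], [x3, x4, x5, x7], [x4, x5, x6, x7], [x2, x4, x6, x7], [x1, x4, x5, x6], [x1, x2, x3, x16], [x0, x2, x3, x16], [x0, x1, x3, x16], [x0, x1, x2, x16], [x12, x13, x14, x15]] ! v"

definition co17 :: "nat \<Rightarrow> int \<times> int \<times> int" where
  "co17 v = [(-5, 0, 7), (-3, 5, 1), (13, 11, 4), (4, 6, 2), (-2, -7, 3), (2, -2, 4), (-11, -11, 1), (8, 3, 1), (6, 0, 2), (4, -5, 7), (15, -4, 6), (-8, -6, 3), (2, 6, 4), (10, 8, 2), (0, 5, 6), (-12, 14, 3), (5, 8, 6)] ! v"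

definition es17 :: "(nat \<times> nat) list" where
  "es17 = [(x0, x5), (x0, x6), (x0, x7), (x0, x13), (x0, x14), (x0, x15), (x1, x11), (x1, x12), (x1, x14), (x1, x15), (x2, x10), (x2, x12), (x2, x13), (x2, x15), (x3, x8), (x3, x12), (x3, x13), (x3, x14), (x4, x8), (x4, x9), (x4, x10), (x4, x11), (x5, x8), (x5, x9), (x5, x11), (x6, x9), (x6, x10), (x6, x11), (x7, x8), (x7, x9), (x7, x10), (x12, x16), (x13, x16), (x14, x16), (x15, x16)]"

definition cr17 :: "((nat \<times> nat) \<times> (nat \<times> nat)) list" where
  "cr17 = [((x0, x6), (x1, x11)), ((x0, x15), (x1, x11)), ((x0, x7), (x3, x8)), ((x0, x13), (x3, x8)), ((x5, x9), (x4, x8)), ((x6, x9), (x4, x10)), ((x13, x16), (x2, x12)), ((x14, x16), (x1, x12))]"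

lemma nb17_simps:
  "nb17 x0 = [x5, x6, x7, x13, x14, x15]" "nb17 x1 = [x11, x12, x14, x15]" "nb17 x2 = [x10, x12, x13, x15]" "nb17 x3 = [x8, x12, x13, x14]"
  "nb17 x4 = [x8, x9, x10, x11]" "nb17 x5 = [x0, x8, x9, x11]" "nb17 x6 = [x0, x9, x10, x11]" "nb17 x7 = [x0, x8, x9, x10]"
  "nb17 x8 = [x3, x4, x5, x7]" "nb17 x9 = [x4, x5, x6, x7]" "nb17 x10 = [x2, x4, x6, x7]" "nb17 x11 = [x1, x4, x5, x6]"
  "nb17 x12 = [x1, x2, x3, x16]" "nb17 x13 = [x0, x2, x3, x16]" "nb17 x14 = [x0, x1, x3, x16]" "nb17 x15 = [x0, x1, x2, x16]"
  "nb17 x16 = [x12, x13, x14, x15]"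
  by (simp_all add: nb17_def label_defs)

lemma co17_simps:
  "co17 x0 = (-5, 0, 7)" "co17 x1 = (-3, 5, 1)" "co17 x2 = (13, 11, 4)" "co17 x3 = (4, 6, 2)" "co17 x4 = (-2, -7, 3)"
  "co17 x5 = (2, -2, 4)" "co17 x6 = (-11, -11, 1)" "co17 x7 = (8, 3, 1)" "co17 x8 = (6, 0, 2)" "co17 x9 = (4, -5, 7)"
  "co17 x10 = (15, -4, 6)" "co17 x11 = (-8, -6, 3)" "co17 x12 = (2, 6, 4)" "co17 x13 = (10, 8, 2)" "co17 x14 = (0, 5, 6)"
  "co17 x15 = (-12, 14, 3)" "co17 x16 = (5, 8, 6)"
  by (simp_all add: co17_def label_defs)

lemma graph17: "list_graph_ok vs17 nb17 vs17" "list_all (\<lambda>u. edge_list_for es17 u (nb17 u)) vs17"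
  by (simp_all add: vs17_def es17_def nb17_simps drawing_eval)

lemma drawing17: "list_all (\<lambda>e. list_all (vertex_test co17 e) vs17) es17"
    "list_all (\<lambda>e. list_all (edge_test co17 cr17 e) es17) es17"
    "list_all (crossing_test co17 cr17) cr17"
  by (simp_all add: vs17_def es17_def cr17_def co17_simps drawing_eval)

lemma quads17: "pairwise_ok (quad_free nb17 vs17) cr17"
  by (simp only: vs17_def cr17_def nb17_simps search_eval cong: if_weak_cong)

lemma triples17: "triplewise_ok (triple_ok nb17 vs17 cr17) cr17"
  by (simp only: vs17_def cr17_def nb17_simps search_eval cong: if_weak_cong, (simp add: winding_eval)?)

lemma connected17: "list_all (\<lambda>i. list_all (\<lambda>j. list_all (survives nb17 vs17 i j) vs17) vs17) vs17"
  by (simp only: vs17_def nb17_simps connectivity_eval cong: if_weak_cong)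

lemma sporadic17: "\<exists>E. simple_graph {0..<17::nat} E \<and> linklessly_embeddable {0..<17} E \<and> tutte_4_connected {0..<17} E"
proof -
  have upt: "vs17 = [0..<17]" by (simp add: vs17_def label_defs upt_rec)
  have vs: "set vs17 = {0..<17}" unfolding upt by (rule set_upt)
  show ?thesis
    by (rule checked_drawing_tutte[OF graph17 drawing17 quads17 triples17 connected17, unfolded vs])
      (simp_all add: vs17_def label_eq)
qed

section \<open>Base graph with 15 vertices\<close>

definition vs15 :: "nat list" where "vs15 = [x0, x1, x2, x3, x4, x5, x6, x7, x8, x9, x10, x11, x12, x13, x14]"

text \<open>The octahedron has the vertices 1, 2, 3, 4, 7, 8; its eight triangles are the neighbours
  of the apex 0. The triangles 5 and 6 share the edge between 3 and 4, where columns are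
  inserted.\<close>

definition nb15 :: "nat \<Rightarrow> nat list" where
  "nb15 v = [[x5, x6, x9, x10, x11, x12, x13, x14], [x5, x9, x10, x11], [x6, x12, x13, x14], [x5, x6, x11, x14], [x5, x6, x9, x12], [x0, x1, x3, x4], [x0, x2, x3, x4], [x9, x10, x12, x13], [x10, x11, x13, x14], [x0, x1, x4, x7], [x0, x1, x7, x8], [x0, x1, x3, x8], [x0, x2, x4, x7], [x0, x2, x7, x8], [x0, x2, x3, x8]] ! v"

definition outer_vs15 :: "nat list" where "outer_vs15 = [x1, x2, x3, x4, x7, x8, x9, x10, x11, x12, x13, x14]"

definition outer_nb15 :: "nat \<Rightarrow> nat list" where
  "outer_nb15 v = [[], [x9, x10, x11], [x12, x13, x14], [x11, x14], [x9, x12], [], [], [x9, x10, x12, x13], [x10, x11, x13, x14], [x1, x4, x7], [x1, x7, x8], [x1, x3, x8], [x2, x4, x7], [x2, x7, x8], [x2, x3, x8]] ! v"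

definition outer_es15 :: "(nat \<times> nat) list" where
  "outer_es15 = [(x1, x9), (x1, x10), (x1, x11), (x2, x12), (x2, x13), (x2, x14), (x3, x11), (x3, x14), (x4, x9), (x4, x12), (x7, x9), (x7, x10), (x7, x12), (x7, x13), (x8, x10), (x8, x11), (x8, x13), (x8, x14)]"

definition co15 :: "nat \<Rightarrow> int \<times> int \<times> int" where
  "co15 v = [(0, 0, 0), (0, 4, 0), (0, -4, 0), (-4, 0, 0), (4, 0, 0), (0, 0, 0), (0, 0, 0), (18, -12, 0), (-6, 14, 0), (6, 7, 0), (20, 20, 0), (1, 10, 0), (6, -11, 0), (-20, -20, 0), (-8, -9, 0)] ! v"

lemma nb15_simps:
  "nb15 x0 = [x5, x6, x9, x10, x11, x12, x13, x14]" "nb15 x1 = [x5, x9, x10, x11]" "nb15 x2 = [x6, x12, x13, x14]"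
  "nb15 x3 = [x5, x6, x11, x14]" "nb15 x4 = [x5, x6, x9, x12]" "nb15 x5 = [x0, x1, x3, x4]" "nb15 x6 = [x0, x2, x3, x4]"
  "nb15 x7 = [x9, x10, x12, x13]" "nb15 x8 = [x10, x11, x13, x14]" "nb15 x9 = [x0, x1, x4, x7]" "nb15 x10 = [x0, x1, x7, x8]"
  "nb15 x11 = [x0, x1, x3, x8]" "nb15 x12 = [x0, x2, x4, x7]" "nb15 x13 = [x0, x2, x7, x8]" "nb15 x14 = [x0, x2, x3, x8]"
  by (simp_all add: nb15_def label_defs)

lemma outer_nb15_simps:
  "outer_nb15 x1 = [x9, x10, x11]" "outer_nb15 x2 = [x12, x13, x14]" "outer_nb15 x3 = [x11, x14]" "outer_nb15 x4 = [x9, x12]"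
  "outer_nb15 x7 = [x9, x10, x12, x13]" "outer_nb15 x8 = [x10, x11, x13, x14]" "outer_nb15 x9 = [x1, x4, x7]"
  "outer_nb15 x10 = [x1, x7, x8]" "outer_nb15 x11 = [x1, x3, x8]" "outer_nb15 x12 = [x2, x4, x7]" "outer_nb15 x13 = [x2, x7, x8]"
  "outer_nb15 x14 = [x2, x3, x8]"
  by (simp_all add: outer_nb15_def label_defs)

lemma co15_simps:
  "co15 x1 = (0, 4, 0)" "co15 x2 = (0, -4, 0)" "co15 x3 = (-4, 0, 0)" "co15 x4 = (4, 0, 0)" "co15 x7 = (18, -12, 0)"
  "co15 x8 = (-6, 14, 0)" "co15 x9 = (6, 7, 0)" "co15 x10 = (20, 20, 0)" "co15 x11 = (1, 10, 0)" "co15 x12 = (6, -11, 0)"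
  "co15 x13 = (-20, -20, 0)" "co15 x14 = (-8, -9, 0)"
  by (simp_all add: co15_def label_defs)

lemma graph15: "list_graph_ok vs15 nb15 vs15" "list_graph_ok outer_vs15 outer_nb15 outer_vs15"
    "list_all (\<lambda>u. edge_list_for outer_es15 u (outer_nb15 u)) outer_vs15"
  by (simp_all add: vs15_def outer_vs15_def outer_es15_def nb15_simps outer_nb15_simps drawing_eval)

lemma drawing15: "list_all (\<lambda>e. list_all (vertex_test co15 e) outer_vs15) outer_es15"
    "list_all (\<lambda>e. list_all (edge_test co15 [] e) outer_es15) outer_es15"
  by (simp_all add: outer_vs15_def outer_es15_def co15_simps drawing_eval)

lemma connected15: "list_all (\<lambda>j. list_all (survives nb15 vs15 x0 j) vs15) vs15"
  by (simp only: vs15_def nb15_simps connectivity_eval cong: if_weak_cong)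

lemma columns15:
  fixes K :: nat
  shows "\<exists>E. simple_graph {0..<15 + 3 * K} E \<and> linklessly_embeddable {0..<15 + 3 * K} E \<and> tutte_4_connected {0..<15 + 3 * K} E"
proof (rule checked_columns[OF graph15(1) _ _ _ connected15[unfolded x0_def] _ _ _ _ graph15(2,3) drawing15])
  show "vs15 = [0..<15]" by (simp add: vs15_def label_defs upt_rec)
  show "outer_vs15 = [1, 2, 3, 4] @ [7..<15]" by (simp add: outer_vs15_def label_defs upt_rec)
  show "list_all (\<lambda>v. v = 0 \<or> mem v (nb15 0) \<or> (all_mem (nb15 v) (nb15 0) \<and> distinct (nb15 v) \<and> 4 \<le> length (nb15 v))) vs15"
    by (simp add: vs15_def label_defs nb15_simps[unfolded label_defs One_nat_def])
  show "list_all (\<lambda>u. list_all (\<lambda>v. mem v [0, 5, 6] \<or> mem v (outer_nb15 u)) (nb15 u)) outer_vs15"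
    by (simp add: outer_vs15_def label_defs nb15_simps[unfolded label_defs One_nat_def] outer_nb15_simps[unfolded label_defs One_nat_def])
  show "list_all (\<lambda>v. snd (snd (co15 v)) = 0 \<and> 4 < \<bar>fst (co15 v)\<bar> + \<bar>fst (snd (co15 v))\<bar>) [7..<15]"
    by (simp add: co15_def upt_rec)
  \<comment> \<open>For an edge ending at a corner the line passes through that corner, such as (0,
    -1, 4) at vertex 1; the lines for the remaining edges have constant term 5 and miss the
    diamond.\<close>
  show "list_all2 (separation_test co15) outer_es15
    [(0, -1, 4), (0, -1, 4), (0, -1, 4), (0, 1, 4), (0, 1, 4), (0, 1, 4), (2, -1, 8), (1, 0, 4), (-1, 0, 4), (-1, 0, 4), (-1, -1, 5), (-1, -1, 5), (-1, 0, 5), (0, 1, 5), (-1, -1, 5), (-1, -1, 5), (1, 0, 5), (1, 0, 5)]"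
    by (simp add: outer_es15_def separation_test_def Let_def label_defs co15_simps[unfolded label_defs One_nat_def])
qed (simp_all add: nb15_def co15_def label_defs)

section \<open>Base graph with 19 vertices\<close>

definition vs19 :: "nat list" where "vs19 = [x0, x1, x2, x3, x4, x5, x6, x7, x8, x9, x10, x11, x12, x13, x14, x15, x16, x17, x18]"

text \<open>The square antiprism on 1 to 4 and 7 to 10. Its squares are 11 and 12, the other
  neighbours of the apex 0 are its triangles.\<close>

definition nb19 :: "nat \<Rightarrow> nat list" where
  "nb19 v = [[x5, x6, x11, x12, x13, x14, x15, x16, x17, x18], [x5, x11, x15, x18], [x6, x12, x13, x16], [x5, x6, x11, x13], [x5, x6, x12, x18], [x0, x1, x3, x4], [x0, x2, x3, x4], [x11, x13, x14, x16], [x11, x14, x15, x17], [x12, x14, x16, x17], [x12, x15, x17, x18], [x0, x1, x3, x7, x8], [x0, x2, x4, x9, x10], [x0, x2, x3, x7], [x0, x7, x8, x9], [x0, x1, x8, x10], [x0, x2, x7, x9], [x0, x8, x9, x10], [x0, x1, x4, x10]] ! v"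

definition outer_vs19 :: "nat list" where "outer_vs19 = [x1, x2, x3, x4, x7, x8, x9, x10, x11, x12, x13, x14, x15, x16, x17, x18]"

definition outer_nb19 :: "nat \<Rightarrow> nat list" where
  "outer_nb19 v = [[], [x11, x15, x18], [x12, x13, x16], [x11, x13], [x12, x18], [], [], [x11, x13, x14, x16], [x11, x14, x15, x17], [x12, x14, x16, x17], [x12, x15, x17, x18], [x1, x3, x7, x8], [x2, x4, x9, x10], [x2, x3, x7], [x7, x8, x9], [x1, x8, x10], [x2, x7, x9], [x8, x9, x10], [x1, x4, x10]] ! v"

definition outer_es19 :: "(nat \<times> nat) list" where
  "outer_es19 = [(x1, x11), (x1, x15), (x1, x18), (x2, x12), (x2, x13), (x2, x16), (x3, x11), (x3, x13), (x4, x12), (x4, x18), (x7, x11), (x7, x13), (x7, x14), (x7, x16), (x8, x11), (x8, x14), (x8, x15), (x8, x17), (x9, x12), (x9, x14), (x9, x16), (x9, x17), (x10, x12), (x10, x15), (x10, x17), (x10, x18)]"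

definition co19 :: "nat \<Rightarrow> int \<times> int \<times> int" where
  "co19 v = [(0, 0, 0), (0, 4, 0), (0, -4, 0), (-4, 0, 0), (4, 0, 0), (0, 0, 0), (0, 0, 0), (1, -19, 0), (-20, 20, 0), (20, -20, 0), (16, 11, 0), (-12, 5, 0), (18, -9, 0), (3, -10, 0), (-20, -20, 0), (-4, 18, 0), (6, -12, 0), (20, 20, 0), (14, 6, 0)] ! v"

lemma nb19_simps:
  "nb19 x0 = [x5, x6, x11, x12, x13, x14, x15, x16, x17, x18]" "nb19 x1 = [x5, x11, x15, x18]" "nb19 x2 = [x6, x12, x13, x16]"
  "nb19 x3 = [x5, x6, x11, x13]" "nb19 x4 = [x5, x6, x12, x18]" "nb19 x5 = [x0, x1, x3, x4]" "nb19 x6 = [x0, x2, x3, x4]"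
  "nb19 x7 = [x11, x13, x14, x16]" "nb19 x8 = [x11, x14, x15, x17]" "nb19 x9 = [x12, x14, x16, x17]" "nb19 x10 = [x12, x15, x17, x18]"
  "nb19 x11 = [x0, x1, x3, x7, x8]" "nb19 x12 = [x0, x2, x4, x9, x10]" "nb19 x13 = [x0, x2, x3, x7]" "nb19 x14 = [x0, x7, x8, x9]"
  "nb19 x15 = [x0, x1, x8, x10]" "nb19 x16 = [x0, x2, x7, x9]" "nb19 x17 = [x0, x8, x9, x10]" "nb19 x18 = [x0, x1, x4, x10]"
  by (simp_all add: nb19_def label_defs)

lemma outer_nb19_simps:
  "outer_nb19 x1 = [x11, x15, x18]" "outer_nb19 x2 = [x12, x13, x16]" "outer_nb19 x3 = [x11, x13]" "outer_nb19 x4 = [x12, x18]"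
  "outer_nb19 x7 = [x11, x13, x14, x16]" "outer_nb19 x8 = [x11, x14, x15, x17]" "outer_nb19 x9 = [x12, x14, x16, x17]"
  "outer_nb19 x10 = [x12, x15, x17, x18]" "outer_nb19 x11 = [x1, x3, x7, x8]" "outer_nb19 x12 = [x2, x4, x9, x10]"
  "outer_nb19 x13 = [x2, x3, x7]" "outer_nb19 x14 = [x7, x8, x9]" "outer_nb19 x15 = [x1, x8, x10]" "outer_nb19 x16 = [x2, x7, x9]"
  "outer_nb19 x17 = [x8, x9, x10]" "outer_nb19 x18 = [x1, x4, x10]"
  by (simp_all add: outer_nb19_def label_defs)

lemma co19_simps:
  "co19 x1 = (0, 4, 0)" "co19 x2 = (0, -4, 0)" "co19 x3 = (-4, 0, 0)" "co19 x4 = (4, 0, 0)" "co19 x7 = (1, -19, 0)"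
  "co19 x8 = (-20, 20, 0)" "co19 x9 = (20, -20, 0)" "co19 x10 = (16, 11, 0)" "co19 x11 = (-12, 5, 0)" "co19 x12 = (18, -9, 0)"
  "co19 x13 = (3, -10, 0)" "co19 x14 = (-20, -20, 0)" "co19 x15 = (-4, 18, 0)" "co19 x16 = (6, -12, 0)" "co19 x17 = (20, 20, 0)"
  "co19 x18 = (14, 6, 0)"
  by (simp_all add: co19_def label_defs)

lemma graph19: "list_graph_ok vs19 nb19 vs19" "list_graph_ok outer_vs19 outer_nb19 outer_vs19"
    "list_all (\<lambda>u. edge_list_for outer_es19 u (outer_nb19 u)) outer_vs19"
  by (simp_all add: vs19_def outer_vs19_def outer_es19_def nb19_simps outer_nb19_simps drawing_eval)

lemma drawing19: "list_all (\<lambda>e. list_all (vertex_test co19 e) outer_vs19) outer_es19"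
    "list_all (\<lambda>e. list_all (edge_test co19 [] e) outer_es19) outer_es19"
  by (simp_all add: outer_vs19_def outer_es19_def co19_simps drawing_eval)

lemma connected19: "list_all (\<lambda>j. list_all (survives nb19 vs19 x0 j) vs19) vs19"
  by (simp only: vs19_def nb19_simps connectivity_eval cong: if_weak_cong)

lemma columns19:
  fixes K :: nat
  shows "\<exists>E. simple_graph {0..<19 + 3 * K} E \<and> linklessly_embeddable {0..<19 + 3 * K} E \<and> tutte_4_connected {0..<19 + 3 * K} E"
proof (rule checked_columns[OF graph19(1) _ _ _ connected19[unfolded x0_def] _ _ _ _ graph19(2,3) drawing19])
  show "vs19 = [0..<19]" by (simp add: vs19_def label_defs upt_rec)
  show "outer_vs19 = [1, 2, 3, 4] @ [7..<19]" by (simp add: outer_vs19_def label_defs upt_rec)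
  show "list_all (\<lambda>v. v = 0 \<or> mem v (nb19 0) \<or> (all_mem (nb19 v) (nb19 0) \<and> distinct (nb19 v) \<and> 4 \<le> length (nb19 v))) vs19"
    by (simp add: vs19_def label_defs nb19_simps[unfolded label_defs One_nat_def])
  show "list_all (\<lambda>u. list_all (\<lambda>v. mem v [0, 5, 6] \<or> mem v (outer_nb19 u)) (nb19 u)) outer_vs19"
    by (simp add: outer_vs19_def label_defs nb19_simps[unfolded label_defs One_nat_def] outer_nb19_simps[unfolded label_defs One_nat_def])
  show "list_all (\<lambda>v. snd (snd (co19 v)) = 0 \<and> 4 < \<bar>fst (co19 v)\<bar> + \<bar>fst (snd (co19 v))\<bar>) [7..<19]"
    by (simp add: co19_def upt_rec)
  show "list_all2 (separation_test co19) outer_es19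
    [(0, -1, 4), (0, -1, 4), (0, -1, 4), (0, 1, 4), (0, 1, 4), (0, 1, 4), (1, 0, 4), (4, 3, 16), (-1, 0, 4), (-1, 0, 4), (1, 1, 5), (-1, 1, 5), (0, 1, 5), (-1, 1, 5), (0, -1, 5), (1, 0, 5), (0, -1, 5), (0, -1, 5), (-1, 0, 5), (0, 1, 5), (-1, 0, 5), (-1, 0, 5), (-1, -1, 5), (-1, -1, 5), (-1, -1, 5), (-1, -1, 5)]"
    by (simp add: outer_es19_def separation_test_def Let_def label_defs co19_simps[unfolded label_defs One_nat_def])
qed (simp_all add: nb19_def co19_def label_defs)

section \<open>Base graph with 20 vertices\<close>

definition vs20 :: "nat list" where "vs20 = [x0, x1, x2, x3, x4, x5, x6, x7, x8, x9, x10, x11, x12, x13, x14, x15, x16, x17, x18, x19]"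

text \<open>The antiprism again, with one square cut by the diagonal from 1 to 7 into the triangles
  11 and 12; the remaining square is 13.\<close>

definition nb20 :: "nat \<Rightarrow> nat list" where
  "nb20 v = [[x5, x6, x11, x12, x13, x14, x15, x16, x17, x18, x19], [x5, x11, x12, x16, x19], [x6, x13, x14, x17], [x5, x6, x11, x14], [x5, x6, x13, x19], [x0, x1, x3, x4], [x0, x2, x3, x4], [x11, x12, x14, x15, x17], [x12, x15, x16, x18], [x13, x15, x17, x18], [x13, x16, x18, x19], [x0, x1, x3, x7], [x0, x1, x7, x8], [x0, x2, x4, x9, x10], [x0, x2, x3, x7], [x0, x7, x8, x9], [x0, x1, x8, x10], [x0, x2, x7, x9], [x0, x8, x9, x10], [x0, x1, x4, x10]] ! v"

definition outer_vs20 :: "nat list" where "outer_vs20 = [x1, x2, x3, x4, x7, x8, x9, x10, x11, x12, x13, x14, x15, x16, x17, x18, x19]"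

definition outer_nb20 :: "nat \<Rightarrow> nat list" where
  "outer_nb20 v = [[], [x11, x12, x16, x19], [x13, x14, x17], [x11, x14], [x13, x19], [], [], [x11, x12, x14, x15, x17], [x12, x15, x16, x18], [x13, x15, x17, x18], [x13, x16, x18, x19], [x1, x3, x7], [x1, x7, x8], [x2, x4, x9, x10], [x2, x3, x7], [x7, x8, x9], [x1, x8, x10], [x2, x7, x9], [x8, x9, x10], [x1, x4, x10]] ! v"

definition outer_es20 :: "(nat \<times> nat) list" where
  "outer_es20 = [(x1, x11), (x1, x12), (x1, x16), (x1, x19), (x2, x13), (x2, x14), (x2, x17), (x3, x11), (x3, x14), (x4, x13), (x4, x19), (x7, x11), (x7, x12), (x7, x14), (x7, x15), (x7, x17), (x8, x12), (x8, x15), (x8, x16), (x8, x18), (x9, x13), (x9, x15), (x9, x17), (x9, x18), (x10, x13), (x10, x16), (x10, x18), (x10, x19)]"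

definition co20 :: "nat \<Rightarrow> int \<times> int \<times> int" where
  "co20 v = [(0, 0, 0), (0, 4, 0), (0, -4, 0), (-4, 0, 0), (4, 0, 0), (0, 0, 0), (0, 0, 0), (-17, 11, 0), (17, -16, 0), (0, -8, 0), (16, -12, 0), (-2, 11, 0), (20, 17, 0), (7, -2, 0), (-13, 4, 0), (-20, -12, 0), (19, 8, 0), (-18, -6, 0), (15, -13, 0), (16, 1, 0)] ! v"

lemma nb20_simps:
  "nb20 x0 = [x5, x6, x11, x12, x13, x14, x15, x16, x17, x18, x19]" "nb20 x1 = [x5, x11, x12, x16, x19]" "nb20 x2 = [x6, x13, x14, x17]"
  "nb20 x3 = [x5, x6, x11, x14]" "nb20 x4 = [x5, x6, x13, x19]" "nb20 x5 = [x0, x1, x3, x4]" "nb20 x6 = [x0, x2, x3, x4]"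
  "nb20 x7 = [x11, x12, x14, x15, x17]" "nb20 x8 = [x12, x15, x16, x18]" "nb20 x9 = [x13, x15, x17, x18]" "nb20 x10 = [x13, x16, x18, x19]"
  "nb20 x11 = [x0, x1, x3, x7]" "nb20 x12 = [x0, x1, x7, x8]" "nb20 x13 = [x0, x2, x4, x9, x10]" "nb20 x14 = [x0, x2, x3, x7]"
  "nb20 x15 = [x0, x7, x8, x9]" "nb20 x16 = [x0, x1, x8, x10]" "nb20 x17 = [x0, x2, x7, x9]" "nb20 x18 = [x0, x8, x9, x10]"
  "nb20 x19 = [x0, x1, x4, x10]"
  by (simp_all add: nb20_def label_defs)

lemma outer_nb20_simps:
  "outer_nb20 x1 = [x11, x12, x16, x19]" "outer_nb20 x2 = [x13, x14, x17]" "outer_nb20 x3 = [x11, x14]" "outer_nb20 x4 = [x13, x19]"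
  "outer_nb20 x7 = [x11, x12, x14, x15, x17]" "outer_nb20 x8 = [x12, x15, x16, x18]" "outer_nb20 x9 = [x13, x15, x17, x18]"
  "outer_nb20 x10 = [x13, x16, x18, x19]" "outer_nb20 x11 = [x1, x3, x7]" "outer_nb20 x12 = [x1, x7, x8]"
  "outer_nb20 x13 = [x2, x4, x9, x10]" "outer_nb20 x14 = [x2, x3, x7]" "outer_nb20 x15 = [x7, x8, x9]" "outer_nb20 x16 = [x1, x8, x10]"
  "outer_nb20 x17 = [x2, x7, x9]" "outer_nb20 x18 = [x8, x9, x10]" "outer_nb20 x19 = [x1, x4, x10]"
  by (simp_all add: outer_nb20_def label_defs)

lemma co20_simps:
  "co20 x1 = (0, 4, 0)" "co20 x2 = (0, -4, 0)" "co20 x3 = (-4, 0, 0)" "co20 x4 = (4, 0, 0)" "co20 x7 = (-17, 11, 0)"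
  "co20 x8 = (17, -16, 0)" "co20 x9 = (0, -8, 0)" "co20 x10 = (16, -12, 0)" "co20 x11 = (-2, 11, 0)" "co20 x12 = (20, 17, 0)"
  "co20 x13 = (7, -2, 0)" "co20 x14 = (-13, 4, 0)" "co20 x15 = (-20, -12, 0)" "co20 x16 = (19, 8, 0)" "co20 x17 = (-18, -6, 0)"
  "co20 x18 = (15, -13, 0)" "co20 x19 = (16, 1, 0)"
  by (simp_all add: co20_def label_defs)

lemma graph20: "list_graph_ok vs20 nb20 vs20" "list_graph_ok outer_vs20 outer_nb20 outer_vs20"
    "list_all (\<lambda>u. edge_list_for outer_es20 u (outer_nb20 u)) outer_vs20"
  by (simp_all add: vs20_def outer_vs20_def outer_es20_def nb20_simps outer_nb20_simps drawing_eval)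

lemma drawing20: "list_all (\<lambda>e. list_all (vertex_test co20 e) outer_vs20) outer_es20"
    "list_all (\<lambda>e. list_all (edge_test co20 [] e) outer_es20) outer_es20"
  by (simp_all add: outer_vs20_def outer_es20_def co20_simps drawing_eval)

lemma connected20: "list_all (\<lambda>j. list_all (survives nb20 vs20 x0 j) vs20) vs20"
  by (simp only: vs20_def nb20_simps connectivity_eval cong: if_weak_cong)

lemma columns20:
  fixes K :: nat
  shows "\<exists>E. simple_graph {0..<20 + 3 * K} E \<and> linklessly_embeddable {0..<20 + 3 * K} E \<and> tutte_4_connected {0..<20 + 3 * K} E"
proof (rule checked_columns[OF graph20(1) _ _ _ connected20[unfolded x0_def] _ _ _ _ graph20(2,3) drawing20])
  show "vs20 = [0..<20]" by (simp add: vs20_def label_defs upt_rec)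
  show "outer_vs20 = [1, 2, 3, 4] @ [7..<20]" by (simp add: outer_vs20_def label_defs upt_rec)
  show "list_all (\<lambda>v. v = 0 \<or> mem v (nb20 0) \<or> (all_mem (nb20 v) (nb20 0) \<and> distinct (nb20 v) \<and> 4 \<le> length (nb20 v))) vs20"
    by (simp add: vs20_def label_defs nb20_simps[unfolded label_defs One_nat_def])
  show "list_all (\<lambda>u. list_all (\<lambda>v. mem v [0, 5, 6] \<or> mem v (outer_nb20 u)) (nb20 u)) outer_vs20"
    by (simp add: outer_vs20_def label_defs nb20_simps[unfolded label_defs One_nat_def] outer_nb20_simps[unfolded label_defs One_nat_def])
  show "list_all (\<lambda>v. snd (snd (co20 v)) = 0 \<and> 4 < \<bar>fst (co20 v)\<bar> + \<bar>fst (snd (co20 v))\<bar>) [7..<20]"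
    by (simp add: co20_def upt_rec)
  show "list_all2 (separation_test co20) outer_es20
    [(0, -1, 4), (0, -1, 4), (0, -1, 4), (-1, -2, 8), (-1, 2, 8), (2, 3, 12), (0, 1, 4), (2, -1, 8), (1, 0, 4), (-1, 0, 4), (-1, 0, 4), (0, -1, 5), (0, -1, 5), (1, -1, 5), (1, -1, 5), (1, -1, 5), (-1, 0, 5), (0, 1, 5), (-1, 0, 5), (-1, 0, 5), (-1, 1, 5), (0, 1, 5), (0, 1, 5), (-1, 1, 5), (-1, 0, 5), (-1, 0, 5), (-1, 0, 5), (-1, 0, 5)]"
    by (simp add: outer_es20_def separation_test_def Let_def label_defs co20_simps[unfolded label_defs One_nat_def])
qed (simp_all add: nb20_def co20_def label_defs)

section \<open>The theorem\<close>

theorem theorem1: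
  fixes n :: nat
  assumes "n \<ge> 13"
  shows "\<exists>E :: nat \<Rightarrow> nat \<Rightarrow> bool.
           simple_graph {0..<n} E \<and> linklessly_embeddable {0..<n} E \<and> tutte_4_connected {0..<n} E"
proof -
  consider "n = 13" | "n = 14" | "n = 16" | "n = 17" | K where "n = 15 + 3 * K" | K where "n = 19 + 3 * K" | K where "n = 20 + 3 * K"
  proof -
    \<comment> \<open>Each base graph serves one residue class modulo 3, from 15, 19 and 20 on.
      Below these bounds only 16 and 13, and 17 and 14, are missing.\<close>
    have "(n = 13 \<or> n = 14 \<or> n = 16 \<or> n = 17) \<or> (n mod 3 = 0 \<and> 15 \<le> n) \<or> (n mod 3 = 1 \<and> 19 \<le> n) \<or> (n mod 3 = 2 \<and> 20 \<le> n)"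
      using assms by presburger
    then show thesis
    proof (elim disjE conjE)
      assume "n mod 3 = 0" "15 \<le> n"
      then have "n = 15 + 3 * ((n - 15) div 3)" by presburger
      then show thesis by (rule that(5))
    next
      assume "n mod 3 = 1" "19 \<le> n"
      then have "n = 19 + 3 * ((n - 19) div 3)" by presburger
      then show thesis by (rule that(6))
    next
      assume "n mod 3 = 2" "20 \<le> n"
      then have "n = 20 + 3 * ((n - 20) div 3)" by presburger
      then show thesis by (rule that(7))
    qed (fact that(1-4))+
  qed
  then show ?thesis
    by cases (simp_all only: sporadic13 sporadic14 sporadic16 sporadic17 columns15 columns19 columns20)
qed

end
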